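(* Consider a base model $\mathfrak M_0$ satisfying Assumptions 3.1 and 2 (stated in the context). Suppose that $J_1^{\mathcal N,0}>J_1^{\mathcal P,0}$ (resp. $J_1^{\mathcal N,0}<J_1^{\mathcal P,0}$), where $J_1^{\mathcal I,0}$ is the optimal cost of the representative follower under game $\mathcal I$ for $\mathfrak M_0$, and let $\Delta J_1^0=|J_1^{\mathcal N,0}-J_1^{\mathcal P,0}|>0$. Then there exists a constant $\mathcal C_{\mathfrak M_0,T}>0$, depending solely on $\mathfrak M_0$ and $T$, such that for any model $\mathfrak M$ satisfying 1) $\mathcal D(\mathfrak M,\mathfrak M_0)<\delta:=\mathcal C_{\mathfrak M_0,T}\,\Delta J_1^0$; and 2) for $\mathcal I=\mathcal N,\mathcal P$, $\mathcal E_0^{\mathcal I}(\delta)>1$ and $$T\le\frac{\log(\mathcal E_0^{\mathcal I}(\delta))}{\rho_T\big(\mathbf A-\mathbf B^{\mathcal I}\mathbf\Gamma_0^{\mathcal I}\big)+\rho_T\big(\mathbf C^{\mathcal I}-\mathbf\Gamma_0^{\mathcal I}\mathbf B^{\mathcal I}\big)},$$ one has $J_1^{\mathcal N}>J_1^{\mathcal P}$ (resp. $J_1^{\mathcal N}<J_1^{\mathcal P}$), where $J_1^{\mathcal N}$ and $J_1^{\mathcal P}$ are the optimal costs of the representative follower under the Nash and the Pareto game for the model $\mathfrak M$.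
   Context: **Models.** All quantities are scalar. $T>0$ is fixed. A model is $\mathfrak M=(\Theta,\boldsymbol\eta)$ with parameter vector $$\Theta=(A_\alpha,B_\alpha,C_\alpha,D_\alpha,\sigma_\alpha,A_\beta,B_\beta,C_\beta,D_\beta,\sigma_\beta,A_1,B_1,C_1,D_1,E_1,\sigma_1,F_\alpha,G_\alpha,M_\alpha,Q_\alpha,R_\alpha,F_\beta,G_\beta,M_\beta,Q_\beta,R_\beta,$$ $$F_1,G_1,H_1,M_1,Q_1,R_1,\bar F_\alpha,\bar G_\alpha,\bar M_\alpha,\bar Q_\alpha,\bar F_\beta,\bar G_\beta,\bar M_\beta,\bar Q_\beta,\bar F_1,\bar G_1,\bar H_1,\bar M_1,\bar Q_1)$$ of real numbers with $D_\alpha,D_\beta,E_1\ne0$, $Q_\gamma,R_\gamma>0$, $\bar Q_\gamma\ge0$ ($\gamma\in\{\alpha,\beta,1\}$), and $\boldsymbol\eta=(\eta_\alpha,\eta_\beta,\eta_1)$ independent square-integrable real random variables, independent of the independent one-dimensional Wiener processes $W^\alpha,W^\beta,W^1$. $\mathcal F^\gamma_t=\sigma(\eta_\gamma,W^\gamma(s):s\le t)$. The distance is $\mathcal D(\mathfrak M_1,\mathfrak M_2)=\max\{\|\Theta_1-\Theta_2\|_\infty,\ \mathbb E[|\boldsymbol\eta_1-\boldsymbol\eta_2|^2]\}$, with $\|\cdot\|_\infty$ the sup-norm and $|\cdot|$ the Euclidean norm. **Game for a model.** For $\gamma\in\{\alpha,\beta\}$ and $\gamma'$ the other leader, $$dx_\gamma=(A_\gamma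 x_\alpha+B_\gamma x_\beta+C_\gamma z+D_\gamma v_\gamma)dt+\sigma_\gamma dW^\gamma,\quad dx_1=(A_1x_1+B_1z+C_1x_\alpha+D_1x_\beta+E_1v_1)dt+\sigma_1dW^1,$$ $x_\gamma(0)=\eta_\gamma$, $x_1(0)=\eta_1$, with costs $$J_\gamma(v_\gamma;v_{\gamma'})=\mathbb E\Big[\int_0^T\big(Q_\gamma(x_\gamma-F_\gamma z-G_\gamma x_{\gamma'}-M_\gamma)^2+R_\gamma v_\gamma^2\big)dt+\bar Q_\gamma(x_\gamma(T)-\bar F_\gamma z(T)-\bar G_\gamma x_{\gamma'}(T)-\bar M_\gamma)^2\Big],$$ $$J_1(v_1;x_\alpha,x_\beta,z)=\mathbb E\Big[\int_0^T\big(Q_1(x_1-F_1z-G_1x_\alpha-H_1x_\beta-M_1)^2+R_1v_1^2\big)dt+\bar Q_1(x_1(T)-\bar F_1z(T)-\bar G_1x_\alpha(T)-\bar H_1x_\beta(T)-\bar M_1)^2\Big].$$ The follower minimizes $J_1$ given $(x_\alpha,x_\beta,z)$; the mean field term satisfies $z(t)=\mathbb E[x_1(t)\mid\mathcal F_t^\alpha\vee\mathcal F_t^\beta]$ ($x_1$ optimally controlled) and is endogenous to the leaders. Nash game ($\mathcal N$): $u_\alpha^{\mathcal N}=\arg\min_{v_\alpha}J_\alpha(v_\alpha;u_\beta^{\mathcal N})$, $u_\beta^{\mathcal N}=\arg\min_{v_\beta}J_\beta(v_\beta;u_\alpha^{\mathcal N})$. Pareto game ($\mathcal P$): $(u_\alpha^{\mathcal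 P},u_\beta^{\mathcal P})=\arg\min(J_\alpha+J_\beta)$. For $\mathcal I\in\{\mathcal N,\mathcal P\}$ the equilibrium is given by the solution of $$d\mathbf x^{\mathcal I}=(\mathbf A\mathbf x^{\mathcal I}-\mathbf B^{\mathcal I}\mathbf p^{\mathcal I})dt+\mathbf\Sigma d\mathbf W,\ \ -d\mathbf p^{\mathcal I}=(\mathbf C^{\mathcal I}\mathbf p^{\mathcal I}+\mathbf D^{\mathcal I}\mathbf x^{\mathcal I}+\mathbf M^{\mathcal I})dt-\mathbf Z^{\mathcal I}d\mathbf W,\ \ \mathbf x^{\mathcal I}(0)=\mathbf x_0,\ \mathbf p^{\mathcal I}(T)=\mathbf E^{\mathcal I}\mathbf x^{\mathcal I}(T)+\mathbf h^{\mathcal I},$$ $\mathbf p^{\mathcal I}=\mathbf\Gamma^{\mathcal I}\mathbf x^{\mathcal I}+\mathbf g^{\mathcal I}$, where $\mathbf\Gamma^{\mathcal I}$ solves the Riccati equation $$-\frac{d\mathbf\Gamma^{\mathcal I}}{dt}=\mathbf\Gamma^{\mathcal I}\mathbf A+\mathbf C^{\mathcal I}\mathbf\Gamma^{\mathcal I}-\mathbf\Gamma^{\mathcal I}\mathbf B^{\mathcal I}\mathbf\Gamma^{\mathcal I}+\mathbf D^{\mathcal I},\quad\mathbf\Gamma^{\mathcal I}(T)=\mathbf E^{\mathcal I},\qquad(\ast)$$ and $-\frac{d\mathbf g^{\mathcal I}}{dt}=(\mathbf C^{\mathcal I}-\mathbf\Gamma^{\mathcal I}\mathbf B^{\mathcal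 I})\mathbf g^{\mathcal I}+\mathbf M^{\mathcal I}$, $\mathbf g^{\mathcal I}(T)=\mathbf h^{\mathcal I}$. The first three entries of $\mathbf x^{\mathcal I}$ are the equilibrium $x_\alpha^{\mathcal I},x_\beta^{\mathcal I},z^{\mathcal I}$, and $J_1^{\mathcal I}=\min_{v_1}J_1(v_1;x_\alpha^{\mathcal I},x_\beta^{\mathcal I},z^{\mathcal I})$. **Matrices.** $\mathbf W=(W^\alpha,W^\beta)^\top$, $\mathbf x_0=(\eta_\alpha,\eta_\beta,\mathbb E[\eta_1],0,0)^\top$, $\mathbf\Sigma=\begin{pmatrix}\sigma_\alpha&0\\ 0&\sigma_\beta\\ 0&0\\ 0&0\\ 0&0\end{pmatrix}$, $$\mathbf A=\begin{pmatrix}A_\alpha&B_\alpha&C_\alpha&0&0\\ A_\beta&B_\beta&C_\beta&0&0\\ C_1&D_1&A_1+B_1&0&0\\ 0&0&0&A_1&0\\ 0&0&0&0&A_1\end{pmatrix},\ \mathbf B^{\mathcal P}=\mathrm{diag}\Big(\tfrac{D_\alpha^2}{R_\alpha},\tfrac{D_\beta^2}{R_\beta},\tfrac{E_1^2}{R_1},\tfrac{E_1^2}{R_1},\tfrac{E_1^2}{R_1}\Big),\ \mathbf B^{\mathcal N}=(\mathbf B^{\mathcal P}\ \ 0_{5\times2}),$$ $$\mathbf C^{\mathcal N}=\begin{pmatrix}A_\alpha&0&0&C_1&0&A_\beta&0\\ 0&B_\beta&0&0&D_1&0&B_\alpha\\ 0&0&A_1&0&0&0&0\\ C_\alpha&0&0&A_1+B_1&0&C_\beta&0\\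 0&C_\beta&0&0&A_1+B_1&0&C_\alpha\\ B_\alpha&0&0&D_1&0&B_\beta&0\\ 0&A_\beta&0&0&C_1&0&A_\alpha\end{pmatrix},$$ $$\mathbf D^{\mathcal N}=\begin{pmatrix}Q_\alpha&-Q_\alpha G_\alpha&-Q_\alpha F_\alpha&-Q_1G_1&0\\ -Q_\beta G_\beta&Q_\beta&-Q_\beta F_\beta&0&-Q_1H_1\\ -Q_1G_1&-Q_1H_1&Q_1(1-F_1)&0&0\\ -Q_\alpha F_\alpha&Q_\alpha F_\alpha G_\alpha&Q_\alpha F_\alpha^2&Q_1(1-F_1)&0\\ Q_\beta F_\beta G_\beta&-Q_\beta F_\beta&Q_\beta F_\beta^2&0&Q_1(1-F_1)\\ -Q_\alpha G_\alpha&Q_\alpha G_\alpha^2&Q_\alpha G_\alpha F_\alpha&-Q_1H_1&0\\ Q_\beta G_\beta^2&-Q_\beta G_\beta&Q_\beta G_\beta F_\beta&0&-Q_1G_1\end{pmatrix},$$ $\mathbf M^{\mathcal N}=(-Q_\alpha M_\alpha,-Q_\beta M_\beta,-Q_1M_1,Q_\alpha F_\alpha M_\alpha,Q_\beta F_\beta M_\beta,Q_\alpha G_\alpha M_\alpha,Q_\beta G_\beta M_\beta)^\top$; $\mathbf E^{\mathcal N},\mathbf h^{\mathcal N}$ are $\mathbf D^{\mathcal N},\mathbf M^{\mathcal N}$ with all $Q_\gamma,F_\gamma,G_\gamma,H_1,M_\gamma$ replaced by their barred counterparts. With $\mathbf I_1=\begin{pmatrix}1&0&0&0&0&0&1\\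 0&1&0&0&0&1&0\\ 0&0&1&0&0&0&0\\ 0&0&0&1&0&0&0\\ 0&0&0&0&1&0&0\end{pmatrix}$, $\mathbf I_2=\begin{pmatrix}I_5\\ 0_{2\times5}\end{pmatrix}$: $\mathbf C^{\mathcal P}=\mathbf I_1\mathbf C^{\mathcal N}\mathbf I_2$, $\mathbf D^{\mathcal P}=\mathbf I_1\mathbf D^{\mathcal N}$, $\mathbf E^{\mathcal P}=\mathbf I_1\mathbf E^{\mathcal N}$, $\mathbf M^{\mathcal P}=\mathbf I_1\mathbf M^{\mathcal N}$, $\mathbf h^{\mathcal P}=\mathbf I_1\mathbf h^{\mathcal N}$. Put $\ell_{\mathcal P}=5$, $\ell_{\mathcal N}=7$. **Assumption 3.1 (scalar form).** $B_1^2<4Q_1(1-F_1)E_1^2/R_1$ and $\bar Q_1(1-\bar F_1)\ge0$. **Assumption 2.** At least one holds: (1) Condition 2A for both $\mathcal I=\mathcal N,\mathcal P$; (2) Condition 2A for $\mathcal I=\mathcal P$ and Condition 2B. Condition 2A (for $\mathcal I$): there exist a symmetric $\Pi_1\in\mathbb R^{5\times5}$ and $\Pi_2\in\mathbb R^{5\times\ell_{\mathcal I}}$ such that, with $\mathbf\Lambda=\begin{pmatrix}-\Pi_1\mathbf A+\Pi_2\mathbf D^{\mathcal I}&\Pi_1\mathbf B^{\mathcal I}-\mathbf A^\top\Pi_2+\Pi_2\mathbf C^{\mathcal I}\\ 0&(\mathbf B^{\mathcal I})^\top\Pi_2\end{pmatrix}$, $\lambda_{\min}(\mathbf\Lambda+\mathbf\Lambda^\top)\ge0$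 and $\lambda_{\min}(\Pi_1+\Pi_2\mathbf E^{\mathcal I}+(\mathbf E^{\mathcal I})^\top\Pi_2^\top)>0$. Condition 2B: there exist a symmetric $\bar\Pi_1\in\mathbb R^{7\times7}$, $\bar\Pi_2\in\mathbb R^{7\times7}$, $\hat{\mathbf A}\in\mathbb R^{2\times2}$, $\hat{\mathbf B}\in\mathbb R^{2\times7}$ such that, with $\bar{\mathbf A}=\begin{pmatrix}\mathbf A&0\\ 0&\hat{\mathbf A}\end{pmatrix}$, $\bar{\mathbf B}=\begin{pmatrix}\mathbf B^{\mathcal N}\\ \hat{\mathbf B}\end{pmatrix}$, $\bar{\mathbf D}=(\mathbf D^{\mathcal N}\ 0)$, $\bar{\mathbf E}=(\mathbf E^{\mathcal N}\ 0)$, $\bar{\mathbf\Lambda}=\begin{pmatrix}-\bar\Pi_1\bar{\mathbf A}+\bar\Pi_2\bar{\mathbf D}&\bar\Pi_1\bar{\mathbf B}-\bar{\mathbf A}^\top\bar\Pi_2+\bar\Pi_2\mathbf C^{\mathcal N}\\ 0&\bar{\mathbf B}^\top\bar\Pi_2\end{pmatrix}$, $\lambda_{\min}(\bar{\mathbf\Lambda}+\bar{\mathbf\Lambda}^\top)\ge0$ and $\lambda_{\min}(\bar\Pi_1+\bar\Pi_2\bar{\mathbf E}+\bar{\mathbf E}^\top\bar\Pi_2^\top)>0$. **The quantity $\mathcal E_0^{\mathcal I}(\delta)$.** $\rho(M)=\sqrt{\lambda_{\max}(M^\top M)}$ is the spectral norm and $\rho_T(\Phi)=\sup_{0\le t\le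 T}\rho(\Phi(t))$. Matrices with subscript $0$ are those of $\mathfrak M_0$, those without subscript belong to $\mathfrak M$; $\tilde{\mathbf A}=\mathbf A-\mathbf A_0$, and similarly $\tilde{\mathbf C}^{\mathcal I},\tilde{\mathbf E}^{\mathcal I}$; $\mathbf\Gamma_0^{\mathcal I}$ is the solution of $(\ast)$ for $\mathfrak M_0$. For $\mathcal D(\mathfrak M,\mathfrak M_0)<\delta$, $$\mathcal E_0^{\mathcal I}(\delta)=\frac{\rho_T(\mathbf A-\mathbf B^{\mathcal I}\mathbf\Gamma_0^{\mathcal I})+\rho_T(\mathbf C^{\mathcal I}-\mathbf\Gamma_0^{\mathcal I}\mathbf B^{\mathcal I})}{2\sqrt{\rho(\mathbf B^{\mathcal I})}}\Big\{\rho_T(\mathbf\Gamma_0^{\mathcal I}\tilde{\mathbf A}+\tilde{\mathbf C}^{\mathcal I}\mathbf\Gamma_0^{\mathcal I})+\rho(\tilde{\mathbf E}^{\mathcal I})\big(\rho_T(\mathbf A-\mathbf B^{\mathcal I}\mathbf\Gamma_0^{\mathcal I})+\rho_T(\mathbf C^{\mathcal I}-\mathbf\Gamma_0^{\mathcal I}\mathbf B^{\mathcal I})\big)\Big\}^{-1/2}$$ (understood as $+\infty$ if the brace vanishes). *)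

theory Defs
  imports "HOL-Probability.Probability"
begin

section \<open>Models\<close>

text \<open>
  The coordinates of \<open>\<Theta>\<close>; a letter \<open>b\<close> before the subscript stands for a bar, so that
  \<open>Qb\<^sub>\<alpha>\<close> is the terminal weight. A parameter vector is an element of \<open>real ^ param\<close>,
  whose sup-norm is \<^const>\<open>infnorm\<close>.
\<close>

datatype param =
    A\<^sub>\<alpha> | B\<^sub>\<alpha> | C\<^sub>\<alpha> | D\<^sub>\<alpha> | \<sigma>\<^sub>\<alpha>
  | A\<^sub>\<beta> | B\<^sub>\<beta> | C\<^sub>\<beta> | D\<^sub>\<beta> | \<sigma>\<^sub>\<beta>
  | A\<^sub>1 | B\<^sub>1 | C\<^sub>1 | D\<^sub>1 | E\<^sub>1 | \<sigma>\<^sub>1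
  | F\<^sub>\<alpha> | G\<^sub>\<alpha> | M\<^sub>\<alpha> | Q\<^sub>\<alpha> | R\<^sub>\<alpha>
  | F\<^sub>\<beta> | G\<^sub>\<beta> | M\<^sub>\<beta> | Q\<^sub>\<beta> | R\<^sub>\<beta>
  | F\<^sub>1 | G\<^sub>1 | H\<^sub>1 | M\<^sub>1 | Q\<^sub>1 | R\<^sub>1
  | Fb\<^sub>\<alpha> | Gb\<^sub>\<alpha> | Mb\<^sub>\<alpha> | Qb\<^sub>\<alpha>
  | Fb\<^sub>\<beta> | Gb\<^sub>\<beta> | Mb\<^sub>\<beta> | Qb\<^sub>\<beta>
  | Fb\<^sub>1 | Gb\<^sub>1 | Hb\<^sub>1 | Mb\<^sub>1 | Qb\<^sub>1

instance param :: finite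
proof
  have "(UNIV :: param set) \<subseteq> {A\<^sub>\<alpha>, B\<^sub>\<alpha>, C\<^sub>\<alpha>, D\<^sub>\<alpha>, \<sigma>\<^sub>\<alpha>, A\<^sub>\<beta>, B\<^sub>\<beta>, C\<^sub>\<beta>, D\<^sub>\<beta>, \<sigma>\<^sub>\<beta>,
      A\<^sub>1, B\<^sub>1, C\<^sub>1, D\<^sub>1, E\<^sub>1, \<sigma>\<^sub>1, F\<^sub>\<alpha>, G\<^sub>\<alpha>, M\<^sub>\<alpha>, Q\<^sub>\<alpha>, R\<^sub>\<alpha>, F\<^sub>\<beta>, G\<^sub>\<beta>, M\<^sub>\<beta>, Q\<^sub>\<beta>, R\<^sub>\<beta>,
      F\<^sub>1, G\<^sub>1, H\<^sub>1, M\<^sub>1, Q\<^sub>1, R\<^sub>1, Fb\<^sub>\<alpha>, Gb\<^sub>\<alpha>, Mb\<^sub>\<alpha>, Qb\<^sub>\<alpha>, Fb\<^sub>\<beta>, Gb\<^sub>\<beta>, Mb\<^sub>\<beta>, Qb\<^sub>\<beta>,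
      Fb\<^sub>1, Gb\<^sub>1, Hb\<^sub>1, Mb\<^sub>1, Qb\<^sub>1}"
  proof
    fix k :: param
    show "k \<in> {A\<^sub>\<alpha>, B\<^sub>\<alpha>, C\<^sub>\<alpha>, D\<^sub>\<alpha>, \<sigma>\<^sub>\<alpha>, A\<^sub>\<beta>, B\<^sub>\<beta>, C\<^sub>\<beta>, D\<^sub>\<beta>, \<sigma>\<^sub>\<beta>,
      A\<^sub>1, B\<^sub>1, C\<^sub>1, D\<^sub>1, E\<^sub>1, \<sigma>\<^sub>1, F\<^sub>\<alpha>, G\<^sub>\<alpha>, M\<^sub>\<alpha>, Q\<^sub>\<alpha>, R\<^sub>\<alpha>, F\<^sub>\<beta>, G\<^sub>\<beta>, M\<^sub>\<beta>, Q\<^sub>\<beta>, R\<^sub>\<beta>,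
      F\<^sub>1, G\<^sub>1, H\<^sub>1, M\<^sub>1, Q\<^sub>1, R\<^sub>1, Fb\<^sub>\<alpha>, Gb\<^sub>\<alpha>, Mb\<^sub>\<alpha>, Qb\<^sub>\<alpha>, Fb\<^sub>\<beta>, Gb\<^sub>\<beta>, Mb\<^sub>\<beta>, Qb\<^sub>\<beta>,
      Fb\<^sub>1, Gb\<^sub>1, Hb\<^sub>1, Mb\<^sub>1, Qb\<^sub>1}"
      by (cases k) simp_all
  qed
  then show "finite (UNIV :: param set)"
    by (rule finite_subset) simp
qed

text \<open>The two leaders \<open>\<alpha>\<close>, \<open>\<beta>\<close> and the representative follower (index 1).\<close>

datatype agent = Alpha | Beta | Follower

instance agent :: finite
proof
  have "(UNIV :: agent set) \<subseteq> {Alpha, Beta, Follower}"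
    by (auto intro: agent.exhaust)
  then show "finite (UNIV :: agent set)"
    by (rule finite_subset) simp
qed

type_synonym 'a process = "real \<Rightarrow> 'a \<Rightarrow> real"
type_synonym 'a noise = "agent \<Rightarrow> 'a process"

record 'a model =
  par :: "real ^ param"
  eta :: "'a \<Rightarrow> real ^ agent"

definition model_dist :: "'a measure \<Rightarrow> 'a model \<Rightarrow> 'a model \<Rightarrow> real" where
  "model_dist P m m' =
     max (infnorm (par m - par m')) (LINT \<omega>|P. (norm (eta m \<omega> - eta m' \<omega>))\<^sup>2)"

subsection \<open>Wiener processes and filtrations\<close>

definition generated_sets :: "'a measure \<Rightarrow> (real \<Rightarrow> 'a \<Rightarrow> real) \<Rightarrow> real set \<Rightarrow> 'a set set" where
  "generated_sets P X I = sigma_sets (space P) {X t -` A \<inter> space P |t A. t \<in> I \<and> A \<in> sets borel}"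

definition wiener :: "'a measure \<Rightarrow> (real \<Rightarrow> 'a \<Rightarrow> real) \<Rightarrow> bool" where
  "wiener P X \<longleftrightarrow>
     (\<forall>t\<ge>0. X t \<in> borel_measurable P) \<and>
     (AE \<omega> in P. X 0 \<omega> = 0) \<and>
     (\<forall>\<omega>\<in>space P. continuous_on {0..} (\<lambda>t. X t \<omega>)) \<and>
     (\<forall>s t. 0 \<le> s \<and> s < t \<longrightarrow>
        distributed P lborel (\<lambda>\<omega>. X t \<omega> - X s \<omega>) (normal_density 0 (sqrt (t - s))) \<and>
        prob_space.indep_set P (generated_sets P X {0..s})
          {(\<lambda>\<omega>. X t \<omega> - X s \<omega>) -` A \<inter> space P |A. A \<in> sets borel})"

definition independent_wieners :: "'a measure \<Rightarrow> 'a noise \<Rightarrow> bool" where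
  "independent_wieners P W \<longleftrightarrow>
     (\<forall>\<gamma>. wiener P (W \<gamma>)) \<and>
     prob_space.indep_sets P (\<lambda>\<gamma>. generated_sets P (W \<gamma>) {0..}) UNIV"

definition is_model :: "'a measure \<Rightarrow> 'a noise \<Rightarrow> 'a model \<Rightarrow> bool" where
  "is_model P W m \<longleftrightarrow>
     (let \<theta> = par m; \<eta> = eta m in
       \<theta> $ D\<^sub>\<alpha> \<noteq> 0 \<and> \<theta> $ D\<^sub>\<beta> \<noteq> 0 \<and> \<theta> $ E\<^sub>1 \<noteq> 0 \<and>
       \<theta> $ Q\<^sub>\<alpha> > 0 \<and> \<theta> $ Q\<^sub>\<beta> > 0 \<and> \<theta> $ Q\<^sub>1 > 0 \<and>
       \<theta> $ R\<^sub>\<alpha> > 0 \<and> \<theta> $ R\<^sub>\<beta> > 0 \<and> \<theta> $ R\<^sub>1 > 0 \<and>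
       \<theta> $ Qb\<^sub>\<alpha> \<ge> 0 \<and> \<theta> $ Qb\<^sub>\<beta> \<ge> 0 \<and> \<theta> $ Qb\<^sub>1 \<ge> 0 \<and>
       (\<forall>\<gamma>. (\<lambda>\<omega>. \<eta> \<omega> $ \<gamma>) \<in> borel_measurable P \<and> integrable P (\<lambda>\<omega>. (\<eta> \<omega> $ \<gamma>)\<^sup>2)) \<and>
       prob_space.indep_sets P
         (\<lambda>i. case i of
            Inl \<gamma> \<Rightarrow> {(\<lambda>\<omega>. \<eta> \<omega> $ \<gamma>) -` A \<inter> space P |A. A \<in> sets borel}
          | Inr \<gamma> \<Rightarrow> generated_sets P (W \<gamma>) {0..})
         (UNIV :: (agent + agent) set))"

text \<open>\<open>joint_filtration P W \<eta> S t\<close> is the join of the \<open>\<F>\<^sup>\<gamma>\<^sub>t\<close> over \<open>\<gamma> \<in> S\<close>.\<close>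

definition joint_filtration ::
    "'a measure \<Rightarrow> 'a noise \<Rightarrow> ('a \<Rightarrow> real ^ agent) \<Rightarrow> agent set \<Rightarrow> real \<Rightarrow> 'a measure"
  where
  "joint_filtration P W \<eta> S t = sigma (space P)
     ({(\<lambda>\<omega>. \<eta> \<omega> $ \<gamma>) -` A \<inter> space P |\<gamma> A. \<gamma> \<in> S \<and> A \<in> sets borel} \<union>
      {W \<gamma> s -` A \<inter> space P |\<gamma> s A. \<gamma> \<in> S \<and> s \<in> {0..t} \<and> A \<in> sets borel})"

definition leader_filtration ::
    "'a measure \<Rightarrow> 'a noise \<Rightarrow> 'a model \<Rightarrow> real \<Rightarrow> 'a measure" where
  "leader_filtration P W m = joint_filtration P W (eta m) {Alpha, Beta}"

definition full_filtration ::
    "'a measure \<Rightarrow> 'a noise \<Rightarrow> 'a model \<Rightarrow> real \<Rightarrow> 'a measure" where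
  "full_filtration P W m = joint_filtration P W (eta m) UNIV"

definition L2_process ::
    "'a measure \<Rightarrow> real \<Rightarrow> (real \<Rightarrow> 'a measure) \<Rightarrow> (real \<Rightarrow> 'a \<Rightarrow> 'b::euclidean_space) \<Rightarrow> bool" where
  "L2_process P T \<F> X \<longleftrightarrow>
     (\<forall>t\<in>{0..T}. (\<lambda>(s, \<omega>). X s \<omega>) \<in> borel_measurable (restrict_space borel {0..t} \<Otimes>\<^sub>M \<F> t)) \<and>
     integrable (restrict_space lborel {0..T} \<Otimes>\<^sub>M P) (\<lambda>(s, \<omega>). (norm (X s \<omega>))\<^sup>2)"

definition state_process ::
    "'a measure \<Rightarrow> real \<Rightarrow> (real \<Rightarrow> 'a measure) \<Rightarrow> (real \<Rightarrow> 'a \<Rightarrow> 'b::euclidean_space) \<Rightarrow> bool" where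
  "state_process P T \<F> X \<longleftrightarrow>
     L2_process P T \<F> X \<and>
     (AE \<omega> in P. continuous_on {0..T} (\<lambda>t. X t \<omega>)) \<and>
     (\<forall>t\<in>{0..T}. integrable P (\<lambda>\<omega>. (norm (X t \<omega>))\<^sup>2))"

section \<open>The games\<close>

text \<open>All stochastic differential equations below have additive noise and are written in
  integrated form, path by path.\<close>

definition lq_cost ::
    "'a measure \<Rightarrow> real \<Rightarrow> real \<Rightarrow> real \<Rightarrow> real \<Rightarrow> 'a process \<Rightarrow> 'a process \<Rightarrow> ('a \<Rightarrow> real) \<Rightarrow> real" where
  "lq_cost P T q r qb v e f =
     (LINT \<omega>|P. (LBINT t:{0..T}. q * (e t \<omega>)\<^sup>2 + r * (v t \<omega>)\<^sup>2) + qb * (f \<omega>)\<^sup>2)"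

definition J_alpha ::
    "'a measure \<Rightarrow> real \<Rightarrow> real ^ param \<Rightarrow> 'a process \<Rightarrow> 'a process \<Rightarrow> 'a process \<Rightarrow> 'a process \<Rightarrow> real" where
  "J_alpha P T \<theta> xa xb z v = lq_cost P T (\<theta> $ Q\<^sub>\<alpha>) (\<theta> $ R\<^sub>\<alpha>) (\<theta> $ Qb\<^sub>\<alpha>) v
     (\<lambda>t \<omega>. xa t \<omega> - \<theta> $ F\<^sub>\<alpha> * z t \<omega> - \<theta> $ G\<^sub>\<alpha> * xb t \<omega> - \<theta> $ M\<^sub>\<alpha>)
     (\<lambda>\<omega>. xa T \<omega> - \<theta> $ Fb\<^sub>\<alpha> * z T \<omega> - \<theta> $ Gb\<^sub>\<alpha> * xb T \<omega> - \<theta> $ Mb\<^sub>\<alpha>)"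

definition J_beta ::
    "'a measure \<Rightarrow> real \<Rightarrow> real ^ param \<Rightarrow> 'a process \<Rightarrow> 'a process \<Rightarrow> 'a process \<Rightarrow> 'a process \<Rightarrow> real" where
  "J_beta P T \<theta> xa xb z v = lq_cost P T (\<theta> $ Q\<^sub>\<beta>) (\<theta> $ R\<^sub>\<beta>) (\<theta> $ Qb\<^sub>\<beta>) v
     (\<lambda>t \<omega>. xb t \<omega> - \<theta> $ F\<^sub>\<beta> * z t \<omega> - \<theta> $ G\<^sub>\<beta> * xa t \<omega> - \<theta> $ M\<^sub>\<beta>)
     (\<lambda>\<omega>. xb T \<omega> - \<theta> $ Fb\<^sub>\<beta> * z T \<omega> - \<theta> $ Gb\<^sub>\<beta> * xa T \<omega> - \<theta> $ Mb\<^sub>\<beta>)"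

definition J_follower ::
    "'a measure \<Rightarrow> real \<Rightarrow> real ^ param \<Rightarrow> 'a process \<Rightarrow> 'a process \<Rightarrow> 'a process \<Rightarrow> 'a process \<Rightarrow> 'a process \<Rightarrow> real" where
  "J_follower P T \<theta> xa xb z x1 v = lq_cost P T (\<theta> $ Q\<^sub>1) (\<theta> $ R\<^sub>1) (\<theta> $ Qb\<^sub>1) v
     (\<lambda>t \<omega>. x1 t \<omega> - \<theta> $ F\<^sub>1 * z t \<omega> - \<theta> $ G\<^sub>1 * xa t \<omega> - \<theta> $ H\<^sub>1 * xb t \<omega> - \<theta> $ M\<^sub>1)
     (\<lambda>\<omega>. x1 T \<omega> - \<theta> $ Fb\<^sub>1 * z T \<omega> - \<theta> $ Gb\<^sub>1 * xa T \<omega> - \<theta> $ Hb\<^sub>1 * xb T \<omega> - \<theta> $ Mb\<^sub>1)"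

definition follower_response ::
    "'a measure \<Rightarrow> 'a noise \<Rightarrow> real \<Rightarrow> 'a model \<Rightarrow>
     'a process \<Rightarrow> 'a process \<Rightarrow> 'a process \<Rightarrow> 'a process \<Rightarrow> 'a process \<Rightarrow> bool" where
  "follower_response P W T m xa xb z v x1 \<longleftrightarrow>
     (let \<theta> = par m in
       L2_process P T (full_filtration P W m) v \<and>
       state_process P T (full_filtration P W m) x1 \<and>
       (AE \<omega> in P. \<forall>t\<in>{0..T}. x1 t \<omega> = eta m \<omega> $ Follower +
          (LBINT s:{0..t}. \<theta> $ A\<^sub>1 * x1 s \<omega> + \<theta> $ B\<^sub>1 * z s \<omega> + \<theta> $ C\<^sub>1 * xa s \<omega>
             + \<theta> $ D\<^sub>1 * xb s \<omega> + \<theta> $ E\<^sub>1 * v s \<omega>)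
          + \<theta> $ \<sigma>\<^sub>1 * W Follower t \<omega>))"

definition follower_optimal ::
    "'a measure \<Rightarrow> 'a noise \<Rightarrow> real \<Rightarrow> 'a model \<Rightarrow>
     'a process \<Rightarrow> 'a process \<Rightarrow> 'a process \<Rightarrow> 'a process \<Rightarrow> 'a process \<Rightarrow> bool" where
  "follower_optimal P W T m xa xb z u x1 \<longleftrightarrow>
     follower_response P W T m xa xb z u x1 \<and>
     (\<forall>v y. follower_response P W T m xa xb z v y \<longrightarrow>
        J_follower P T (par m) xa xb z x1 u \<le> J_follower P T (par m) xa xb z y v)"

text \<open>Leader states and mean field term produced by the leader controls \<open>va\<close>, \<open>vb\<close>. The mean field
  term is part of the outcome, hence reacts to a change of either control.\<close>

definition leader_outcome ::
    "'a measure \<Rightarrow> 'a noise \<Rightarrow> real \<Rightarrow> 'a model \<Rightarrow>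
     'a process \<Rightarrow> 'a process \<Rightarrow> 'a process \<Rightarrow> 'a process \<Rightarrow> 'a process \<Rightarrow> bool" where
  "leader_outcome P W T m va vb xa xb z \<longleftrightarrow>
     (let \<theta> = par m; \<G> = leader_filtration P W m in
       L2_process P T \<G> va \<and> L2_process P T \<G> vb \<and>
       state_process P T \<G> xa \<and> state_process P T \<G> xb \<and> state_process P T \<G> z \<and>
       (AE \<omega> in P. \<forall>t\<in>{0..T}. xa t \<omega> = eta m \<omega> $ Alpha +
          (LBINT s:{0..t}. \<theta> $ A\<^sub>\<alpha> * xa s \<omega> + \<theta> $ B\<^sub>\<alpha> * xb s \<omega> + \<theta> $ C\<^sub>\<alpha> * z s \<omega> + \<theta> $ D\<^sub>\<alpha> * va s \<omega>)
          + \<theta> $ \<sigma>\<^sub>\<alpha> * W Alpha t \<omega>) \<and>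
       (AE \<omega> in P. \<forall>t\<in>{0..T}. xb t \<omega> = eta m \<omega> $ Beta +
          (LBINT s:{0..t}. \<theta> $ A\<^sub>\<beta> * xa s \<omega> + \<theta> $ B\<^sub>\<beta> * xb s \<omega> + \<theta> $ C\<^sub>\<beta> * z s \<omega> + \<theta> $ D\<^sub>\<beta> * vb s \<omega>)
          + \<theta> $ \<sigma>\<^sub>\<beta> * W Beta t \<omega>) \<and>
       (\<exists>u x1. follower_optimal P W T m xa xb z u x1 \<and>
          (\<forall>t\<in>{0..T}. AE \<omega> in P. z t \<omega> = real_cond_exp P (\<G> t) (x1 t) \<omega>)))"

definition nash ::
    "'a measure \<Rightarrow> 'a noise \<Rightarrow> real \<Rightarrow> 'a model \<Rightarrow>
     'a process \<Rightarrow> 'a process \<Rightarrow> 'a process \<Rightarrow> 'a process \<Rightarrow> 'a process \<Rightarrow> bool" where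
  "nash P W T m ua ub xa xb z \<longleftrightarrow>
     leader_outcome P W T m ua ub xa xb z \<and>
     (\<forall>va xa' xb' z'. leader_outcome P W T m va ub xa' xb' z' \<longrightarrow>
        J_alpha P T (par m) xa xb z ua \<le> J_alpha P T (par m) xa' xb' z' va) \<and>
     (\<forall>vb xa' xb' z'. leader_outcome P W T m ua vb xa' xb' z' \<longrightarrow>
        J_beta P T (par m) xa xb z ub \<le> J_beta P T (par m) xa' xb' z' vb)"

definition pareto ::
    "'a measure \<Rightarrow> 'a noise \<Rightarrow> real \<Rightarrow> 'a model \<Rightarrow>
     'a process \<Rightarrow> 'a process \<Rightarrow> 'a process \<Rightarrow> 'a process \<Rightarrow> 'a process \<Rightarrow> bool" where
  "pareto P W T m ua ub xa xb z \<longleftrightarrow>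
     leader_outcome P W T m ua ub xa xb z \<and>
     (\<forall>va vb xa' xb' z'. leader_outcome P W T m va vb xa' xb' z' \<longrightarrow>
        J_alpha P T (par m) xa xb z ua + J_beta P T (par m) xa xb z ub
          \<le> J_alpha P T (par m) xa' xb' z' va + J_beta P T (par m) xa' xb' z' vb)"

section \<open>The equilibrium system\<close>

text \<open>The type \<open>'l\<close> has \<open>\<ell>\<close> elements: 7 for the Nash game, 5 for the Pareto game. Recall that
  \<open>real ^ 'n ^ 'm\<close> has \<open>'m\<close> rows and \<open>'n\<close> columns.\<close>

record ('l::finite) system =
  mB :: "real ^ 'l ^ 5"
  mC :: "real ^ 'l ^ 'l"
  mD :: "real ^ 5 ^ 'l"
  mM :: "real ^ 'l"
  mE :: "real ^ 5 ^ 'l"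
  mh :: "real ^ 'l"

definition mat_A :: "real ^ param \<Rightarrow> real ^ 5 ^ 5" where
  "mat_A \<theta> = vector [
     vector [\<theta> $ A\<^sub>\<alpha>, \<theta> $ B\<^sub>\<alpha>, \<theta> $ C\<^sub>\<alpha>, 0, 0],
     vector [\<theta> $ A\<^sub>\<beta>, \<theta> $ B\<^sub>\<beta>, \<theta> $ C\<^sub>\<beta>, 0, 0],
     vector [\<theta> $ C\<^sub>1, \<theta> $ D\<^sub>1, \<theta> $ A\<^sub>1 + \<theta> $ B\<^sub>1, 0, 0],
     vector [0, 0, 0, \<theta> $ A\<^sub>1, 0],
     vector [0, 0, 0, 0, \<theta> $ A\<^sub>1]]"

definition mat_Sigma :: "real ^ param \<Rightarrow> real ^ 2 ^ 5" where
  "mat_Sigma \<theta> = vector [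
     vector [\<theta> $ \<sigma>\<^sub>\<alpha>, 0],
     vector [0, \<theta> $ \<sigma>\<^sub>\<beta>],
     vector [0, 0],
     vector [0, 0],
     vector [0, 0]]"

definition x_init :: "'a measure \<Rightarrow> 'a model \<Rightarrow> 'a \<Rightarrow> real ^ 5" where
  "x_init P m \<omega> = vector [eta m \<omega> $ Alpha, eta m \<omega> $ Beta, (LINT \<omega>'|P. eta m \<omega>' $ Follower), 0, 0]"

definition mat_BP :: "real ^ param \<Rightarrow> real ^ 5 ^ 5" where
  "mat_BP \<theta> = (\<chi> i j. if i = j then
     (vector [(\<theta> $ D\<^sub>\<alpha>)\<^sup>2 / \<theta> $ R\<^sub>\<alpha>, (\<theta> $ D\<^sub>\<beta>)\<^sup>2 / \<theta> $ R\<^sub>\<beta>, (\<theta> $ E\<^sub>1)\<^sup>2 / \<theta> $ R\<^sub>1,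
              (\<theta> $ E\<^sub>1)\<^sup>2 / \<theta> $ R\<^sub>1, (\<theta> $ E\<^sub>1)\<^sup>2 / \<theta> $ R\<^sub>1] :: real ^ 5) $ i
     else 0)"

definition mat_BN :: "real ^ param \<Rightarrow> real ^ 7 ^ 5" where
  "mat_BN \<theta> = vector [
     vector [(\<theta> $ D\<^sub>\<alpha>)\<^sup>2 / \<theta> $ R\<^sub>\<alpha>, 0, 0, 0, 0, 0, 0],
     vector [0, (\<theta> $ D\<^sub>\<beta>)\<^sup>2 / \<theta> $ R\<^sub>\<beta>, 0, 0, 0, 0, 0],
     vector [0, 0, (\<theta> $ E\<^sub>1)\<^sup>2 / \<theta> $ R\<^sub>1, 0, 0, 0, 0],
     vector [0, 0, 0, (\<theta> $ E\<^sub>1)\<^sup>2 / \<theta> $ R\<^sub>1, 0, 0, 0],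
     vector [0, 0, 0, 0, (\<theta> $ E\<^sub>1)\<^sup>2 / \<theta> $ R\<^sub>1, 0, 0]]"

definition mat_CN :: "real ^ param \<Rightarrow> real ^ 7 ^ 7" where
  "mat_CN \<theta> = vector [
     vector [\<theta> $ A\<^sub>\<alpha>, 0, 0, \<theta> $ C\<^sub>1, 0, \<theta> $ A\<^sub>\<beta>, 0],
     vector [0, \<theta> $ B\<^sub>\<beta>, 0, 0, \<theta> $ D\<^sub>1, 0, \<theta> $ B\<^sub>\<alpha>],
     vector [0, 0, \<theta> $ A\<^sub>1, 0, 0, 0, 0],
     vector [\<theta> $ C\<^sub>\<alpha>, 0, 0, \<theta> $ A\<^sub>1 + \<theta> $ B\<^sub>1, 0, \<theta> $ C\<^sub>\<beta>, 0],
     vector [0, \<theta> $ C\<^sub>\<beta>, 0, 0, \<theta> $ A\<^sub>1 + \<theta> $ B\<^sub>1, 0, \<theta> $ C\<^sub>\<alpha>],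
     vector [\<theta> $ B\<^sub>\<alpha>, 0, 0, \<theta> $ D\<^sub>1, 0, \<theta> $ B\<^sub>\<beta>, 0],
     vector [0, \<theta> $ A\<^sub>\<beta>, 0, 0, \<theta> $ C\<^sub>1, 0, \<theta> $ A\<^sub>\<alpha>]]"

definition mat_DN :: "real ^ param \<Rightarrow> real ^ 5 ^ 7" where
  "mat_DN \<theta> =
    (let Qa = \<theta> $ Q\<^sub>\<alpha>; Fa = \<theta> $ F\<^sub>\<alpha>; Ga = \<theta> $ G\<^sub>\<alpha>;
         Qb = \<theta> $ Q\<^sub>\<beta>; Fb = \<theta> $ F\<^sub>\<beta>; Gb = \<theta> $ G\<^sub>\<beta>;
         Q1 = \<theta> $ Q\<^sub>1; F1 = \<theta> $ F\<^sub>1; G1 = \<theta> $ G\<^sub>1; H1 = \<theta> $ H\<^sub>1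
     in vector [
     vector [Qa, - Qa * Ga, - Qa * Fa, - Q1 * G1, 0],
     vector [- Qb * Gb, Qb, - Qb * Fb, 0, - Q1 * H1],
     vector [- Q1 * G1, - Q1 * H1, Q1 * (1 - F1), 0, 0],
     vector [- Qa * Fa, Qa * Fa * Ga, Qa * Fa\<^sup>2, Q1 * (1 - F1), 0],
     vector [Qb * Fb * Gb, - Qb * Fb, Qb * Fb\<^sup>2, 0, Q1 * (1 - F1)],
     vector [- Qa * Ga, Qa * Ga\<^sup>2, Qa * Ga * Fa, - Q1 * H1, 0],
     vector [Qb * Gb\<^sup>2, - Qb * Gb, Qb * Gb * Fb, 0, - Q1 * G1]])"

definition vec_MN :: "real ^ param \<Rightarrow> real ^ 7" where
  "vec_MN \<theta> = vector [
     - \<theta> $ Q\<^sub>\<alpha> * \<theta> $ M\<^sub>\<alpha>, - \<theta> $ Q\<^sub>\<beta> * \<theta> $ M\<^sub>\<beta>, - \<theta> $ Q\<^sub>1 * \<theta> $ M\<^sub>1,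
     \<theta> $ Q\<^sub>\<alpha> * \<theta> $ F\<^sub>\<alpha> * \<theta> $ M\<^sub>\<alpha>, \<theta> $ Q\<^sub>\<beta> * \<theta> $ F\<^sub>\<beta> * \<theta> $ M\<^sub>\<beta>,
     \<theta> $ Q\<^sub>\<alpha> * \<theta> $ G\<^sub>\<alpha> * \<theta> $ M\<^sub>\<alpha>, \<theta> $ Q\<^sub>\<beta> * \<theta> $ G\<^sub>\<beta> * \<theta> $ M\<^sub>\<beta>]"

text \<open>Replaces \<open>Q\<close>, \<open>F\<close>, \<open>G\<close>, \<open>H\<close>, \<open>M\<close> by their barred counterparts.\<close>

definition barred :: "real ^ param \<Rightarrow> real ^ param" where
  "barred \<theta> = (\<chi> k. case k of
       Q\<^sub>\<alpha> \<Rightarrow> \<theta> $ Qb\<^sub>\<alpha> | F\<^sub>\<alpha> \<Rightarrow> \<theta> $ Fb\<^sub>\<alpha> | G\<^sub>\<alpha> \<Rightarrow> \<theta> $ Gb\<^sub>\<alpha> | M\<^sub>\<alpha> \<Rightarrow> \<theta> $ Mb\<^sub>\<alpha>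
     | Q\<^sub>\<beta> \<Rightarrow> \<theta> $ Qb\<^sub>\<beta> | F\<^sub>\<beta> \<Rightarrow> \<theta> $ Fb\<^sub>\<beta> | G\<^sub>\<beta> \<Rightarrow> \<theta> $ Gb\<^sub>\<beta> | M\<^sub>\<beta> \<Rightarrow> \<theta> $ Mb\<^sub>\<beta>
     | Q\<^sub>1 \<Rightarrow> \<theta> $ Qb\<^sub>1 | F\<^sub>1 \<Rightarrow> \<theta> $ Fb\<^sub>1 | G\<^sub>1 \<Rightarrow> \<theta> $ Gb\<^sub>1 | H\<^sub>1 \<Rightarrow> \<theta> $ Hb\<^sub>1 | M\<^sub>1 \<Rightarrow> \<theta> $ Mb\<^sub>1
     | _ \<Rightarrow> \<theta> $ k)"

definition mat_I1 :: "real ^ 7 ^ 5" where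
  "mat_I1 = vector [
     vector [1, 0, 0, 0, 0, 0, 1],
     vector [0, 1, 0, 0, 0, 1, 0],
     vector [0, 0, 1, 0, 0, 0, 0],
     vector [0, 0, 0, 1, 0, 0, 0],
     vector [0, 0, 0, 0, 1, 0, 0]]"

definition mat_I2 :: "real ^ 5 ^ 7" where
  "mat_I2 = vector [
     vector [1, 0, 0, 0, 0],
     vector [0, 1, 0, 0, 0],
     vector [0, 0, 1, 0, 0],
     vector [0, 0, 0, 1, 0],
     vector [0, 0, 0, 0, 1],
     vector [0, 0, 0, 0, 0],
     vector [0, 0, 0, 0, 0]]"

definition nash_system :: "real ^ param \<Rightarrow> 7 system" where
  "nash_system \<theta> = \<lparr> mB = mat_BN \<theta>, mC = mat_CN \<theta>, mD = mat_DN \<theta>, mM = vec_MN \<theta>,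
     mE = mat_DN (barred \<theta>), mh = vec_MN (barred \<theta>) \<rparr>"

definition pareto_system :: "real ^ param \<Rightarrow> 5 system" where
  "pareto_system \<theta> = \<lparr> mB = mat_BP \<theta>, mC = mat_I1 ** mat_CN \<theta> ** mat_I2, mD = mat_I1 ** mat_DN \<theta>,
     mM = mat_I1 *v vec_MN \<theta>, mE = mat_I1 ** mat_DN (barred \<theta>), mh = mat_I1 *v vec_MN (barred \<theta>) \<rparr>"

definition riccati_solution ::
    "real \<Rightarrow> real ^ 5 ^ 5 \<Rightarrow> ('l::finite) system \<Rightarrow> (real \<Rightarrow> real ^ 5 ^ 'l) \<Rightarrow> bool" where
  "riccati_solution T A S \<Gamma> \<longleftrightarrow>
     (\<forall>t\<in>{0..T}. (\<Gamma> has_vector_derivative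
        - (\<Gamma> t ** A + mC S ** \<Gamma> t - \<Gamma> t ** mB S ** \<Gamma> t + mD S)) (at t within {0..T})) \<and>
     \<Gamma> T = mE S"

text \<open>Solutions are unique on \<open>[0, T]\<close>; the values outside that interval are never used.\<close>

definition riccati ::
    "real \<Rightarrow> real ^ 5 ^ 5 \<Rightarrow> ('l::finite) system \<Rightarrow> real \<Rightarrow> real ^ 5 ^ 'l" where
  "riccati T A S = (SOME \<Gamma>. riccati_solution T A S \<Gamma>)"

definition offset_solution ::
    "real \<Rightarrow> ('l::finite) system \<Rightarrow> (real \<Rightarrow> real ^ 5 ^ 'l) \<Rightarrow> (real \<Rightarrow> real ^ 'l) \<Rightarrow> bool" where
  "offset_solution T S \<Gamma> g \<longleftrightarrow>
     (\<forall>t\<in>{0..T}. (g has_vector_derivative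
        - ((mC S - \<Gamma> t ** mB S) *v g t + mM S)) (at t within {0..T})) \<and>
     g T = mh S"

text \<open>
  In the backward equation the term \<open>\<integral>\<^sub>t\<^sup>T Z dW\<close>, whose integrand \<open>Z\<close> is part of the unknown, is
  eliminated in the usual way by conditioning on the filtration generated by \<open>W\<close> and the initial
  data: \<open>p t\<close> is the conditional expectation of \<open>E x(T) + h + \<integral>\<^sub>t\<^sup>T (C p + D x + M) ds\<close>.
  (\<open>Z\<close> is recovered by martingale representation.)
\<close>

definition fbsde_solution ::
    "'a measure \<Rightarrow> 'a noise \<Rightarrow> real \<Rightarrow> 'a model \<Rightarrow> ('l::finite) system \<Rightarrow>
     (real \<Rightarrow> 'a \<Rightarrow> real ^ 5) \<Rightarrow> (real \<Rightarrow> 'a \<Rightarrow> real ^ 'l) \<Rightarrow> bool" where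
  "fbsde_solution P W T m S x p \<longleftrightarrow>
     (let A = mat_A (par m); \<Sigma> = mat_Sigma (par m); \<G> = leader_filtration P W m in
       state_process P T \<G> x \<and> state_process P T \<G> p \<and>
       (AE \<omega> in P. \<forall>t\<in>{0..T}. x t \<omega> = x_init P m \<omega>
          + (LBINT s:{0..t}. A *v x s \<omega> - mB S *v p s \<omega>)
          + \<Sigma> *v vector [W Alpha t \<omega>, W Beta t \<omega>]) \<and>
       (\<forall>t\<in>{0..T}. \<forall>i. AE \<omega> in P. p t \<omega> $ i = real_cond_exp P (\<G> t)
          (\<lambda>\<omega>'. (mE S *v x T \<omega>' + mh S
             + (LBINT s:{t..T}. mC S *v p s \<omega>' + mD S *v x s \<omega>' + mM S)) $ i) \<omega>))"

text \<open>
  \<open>sol\<close> is the solution concept, \<^const>\<open>nash\<close> or \<^const>\<open>pareto\<close>. In both systems the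
  equilibrium controls are \<open>u\<^sub>\<gamma> = - (D\<^sub>\<gamma> / R\<^sub>\<gamma>) p\<^sub>\<gamma>\<close>, where \<open>p\<^sub>\<alpha>\<close>, \<open>p\<^sub>\<beta>\<close> are the first
  two entries of \<open>p\<close>: this is what the first two rows of the forward equation say.
\<close>

type_synonym 'a solution_concept =
  "'a measure \<Rightarrow> 'a noise \<Rightarrow> real \<Rightarrow> 'a model \<Rightarrow>
   'a process \<Rightarrow> 'a process \<Rightarrow> 'a process \<Rightarrow> 'a process \<Rightarrow> 'a process \<Rightarrow> bool"

definition equilibrium ::
    "'a measure \<Rightarrow> 'a noise \<Rightarrow> real \<Rightarrow> 'a solution_concept \<Rightarrow> ('l::{finite, numeral}) system \<Rightarrow> 'a model \<Rightarrow>
     (real \<Rightarrow> 'a \<Rightarrow> real ^ 5) \<Rightarrow> (real \<Rightarrow> 'a \<Rightarrow> real ^ ('l::{finite, numeral})) \<Rightarrow> bool" where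
  "equilibrium P W T sol S m x p \<longleftrightarrow>
     fbsde_solution P W T m S x p \<and>
     (\<exists>\<Gamma> g. riccati_solution T (mat_A (par m)) S \<Gamma> \<and> offset_solution T S \<Gamma> g \<and>
        (AE \<omega> in P. \<forall>t\<in>{0..T}. p t \<omega> = \<Gamma> t *v x t \<omega> + g t)) \<and>
     sol P W T m
       (\<lambda>t \<omega>. - (par m $ D\<^sub>\<alpha> / par m $ R\<^sub>\<alpha>) * (p t \<omega> $ 1))
       (\<lambda>t \<omega>. - (par m $ D\<^sub>\<beta> / par m $ R\<^sub>\<beta>) * (p t \<omega> $ 2))
       (\<lambda>t \<omega>. x t \<omega> $ 1) (\<lambda>t \<omega>. x t \<omega> $ 2) (\<lambda>t \<omega>. x t \<omega> $ 3)"

definition equilibrium_cost ::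
    "'a measure \<Rightarrow> 'a noise \<Rightarrow> real \<Rightarrow> 'a solution_concept \<Rightarrow> ('l::{finite, numeral}) system \<Rightarrow> 'a model \<Rightarrow>
     real \<Rightarrow> bool" where
  "equilibrium_cost P W T sol S m c \<longleftrightarrow>
     (\<exists>x p u x1. equilibrium P W T sol S m x p \<and>
        follower_optimal P W T m (\<lambda>t \<omega>. x t \<omega> $ 1) (\<lambda>t \<omega>. x t \<omega> $ 2) (\<lambda>t \<omega>. x t \<omega> $ 3) u x1 \<and>
        c = J_follower P T (par m) (\<lambda>t \<omega>. x t \<omega> $ 1) (\<lambda>t \<omega>. x t \<omega> $ 2) (\<lambda>t \<omega>. x t \<omega> $ 3) x1 u)"

definition is_J1_nash ::
    "'a measure \<Rightarrow> 'a noise \<Rightarrow> real \<Rightarrow> 'a model \<Rightarrow> real \<Rightarrow> bool" where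
  "is_J1_nash P W T m = equilibrium_cost P W T nash (nash_system (par m)) m"

definition is_J1_pareto ::
    "'a measure \<Rightarrow> 'a noise \<Rightarrow> real \<Rightarrow> 'a model \<Rightarrow> real \<Rightarrow> bool" where
  "is_J1_pareto P W T m = equilibrium_cost P W T pareto (pareto_system (par m)) m"

definition J1_nash ::
    "'a measure \<Rightarrow> 'a noise \<Rightarrow> real \<Rightarrow> 'a model \<Rightarrow> real" where
  "J1_nash P W T m = (THE c. is_J1_nash P W T m c)"

definition J1_pareto ::
    "'a measure \<Rightarrow> 'a noise \<Rightarrow> real \<Rightarrow> 'a model \<Rightarrow> real" where
  "J1_pareto P W T m = (THE c. is_J1_pareto P W T m c)"

section \<open>Assumptions on the base model\<close>

definition eigenvalues :: "real ^ 'n ^ 'n \<Rightarrow> real set" where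
  "eigenvalues K = {e. \<exists>v. v \<noteq> 0 \<and> K *v v = e *\<^sub>R v}"

text \<open>The next two are only applied to symmetric matrices.\<close>

definition lambda_min :: "real ^ 'n ^ 'n \<Rightarrow> real" where
  "lambda_min K = Min (eigenvalues K)"

definition lambda_max :: "real ^ 'n ^ 'n \<Rightarrow> real" where
  "lambda_max K = Max (eigenvalues K)"

definition block_matrix ::
    "real ^ ('c::finite) ^ ('r::finite) \<Rightarrow> real ^ ('d::finite) ^ 'r \<Rightarrow>
     real ^ 'c ^ ('s::finite) \<Rightarrow> real ^ 'd ^ 's \<Rightarrow> real ^ ('c + 'd) ^ ('r + 's)" where
  "block_matrix K11 K12 K21 K22 = (\<chi> i j. case (i, j) of
       (Inl a, Inl b) \<Rightarrow> K11 $ a $ b | (Inl a, Inr b) \<Rightarrow> K12 $ a $ b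
     | (Inr a, Inl b) \<Rightarrow> K21 $ a $ b | (Inr a, Inr b) \<Rightarrow> K22 $ a $ b)"

definition append_rows ::
    "real ^ 'c ^ ('r::finite) \<Rightarrow> real ^ 'c ^ ('s::finite) \<Rightarrow> real ^ 'c ^ ('r + 's)" where
  "append_rows K L = (\<chi> i. case i of Inl a \<Rightarrow> K $ a | Inr a \<Rightarrow> L $ a)"

definition append_zero_columns :: "real ^ ('c::finite) ^ 'r \<Rightarrow> real ^ ('c + 'd::finite) ^ 'r" where
  "append_zero_columns K = (\<chi> i j. case j of Inl b \<Rightarrow> K $ i $ b | Inr _ \<Rightarrow> 0)"

text \<open>Used both with state dimension 5 and, for the extended system, with state dimension 7, the
  rows and columns then being indexed by the type \<open>5 + 2\<close>.\<close>

definition pi_condition ::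
    "real ^ 'n ^ 'n \<Rightarrow> real ^ 'l ^ 'n \<Rightarrow> real ^ 'l ^ 'l \<Rightarrow> real ^ 'n ^ 'l \<Rightarrow> real ^ 'n ^ 'l \<Rightarrow> bool" where
  "pi_condition A B C D E \<longleftrightarrow>
     (\<exists>(\<Pi>1 :: real ^ 'n ^ 'n) (\<Pi>2 :: real ^ 'l ^ 'n).
        transpose \<Pi>1 = \<Pi>1 \<and>
        (let \<Lambda> = block_matrix
               (- (\<Pi>1 ** A) + \<Pi>2 ** D) (\<Pi>1 ** B - transpose A ** \<Pi>2 + \<Pi>2 ** C)
               0 (transpose B ** \<Pi>2)
         in lambda_min (\<Lambda> + transpose \<Lambda>) \<ge> 0) \<and>
        lambda_min (\<Pi>1 + \<Pi>2 ** E + transpose E ** transpose \<Pi>2) > 0)"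

definition condition_2A :: "real ^ 5 ^ 5 \<Rightarrow> ('l::finite) system \<Rightarrow> bool" where
  "condition_2A A S \<longleftrightarrow> pi_condition A (mB S) (mC S) (mD S) (mE S)"

definition condition_2B :: "real ^ 5 ^ 5 \<Rightarrow> 7 system \<Rightarrow> bool" where
  "condition_2B A S \<longleftrightarrow>
     (\<exists>(A' :: real ^ 2 ^ 2) (B' :: real ^ 7 ^ 2).
        pi_condition (block_matrix A 0 0 A') (append_rows (mB S) B') (mC S)
          (append_zero_columns (mD S)) (append_zero_columns (mE S)))"

definition assumption_3_1 :: "real ^ param \<Rightarrow> bool" where
  "assumption_3_1 \<theta> \<longleftrightarrow>
     (\<theta> $ B\<^sub>1)\<^sup>2 < 4 * \<theta> $ Q\<^sub>1 * (1 - \<theta> $ F\<^sub>1) * (\<theta> $ E\<^sub>1)\<^sup>2 / \<theta> $ R\<^sub>1 \<and>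
     \<theta> $ Qb\<^sub>1 * (1 - \<theta> $ Fb\<^sub>1) \<ge> 0"

definition assumption_2 :: "real ^ param \<Rightarrow> bool" where
  "assumption_2 \<theta> \<longleftrightarrow>
     (condition_2A (mat_A \<theta>) (nash_system \<theta>) \<and> condition_2A (mat_A \<theta>) (pareto_system \<theta>)) \<or>
     (condition_2A (mat_A \<theta>) (pareto_system \<theta>) \<and> condition_2B (mat_A \<theta>) (nash_system \<theta>))"

section \<open>The condition on the horizon\<close>

definition spectral_norm :: "real ^ 'n ^ 'm \<Rightarrow> real" where
  "spectral_norm K = sqrt (lambda_max (transpose K ** K))"

definition rho_T :: "real \<Rightarrow> (real \<Rightarrow> real ^ 'n ^ 'm) \<Rightarrow> real" where
  "rho_T T \<Phi> = (SUP t\<in>{0..T}. spectral_norm (\<Phi> t))"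

definition growth_rate ::
    "real \<Rightarrow> (real ^ param \<Rightarrow> ('l::finite) system) \<Rightarrow> real ^ param \<Rightarrow> real ^ param \<Rightarrow> real" where
  "growth_rate T Sys \<theta>0 \<theta> =
     (let \<Gamma>0 = riccati T (mat_A \<theta>0) (Sys \<theta>0); S = Sys \<theta> in
       rho_T T (\<lambda>t. mat_A \<theta> - mB S ** \<Gamma>0 t) + rho_T T (\<lambda>t. mC S - \<Gamma>0 t ** mB S))"

text \<open>The quantity \<open>\<E>\<^sub>0(\<delta>)\<close>; \<open>\<delta>\<close> does not occur in its formula, it only delimits the models
  \<open>\<theta>\<close> for which the quantity is considered.\<close>

definition E0 ::
    "real \<Rightarrow> (real ^ param \<Rightarrow> ('l::finite) system) \<Rightarrow> real ^ param \<Rightarrow> real ^ param \<Rightarrow> ereal" where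
  "E0 T Sys \<theta>0 \<theta> =
     (let \<Gamma>0 = riccati T (mat_A \<theta>0) (Sys \<theta>0); S0 = Sys \<theta>0; S = Sys \<theta>;
          dA = mat_A \<theta> - mat_A \<theta>0; dC = mC S - mC S0; dE = mE S - mE S0;
          a = growth_rate T Sys \<theta>0 \<theta>;
          brace = rho_T T (\<lambda>t. \<Gamma>0 t ** dA + dC ** \<Gamma>0 t) + spectral_norm dE * a
      in if brace = 0 then \<infinity>
         else ereal (a / (2 * sqrt (spectral_norm (mB S))) * brace powr (- (1 / 2))))"

definition log_ereal :: "ereal \<Rightarrow> ereal" where
  "log_ereal y = (if y = \<infinity> then \<infinity> else ereal (ln (real_of_ereal y)))"

text \<open>In the degenerate case of an infinite numerator and a vanishing denominator, the quotient in
  \<^typ>\<open>ereal\<close> is \<open>\<infinity>\<close>.\<close>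

definition horizon_condition ::
    "real \<Rightarrow> (real ^ param \<Rightarrow> ('l::finite) system) \<Rightarrow> real ^ param \<Rightarrow> real ^ param \<Rightarrow> bool" where
  "horizon_condition T Sys \<theta>0 \<theta> \<longleftrightarrow>
     E0 T Sys \<theta>0 \<theta> > 1 \<and>
     ereal T \<le> log_ereal (E0 T Sys \<theta>0 \<theta>) / ereal (growth_rate T Sys \<theta>0 \<theta>)"

end

theory Submission
  imports Defs
begin

text \<open>A solution of the Riccati equation is \<open>\<Gamma> = Y X\<^sup>-\<^sup>1\<close>, where \<open>(X, Y)\<close> is the Hamiltonian flow with terminal
  value \<open>(I, E)\<close>. Conditions 2A and 2B provide a Lyapunov function along this flow which prevents \<open>X\<close> from becoming
  singular on \<open>[0, T]\<close>. Since the flow depends continuously on the coefficients, the Riccati equation stays solvable, with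
  uniformly close solutions, for all models near \<open>\<MM>0\<close>. The noise being additive, the closed-loop states are explicit
  functionals of the Wiener paths and of the initial data, and they depend continuously in \<open>L\<^sup>2\<close> on the model.

  These states are equilibria. The process \<open>p = \<Gamma> x + g\<close> satisfies the backward equation when tested against the past,
  and pairing it with a variation of the states yields the first-order conditions of the convex problems of the leaders.
  The follower's optimal state is \<open>z\<close> plus an independent centred fluctuation, the optimal state of a scalar regulator.
  So both costs exist, are unique and are continuous at \<open>\<MM>0\<close>; their difference keeps its sign on a ball around \<open>\<MM>0\<close>,
  and \<open>\<C>\<close> is the radius of this ball divided by \<open>\<Delta>J\<close>.\<close>

section \<open>Linear differential equations\<close>

text \<open>The Riccati equation is nonlinear and could blow up, whereas the Hamiltonian flow is
  linear, exists on all of [0, T] for every model and depends continuously on its coefficients. Only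
  the nonvanishing of det X has to be secured, and only at the base model: being uniform on a
  compact interval, it persists nearby.

  The second obstacle is that z is endogenous. A deviating leader produces some outcome about which
  only the follower's optimality and the conditional mean identity are known, so no formula for the
  new z is available. Instead the follower's stationarity condition is tested, for both outcomes, in
  one prescribed direction: component 4 or 5 of the state in the Nash game, their sum in the Pareto
  game. The control in that direction is tuned so that the unknown change of the follower's control
  drops out of the duality identities.

  Finally, the costs are definite descriptions, so continuity also needs uniqueness. The feedback
  relation p = \<Gamma> x + g, which an equilibrium must satisfy, forces two equilibria to have the
  same states almost surely; the follower's optimality then compares their costs in both
  directions.\<close>

lemma matrix_transpose_inner:
  fixes K :: "real ^ 'n ^ 'm"
  shows "x \<bullet> (K *v y) = (transpose K *v x) \<bullet> y"
  by (metis dot_lmul_matrix inner_commute vector_transpose_matrix transpose_transpose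
      transpose_matrix_vector)

text \<open>\<open>lambda_min\<close> is a \<open>Min\<close>, which bounds its set from below only
  if that set is finite. Eigenvectors of a symmetric matrix for distinct eigenvalues are orthogonal,
  hence independent, so a choice of one eigenvector per eigenvalue has a finite image.\<close>

lemma finite_eigenvalues:
  fixes K :: "real ^ 'n ^ 'n"
  assumes "transpose K = K"
  shows "finite (eigenvalues K)"
proof -
  have "\<forall>e\<in>eigenvalues K. \<exists>v. v \<noteq> 0 \<and> K *v v = e *\<^sub>R v"
    by (auto simp: eigenvalues_def)
  then obtain v where v: "\<And>e. e \<in> eigenvalues K \<Longrightarrow> v e \<noteq> 0 \<and> K *v v e = e *\<^sub>R v e"
    by metis
  have orth: "v a \<bullet> v b = 0" if "a \<in> eigenvalues K" "b \<in> eigenvalues K" "a \<noteq> b" for a b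
  proof -
    have "v a \<bullet> (K *v v b) = (K *v v a) \<bullet> v b"
      using matrix_transpose_inner[of "v a" K "v b"] by (simp add: assms)
    then have "b * (v a \<bullet> v b) = a * (v a \<bullet> v b)"
      using v that by simp
    then show ?thesis using that by simp
  qed
  have inj: "inj_on v (eigenvalues K)"
    by (metis inj_onI inner_eq_zero_iff orth v)
  have "pairwise orthogonal (v ` eigenvalues K)"
    using orth by (auto simp: pairwise_def orthogonal_def)
  then have "independent (v ` eigenvalues K)"
    by (rule pairwise_orthogonal_independent) (use v in fastforce)
  then have "finite (v ` eigenvalues K)"
    by (rule independent_imp_finite)
  then show ?thesis
    using finite_imageD inj by blast
qed

text \<open>The quadratic form attains its minimum on the unit sphere, and a minimiser is an
  eigenvector; so the smallest eigenvalue bounds the form. It is in this form that the eigenvalue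
  conditions of \<open>assumption_2\<close> enter the proof.\<close>

lemma lambda_min_le:
  fixes K :: "real ^ 'n ^ 'n"
  assumes sym: "transpose K = K"
  shows "lambda_min K * (v \<bullet> v) \<le> v \<bullet> (K *v v)"
proof -
  let ?q = "\<lambda>v. v \<bullet> (K *v v)"
  have "\<exists>v0 \<in> sphere 0 1. \<forall>v \<in> sphere 0 1. ?q v0 \<le> ?q v"
    by (rule continuous_attains_inf)
      (auto intro!: continuous_intros matrix_vector_mult_linear_continuous_on)
  then obtain v0 where v0: "norm v0 = 1" and min: "\<And>v. norm v = 1 \<Longrightarrow> ?q v0 \<le> ?q v"
    by (auto simp: dist_norm)
  define m where "m = ?q v0"
  have ray: "m * (v \<bullet> v) \<le> ?q v" for v
  proof (cases "v = 0")
    case False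
    have "m \<le> ?q (v /\<^sub>R norm v)" unfolding m_def by (rule min) (use False in simp)
    also have "\<dots> = ?q v / (norm v)\<^sup>2"
      by (simp add: matrix_vector_mult_scaleR power2_eq_square field_simps)
    finally show ?thesis using False by (simp add: field_simps power2_norm_eq_inner)
  qed simp
  \<comment> \<open>The residual of the eigenvector equation at the minimiser \<open>v0\<close>.
    Moving \<open>v0\<close> along \<open>w\<close> changes the form, to first order in
    \<open>s\<close>, by \<open>2 * s * (w \<bullet> w)\<close>, so a small negative
    \<open>s\<close> would undercut the minimum unless \<open>w = 0\<close>.\<close>
  define w where "w = K *v v0 - m *\<^sub>R v0"
  have "w = 0"
  proof (rule ccontr)
    assume "w \<noteq> 0"
    have pos: "0 \<le> 2 * s * (w \<bullet> w) + s\<^sup>2 * (?q w - m * (w \<bullet> w))" for s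
    proof -
      have "m * ((v0 + s *\<^sub>R w) \<bullet> (v0 + s *\<^sub>R w)) \<le> ?q (v0 + s *\<^sub>R w)" by (rule ray)
      moreover have "(v0 + s *\<^sub>R w) \<bullet> (v0 + s *\<^sub>R w) = 1 + 2 * s * (w \<bullet> v0) + s\<^sup>2 * (w \<bullet> w)"
      proof -
        have "v0 \<bullet> v0 = 1" using v0 by (metis power2_norm_eq_inner power_one)
        then show ?thesis
          by (simp add: inner_add_left inner_add_right inner_commute[of v0 w] power2_eq_square algebra_simps)
      qed
      moreover have "v0 \<bullet> (K *v w) = w \<bullet> (K *v v0)"
        using matrix_transpose_inner[of v0 K w] by (simp add: sym inner_commute)
      then have "?q (v0 + s *\<^sub>R w) = m + 2 * s * (w \<bullet> (K *v v0)) + s\<^sup>2 * ?q w"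
        by (simp add: matrix_vector_right_distrib matrix_vector_mult_scaleR inner_add_left
            inner_add_right m_def power2_eq_square algebra_simps)
      moreover have "2 * s * (w \<bullet> w) = 2 * s * (w \<bullet> (K *v v0) - m * (w \<bullet> v0))"
        by (simp add: w_def inner_diff_right)
      ultimately show ?thesis
        by (simp only: ) (simp add: algebra_simps)
    qed
    \<comment> \<open>An upper bound for the curvature along \<open>w\<close>, made positive so that
      the vertex \<open>- (w \<bullet> w) / c\<close> of the dominating parabola can be taken as
      step size.\<close>
    define c where "c = \<bar>?q w - m * (w \<bullet> w)\<bar> + 1"
    have c: "c > 0" "?q w - m * (w \<bullet> w) \<le> c" unfolding c_def by auto
    have ww: "w \<bullet> w > 0" using \<open>w \<noteq> 0\<close> by simp
    let ?s = "- (w \<bullet> w) / c"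
    have "2 * ?s * (w \<bullet> w) + ?s\<^sup>2 * (?q w - m * (w \<bullet> w)) \<le> 2 * ?s * (w \<bullet> w) + ?s\<^sup>2 * c"
      using c by (intro add_left_mono mult_left_mono) auto
    also have "\<dots> = - (w \<bullet> w)\<^sup>2 / c" using c by (simp add: field_simps power2_eq_square)
    also have "\<dots> < 0" using c ww by simp
    finally show False using pos[of ?s] by linarith
  qed
  then have "m \<in> eigenvalues K"
    using v0 by (auto simp: eigenvalues_def w_def intro!: exI[of _ v0])
  then have "lambda_min K \<le> m"
    unfolding lambda_min_def by (intro Min_le finite_eigenvalues sym)
  then show ?thesis
    by (meson inner_ge_zero mult_right_mono order_trans ray)
qed

text \<open>Gronwall's inequality for the squared norm, which unlike the norm is differentiable
  where \<open>D\<close> vanishes. The extra 1 in the rate comes from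
  \<open>2 * (norm (D s) * r) \<le> (norm (D s))\<^sup>2 + r\<^sup>2\<close>, which trades the cross
  term for \<open>r\<^sup>2\<close>.\<close>

lemma energy_estimate_forward:
  fixes D :: "real \<Rightarrow> 'v::real_inner"
  assumes der: "\<And>t. t \<in> {a..b} \<Longrightarrow> (D has_vector_derivative D' t) (at t within {a..b})"
    and bd: "\<And>t. t \<in> {a..b} \<Longrightarrow> norm (D' t) \<le> c * norm (D t) + r"
    and r: "0 \<le> r" and t: "t \<in> {a..b}" and c: "0 \<le> c"
  shows "(norm (D t))\<^sup>2 \<le> exp ((2 * c + 1) * (t - a)) * ((norm (D a))\<^sup>2 + r\<^sup>2 * (t - a))"
proof -
  let ?k = "2 * c + 1"
  \<comment> \<open>Integrating factor for the quadratic growth, minus the accumulated source; since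
    the exponential factor is at most 1, the mean value theorem shows that \<open>f\<close> does not
    increase.\<close>
  define f where "f s = exp (- ?k * (s - a)) * (D s \<bullet> D s) - r\<^sup>2 * (s - a)" for s
  have "f t \<le> f a"
  proof -
    show ?thesis
    proof (rule ccontr)
      assume "\<not> f t \<le> f a"
      then have "a < t" using t by (cases "a = t") auto
      have fd: "(f has_derivative (\<lambda>h. h * (exp (- ?k * (s - a)) * (2 * (D s \<bullet> D' s) - ?k * (D s \<bullet> D s)) - r\<^sup>2)))
          (at s within {a..t})" if "s \<in> {a..t}" for s
      proof -
        have "(D has_derivative (\<lambda>h. h *\<^sub>R D' s)) (at s within {a..t})"
          using has_vector_derivative_within_subset[OF der, of s "{a..t}"] that t
          by (auto simp: has_vector_derivative_def)
        then show ?thesis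
          unfolding f_def
          by (auto intro!: derivative_eq_intros simp: inner_commute algebra_simps)
      qed
      obtain s where s: "s \<in> {a<..<t}"
        and eq: "f t - f a = (t - a) * (exp (- ?k * (s - a)) * (2 * (D s \<bullet> D' s) - ?k * (D s \<bullet> D s)) - r\<^sup>2)"
        using mvt_simple[OF \<open>a < t\<close>, of f, OF fd] by auto
      have sab: "s \<in> {a..b}" using s t by auto
      have "D s \<bullet> D' s \<le> norm (D s) * (c * norm (D s) + r)"
        by (meson Cauchy_Schwarz_ineq2 abs_le_D1 bd mult_left_mono norm_ge_zero order_trans sab)
      moreover have "2 * (norm (D s) * r) \<le> (norm (D s))\<^sup>2 + r\<^sup>2"
        using sum_squares_bound[of "norm (D s)" r] by simp
      ultimately have "2 * (D s \<bullet> D' s) - ?k * (D s \<bullet> D s) \<le> r\<^sup>2"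
        by (simp add: power2_norm_eq_inner[symmetric] power2_eq_square algebra_simps)
      then have "exp (- ?k * (s - a)) * (2 * (D s \<bullet> D' s) - ?k * (D s \<bullet> D s)) \<le> exp (- ?k * (s - a)) * r\<^sup>2"
        by (intro mult_left_mono) auto
      also have "\<dots> \<le> 1 * r\<^sup>2"
        using s c by (intro mult_right_mono) (auto intro!: mult_nonpos_nonneg)
      finally have "f t - f a \<le> 0"
        unfolding eq using \<open>a < t\<close> by (intro mult_nonneg_nonpos) auto
      with \<open>\<not> f t \<le> f a\<close> show False by simp
    qed
  qed
  then have "exp (- ?k * (t - a)) * (norm (D t))\<^sup>2 \<le> (norm (D a))\<^sup>2 + r\<^sup>2 * (t - a)"
    by (simp add: f_def power2_norm_eq_inner)
  then have "exp (?k * (t - a)) * (exp (- ?k * (t - a)) * (norm (D t))\<^sup>2)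
      \<le> exp (?k * (t - a)) * ((norm (D a))\<^sup>2 + r\<^sup>2 * (t - a))"
    by (intro mult_left_mono) auto
  moreover have "exp (?k * (t - a)) * exp (- ?k * (t - a)) = 1"
    by (simp flip: exp_add add: algebra_simps)
  ultimately show ?thesis
    by (simp only: mult.assoc[symmetric] mult_1)
qed

text \<open>Time reversal of the forward estimate. The Riccati, offset and Hamiltonian systems all
  prescribe their data at the right end point.\<close>

lemma energy_estimate_backward:
  fixes D :: "real \<Rightarrow> 'v::real_inner"
  assumes der: "\<And>t. t \<in> {a..b} \<Longrightarrow> (D has_vector_derivative D' t) (at t within {a..b})"
    and bd: "\<And>t. t \<in> {a..b} \<Longrightarrow> norm (D' t) \<le> c * norm (D t) + r"
    and r: "0 \<le> r" and t: "t \<in> {a..b}" and c: "0 \<le> c"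
  shows "(norm (D t))\<^sup>2 \<le> exp ((2 * c + 1) * (b - t)) * ((norm (D b))\<^sup>2 + r\<^sup>2 * (b - t))"
proof -
  let ?E = "\<lambda>s. D (a + b - s)"
  have "(?E has_vector_derivative - D' (a + b - s)) (at s within {a..b})" if "s \<in> {a..b}" for s
  proof -
    have img: "(\<lambda>s. a + b - s) ` {a..b} \<subseteq> {a..b}" by auto
    have "((D \<circ> (\<lambda>s. a + b - s)) has_vector_derivative (- 1) *\<^sub>R D' (a + b - s)) (at s within {a..b})"
    proof (rule vector_diff_chain_within)
      show "((\<lambda>s. a + b - s) has_vector_derivative - 1) (at s within {a..b})"
        by (auto intro!: derivative_eq_intros simp: has_vector_derivative_def)
      show "(D has_vector_derivative D' (a + b - s)) (at (a + b - s) within (\<lambda>s. a + b - s) ` {a..b})"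
        by (rule has_vector_derivative_within_subset[OF der img]) (use that in auto)
    qed
    then show ?thesis by (simp add: o_def)
  qed
  from energy_estimate_forward[OF this, of c r "a + b - t"] show ?thesis
    using assms by (simp add: algebra_simps)
qed

lemma vector_derivative_zero_forward:
  fixes D :: "real \<Rightarrow> 'v::real_inner"
  assumes "\<And>t. t \<in> {a..b} \<Longrightarrow> (D has_vector_derivative D' t) (at t within {a..b})"
    and "\<And>t. t \<in> {a..b} \<Longrightarrow> norm (D' t) \<le> c * norm (D t)" and "0 \<le> c" and "D a = 0" and "t \<in> {a..b}"
  shows "D t = 0"
  using energy_estimate_forward[of a b D D' c 0 t] assms by simp

lemma vector_derivative_zero_backward:
  fixes D :: "real \<Rightarrow> 'v::real_inner"
  assumes "\<And>t. t \<in> {a..b} \<Longrightarrow> (D has_vector_derivative D' t) (at t within {a..b})"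
    and "\<And>t. t \<in> {a..b} \<Longrightarrow> norm (D' t) \<le> c * norm (D t)" and "0 \<le> c" and "D b = 0" and "t \<in> {a..b}"
  shows "D t = 0"
  using energy_estimate_backward[of a b D D' c 0 t] assms by simp

text \<open>The exponential series applied to \<open>z\<close>. Its coordinates are ordinary real
  power series, so termwise differentiation needs no calculus of operators; the general Euclidean
  space allows several matrix and vector blocks to be solved for at once.\<close>

lemma linear_ode_solution_exists:
  fixes K :: "'v::euclidean_space \<Rightarrow> 'v"
  assumes "bounded_linear K"
  shows "\<exists>Z. Z t0 = z \<and> (\<forall>t. (Z has_vector_derivative K (Z t)) (at t))"
proof -
  interpret K: bounded_linear K by fact
  obtain c where c: "c > 0" "\<And>v. norm (K v) \<le> norm v * c"
    using K.pos_bounded by blast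
  define w where "w n = (K ^^ n) z" for n
  have w_bound: "norm (w n) \<le> c ^ n * norm z" for n
  proof (induction n)
    case (Suc n)
    have "norm (w (Suc n)) \<le> norm (w n) * c" by (simp add: w_def c)
    also have "\<dots> \<le> c ^ n * norm z * c" using Suc c by (intro mult_right_mono) auto
    finally show ?case by (simp add: algebra_simps)
  qed (simp add: w_def)
  have sm: "summable (\<lambda>n. (t ^ n / fact n) *\<^sub>R w n)" for t :: real
  proof (rule summable_comparison_test')
    show "summable (\<lambda>n. norm z * (inverse (fact n) * (\<bar>t\<bar> * c) ^ n))"
      by (intro summable_mult summable_exp)
    show "norm ((t ^ n / fact n) *\<^sub>R w n) \<le> norm z * (inverse (fact n) * (\<bar>t\<bar> * c) ^ n)" for n
      using mult_left_mono[OF w_bound, of "\<bar>t\<bar> ^ n / fact n" n]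
      by (simp add: power_abs power_mult_distrib field_simps)
  qed
  define Z where "Z t = (\<Sum>n. (t ^ n / fact n) *\<^sub>R w n)" for t :: real
  have comp: "(\<lambda>n. (w n \<bullet> b / fact n) * t ^ n) sums (Z t \<bullet> b)" for t b
    using bounded_linear.sums[OF bounded_linear_inner_left summable_sums[OF sm[of t]], of b]
    by (simp add: Z_def algebra_simps)
  have KZ: "K (Z t) \<bullet> b = (\<Sum>n. (w (Suc n) \<bullet> b / fact n) * t ^ n)" for t b
  proof -
    have "(\<lambda>n. K ((t ^ n / fact n) *\<^sub>R w n) \<bullet> b) sums (K (Z t) \<bullet> b)"
      unfolding Z_def by (intro bounded_linear.sums[OF bounded_linear_inner_left] K.sums summable_sums sm)
    then show ?thesis
      by (simp add: K.scaleR w_def sums_iff algebra_simps)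
  qed
  have der: "((\<lambda>t. Z t \<bullet> b) has_real_derivative K (Z t) \<bullet> b) (at t)" for t b
  proof -
    have "((\<lambda>t. \<Sum>n. (w n \<bullet> b / fact n) * t ^ n) has_real_derivative
       (\<Sum>n. diffs (\<lambda>n. w n \<bullet> b / fact n) n * t ^ n)) (at t)"
      by (rule termdiffs_strong[where K = "\<bar>t\<bar> + 1"]) (use comp in \<open>auto simp: sums_iff\<close>)
    moreover have "diffs (\<lambda>n. w n \<bullet> b / fact n) n = w (Suc n) \<bullet> b / fact n" for n
      by (simp add: diffs_def field_simps del: of_nat_Suc)
    ultimately show ?thesis
      using comp by (simp add: KZ sums_iff)
  qed
  have "(Z has_vector_derivative K (Z t)) (at t)" for t
    unfolding has_vector_derivative_def
    by (subst has_derivative_componentwise_within)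
      (use der in \<open>auto simp: has_field_derivative_def mult.commute[of _ "K (Z t) \<bullet> _"]\<close>)
  then have "((Z \<circ> (\<lambda>t. t - t0)) has_vector_derivative 1 *\<^sub>R K (Z (t - t0))) (at t)" for t
    by (intro vector_diff_chain_at) (auto intro!: derivative_eq_intros simp: has_vector_derivative_def)
  moreover have "Z 0 = z"
    unfolding Z_def by (subst suminf_finite[of "{0}"]) (auto simp: w_def)
  ultimately show ?thesis
    by (intro exI[of _ "\<lambda>t. Z (t - t0)"]) (simp add: o_def)
qed

text \<open>In finite dimension convergence on a basis already controls the operator norm; this
  turns convergence of coefficients, vector by vector, into one estimate valid for all
  arguments.\<close>

lemma linear_operator_tendsto_bound:
  fixes K :: "'p \<Rightarrow> 'v::euclidean_space \<Rightarrow> 'v"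
  assumes lin: "\<And>p. linear (K p)" and lim: "\<And>v. ((\<lambda>p. K p v) \<longlongrightarrow> K p0 v) F" and "0 < e"
  shows "\<forall>\<^sub>F p in F. \<forall>v. norm (K p v - K p0 v) \<le> e * norm v"
proof -
  let ?d = "real DIM('v)"
  have "\<forall>\<^sub>F p in F. \<forall>b\<in>Basis. norm (K p b - K p0 b) < e / ?d"
    using lim[THEN tendstoD] assms(3) by (intro eventually_ball_finite) (auto simp: dist_norm)
  then show ?thesis
  proof eventually_elim
    case (elim p)
    show ?case
    proof
      fix v
      have "K p v - K p0 v = (\<Sum>b\<in>Basis. (v \<bullet> b) *\<^sub>R (K p b - K p0 b))"
        by (subst (1 2) euclidean_representation[of v, symmetric])
          (simp add: linear_sum[OF lin] linear_scale[OF lin] sum_subtractf scaleR_diff_right)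
      also have "norm \<dots> \<le> (\<Sum>b\<in>(Basis::'v set). norm v * (e / ?d))"
      proof (rule sum_norm_le)
        fix b :: 'v assume "b \<in> Basis"
        then have "\<bar>v \<bullet> b\<bar> * norm (K p b - K p0 b) \<le> norm v * (e / ?d)"
          using elim by (intro mult_mono) (auto simp: Basis_le_norm less_imp_le)
        then show "norm ((v \<bullet> b) *\<^sub>R (K p b - K p0 b)) \<le> norm v * (e / ?d)" by simp
      qed
      finally show "norm (K p v - K p0 v) \<le> e * norm v" by (simp add: mult.commute)
    qed
  qed
qed

text \<open>The difference of two trajectories solves the equation of one of them up to the source
  \<open>(K p - K p0) Z p0\<close>, which is small uniformly in time because the reference
  trajectory is bounded. The terminal values are the prescribed data, hence the backward
  estimate.\<close>

lemma linear_ode_uniform_limit: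
  fixes K :: "'p \<Rightarrow> 'v::euclidean_space \<Rightarrow> 'v"
  assumes lin: "\<And>p. linear (K p)" and lim: "\<And>v. ((\<lambda>p. K p v) \<longlongrightarrow> K p0 v) F"
    and der: "\<And>p t. t \<in> {a..b} \<Longrightarrow> (Z p has_vector_derivative K p (Z p t)) (at t within {a..b})"
    and fin: "((\<lambda>p. Z p b) \<longlongrightarrow> Z p0 b) F" and "a \<le> b"
  shows "uniform_limit {a..b} Z (Z p0) F"
proof (rule uniform_limitI)
  fix e :: real assume e: "0 < e"
  have "bounded_linear (K p0)" by (simp add: lin linear_conv_bounded_linear[symmetric])
  then obtain c0 where c0: "c0 > 0" "\<And>v. norm (K p0 v) \<le> norm v * c0"
    using bounded_linear.pos_bounded by blast
  have "continuous_on {a..b} (Z p0)"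
    by (meson der continuous_on_vector_derivative)
  then have "bounded (Z p0 ` {a..b})"
    by (intro compact_imp_bounded compact_continuous_image) auto
  then obtain m where m: "m > 0" "\<And>t. t \<in> {a..b} \<Longrightarrow> norm (Z p0 t) \<le> m"
    by (auto simp: bounded_pos)
  \<comment> \<open>One unit above a bound for \<open>K p0\<close>: it bounds \<open>K p\<close>
    once the operators differ by at most \<open>d \<le> 1\<close>.\<close>
  let ?c = "c0 + 1"
  define L where "L = exp ((2 * ?c + 1) * (b - a))"
  have L: "L > 0" by (simp add: L_def)
  \<comment> \<open>The right-hand side of the energy estimate with terminal gap \<open>d\<close>
    and source \<open>d * m\<close> tends to 0 with \<open>d\<close>; a \<open>d\<close> is picked
    that also keeps \<open>K p\<close> within the rate \<open>?c\<close>.\<close>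
  have "\<exists>d>0. d \<le> 1 \<and> L * (d\<^sup>2 + (d * m)\<^sup>2 * (b - a)) < e\<^sup>2"
  proof -
    have "((\<lambda>d. L * (d\<^sup>2 + (d * m)\<^sup>2 * (b - a))) \<longlongrightarrow> L * (0\<^sup>2 + (0 * m)\<^sup>2 * (b - a))) (at_right 0)"
      by (intro tendsto_intros)
    then have "\<forall>\<^sub>F d in at_right 0. L * (d\<^sup>2 + (d * m)\<^sup>2 * (b - a)) < e\<^sup>2"
      by (rule order_tendstoD) (use e in simp)
    moreover have "\<forall>\<^sub>F d in at_right (0::real). d \<in> {0<..<1}"
      by (rule eventually_at_right_real) simp
    ultimately have "\<forall>\<^sub>F d in at_right (0::real). d > 0 \<and> d \<le> 1 \<and> L * (d\<^sup>2 + (d * m)\<^sup>2 * (b - a)) < e\<^sup>2"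
      by eventually_elim auto
    then show ?thesis using eventually_happens' trivial_limit_at_right_real by blast
  qed
  then obtain d where d: "d > 0" "d \<le> 1" "L * (d\<^sup>2 + (d * m)\<^sup>2 * (b - a)) < e\<^sup>2" by blast
  have "\<forall>\<^sub>F p in F. norm (Z p b - Z p0 b) < d"
    using tendstoD[OF fin d(1)] by (simp add: dist_norm)
  moreover have "\<forall>\<^sub>F p in F. \<forall>v. norm (K p v - K p0 v) \<le> d * norm v"
    by (rule linear_operator_tendsto_bound) (use lin lim d in auto)
  ultimately show "\<forall>\<^sub>F p in F. \<forall>t\<in>{a..b}. dist (Z p t) (Z p0 t) < e"
  proof eventually_elim
    case (elim p)
    show ?case
    proof
      fix t assume t: "t \<in> {a..b}"
      have "(norm (Z p t - Z p0 t))\<^sup>2 \<le> exp ((2 * ?c + 1) * (b - t)) * ((norm (Z p b - Z p0 b))\<^sup>2 + (d * m)\<^sup>2 * (b - t))"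
      proof (rule energy_estimate_backward[where D = "\<lambda>t. Z p t - Z p0 t" and D' = "\<lambda>t. K p (Z p t) - K p0 (Z p0 t)"])
        fix s assume s: "s \<in> {a..b}"
        show "((\<lambda>t. Z p t - Z p0 t) has_vector_derivative K p (Z p s) - K p0 (Z p0 s)) (at s within {a..b})"
          by (intro has_vector_derivative_diff der s)
        have "K p (Z p s) - K p0 (Z p0 s) = K p0 (Z p s - Z p0 s) + (K p (Z p s - Z p0 s) - K p0 (Z p s - Z p0 s))
           + (K p (Z p0 s) - K p0 (Z p0 s))"
          by (simp add: linear_diff[OF lin])
        also have "norm \<dots> \<le> norm (Z p s - Z p0 s) * c0 + d * norm (Z p s - Z p0 s) + d * norm (Z p0 s)"
          by (intro norm_triangle_mono c0 elim(2)[rule_format])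
        also have "\<dots> \<le> norm (Z p s - Z p0 s) * c0 + 1 * norm (Z p s - Z p0 s) + d * m"
          using d s m c0 by (intro add_mono mult_mono) auto
        finally show "norm (K p (Z p s) - K p0 (Z p0 s)) \<le> ?c * norm (Z p s - Z p0 s) + d * m"
          by (simp add: algebra_simps)
      qed (use t d m c0 in auto)
      also have "\<dots> \<le> L * (d\<^sup>2 + (d * m)\<^sup>2 * (b - a))"
        unfolding L_def using elim(1) c0 t d m
        by (intro mult_mono add_mono power_mono) (auto intro!: mult_left_mono add_nonneg_nonneg)
      also have "\<dots> < e\<^sup>2" by (rule d)
      finally show "dist (Z p t) (Z p0 t) < e"
        using e by (simp add: dist_norm power_less_imp_less_base)
    qed
  qed
qed

section \<open>Riccati equations\<close>

lemma bounded_bilinear_matrix_mult: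
  "bounded_bilinear ((**) :: real ^ 'n ^ 'm \<Rightarrow> real ^ 'k ^ 'n \<Rightarrow> real ^ 'k ^ 'm)"
  unfolding bilinear_conv_bounded_bilinear[symmetric] bilinear_def
  by (auto intro!: linearI simp: matrix_matrix_mult_def vec_eq_iff algebra_simps sum.distrib sum_distrib_left)

lemma bounded_bilinear_matrix_vector_mult:
  "bounded_bilinear ((*v) :: real ^ 'n ^ 'm \<Rightarrow> real ^ 'n \<Rightarrow> real ^ 'm)"
  unfolding bilinear_conv_bounded_bilinear[symmetric] bilinear_def
  by (auto intro!: linearI simp: matrix_vector_mult_def vec_eq_iff algebra_simps sum.distrib sum_distrib_left)

interpretation mmult: bounded_bilinear "(**) :: real ^ 'n ^ 'm \<Rightarrow> real ^ 'k ^ 'n \<Rightarrow> real ^ 'k ^ 'm"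
  by (rule bounded_bilinear_matrix_mult)

interpretation vmult: bounded_bilinear "(*v) :: real ^ 'n ^ 'm \<Rightarrow> real ^ 'n \<Rightarrow> real ^ 'm"
  by (rule bounded_bilinear_matrix_vector_mult)

lemma matrix_inv_mult:
  fixes X :: "real ^ 'n ^ 'n"
  assumes "det X \<noteq> 0"
  shows "X ** matrix_inv X = mat 1" "matrix_inv X ** X = mat 1"
  using assms someI_ex[of "\<lambda>B. X ** B = mat 1 \<and> B ** X = mat 1"]
  unfolding invertible_det_nz[symmetric] invertible_def matrix_inv_def by auto

lemma isCont_det: "isCont (det :: real ^ 'n ^ 'n \<Rightarrow> real) X"
  unfolding det_def by (intro continuous_intros)

text \<open>By Cramer's rule the entries of the inverse are quotients of determinants, hence of
  polynomials. The formula holds only where the determinant is nonzero, but this set is a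
  neighbourhood of \<open>X\<close>.\<close>

lemma isCont_matrix_inv:
  fixes X :: "real ^ 'n ^ 'n"
  assumes "det X \<noteq> 0"
  shows "isCont matrix_inv X"
proof -
  define R :: "real ^ 'n ^ 'n \<Rightarrow> real ^ 'n ^ 'n" where
    "R Y = (\<chi> k l. det (\<chi> i j. if j = k then axis l 1 $ i else Y $ i $ j) / det Y)" for Y
  have R: "matrix_inv Y = R Y" if "det Y \<noteq> 0" for Y
  proof -
    have "matrix_inv Y *v axis l 1 = (\<chi> k. R Y $ k $ l)" for l
      using cramer[OF that, of "matrix_inv Y *v axis l 1" "axis l 1"] matrix_inv_mult[OF that]
      by (simp add: matrix_vector_mul_assoc R_def)
    then show ?thesis
      by (simp add: vec_eq_iff matrix_vector_mult_basis column_def)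
  qed
  have det: "(det \<longlongrightarrow> det X) (at X)"
    using isCont_det by (simp add: isCont_def)
  have "isCont R X"
    unfolding R_def isCont_def
  proof (intro vec_tendstoI, simp, intro tendsto_divide det assms)
    fix k l
    let ?G = "\<lambda>Y. (\<chi> i j. if j = k then axis l 1 $ i else Y $ i $ j) :: real ^ 'n ^ 'n"
    have "(?G \<longlongrightarrow> ?G X) (at X)"
      by (intro vec_tendstoI) (auto intro!: tendsto_intros)
    then show "((\<lambda>Y. det (?G Y)) \<longlongrightarrow> det (?G X)) (at X)"
      by (rule isCont_tendsto_compose[OF isCont_det])
  qed
  moreover have "\<forall>\<^sub>F Y in nhds X. matrix_inv Y = R Y"
  proof -
    have "\<forall>\<^sub>F Y in nhds X. det Y \<noteq> 0"
      using tendsto_imp_eventually_ne[of det "det X" "nhds X" 0] isCont_det[of X] assms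
      by (simp add: isCont_def tendsto_at_iff_tendsto_nhds)
    then show ?thesis by eventually_elim (rule R)
  qed
  ultimately show ?thesis
    by (simp add: isCont_cong)
qed

text \<open>In the form of a limit of difference quotients the derivative of the inverse can be read
  off from the resolvent identity, divided by the time step.\<close>

lemma has_vector_derivative_within_quotient:
  "(f has_vector_derivative f') (at x within S) \<longleftrightarrow> ((\<lambda>y. (f y - f x) /\<^sub>R (y - x)) \<longlongrightarrow> f') (at x within S)"
proof -
  have "norm (f y - f x - (y - x) *\<^sub>R f') / norm (y - x) = norm ((f y - f x) /\<^sub>R (y - x) - f')" if "y \<noteq> x" for y
  proof -
    have "(f y - f x) /\<^sub>R (y - x) - f' = (f y - f x - (y - x) *\<^sub>R f') /\<^sub>R (y - x)"
      using that by (simp add: scaleR_diff_right)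
    then show ?thesis by (simp add: divide_inverse mult.commute)
  qed
  then have "((\<lambda>y. norm (f y - f x - (y - x) *\<^sub>R f') / norm (y - x)) \<longlongrightarrow> 0) (at x within S) \<longleftrightarrow>
      ((\<lambda>y. norm ((f y - f x) /\<^sub>R (y - x) - f')) \<longlongrightarrow> 0) (at x within S)"
    by (intro Lim_cong_within) auto
  then show ?thesis
    by (simp add: has_vector_derivative_def has_derivative_iff_norm bounded_linear_scaleR_left
        tendsto_norm_zero_iff LIM_zero_iff)
qed

text \<open>Resolvent identity: the difference of the inverses at \<open>s\<close> and
  \<open>t\<close> is minus the inverse at \<open>s\<close> times \<open>X s - X t\<close> times the
  inverse at \<open>t\<close>. Dividing by \<open>s - t\<close> and using continuity of inversion
  gives the limit.\<close>

lemma matrix_inv_has_vector_derivative: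
  fixes X :: "real \<Rightarrow> real ^ 'n ^ 'n"
  assumes X: "(X has_vector_derivative X') (at t within S)" and inv: "\<And>s. s \<in> S \<Longrightarrow> det (X s) \<noteq> 0"
    and t: "t \<in> S"
  shows "((\<lambda>s. matrix_inv (X s)) has_vector_derivative - (matrix_inv (X t) ** X' ** matrix_inv (X t))) (at t within S)"
proof -
  let ?I = "\<lambda>s. matrix_inv (X s)"
  have q: "((\<lambda>s. (X s - X t) /\<^sub>R (s - t)) \<longlongrightarrow> X') (at t within S)"
    using X by (simp add: has_vector_derivative_within_quotient)
  have "continuous (at t within S) X"
    using X has_vector_derivative_continuous by blast
  then have "(?I \<longlongrightarrow> ?I t) (at t within S)"
    unfolding continuous_within by (rule isCont_tendsto_compose[OF isCont_matrix_inv[OF inv[OF t]]])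
  then have "((\<lambda>s. - (?I s ** ((X s - X t) /\<^sub>R (s - t)) ** ?I t)) \<longlongrightarrow> - (?I t ** X' ** ?I t)) (at t within S)"
    by (intro tendsto_minus mmult.tendsto q tendsto_const)
  moreover have "\<forall>\<^sub>F s in at t within S. - (?I s ** ((X s - X t) /\<^sub>R (s - t)) ** ?I t) = (?I s - ?I t) /\<^sub>R (s - t)"
    unfolding eventually_at_filter
  proof (intro always_eventually allI impI)
    fix s assume "s \<noteq> t" "s \<in> S"
    then show "- (?I s ** ((X s - X t) /\<^sub>R (s - t)) ** ?I t) = (?I s - ?I t) /\<^sub>R (s - t)"
      using matrix_inv_mult[OF inv[of s]] matrix_inv_mult[OF inv[OF t]]
      by (simp add: mmult.scaleR_left mmult.scaleR_right mmult.diff_left mmult.diff_right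
          flip: matrix_mul_assoc scaleR_minus_right)
  qed
  ultimately show ?thesis
    by (simp add: has_vector_derivative_within_quotient tendsto_cong)
qed

text \<open>Stronger than uniform continuity on \<open>K\<close>, since \<open>y\<close> may leave
  \<open>K\<close>: perturbed paths need not stay in the range of the limit path. The radius is a
  Lebesgue number of a cover by balls on which the oscillation is below \<open>e\<close>.\<close>

lemma compact_isCont_uniform:
  fixes \<phi> :: "'a::metric_space \<Rightarrow> 'b::metric_space"
  assumes K: "compact K" and cont: "\<And>x. x \<in> K \<Longrightarrow> isCont \<phi> x" and e: "0 < e"
  obtains d where "0 < d" "\<And>x y. x \<in> K \<Longrightarrow> dist y x < d \<Longrightarrow> dist (\<phi> y) (\<phi> x) < e"
proof -
  have "\<exists>r>0. \<forall>y. dist y x < r \<longrightarrow> dist (\<phi> y) (\<phi> x) < e / 2" if "x \<in> K" for x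
    using cont[OF that, unfolded continuous_at_eps_delta, rule_format, of "e / 2"] e by simp
  then obtain r where r: "\<And>x. x \<in> K \<Longrightarrow> r x > 0"
    "\<And>x y. x \<in> K \<Longrightarrow> dist y x < r x \<Longrightarrow> dist (\<phi> y) (\<phi> x) < e / 2"
    by metis
  obtain d where d: "0 < d" "\<And>x. x \<in> K \<Longrightarrow> \<exists>G\<in>(\<lambda>x. ball x (r x)) ` K. ball x d \<subseteq> G"
  proof (rule Heine_Borel_lemma[OF K])
    show "K \<subseteq> \<Union> ((\<lambda>x. ball x (r x)) ` K)" using r by auto
  qed auto
  show ?thesis
  proof (rule that[OF d(1)])
    fix x y assume x: "x \<in> K" and y: "dist y x < d"
    obtain z where z: "z \<in> K" "ball x d \<subseteq> ball z (r z)" using d(2)[OF x] by auto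
    have "x \<in> ball z (r z)" "y \<in> ball z (r z)"
      using z y d(1) by (auto simp: subset_iff dist_commute)
    then have "dist (\<phi> y) (\<phi> z) < e / 2" "dist (\<phi> x) (\<phi> z) < e / 2"
      using r(2)[OF z(1)] by (auto simp: dist_commute)
    then show "dist (\<phi> y) (\<phi> x) < e" by (rule dist_triangle_half_l)
  qed
qed

text \<open>Continuity is demanded only at the values of the limit, so inversion may be composed
  although perturbed paths could meet singular matrices.\<close>

lemma uniform_limit_compose_compact:
  fixes \<phi> :: "'a::metric_space \<Rightarrow> 'b::metric_space"
  assumes lim: "uniform_limit S f l F" and K: "compact (l ` S)" and cont: "\<And>t. t \<in> S \<Longrightarrow> isCont \<phi> (l t)"
  shows "uniform_limit S (\<lambda>p t. \<phi> (f p t)) (\<lambda>t. \<phi> (l t)) F"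
proof (rule uniform_limitI)
  fix e :: real assume "0 < e"
  then obtain d where d: "0 < d" "\<And>x y. x \<in> l ` S \<Longrightarrow> dist y x < d \<Longrightarrow> dist (\<phi> y) (\<phi> x) < e"
    using compact_isCont_uniform[OF K, of \<phi> e] cont by blast
  show "\<forall>\<^sub>F p in F. \<forall>t\<in>S. dist (\<phi> (f p t)) (\<phi> (l t)) < e"
    using uniform_limitD[OF lim d(1)] by eventually_elim (use d in auto)
qed

text \<open>The \<open>X\<close>-block of the Hamiltonian flow from \<open>(I, E)\<close> at time \<open>T\<close> is singular at \<open>t\<close> iff some nontrivial
  solution vanishes there in its first component.\<close>

definition nondegenerate ::
    "real \<Rightarrow> real ^ 'n ^ 'n \<Rightarrow> real ^ 'l ^ 'n \<Rightarrow> real ^ 'l ^ 'l \<Rightarrow> real ^ 'n ^ 'l \<Rightarrow> real ^ 'n ^ 'l \<Rightarrow> bool" where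
  "nondegenerate T A B C D E \<longleftrightarrow>
     (\<forall>x y. (\<forall>t\<in>{0..T}. (x has_vector_derivative A *v x t - B *v y t) (at t within {0..T}) \<and>
          (y has_vector_derivative - (D *v x t) - C *v y t) (at t within {0..T})) \<and>
        y T = E *v x T \<and> (\<exists>t\<in>{0..T}. x t = 0) \<longrightarrow> x T = 0)"

text \<open>\<open>\<Phi>\<close> is a fundamental matrix of the closed loop and
  \<open>\<Psi>\<close> its inverse. They are recorded together with \<open>\<Gamma>\<close> and
  \<open>g\<close> because the state is built from them by variation of constants, where only
  \<open>\<Phi> t ** \<Psi> s\<close> matters; hence no normalisation of
  \<open>\<Phi>\<close>.\<close>

definition riccati_data ::
    "real \<Rightarrow> real ^ 'n ^ 'n \<Rightarrow> real ^ 'l ^ 'n \<Rightarrow> real ^ 'l ^ 'l \<Rightarrow> real ^ 'n ^ 'l \<Rightarrow> real ^ 'n ^ 'l \<Rightarrow>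
      real ^ 'l \<Rightarrow> real ^ 'l \<Rightarrow> (real \<Rightarrow> real ^ 'n ^ 'l) \<Rightarrow> (real \<Rightarrow> real ^ 'l) \<Rightarrow>
      (real \<Rightarrow> real ^ 'n ^ 'n) \<Rightarrow> (real \<Rightarrow> real ^ 'n ^ 'n) \<Rightarrow> bool" where
  "riccati_data T A B C D E M h \<Gamma> g \<Phi> \<Psi> \<longleftrightarrow>
     (\<forall>t\<in>{0..T}. (\<Gamma> has_vector_derivative - (\<Gamma> t ** A + C ** \<Gamma> t - \<Gamma> t ** B ** \<Gamma> t + D)) (at t within {0..T})) \<and>
     (\<forall>t\<in>{0..T}. (g has_vector_derivative - ((C - \<Gamma> t ** B) *v g t + M)) (at t within {0..T})) \<and>
     (\<forall>t\<in>{0..T}. (\<Phi> has_vector_derivative (A - B ** \<Gamma> t) ** \<Phi> t) (at t within {0..T})) \<and>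
     \<Gamma> T = E \<and> g T = h \<and> continuous_on {0..T} \<Psi> \<and> (\<forall>t\<in>{0..T}. \<Phi> t ** \<Psi> t = mat 1)"

text \<open>The quotient \<open>Y ** matrix_inv X\<close> linearises the Riccati equation; since
  then \<open>X' = (A - B ** \<Gamma>) ** X\<close>, the block \<open>X\<close> is itself the
  fundamental matrix. A single affine trajectory with \<open>x T = 0\<close> and
  \<open>y T = h\<close> yields the offset \<open>g = y - \<Gamma> *v x\<close>.\<close>

lemma hamiltonian_riccati_data:
  fixes X :: "real \<Rightarrow> real ^ 'n ^ 'n" and Y :: "real \<Rightarrow> real ^ 'n ^ 'l" and x :: "real \<Rightarrow> real ^ 'n"
  assumes X: "\<And>t. t \<in> {0..T} \<Longrightarrow> (X has_vector_derivative A ** X t - B ** Y t) (at t within {0..T})"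
    and Y: "\<And>t. t \<in> {0..T} \<Longrightarrow> (Y has_vector_derivative - (D ** X t) - C ** Y t) (at t within {0..T})"
    and x: "\<And>t. t \<in> {0..T} \<Longrightarrow> (x has_vector_derivative A *v x t - B *v y t) (at t within {0..T})"
    and y: "\<And>t. t \<in> {0..T} \<Longrightarrow> (y has_vector_derivative - (D *v x t) - C *v y t - M) (at t within {0..T})"
    and T: "X T = mat 1" "Y T = E" "x T = 0" "y T = h" "0 \<le> T"
    and inv: "\<And>t. t \<in> {0..T} \<Longrightarrow> det (X t) \<noteq> 0"
  shows "riccati_data T A B C D E M h (\<lambda>t. Y t ** matrix_inv (X t))
     (\<lambda>t. y t - Y t ** matrix_inv (X t) *v x t) X (\<lambda>t. matrix_inv (X t))"
proof -
  let ?I = "\<lambda>t. matrix_inv (X t)" and ?G = "\<lambda>t. Y t ** matrix_inv (X t)"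
  have I: "X t ** ?I t = mat 1" "?I t ** X t = mat 1" if "t \<in> {0..T}" for t
    using matrix_inv_mult inv that by auto
  have I': "Z ** X t ** ?I t = Z" "Z' ** ?I t ** X t = Z'" if "t \<in> {0..T}" for t and Z Z' :: "real ^ 'n ^ 'k"
    using I[OF that] by (simp_all flip: matrix_mul_assoc)
  have Id: "(?I has_vector_derivative - (?I t ** (A ** X t - B ** Y t) ** ?I t)) (at t within {0..T})"
    if "t \<in> {0..T}" for t
    by (rule matrix_inv_has_vector_derivative[OF X inv]) (use that in auto)
  have G: "(?G has_vector_derivative - (?G t ** A + C ** ?G t - ?G t ** B ** ?G t + D)) (at t within {0..T})"
    if "t \<in> {0..T}" for t
    using mmult.has_vector_derivative[OF Y[OF that] Id[OF that]]
    by (simp add: mmult.diff_left mmult.diff_right mmult.minus_left mmult.minus_right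
        matrix_mul_assoc I'[OF that] algebra_simps)
  have g: "((\<lambda>t. y t - ?G t *v x t) has_vector_derivative - ((C - ?G t ** B) *v (y t - ?G t *v x t) + M)) (at t within {0..T})"
    if "t \<in> {0..T}" for t
    using has_vector_derivative_diff[OF y[OF that] vmult.has_vector_derivative[OF G[OF that] x[OF that]]]
    by (simp add: vmult.diff_left vmult.diff_right vmult.minus_left vmult.minus_right vmult.add_left
        vmult.add_right mmult.diff_left matrix_vector_mul_assoc matrix_mul_assoc algebra_simps)
  have "matrix_inv (mat 1 :: real ^ 'n ^ 'n) = mat 1"
    using matrix_inv_mult(1)[of "mat 1 :: real ^ 'n ^ 'n"] by simp
  moreover have "continuous_on {0..T} ?I"
    using continuous_on_vector_derivative[OF Id] by blast
  moreover have "(A - B ** ?G t) ** X t = A ** X t - B ** Y t" if "t \<in> {0..T}" for t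
    using I'[OF that] by (simp add: mmult.diff_left matrix_mul_assoc)
  ultimately show ?thesis
    unfolding riccati_data_def using G g X I T by (auto simp del: atLeastAtMost_iff)
qed

text \<open>The index \<open>p\<close> and the filter are left general so that one statement serves
  the leaders' systems and the follower's scalar regulator. The four families exist for every
  \<open>p\<close>, by means of \<open>matrix_inv\<close>, but they are known to solve the equations
  only where the determinant does not vanish, thus eventually.\<close>

lemma riccati_family:
  fixes A :: "'p \<Rightarrow> real ^ 'n ^ 'n" and B :: "'p \<Rightarrow> real ^ 'l ^ 'n" and C :: "'p \<Rightarrow> real ^ 'l ^ 'l"
    and D E :: "'p \<Rightarrow> real ^ 'n ^ 'l" and M h :: "'p \<Rightarrow> real ^ 'l"
  assumes lim: "(A \<longlongrightarrow> A p0) F" "(B \<longlongrightarrow> B p0) F" "(C \<longlongrightarrow> C p0) F" "(D \<longlongrightarrow> D p0) F"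
      "(E \<longlongrightarrow> E p0) F" "(M \<longlongrightarrow> M p0) F" "(h \<longlongrightarrow> h p0) F"
    and T: "0 \<le> T" and nondeg: "nondegenerate T (A p0) (B p0) (C p0) (D p0) (E p0)"
  obtains \<Gamma> g \<Phi> \<Psi> where
    "riccati_data T (A p0) (B p0) (C p0) (D p0) (E p0) (M p0) (h p0) (\<Gamma> p0) (g p0) (\<Phi> p0) (\<Psi> p0)"
    "\<forall>\<^sub>F p in F. riccati_data T (A p) (B p) (C p) (D p) (E p) (M p) (h p) (\<Gamma> p) (g p) (\<Phi> p) (\<Psi> p)"
    "uniform_limit {0..T} \<Gamma> (\<Gamma> p0) F" "uniform_limit {0..T} g (g p0) F"
    "uniform_limit {0..T} \<Phi> (\<Phi> p0) F" "uniform_limit {0..T} \<Psi> (\<Psi> p0) F"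
proof -
  \<comment> \<open>Both Hamiltonian blocks and the affine trajectory as one linear system: the last
    real coordinate is constantly 1, which makes the source \<open>M p\<close> linear in the
    unknown.\<close>
  define K :: "'p \<Rightarrow> (real ^ 'n ^ 'n) \<times> (real ^ 'n ^ 'l) \<times> (real ^ 'n) \<times> (real ^ 'l) \<times> real \<Rightarrow>
      (real ^ 'n ^ 'n) \<times> (real ^ 'n ^ 'l) \<times> (real ^ 'n) \<times> (real ^ 'l) \<times> real" where
    "K p = (\<lambda>z. (A p ** fst z - B p ** fst (snd z), - (D p ** fst z) - C p ** fst (snd z),
        A p *v fst (snd (snd z)) - B p *v fst (snd (snd (snd z))),
        - (D p *v fst (snd (snd z))) - C p *v fst (snd (snd (snd z))) - snd (snd (snd (snd z))) *\<^sub>R M p, 0))" for p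
  have lin: "linear (K p)" for p
    by (rule linearI) (auto simp: K_def mmult.add_right mmult.scaleR_right vmult.add_right vmult.scaleR_right algebra_simps)
  then have blin: "bounded_linear (K p)" for p
    by (simp add: linear_conv_bounded_linear[symmetric])
  have limK: "((\<lambda>p. K p v) \<longlongrightarrow> K p0 v) F" for v
    by (cases v) (auto simp: K_def intro!: tendsto_intros mmult.tendsto vmult.tendsto lim)
  define z0 where "z0 p = (mat 1 :: real ^ 'n ^ 'n, E p, 0 :: real ^ 'n, h p, 1 :: real)" for p
  have "\<exists>Z. Z T = z0 p \<and> (\<forall>t. (Z has_vector_derivative K p (Z t)) (at t))" for p
    by (rule linear_ode_solution_exists[OF blin])
  then obtain Z where ZT: "\<And>p. Z p T = z0 p" and Z: "\<And>p t. (Z p has_vector_derivative K p (Z p t)) (at t)"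
    by metis
  have Zw: "(Z p has_vector_derivative K p (Z p t)) (at t within S)" for p t S
    using Z has_vector_derivative_at_within by blast
  have Zlim: "uniform_limit {0..T} Z (Z p0) F"
    by (rule linear_ode_uniform_limit[OF lin limK Zw])
      (auto simp: ZT z0_def T intro!: tendsto_intros lim)
  define X where "X = (\<lambda>p t. fst (Z p t))"
  define Y where "Y = (\<lambda>p t. fst (snd (Z p t)))"
  define x where "x = (\<lambda>p t. fst (snd (snd (Z p t))))"
  define y where "y = (\<lambda>p t. fst (snd (snd (snd (Z p t)))))"
  define s where "s = (\<lambda>p t. snd (snd (snd (snd (Z p t)))))"
  note defs = X_def Y_def x_def y_def s_def
  note fstd = bounded_linear.has_vector_derivative[OF bounded_linear_fst]
   and sndd = bounded_linear.has_vector_derivative[OF bounded_linear_snd]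
  have Xd: "(X p has_vector_derivative A p ** X p t - B p ** Y p t) (at t within S)" for p t S
    using fstd[OF Zw[of p t S]] by (simp add: K_def defs)
  have Yd: "(Y p has_vector_derivative - (D p ** X p t) - C p ** Y p t) (at t within S)" for p t S
    using fstd[OF sndd[OF Zw[of p t S]]] by (simp add: K_def defs)
  have xd: "(x p has_vector_derivative A p *v x p t - B p *v y p t) (at t within S)" for p t S
    using fstd[OF sndd[OF sndd[OF Zw[of p t S]]]] by (simp add: K_def defs)
  have sd: "(s p has_vector_derivative 0) (at t)" for p t
    using sndd[OF sndd[OF sndd[OF sndd[OF Zw[of p t UNIV]]]]] by (simp add: K_def defs)
  have s1: "s p t = 1" for p t
  proof -
    have "s p t = s p T"
      using has_derivative_zero_unique_connected[of UNIV "s p" t T] sd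
      by (auto simp: has_vector_derivative_def intro: has_derivative_zero_unique)
    then show ?thesis by (simp add: s_def ZT z0_def)
  qed
  have yd: "(y p has_vector_derivative - (D p *v x p t) - C p *v y p t - M p) (at t within S)" for p t S
    using fstd[OF sndd[OF sndd[OF sndd[OF Zw[of p t S]]]]] s1[of p t] by (simp add: K_def defs)
  have fin: "X p T = mat 1" "Y p T = E p" "x p T = 0" "y p T = h p" for p
    by (simp_all add: defs ZT z0_def)
  have cont: "continuous_on {0..T} (X p)" "continuous_on {0..T} (Z p)" for p
    using continuous_on_vector_derivative[OF Xd] continuous_on_vector_derivative[OF Zw] by auto
  \<comment> \<open>A kernel vector \<open>c\<close> of \<open>X p0 t\<close> turns the two blocks,
    applied to \<open>c\<close>, into a Hamiltonian trajectory vanishing at \<open>t\<close>;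
    nondegeneracy forces its value \<open>c\<close> at time \<open>T\<close> to be zero.\<close>
  have det0: "det (X p0 t) \<noteq> 0" if t: "t \<in> {0..T}" for t
  proof -
    have "c = 0" if c: "X p0 t *v c = 0" for c
    proof -
      have "((\<lambda>t. X p0 t *v c) has_vector_derivative A p0 *v (X p0 r *v c) - B p0 *v (Y p0 r *v c)) (at r within {0..T})"
        and "((\<lambda>t. Y p0 t *v c) has_vector_derivative - (D p0 *v (X p0 r *v c)) - C p0 *v (Y p0 r *v c)) (at r within {0..T})" for r
        using vmult.has_vector_derivative[OF Xd has_vector_derivative_const[of c], of p0 r "{0..T}"]
          vmult.has_vector_derivative[OF Yd has_vector_derivative_const[of c], of p0 r "{0..T}"]
        by (simp_all add: vmult.diff_left vmult.minus_left matrix_vector_mul_assoc)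
      then have "X p0 T *v c = 0"
        using nondeg[unfolded nondegenerate_def, rule_format, of "\<lambda>t. X p0 t *v c" "\<lambda>t. Y p0 t *v c"]
          bexI[of "\<lambda>t. X p0 t *v c = 0", OF c t] by (simp add: fin)
      then show ?thesis by (simp add: fin)
    qed
    then have "\<exists>B. B ** X p0 t = mat 1"
      using matrix_left_invertible_ker by blast
    then show ?thesis
      using invertible_left_inverse invertible_det_nz by blast
  qed
  have Xlim: "uniform_limit {0..T} X (X p0) F"
    using bounded_linear.uniform_limit[OF bounded_linear_fst Zlim] by (simp add: X_def)
  have Ylim: "uniform_limit {0..T} Y (Y p0) F"
    using bounded_linear.uniform_limit[OF bounded_linear_fst bounded_linear.uniform_limit[OF bounded_linear_snd Zlim]]
    by (simp add: Y_def)
  have compX: "compact (X p0 ` {0..T})" and compZ: "compact (Z p0 ` {0..T})"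
    by (auto intro!: compact_continuous_image cont)
  have detlim: "uniform_limit {0..T} (\<lambda>p t. det (X p t)) (\<lambda>t. det (X p0 t)) F"
    by (rule uniform_limit_compose_compact[OF Xlim compX isCont_det])
  have invlim: "uniform_limit {0..T} (\<lambda>p t. matrix_inv (X p t)) (\<lambda>t. matrix_inv (X p0 t)) F"
    by (rule uniform_limit_compose_compact[OF Xlim compX isCont_matrix_inv[OF det0]])
  have Glim0: "uniform_limit {0..T} (\<lambda>p t. (\<lambda>z. fst (snd z) ** matrix_inv (fst z)) (Z p t))
      (\<lambda>t. (\<lambda>z. fst (snd z) ** matrix_inv (fst z)) (Z p0 t)) F"
    by (rule uniform_limit_compose_compact[OF Zlim compZ], unfold isCont_def)
      (auto intro!: tendsto_intros mmult.tendsto isCont_tendsto_compose[OF isCont_matrix_inv] det0[unfolded X_def])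
  have glim0: "uniform_limit {0..T} (\<lambda>p t. (\<lambda>z. fst (snd (snd (snd z))) - fst (snd z) ** matrix_inv (fst z) *v fst (snd (snd z))) (Z p t))
      (\<lambda>t. (\<lambda>z. fst (snd (snd (snd z))) - fst (snd z) ** matrix_inv (fst z) *v fst (snd (snd z))) (Z p0 t)) F"
    by (rule uniform_limit_compose_compact[OF Zlim compZ], unfold isCont_def)
      (auto intro!: tendsto_intros mmult.tendsto vmult.tendsto isCont_tendsto_compose[OF isCont_matrix_inv] det0[unfolded X_def])
  have good: "riccati_data T (A p) (B p) (C p) (D p) (E p) (M p) (h p) (\<lambda>t. Y p t ** matrix_inv (X p t))
     (\<lambda>t. y p t - Y p t ** matrix_inv (X p t) *v x p t) (X p) (\<lambda>t. matrix_inv (X p t))"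
    if "\<forall>t\<in>{0..T}. det (X p t) \<noteq> 0" for p
    by (rule hamiltonian_riccati_data[OF Xd Yd xd yd fin T]) (use that in auto)
  \<comment> \<open>By compactness \<open>\<bar>det (X p0 t)\<bar>\<close> has a positive lower
    bound \<open>m\<close>, and a uniform error below \<open>m\<close> cannot reach zero.\<close>
  have "\<forall>\<^sub>F p in F. \<forall>t\<in>{0..T}. det (X p t) \<noteq> 0"
  proof -
    have "compact ((\<lambda>t. det (X p0 t)) ` {0..T})"
      by (intro compact_continuous_image continuous_on_compose2[OF _ cont(1), of UNIV det])
        (auto intro: continuous_at_imp_continuous_on isCont_det)
    then have "\<exists>t0\<in>{0..T}. \<forall>t\<in>{0..T}. \<bar>det (X p0 t0)\<bar> \<le> \<bar>det (X p0 t)\<bar>"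
      by (intro continuous_attains_inf continuous_intros continuous_on_compose2[OF _ cont(1), of UNIV det])
        (auto intro: continuous_at_imp_continuous_on isCont_det simp: T)
    then obtain m where m: "m > 0" "\<And>t. t \<in> {0..T} \<Longrightarrow> m \<le> \<bar>det (X p0 t)\<bar>"
      using det0 by (metis zero_less_abs_iff)
    from uniform_limitD[OF detlim m(1)] show ?thesis
    proof eventually_elim
      case (elim p)
      show ?case
      proof
        fix t assume t: "t \<in> {0..T}"
        then have "\<bar>det (X p t) - det (X p0 t)\<bar> < m" using elim by (simp add: dist_real_def)
        then show "det (X p t) \<noteq> 0" using m(2)[OF t] by auto
      qed
    qed
  qed
  then have ev: "\<forall>\<^sub>F p in F. riccati_data T (A p) (B p) (C p) (D p) (E p) (M p) (h p) (\<lambda>t. Y p t ** matrix_inv (X p t))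
     (\<lambda>t. y p t - Y p t ** matrix_inv (X p t) *v x p t) (X p) (\<lambda>t. matrix_inv (X p t))"
    by eventually_elim (rule good)
  have Glim: "uniform_limit {0..T} (\<lambda>p t. Y p t ** matrix_inv (X p t)) (\<lambda>t. Y p0 t ** matrix_inv (X p0 t)) F"
    using Glim0 unfolding X_def Y_def .
  have glim: "uniform_limit {0..T} (\<lambda>p t. y p t - Y p t ** matrix_inv (X p t) *v x p t)
      (\<lambda>t. y p0 t - Y p0 t ** matrix_inv (X p0 t) *v x p0 t) F"
    using glim0 unfolding X_def Y_def x_def y_def .
  have "\<forall>t\<in>{0..T}. det (X p0 t) \<noteq> 0" using det0 by blast
  from good[OF this] show ?thesis
    by (rule that[OF _ ev Glim glim Xlim invlim])
qed

section \<open>The coefficients and the solvability conditions\<close>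

lemma exhaust_5:
  fixes x :: 5
  shows "x = 1 \<or> x = 2 \<or> x = 3 \<or> x = 4 \<or> x = 5"
proof (induct x)
  case (of_int z)
  then have "z = 0 \<or> z = 1 \<or> z = 2 \<or> z = 3 \<or> z = 4" by fastforce
  then show ?case by auto
qed

lemma exhaust_7:
  fixes x :: 7
  shows "x = 1 \<or> x = 2 \<or> x = 3 \<or> x = 4 \<or> x = 5 \<or> x = 6 \<or> x = 7"
proof (induct x)
  case (of_int z)
  then have "z = 0 \<or> z = 1 \<or> z = 2 \<or> z = 3 \<or> z = 4 \<or> z = 5 \<or> z = 6" by fastforce
  then show ?case by auto
qed

lemma forall_5: "(\<forall>i::5. P i) \<longleftrightarrow> P 1 \<and> P 2 \<and> P 3 \<and> P 4 \<and> P 5"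
  by (metis exhaust_5)

lemma UNIV_5: "UNIV = {1, 2, 3, 4, 5::5}"
  using exhaust_5 by auto

lemma UNIV_7: "UNIV = {1, 2, 3, 4, 5, 6, 7::7}"
  using exhaust_7 by auto

lemma sum_5: "sum f (UNIV::5 set) = f 1 + f 2 + f 3 + f 4 + f 5"
  unfolding UNIV_5 by (simp add: ac_simps)

lemma sum_7: "sum f (UNIV::7 set) = f 1 + f 2 + f 3 + f 4 + f 5 + f 6 + f 7"
  unfolding UNIV_7 by (simp add: ac_simps)

lemma vector_5 [simp]:
  "(vector [a, b, c, d, e] :: ('a::zero) ^ 5) $ 1 = a"
  "(vector [a, b, c, d, e] :: ('a::zero) ^ 5) $ 2 = b"
  "(vector [a, b, c, d, e] :: ('a::zero) ^ 5) $ 3 = c"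
  "(vector [a, b, c, d, e] :: ('a::zero) ^ 5) $ 4 = d"
  "(vector [a, b, c, d, e] :: ('a::zero) ^ 5) $ 5 = e"
  unfolding vector_def by simp_all

lemma vector_7 [simp]:
  "(vector [a, b, c, d, e, f, g] :: ('a::zero) ^ 7) $ 1 = a"
  "(vector [a, b, c, d, e, f, g] :: ('a::zero) ^ 7) $ 2 = b"
  "(vector [a, b, c, d, e, f, g] :: ('a::zero) ^ 7) $ 3 = c"
  "(vector [a, b, c, d, e, f, g] :: ('a::zero) ^ 7) $ 4 = d"
  "(vector [a, b, c, d, e, f, g] :: ('a::zero) ^ 7) $ 5 = e"
  "(vector [a, b, c, d, e, f, g] :: ('a::zero) ^ 7) $ 6 = f"
  "(vector [a, b, c, d, e, f, g] :: ('a::zero) ^ 7) $ 7 = g"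
  unfolding vector_def by simp_all

lemma vec_tendsto_5I:
  assumes "((\<lambda>p. f p $ 1) \<longlongrightarrow> l $ 1) F" "((\<lambda>p. f p $ 2) \<longlongrightarrow> l $ 2) F" "((\<lambda>p. f p $ 3) \<longlongrightarrow> l $ 3) F"
    "((\<lambda>p. f p $ 4) \<longlongrightarrow> l $ 4) F" "((\<lambda>p. f p $ 5) \<longlongrightarrow> l $ 5) F"
  shows "((f :: 'p \<Rightarrow> ('a::topological_space) ^ 5) \<longlongrightarrow> l) F"
proof (rule vec_tendstoI)
  fix i show "((\<lambda>p. f p $ i) \<longlongrightarrow> l $ i) F"
    using exhaust_5[of i] assms by (elim disjE) simp_all
qed

lemma vec_tendsto_7I:
  assumes "((\<lambda>p. f p $ 1) \<longlongrightarrow> l $ 1) F" "((\<lambda>p. f p $ 2) \<longlongrightarrow> l $ 2) F" "((\<lambda>p. f p $ 3) \<longlongrightarrow> l $ 3) F"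
    "((\<lambda>p. f p $ 4) \<longlongrightarrow> l $ 4) F" "((\<lambda>p. f p $ 5) \<longlongrightarrow> l $ 5) F" "((\<lambda>p. f p $ 6) \<longlongrightarrow> l $ 6) F"
    "((\<lambda>p. f p $ 7) \<longlongrightarrow> l $ 7) F"
  shows "((f :: 'p \<Rightarrow> ('a::topological_space) ^ 7) \<longlongrightarrow> l) F"
proof (rule vec_tendstoI)
  fix i show "((\<lambda>p. f p $ i) \<longlongrightarrow> l $ i) F"
    using exhaust_7[of i] assms by (elim disjE) simp_all
qed

lemma tendsto_mat_A: "(\<theta> \<longlongrightarrow> \<theta>0) F \<Longrightarrow> ((\<lambda>p. mat_A (\<theta> p)) \<longlongrightarrow> mat_A \<theta>0) F"
  by (intro vec_tendsto_5I) (auto simp: mat_A_def intro!: tendsto_intros)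

lemma tendsto_mat_BN:
  "(\<theta> \<longlongrightarrow> \<theta>0) F \<Longrightarrow> \<theta>0 $ R\<^sub>\<alpha> \<noteq> 0 \<Longrightarrow> \<theta>0 $ R\<^sub>\<beta> \<noteq> 0 \<Longrightarrow> \<theta>0 $ R\<^sub>1 \<noteq> 0 \<Longrightarrow>
    ((\<lambda>p. mat_BN (\<theta> p)) \<longlongrightarrow> mat_BN \<theta>0) F"
  by (intro vec_tendsto_5I; intro vec_tendsto_7I) (auto simp: mat_BN_def intro!: tendsto_intros)

lemma tendsto_mat_BP:
  assumes "(\<theta> \<longlongrightarrow> \<theta>0) F" "\<theta>0 $ R\<^sub>\<alpha> \<noteq> 0" "\<theta>0 $ R\<^sub>\<beta> \<noteq> 0" "\<theta>0 $ R\<^sub>1 \<noteq> 0"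
  shows "((\<lambda>p. mat_BP (\<theta> p)) \<longlongrightarrow> mat_BP \<theta>0) F"
proof (intro vec_tendstoI)
  fix i j
  show "((\<lambda>p. mat_BP (\<theta> p) $ i $ j) \<longlongrightarrow> mat_BP \<theta>0 $ i $ j) F"
    using exhaust_5[of i] assms by (elim disjE; simp add: mat_BP_def; intro conjI impI) (auto intro!: tendsto_intros)
qed

lemma tendsto_mat_CN: "(\<theta> \<longlongrightarrow> \<theta>0) F \<Longrightarrow> ((\<lambda>p. mat_CN (\<theta> p)) \<longlongrightarrow> mat_CN \<theta>0) F"
  by (intro vec_tendsto_7I) (auto simp: mat_CN_def intro!: tendsto_intros)

lemma tendsto_mat_DN: "(\<theta> \<longlongrightarrow> \<theta>0) F \<Longrightarrow> ((\<lambda>p. mat_DN (\<theta> p)) \<longlongrightarrow> mat_DN \<theta>0) F"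
  by (intro vec_tendsto_7I; intro vec_tendsto_5I) (auto simp: mat_DN_def Let_def intro!: tendsto_intros)

lemma tendsto_vec_MN: "(\<theta> \<longlongrightarrow> \<theta>0) F \<Longrightarrow> ((\<lambda>p. vec_MN (\<theta> p)) \<longlongrightarrow> vec_MN \<theta>0) F"
  by (intro vec_tendsto_7I) (auto simp: vec_MN_def intro!: tendsto_intros)

lemma tendsto_barred:
  assumes "(\<theta> \<longlongrightarrow> \<theta>0) F"
  shows "((\<lambda>p. barred (\<theta> p)) \<longlongrightarrow> barred \<theta>0) F"
proof (rule vec_tendstoI)
  fix k show "((\<lambda>p. barred (\<theta> p) $ k) \<longlongrightarrow> barred \<theta>0 $ k) F"
    using assms by (cases k) (auto simp: barred_def intro!: tendsto_intros)
qed

text \<open>Vectors indexed like the columns of \<open>block_matrix\<close>: used for the pair of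
  state and costate in the Lyapunov function, and for the state extended by two coordinates.\<close>

definition join_vec :: "real ^ 'a \<Rightarrow> real ^ 'b \<Rightarrow> real ^ ('a::finite + 'b::finite)" where
  "join_vec x y = (\<chi> i. case i of Inl a \<Rightarrow> x $ a | Inr b \<Rightarrow> y $ b)"

lemma sum_UNIV_sum_type:
  "sum f (UNIV :: ('a::finite + 'b::finite) set) = (\<Sum>a\<in>UNIV. f (Inl a)) + (\<Sum>b\<in>UNIV. f (Inr b))"
  unfolding UNIV_Plus_UNIV[symmetric] by (subst sum.Plus) auto

lemma block_matrix_join_vec:
  "block_matrix K11 K12 K21 K22 *v join_vec x y = join_vec (K11 *v x + K12 *v y) (K21 *v x + K22 *v y)"
  by (auto simp: vec_eq_iff matrix_vector_mult_def block_matrix_def join_vec_def sum_UNIV_sum_type split: sum.split)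

lemma append_zero_columns_join_vec: "append_zero_columns K *v join_vec x y = K *v x"
  by (simp add: vec_eq_iff matrix_vector_mult_def append_zero_columns_def join_vec_def sum_UNIV_sum_type)

lemma append_rows_vec: "append_rows K L *v x = join_vec (K *v x) (L *v x)"
  by (auto simp: vec_eq_iff matrix_vector_mult_def append_rows_def join_vec_def split: sum.split)

lemma inner_join_vec: "join_vec x y \<bullet> join_vec x' y' = x \<bullet> x' + y \<bullet> y'"
  by (simp add: inner_vec_def join_vec_def sum_UNIV_sum_type)

lemma join_vec_diff: "join_vec x y - join_vec x' y' = join_vec (x - x') (y - y')"
  by (auto simp: vec_eq_iff join_vec_def split: sum.split)

lemma join_vec_eq_0: "join_vec x y = 0 \<longleftrightarrow> x = 0 \<and> y = 0"
  by (auto simp: vec_eq_iff join_vec_def split: sum.split)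

lemma join_vec_has_vector_derivative:
  assumes "(x has_vector_derivative x') (at t within S)" "(y has_vector_derivative y') (at t within S)"
  shows "((\<lambda>t. join_vec (x t) (y t)) has_vector_derivative join_vec x' y') (at t within S)"
proof -
  have "bounded_linear (\<lambda>z. join_vec (fst z) (snd z) :: real ^ ('a + 'b))"
    unfolding linear_conv_bounded_linear[symmetric]
    by (rule linearI) (auto simp: vec_eq_iff join_vec_def split: sum.split)
  from bounded_linear.has_vector_derivative[OF this has_vector_derivative_Pair[OF assms]]
  show ?thesis by simp
qed

lemma nonincreasing_within:
  fixes V :: "real \<Rightarrow> real"
  assumes der: "\<And>t. t \<in> {a..b} \<Longrightarrow> (V has_vector_derivative V' t) (at t within {a..b})"
    and "\<And>t. t \<in> {a..b} \<Longrightarrow> V' t \<le> 0" and "a \<le> b"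
  shows "V b \<le> V a"
proof (cases "a = b")
  case False
  then have "a < b" using assms by simp
  moreover have "(V has_derivative (\<lambda>h. h * V' t)) (at t within {a..b})" if "t \<in> {a..b}" for t
    using der[OF that] by (simp add: has_vector_derivative_def)
  ultimately obtain t where "t \<in> {a<..<b}" "V b - V a = (b - a) * V' t"
    using mvt_simple[of a b V "\<lambda>t h. h * V' t"] by auto
  then show ?thesis
    using assms(2)[of t] \<open>a < b\<close> mult_nonneg_nonpos[of "b - a" "V' t"] by auto
qed simp

text \<open>The Lyapunov function is \<open>x \<bullet> \<Pi>1 x + 2 x \<bullet> \<Pi>2 y\<close>: it does not increase, it vanishes where \<open>x\<close> does, and
  it is positive at \<open>T\<close> unless \<open>x T = 0\<close>.\<close>

lemma pi_condition_vanishes: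
  fixes x :: "real \<Rightarrow> real ^ 'n" and y :: "real \<Rightarrow> real ^ 'l"
  assumes pi: "pi_condition A B C D E"
    and x: "\<And>t. t \<in> {a..b} \<Longrightarrow> (x has_vector_derivative A *v x t - B *v y t) (at t within {a..b})"
    and y: "\<And>t. t \<in> {a..b} \<Longrightarrow> (y has_vector_derivative - (D *v x t) - C *v y t) (at t within {a..b})"
    and b: "y b = E *v x b" and a: "x a = 0" and "a \<le> b"
  shows "x b = 0"
proof -
  from pi obtain \<Pi>1 \<Pi>2 where sym: "transpose \<Pi>1 = \<Pi>1"
    and L: "let \<Lambda> = block_matrix
               (- (\<Pi>1 ** A) + \<Pi>2 ** D) (\<Pi>1 ** B - transpose A ** \<Pi>2 + \<Pi>2 ** C)
               0 (transpose B ** \<Pi>2)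
         in lambda_min (\<Lambda> + transpose \<Lambda>) \<ge> 0"
    and E: "lambda_min (\<Pi>1 + \<Pi>2 ** E + transpose E ** transpose \<Pi>2) > 0"
    unfolding pi_condition_def by auto
  define \<Lambda> where "\<Lambda> = block_matrix (- (\<Pi>1 ** A) + \<Pi>2 ** D) (\<Pi>1 ** B - transpose A ** \<Pi>2 + \<Pi>2 ** C)
               0 (transpose B ** \<Pi>2)"
  \<comment> \<open>\<open>lambda_min\<close> speaks of the symmetrised matrix, whose quadratic form
    is twice that of \<open>\<Lambda>\<close>.\<close>
  have psd: "0 \<le> z \<bullet> (\<Lambda> *v z)" for z
  proof -
    have "transpose (\<Lambda> + transpose \<Lambda>) = \<Lambda> + transpose \<Lambda>"
      by (simp add: vec_eq_iff transpose_def add.commute)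
    from lambda_min_le[OF this, of z] have "lambda_min (\<Lambda> + transpose \<Lambda>) * (z \<bullet> z) \<le> 2 * (z \<bullet> (\<Lambda> *v z))"
      using matrix_transpose_inner[of z "transpose \<Lambda>" z]
      by (simp add: vmult.add_left inner_add_right inner_commute)
    then show ?thesis
      using L unfolding Let_def \<Lambda>_def[symmetric]
      by (smt (verit) inner_ge_zero mult_nonneg_nonneg)
  qed
  define V where "V t = x t \<bullet> (\<Pi>1 *v x t) + 2 * (x t \<bullet> (\<Pi>2 *v y t))" for t
  note inner_der = bounded_bilinear.has_vector_derivative[OF bounded_bilinear_inner]
  note lin_der = bounded_linear.has_vector_derivative[OF vmult.bounded_linear_right]
  \<comment> \<open>The blocks of \<open>\<Lambda>\<close> are precisely the coefficients that arise
    when \<open>V\<close> is differentiated along the Hamiltonian equations; the terms with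
    \<open>\<Pi>1\<close> combine because \<open>\<Pi>1\<close> is symmetric.\<close>
  have V: "(V has_vector_derivative - 2 * (join_vec (x t) (y t) \<bullet> (\<Lambda> *v join_vec (x t) (y t)))) (at t within {a..b})"
    if t: "t \<in> {a..b}" for t
  proof -
    have "(V has_vector_derivative
        (x t \<bullet> (\<Pi>1 *v (A *v x t - B *v y t)) + (A *v x t - B *v y t) \<bullet> (\<Pi>1 *v x t)) +
        2 * (x t \<bullet> (\<Pi>2 *v (- (D *v x t) - C *v y t)) + (A *v x t - B *v y t) \<bullet> (\<Pi>2 *v y t))) (at t within {a..b})"
      unfolding V_def
      by (intro has_vector_derivative_add has_vector_derivative_mult_right inner_der lin_der x y t)
    moreover have "(A *v x t) \<bullet> (\<Pi>1 *v x t) = x t \<bullet> (\<Pi>1 *v (A *v x t))"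
      "(B *v y t) \<bullet> (\<Pi>1 *v x t) = x t \<bullet> (\<Pi>1 *v (B *v y t))"
      using matrix_transpose_inner[of "A *v x t" \<Pi>1 "x t"] matrix_transpose_inner[of "B *v y t" \<Pi>1 "x t"]
      by (simp_all add: sym inner_commute)
    moreover have "x t \<bullet> (transpose A *v (\<Pi>2 *v y t)) = (A *v x t) \<bullet> (\<Pi>2 *v y t)"
      "y t \<bullet> (transpose B *v (\<Pi>2 *v y t)) = (B *v y t) \<bullet> (\<Pi>2 *v y t)"
      using matrix_transpose_inner[of "x t" "transpose A" "\<Pi>2 *v y t"]
        matrix_transpose_inner[of "y t" "transpose B" "\<Pi>2 *v y t"] by simp_all
    ultimately show ?thesis
      by (simp add: \<Lambda>_def block_matrix_join_vec inner_join_vec vmult.add_left vmult.diff_left vmult.minus_left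
          vmult.diff_right vmult.minus_right inner_add_right inner_diff_right inner_diff_left inner_minus_right
          algebra_simps flip: matrix_vector_mul_assoc)
  qed
  have "V b \<le> V a"
    by (rule nonincreasing_within[OF V]) (use psd \<open>a \<le> b\<close> in auto)
  moreover have "V a = 0" by (simp add: V_def a)
  \<comment> \<open>With \<open>y b = E *v x b\<close>, twice the mixed term is symmetrised into the
    two products with \<open>E\<close> of the terminal condition.\<close>
  moreover have "V b = x b \<bullet> ((\<Pi>1 + \<Pi>2 ** E + transpose E ** transpose \<Pi>2) *v x b)"
  proof -
    have "x b \<bullet> (transpose E *v (transpose \<Pi>2 *v x b)) = x b \<bullet> (\<Pi>2 *v (E *v x b))"
      using matrix_transpose_inner[of "x b" "transpose E" "transpose \<Pi>2 *v x b"]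
        matrix_transpose_inner[of "E *v x b" "transpose \<Pi>2" "x b"]
      by (simp add: inner_commute)
    then show ?thesis
      by (simp add: V_def b vmult.add_left inner_add_right flip: matrix_vector_mul_assoc)
  qed
  moreover have "lambda_min (\<Pi>1 + \<Pi>2 ** E + transpose E ** transpose \<Pi>2) * (x b \<bullet> x b)
      \<le> x b \<bullet> ((\<Pi>1 + \<Pi>2 ** E + transpose E ** transpose \<Pi>2) *v x b)"
  proof (rule lambda_min_le)
    have "transpose \<Pi>1 $ i $ j = \<Pi>1 $ i $ j" for i j by (simp add: sym)
    then show "transpose (\<Pi>1 + \<Pi>2 ** E + transpose E ** transpose \<Pi>2) = \<Pi>1 + \<Pi>2 ** E + transpose E ** transpose \<Pi>2"
      unfolding vec_eq_iff by (simp add: transpose_def matrix_matrix_mult_def mult.commute)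
  qed
  ultimately have "lambda_min (\<Pi>1 + \<Pi>2 ** E + transpose E ** transpose \<Pi>2) * (x b \<bullet> x b) \<le> 0"
    by linarith
  then show ?thesis
    using E by (smt (verit) inner_gt_zero_iff mult_pos_pos)
qed

text \<open>The Lyapunov argument runs from the zero \<open>t0\<close> of \<open>x\<close> to
  \<open>T\<close>, so the equations are restricted to \<open>{t0..T}\<close>.\<close>

lemma condition_2A_nondegenerate:
  assumes "condition_2A A S"
  shows "nondegenerate T A (mB S) (mC S) (mD S) (mE S)"
  unfolding nondegenerate_def
proof (intro allI impI, elim conjE bexE)
  fix x :: "real \<Rightarrow> real ^ 5" and y :: "real \<Rightarrow> real ^ 'a" and t0
  assume ode: "\<forall>t\<in>{0..T}. (x has_vector_derivative A *v x t - mB S *v y t) (at t within {0..T}) \<and>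
          (y has_vector_derivative - (mD S *v x t) - mC S *v y t) (at t within {0..T})"
    and T: "y T = mE S *v x T" and t0: "t0 \<in> {0..T}" "x t0 = 0"
  have sub: "{t0..T} \<subseteq> {0..T}" using t0 by auto
  show "x T = 0"
  proof (rule pi_condition_vanishes[OF assms[unfolded condition_2A_def], of t0 T x y])
    fix t assume "t \<in> {t0..T}"
    then show "(x has_vector_derivative A *v x t - mB S *v y t) (at t within {t0..T})"
      "(y has_vector_derivative - (mD S *v x t) - mC S *v y t) (at t within {t0..T})"
      using ode sub has_vector_derivative_within_subset[OF _ sub] by blast+
  qed (use t0 T in auto)
qed

text \<open>A bound on finitely many basis vectors, each by continuity in time, bounds the whole
  family; this supplies the Lipschitz constant for uniqueness in linear equations with
  time-dependent coefficients.\<close>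

lemma linear_family_bound:
  fixes L :: "real \<Rightarrow> 'v::euclidean_space \<Rightarrow> 'w::real_normed_vector"
  assumes lin: "\<And>t. t \<in> {a..b} \<Longrightarrow> linear (L t)" and cont: "\<And>v. continuous_on {a..b} (\<lambda>t. L t v)"
  obtains c where "0 \<le> c" "\<And>t v. t \<in> {a..b} \<Longrightarrow> norm (L t v) \<le> c * norm v"
proof -
  have "\<exists>k. \<forall>t\<in>{a..b}. norm (L t v) \<le> k" for v
    using compact_imp_bounded[OF compact_continuous_image[OF cont compact_Icc], of v]
    by (auto simp: bounded_iff)
  then obtain k where k: "\<And>v t. t \<in> {a..b} \<Longrightarrow> norm (L t v) \<le> k v" by metis
  show ?thesis
  proof
    show "0 \<le> (\<Sum>v\<in>Basis. \<bar>k v\<bar>)" by (simp add: sum_nonneg)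
    fix t v assume t: "t \<in> {a..b}"
    have "L t v = (\<Sum>b\<in>Basis. (v \<bullet> b) *\<^sub>R L t b)"
      by (subst euclidean_representation[of v, symmetric])
        (simp add: linear_sum[OF lin[OF t]] linear_scale[OF lin[OF t]])
    also have "norm \<dots> \<le> (\<Sum>b\<in>Basis. \<bar>k b\<bar> * norm v)"
    proof (rule sum_norm_le)
      fix u :: 'v assume "u \<in> Basis"
      then have "\<bar>v \<bullet> u\<bar> * norm (L t u) \<le> norm v * \<bar>k u\<bar>"
        using k[OF t, of u] by (intro mult_mono) (auto simp: Basis_le_norm)
      then show "norm ((v \<bullet> u) *\<^sub>R L t u) \<le> \<bar>k u\<bar> * norm v" by (simp add: mult.commute)
    qed
    finally show "norm (L t v) \<le> (\<Sum>v\<in>Basis. \<bar>k v\<bar>) * norm v"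
      by (simp add: sum_distrib_right)
  qed
qed

lemma linear_ode_zero_forward:
  fixes D :: "real \<Rightarrow> 'v::euclidean_space"
  assumes "\<And>t. t \<in> {a..b} \<Longrightarrow> linear (L t)" "\<And>v. continuous_on {a..b} (\<lambda>t. L t v)"
    and "\<And>t. t \<in> {a..b} \<Longrightarrow> (D has_vector_derivative L t (D t)) (at t within {a..b})"
    and "D a = 0" "t \<in> {a..b}"
  shows "D t = 0"
proof (rule linear_family_bound[OF assms(1,2)])
  fix c assume c: "0 \<le> c" "\<And>t v. t \<in> {a..b} \<Longrightarrow> norm (L t v) \<le> c * norm v"
  show "D t = 0"
    by (rule vector_derivative_zero_forward[of a b D "\<lambda>t. L t (D t)" c]) (use assms c in auto)
qed

lemma linear_ode_zero_backward:
  fixes D :: "real \<Rightarrow> 'v::euclidean_space"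
  assumes "\<And>t. t \<in> {a..b} \<Longrightarrow> linear (L t)" "\<And>v. continuous_on {a..b} (\<lambda>t. L t v)"
    and "\<And>t. t \<in> {a..b} \<Longrightarrow> (D has_vector_derivative L t (D t)) (at t within {a..b})"
    and "D b = 0" "t \<in> {a..b}"
  shows "D t = 0"
proof (rule linear_family_bound[OF assms(1,2)])
  fix c assume c: "0 \<le> c" "\<And>t v. t \<in> {a..b} \<Longrightarrow> norm (L t v) \<le> c * norm v"
  show "D t = 0"
    by (rule vector_derivative_zero_backward[of a b D "\<lambda>t. L t (D t)" c]) (use assms c in auto)
qed

text \<open>A trajectory with \<open>x t0 = 0\<close> is completed by two further coordinates
  \<open>w\<close>, started from 0 and driven by \<open>y\<close> through the auxiliary matrices of
  \<open>condition_2B\<close>. The enlarged state still vanishes at \<open>t0\<close> and, the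
  appended columns being zero, meets the enlarged terminal condition; so the Lyapunov argument
  applies in dimension 7.\<close>

lemma condition_2B_nondegenerate:
  assumes "condition_2B A S"
  shows "nondegenerate T A (mB S) (mC S) (mD S) (mE S)"
  unfolding nondegenerate_def
proof (intro allI impI, elim conjE bexE)
  fix x :: "real \<Rightarrow> real ^ 5" and y :: "real \<Rightarrow> real ^ 7" and t0
  assume ode: "\<forall>t\<in>{0..T}. (x has_vector_derivative A *v x t - mB S *v y t) (at t within {0..T}) \<and>
          (y has_vector_derivative - (mD S *v x t) - mC S *v y t) (at t within {0..T})"
    and T: "y T = mE S *v x T" and t0: "t0 \<in> {0..T}" "x t0 = 0"
  obtain A' :: "real ^ 2 ^ 2" and B' :: "real ^ 7 ^ 2" where
    pi: "pi_condition (block_matrix A 0 0 A') (append_rows (mB S) B') (mC S)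
          (append_zero_columns (mD S)) (append_zero_columns (mE S))"
    using assms unfolding condition_2B_def by blast
  \<comment> \<open>\<open>y\<close> is given only on [0, T]; therefore \<open>w\<close> is
    generated by an autonomous system on the whole line that carries its own copy of
    \<open>(x, y)\<close>, identified afterwards by uniqueness.\<close>
  define K :: "(real ^ 5) \<times> (real ^ 7) \<times> (real ^ 2) \<Rightarrow> (real ^ 5) \<times> (real ^ 7) \<times> (real ^ 2)" where
    "K z = (A *v fst z - mB S *v fst (snd z), - (mD S *v fst z) - mC S *v fst (snd z),
       A' *v snd (snd z) - B' *v fst (snd z))" for z
  have linK: "linear K"
    by (rule linearI) (auto simp: K_def vmult.add_right vmult.scaleR_right algebra_simps)
  then have "bounded_linear K" by (simp add: linear_conv_bounded_linear[symmetric])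
  from linear_ode_solution_exists[OF this, of t0 "(0, y t0, 0)"]
  obtain Z where Z0: "Z t0 = (0, y t0, 0)" and Z: "\<And>t. (Z has_vector_derivative K (Z t)) (at t)" by blast
  define w where "w = (\<lambda>t. snd (snd (Z t)))"
  note fstd = bounded_linear.has_vector_derivative[OF bounded_linear_fst]
   and sndd = bounded_linear.has_vector_derivative[OF bounded_linear_snd]
  have Zw: "(Z has_vector_derivative K (Z t)) (at t within s)" for t s
    using Z has_vector_derivative_at_within by blast
  have sub: "{t0..T} \<subseteq> {0..T}" using t0 by auto
  have xd: "(x has_vector_derivative A *v x t - mB S *v y t) (at t within {t0..T})"
    and yd: "(y has_vector_derivative - (mD S *v x t) - mC S *v y t) (at t within {t0..T})" if "t \<in> {t0..T}" for t
    using ode that sub has_vector_derivative_within_subset[OF _ sub] by blast+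
  have eq: "fst (Z t) = x t \<and> fst (snd (Z t)) = y t" if "t \<in> {t0..T}" for t
  proof -
    define L where "L = (\<lambda>(t::real) z. (A *v fst z - mB S *v snd z, - (mD S *v fst z) - mC S *v snd z))"
    have "(fst (Z t) - x t, fst (snd (Z t)) - y t) = 0"
    proof (rule linear_ode_zero_forward[where L = L and D = "\<lambda>t. (fst (Z t) - x t, fst (snd (Z t)) - y t)" and a = t0 and b = T])
      show "linear (L t)" for t
        by (rule linearI) (auto simp: L_def vmult.add_right vmult.scaleR_right algebra_simps)
      fix s assume s: "s \<in> {t0..T}"
      show "((\<lambda>t. (fst (Z t) - x t, fst (snd (Z t)) - y t)) has_vector_derivative
          L s (fst (Z s) - x s, fst (snd (Z s)) - y s)) (at s within {t0..T})"
        using has_vector_derivative_Pair[OF has_vector_derivative_diff[OF fstd[OF Zw] xd[OF s]]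
            has_vector_derivative_diff[OF fstd[OF sndd[OF Zw]] yd[OF s]]]
        by (simp add: L_def K_def vmult.diff_right algebra_simps)
    qed (use that t0 Z0 in \<open>auto simp: L_def zero_prod_def\<close>)
    then show ?thesis by (simp add: zero_prod_def)
  qed
  have wd: "(w has_vector_derivative A' *v w t - B' *v y t) (at t within {t0..T})" if "t \<in> {t0..T}" for t
    using sndd[OF sndd[OF Zw[of t "{t0..T}"]]] eq[OF that] by (simp add: w_def K_def)
  have "join_vec (x T) (w T) = 0"
  proof (rule pi_condition_vanishes[OF pi, of t0 T "\<lambda>t. join_vec (x t) (w t)" y])
    fix t assume t: "t \<in> {t0..T}"
    show "((\<lambda>t. join_vec (x t) (w t)) has_vector_derivative
        block_matrix A 0 0 A' *v join_vec (x t) (w t) - append_rows (mB S) B' *v y t) (at t within {t0..T})"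
      using join_vec_has_vector_derivative[OF xd[OF t] wd[OF t]]
      by (simp add: block_matrix_join_vec append_rows_vec join_vec_diff)
    show "(y has_vector_derivative - (append_zero_columns (mD S) *v join_vec (x t) (w t)) - mC S *v y t) (at t within {t0..T})"
      using yd[OF t] by (simp add: append_zero_columns_join_vec)
  qed (use t0 T Z0 in \<open>auto simp: append_zero_columns_join_vec join_vec_eq_0 w_def\<close>)
  then show "x T = 0" by (simp add: join_vec_eq_0)
qed

text \<open>The product \<open>X * Y\<close> alone is nonincreasing, but its terminal value
  \<open>e * X\<^sup>2\<close> gives nothing when \<open>e = 0\<close>. Adding
  \<open>\<epsilon> * X\<^sup>2\<close> restores positivity, and the decay absorbs the extra terms.
  In the follower's regulator \<open>e\<close> is the terminal weight, which may vanish.\<close>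

lemma scalar_nondegenerate:
  fixes A C :: "real ^ 1 ^ 1"
  assumes "B $ 1 $ 1 > 0" "D $ 1 $ 1 > 0" "E $ 1 $ 1 \<ge> 0" "C = A"
  shows "nondegenerate T A (B :: real ^ 1 ^ 1) C D E"
  unfolding nondegenerate_def
proof (intro allI impI, elim conjE bexE)
  fix x y :: "real \<Rightarrow> real ^ 1" and t0
  assume ode: "\<forall>t\<in>{0..T}. (x has_vector_derivative A *v x t - B *v y t) (at t within {0..T}) \<and>
          (y has_vector_derivative - (D *v x t) - C *v y t) (at t within {0..T})"
    and T: "y T = E *v x T" and t0: "t0 \<in> {0..T}" "x t0 = 0"
  define a b q e where "a = A $ 1 $ 1" and "b = B $ 1 $ 1" and "q = D $ 1 $ 1" and "e = E $ 1 $ 1"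
  note abq = a_def[symmetric] b_def[symmetric] q_def[symmetric] e_def[symmetric]
  have pos: "b > 0" "q > 0" "e \<ge> 0" using assms by (simp_all add: abq)
  \<comment> \<open>Small enough for
    \<open>2 * \<epsilon> * a + \<epsilon>\<^sup>2 * b \<le> q\<close>, so that completing the
    square in \<open>Y\<close> leaves a nonpositive coefficient; the cap 1 serves to estimate
    \<open>\<epsilon>\<^sup>2\<close> by \<open>\<epsilon>\<close>.\<close>
  define \<epsilon> where "\<epsilon> = min 1 (q / (b + 2 * \<bar>a\<bar>))"
  have \<epsilon>: "0 < \<epsilon>" "\<epsilon> \<le> 1" "\<epsilon> * (b + 2 * \<bar>a\<bar>) \<le> q"
    using pos by (auto simp: \<epsilon>_def min_def field_simps add_pos_nonneg)
  define X Y where "X = (\<lambda>t. x t $ 1)" and "Y = (\<lambda>t. y t $ 1)"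
  have comp: "bounded_linear (\<lambda>v :: real ^ 1. v $ 1)" by (rule bounded_linear_vec_nth)
  have sub: "{t0..T} \<subseteq> {0..T}" using t0 by auto
  have "(x has_vector_derivative A *v x t - B *v y t) (at t within {t0..T})"
    and "(y has_vector_derivative - (D *v x t) - C *v y t) (at t within {t0..T})" if "t \<in> {t0..T}" for t
    using ode that sub has_vector_derivative_within_subset[OF _ sub] by blast+
  from this[THEN bounded_linear.has_vector_derivative[OF comp]]
  have xd: "(X has_vector_derivative a * X t - b * Y t) (at t within {t0..T})"
    and yd: "(Y has_vector_derivative - q * X t - a * Y t) (at t within {t0..T})" if "t \<in> {t0..T}" for t
    using that by (simp_all add: X_def Y_def matrix_vector_mult_def abq assms(4))
  define V where "V t = \<epsilon> * (X t * X t) + X t * Y t" for t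
  note mult_der = bounded_bilinear.has_vector_derivative[OF bounded_bilinear_mult]
  have "(V has_vector_derivative \<epsilon> * (X t * (a * X t - b * Y t) + (a * X t - b * Y t) * X t) +
     (X t * (- q * X t - a * Y t) + (a * X t - b * Y t) * Y t)) (at t within {t0..T})" if "t \<in> {t0..T}" for t
    unfolding V_def by (intro has_vector_derivative_add has_vector_derivative_mult_right mult_der xd yd that)
  moreover have "\<epsilon> * (X t * (a * X t - b * Y t) + (a * X t - b * Y t) * X t) +
     (X t * (- q * X t - a * Y t) + (a * X t - b * Y t) * Y t) \<le> 0" for t
  proof -
    have eq: "\<epsilon> * (X t * (a * X t - b * Y t) + (a * X t - b * Y t) * X t) +
     (X t * (- q * X t - a * Y t) + (a * X t - b * Y t) * Y t) =
      (2 * \<epsilon> * a + \<epsilon> * \<epsilon> * b - q) * (X t)\<^sup>2 - b * (Y t + \<epsilon> * X t)\<^sup>2"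
      by (simp add: power2_eq_square algebra_simps)
    have c: "2 * \<epsilon> * a + \<epsilon> * \<epsilon> * b - q \<le> 0"
    proof -
      have "2 * \<epsilon> * a + \<epsilon> * \<epsilon> * b \<le> 2 * \<epsilon> * \<bar>a\<bar> + \<epsilon> * 1 * b"
        using \<epsilon> pos by (intro add_mono mult_left_mono mult_right_mono) auto
      then show ?thesis using \<epsilon>(3) by (simp add: algebra_simps)
    qed
    show ?thesis
      unfolding eq using mult_nonpos_nonneg[OF c zero_le_power2] mult_nonneg_nonneg[OF less_imp_le[OF pos(1)] zero_le_power2]
      by (meson diff_le_0_iff_le order_trans)
  qed
  ultimately have "V T \<le> V t0"
    by (rule nonincreasing_within) (use t0 in auto)
  moreover have "V t0 = 0" using t0 by (simp add: V_def X_def)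
  moreover have "V T = (\<epsilon> + e) * (X T)\<^sup>2"
    using T by (simp add: V_def X_def Y_def matrix_vector_mult_def abq power2_eq_square algebra_simps)
  ultimately have "(\<epsilon> + e) * (X T)\<^sup>2 \<le> 0" by simp
  then have "X T = 0"
    using \<epsilon> pos by (smt (verit) mult_pos_pos zero_less_power2)
  then show "x T = 0" by (simp add: X_def vec_eq_iff)
qed

text \<open>The quadratic terms of two solutions differ by \<open>(\<Gamma>1 - \<Gamma>2) ** mB S **
  \<Gamma>1 + \<Gamma>2 ** mB S ** (\<Gamma>1 - \<Gamma>2)\<close>, so the difference solves a
  linear equation with terminal value 0.\<close>

lemma riccati_solution_unique:
  assumes 1: "riccati_solution T A S \<Gamma>1" and 2: "riccati_solution T A S \<Gamma>2" and t: "t \<in> {0..T}"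
  shows "\<Gamma>1 t = \<Gamma>2 t"
proof -
  note d1 = 1[unfolded riccati_solution_def, THEN conjunct1, rule_format]
   and d2 = 2[unfolded riccati_solution_def, THEN conjunct1, rule_format]
  have cont: "continuous_on {0..T} \<Gamma>1" "continuous_on {0..T} \<Gamma>2"
    using continuous_on_vector_derivative[OF d1] continuous_on_vector_derivative[OF d2] by auto
  have "\<Gamma>1 t - \<Gamma>2 t = 0"
  proof (rule linear_ode_zero_backward[where a = 0 and b = T and D = "\<lambda>t. \<Gamma>1 t - \<Gamma>2 t" and
      L = "\<lambda>t Z. - (Z ** A + mC S ** Z - Z ** mB S ** \<Gamma>1 t - \<Gamma>2 t ** mB S ** Z)"])
    show "linear (\<lambda>Z. - (Z ** A + mC S ** Z - Z ** mB S ** \<Gamma>1 t - \<Gamma>2 t ** mB S ** Z))" for t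
      by (rule linearI) (simp_all add: mmult.add_left mmult.add_right mmult.scaleR_left mmult.scaleR_right algebra_simps)
    show "continuous_on {0..T} (\<lambda>t. - (v ** A + mC S ** v - v ** mB S ** \<Gamma>1 t - \<Gamma>2 t ** mB S ** v))" for v
      by (intro continuous_intros mmult.continuous_on cont)
    fix s assume s: "s \<in> {0..T}"
    show "((\<lambda>t. \<Gamma>1 t - \<Gamma>2 t) has_vector_derivative
      - ((\<Gamma>1 s - \<Gamma>2 s) ** A + mC S ** (\<Gamma>1 s - \<Gamma>2 s) - (\<Gamma>1 s - \<Gamma>2 s) ** mB S ** \<Gamma>1 s -
         \<Gamma>2 s ** mB S ** (\<Gamma>1 s - \<Gamma>2 s))) (at s within {0..T})"
      using has_vector_derivative_diff[OF d1[OF s] d2[OF s]]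
      by (simp add: mmult.diff_left mmult.diff_right algebra_simps)
  qed (use 1 2 t in \<open>auto simp: riccati_solution_def\<close>)
  then show ?thesis by simp
qed

text \<open>The two feedback matrices are assumed to agree only on [0, T], which is where
  \<open>riccati_solution\<close> determines them.\<close>

lemma offset_solution_unique:
  assumes 1: "offset_solution T S \<Gamma>1 g1" and 2: "offset_solution T S \<Gamma>2 g2" and t: "t \<in> {0..T}"
    and \<Gamma>: "\<And>t. t \<in> {0..T} \<Longrightarrow> \<Gamma>1 t = \<Gamma>2 t" and cont: "continuous_on {0..T} \<Gamma>2"
  shows "g1 t = g2 t"
proof -
  have "g1 t - g2 t = 0"
  proof (rule linear_ode_zero_backward[where a = 0 and b = T and D = "\<lambda>t. g1 t - g2 t" and
      L = "\<lambda>t z. - ((mC S - \<Gamma>2 t ** mB S) *v z)"])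
    show "linear (\<lambda>z. - ((mC S - \<Gamma>2 t ** mB S) *v z))" for t
      by (rule linearI) (simp_all add: vmult.add_right vmult.scaleR_right)
    show "continuous_on {0..T} (\<lambda>t. - ((mC S - \<Gamma>2 t ** mB S) *v v))" for v
      by (intro continuous_intros mmult.continuous_on vmult.continuous_on cont)
    fix s assume s: "s \<in> {0..T}"
    have "(g1 has_vector_derivative - ((mC S - \<Gamma>2 s ** mB S) *v g1 s + mM S)) (at s within {0..T})"
      "(g2 has_vector_derivative - ((mC S - \<Gamma>2 s ** mB S) *v g2 s + mM S)) (at s within {0..T})"
      using 1[unfolded offset_solution_def, THEN conjunct1, rule_format, OF s]
        2[unfolded offset_solution_def, THEN conjunct1, rule_format, OF s] \<Gamma>[OF s] by simp_all
    from has_vector_derivative_diff[OF this]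
    show "((\<lambda>t. g1 t - g2 t) has_vector_derivative - ((mC S - \<Gamma>2 s ** mB S) *v (g1 s - g2 s))) (at s within {0..T})"
      by (simp add: vmult.diff_right algebra_simps)
  qed (use 1 2 t in \<open>auto simp: offset_solution_def\<close>)
  then show ?thesis by simp
qed

section \<open>Square-integrable processes\<close>

text \<open>Measurability is included because integrability of the square would not imply
  it.\<close>

definition square_integrable :: "'b measure \<Rightarrow> ('b \<Rightarrow> real) \<Rightarrow> bool" where
  "square_integrable M f \<longleftrightarrow> f \<in> borel_measurable M \<and> integrable M (\<lambda>x. (f x)\<^sup>2)"

lemma square_integrable_measurable [measurable_dest]: "square_integrable M f \<Longrightarrow> f \<in> borel_measurable M"
  by (simp add: square_integrable_def)

lemma square_integrable_square: "square_integrable M f \<Longrightarrow> integrable M (\<lambda>x. (f x)\<^sup>2)"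
  by (simp add: square_integrable_def)

lemma square_integrable_mult:
  assumes [measurable]: "square_integrable M f" "square_integrable M g"
  shows "integrable M (\<lambda>x. f x * g x)"
proof (rule Bochner_Integration.integrable_bound)
  show "integrable M (\<lambda>x. (f x)\<^sup>2 + (g x)\<^sup>2)"
    using assms by (auto simp: square_integrable_def)
  show "AE x in M. norm (f x * g x) \<le> norm ((f x)\<^sup>2 + (g x)\<^sup>2)"
  proof (rule AE_I2)
    fix x
    have "2 * (\<bar>f x\<bar> * \<bar>g x\<bar>) \<le> (f x)\<^sup>2 + (g x)\<^sup>2"
      using sum_squares_bound[of "\<bar>f x\<bar>" "\<bar>g x\<bar>"] by simp
    moreover have "0 \<le> \<bar>f x\<bar> * \<bar>g x\<bar>" by simp
    ultimately show "norm (f x * g x) \<le> norm ((f x)\<^sup>2 + (g x)\<^sup>2)"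
      unfolding real_norm_def abs_mult by linarith
  qed
qed measurable

lemma square_integrable_cmult: "square_integrable M f \<Longrightarrow> square_integrable M (\<lambda>x. c * f x)"
  by (auto simp: square_integrable_def power_mult_distrib)

lemma square_integrable_minus: "square_integrable M f \<Longrightarrow> square_integrable M (\<lambda>x. - f x)"
  by (auto simp: square_integrable_def)

lemma square_integrable_add:
  assumes f: "square_integrable M f" and g: "square_integrable M g"
  shows "square_integrable M (\<lambda>x. f x + g x)"
  using f g square_integrable_mult[OF square_integrable_cmult[OF f, of 2] g]
  by (auto simp: square_integrable_def power2_sum)

lemma square_integrable_diff:
  "square_integrable M f \<Longrightarrow> square_integrable M g \<Longrightarrow> square_integrable M (\<lambda>x. f x - g x)"
  using square_integrable_add[OF _ square_integrable_minus, of M f g] by simp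

lemma square_integrable_sum:
  assumes "\<And>i. i \<in> I \<Longrightarrow> square_integrable M (f i)"
  shows "square_integrable M (\<lambda>x. \<Sum>i\<in>I. f i x)"
  using assms
proof (induction I rule: infinite_finite_induct)
  case (insert i I)
  then show ?case by (simp add: square_integrable_add)
qed (simp_all add: square_integrable_def)

lemma (in finite_measure) square_integrable_const: "square_integrable M (\<lambda>x. c)"
  by (simp add: square_integrable_def)

lemma (in finite_measure) square_integrable_integrable: "square_integrable M f \<Longrightarrow> integrable M f"
  using square_integrable_mult[OF _ square_integrable_const[of 1], of f] by simp

lemmas square_integrable_intros = square_integrable_cmult square_integrable_minus square_integrable_add
  square_integrable_diff square_integrable_sum

lemma integral_square_add_le:
  assumes f: "square_integrable M f" and g: "square_integrable M g"
  shows "(\<integral>x. (f x + g x)\<^sup>2 \<partial>M) \<le> 2 * (\<integral>x. (f x)\<^sup>2 \<partial>M) + 2 * (\<integral>x. (g x)\<^sup>2 \<partial>M)"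
proof -
  have "(\<integral>x. (f x + g x)\<^sup>2 \<partial>M) \<le> (\<integral>x. 2 * (f x)\<^sup>2 + 2 * (g x)\<^sup>2 \<partial>M)"
    using square_integrable_add[OF f g] f g
  proof (intro integral_mono)
    fix x
    show "(f x + g x)\<^sup>2 \<le> 2 * (f x)\<^sup>2 + 2 * (g x)\<^sup>2"
      using sum_squares_bound[of "f x" "g x"] by (simp add: power2_sum)
  qed (auto simp: square_integrable_def)
  also have "\<dots> = 2 * (\<integral>x. (f x)\<^sup>2 \<partial>M) + 2 * (\<integral>x. (g x)\<^sup>2 \<partial>M)"
    using f g by (simp add: square_integrable_def)
  finally show ?thesis .
qed

text \<open>Cauchy-Schwarz against the constant 1, read off from the nonnegative integral of
  \<open>(f x - c)\<^sup>2\<close> at the mean value \<open>c\<close>; the mean needs positive total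
  mass, whence the case distinction.\<close>

lemma (in finite_measure) integral_square_le:
  assumes f: "square_integrable M f"
  shows "(\<integral>x. f x \<partial>M)\<^sup>2 \<le> measure M (space M) * (\<integral>x. (f x)\<^sup>2 \<partial>M)"
proof (cases "measure M (space M) = 0")
  case True
  then have "AE x in M. False"
    by (simp add: emeasure_eq_measure null_setsI AE_iff_null)
  then have "AE x in M. f x = 0" by eventually_elim auto
  then have "(\<integral>x. f x \<partial>M) = 0" by (simp add: integral_eq_zero_AE)
  then show ?thesis by (simp add: True)
next
  case False
  define c where "c = (\<integral>x. f x \<partial>M) / measure M (space M)"
  have "0 \<le> (\<integral>x. (f x - c)\<^sup>2 \<partial>M)" by (simp add: integral_nonneg_AE)
  also have "\<dots> = (\<integral>x. (f x)\<^sup>2 - 2 * c * f x + c\<^sup>2 \<partial>M)"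
    by (simp add: power2_diff algebra_simps)
  also have "\<dots> = (\<integral>x. (f x)\<^sup>2 \<partial>M) - 2 * c * (\<integral>x. f x \<partial>M) + c\<^sup>2 * measure M (space M)"
    using f square_integrable_integrable[OF f] by (simp add: square_integrable_def)
  finally have "0 \<le> measure M (space M) * ((\<integral>x. (f x)\<^sup>2 \<partial>M) - 2 * c * (\<integral>x. f x \<partial>M) + c\<^sup>2 * measure M (space M))"
    by simp
  also have "\<dots> = measure M (space M) * (\<integral>x. (f x)\<^sup>2 \<partial>M) - (\<integral>x. f x \<partial>M)\<^sup>2"
    using False by (simp add: c_def power2_eq_square right_diff_distrib distrib_left)
  finally show ?thesis by simp
qed

text \<open>A continuous adapted process is the pointwise limit of step processes that sample it at
  grid points to the left of the current time, and each of these is jointly measurable.\<close>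

lemma continuous_adapted_progressive:
  fixes X :: "real \<Rightarrow> 'a \<Rightarrow> 'b::metric_space"
  assumes cont: "\<And>\<omega>. \<omega> \<in> space N \<Longrightarrow> continuous_on {0..t} (\<lambda>s. X s \<omega>)"
    and meas: "\<And>s. s \<in> {0..t} \<Longrightarrow> X s \<in> borel_measurable N" and "0 \<le> t"
  shows "(\<lambda>(s, \<omega>). X s \<omega>) \<in> borel_measurable (restrict_space borel {0..t} \<Otimes>\<^sub>M N)"
\<comment> \<open>Mesh \<open>1 / Suc n\<close>, rounding down, so only earlier values are sampled;
  the cap by \<open>t\<close> keeps the sampling time of every grid index in the range where
  measurability is assumed.\<close>
proof (rule borel_measurable_LIMSEQ_metric[where
    f = "\<lambda>n z. X (min t (real (nat \<lfloor>fst z * real (Suc n)\<rfloor>) / real (Suc n))) (snd z)"])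
  let ?M = "restrict_space borel {0..t} \<Otimes>\<^sub>M N"
  let ?U = "\<lambda>n i z. X (min t (real i / real (Suc n))) (snd z)"
  have fst: "fst \<in> borel_measurable ?M"
    by (intro measurable_compose[OF measurable_fst] measurable_restrict_space1) simp
  fix n
  show "(\<lambda>z. ?U n (nat \<lfloor>fst z * real (Suc n)\<rfloor>) z) \<in> borel_measurable ?M"
  proof (rule measurable_compose_countable[where f = "?U n"])
    show "?U n i \<in> borel_measurable ?M" for i
      by (rule measurable_compose[OF measurable_snd meas]) (use \<open>0 \<le> t\<close> in auto)
    show "(\<lambda>z. nat \<lfloor>fst z * real (Suc n)\<rfloor>) \<in> ?M \<rightarrow>\<^sub>M count_space UNIV"
      using fst by measurable
  qed
next
  fix z assume "z \<in> space (restrict_space borel {0..t} \<Otimes>\<^sub>M N)"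
  then obtain s \<omega> where z: "z = (s, \<omega>)" and s: "s \<in> {0..t}" and \<omega>: "\<omega> \<in> space N"
    by (auto simp: space_pair_measure space_restrict_space)
  let ?a = "\<lambda>n. real (nat \<lfloor>s * real (Suc n)\<rfloor>) / real (Suc n)"
  have a: "?a n \<le> s" "s - 1 / real (Suc n) \<le> ?a n" for n
  proof -
    have nn: "real (nat \<lfloor>s * real (Suc n)\<rfloor>) = of_int \<lfloor>s * real (Suc n)\<rfloor>"
      using s by simp
    have fl: "of_int \<lfloor>s * real (Suc n)\<rfloor> \<le> s * real (Suc n)" "s * real (Suc n) \<le> of_int \<lfloor>s * real (Suc n)\<rfloor> + 1"
      by linarith+
    then show "?a n \<le> s"
      unfolding nn by (simp add: divide_le_eq)
    have "s = s * real (Suc n) / real (Suc n)" by simp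
    also have "\<dots> \<le> (of_int \<lfloor>s * real (Suc n)\<rfloor> + 1) / real (Suc n)"
      by (intro divide_right_mono fl) simp
    finally show "s - 1 / real (Suc n) \<le> ?a n"
      unfolding nn by (simp add: add_divide_distrib del: of_nat_Suc)
  qed
  have "(\<lambda>n. ?a n) \<longlonglongrightarrow> s"
  proof (rule real_tendsto_sandwich)
    show "\<forall>\<^sub>F n in sequentially. s - 1 / real (Suc n) \<le> ?a n" "\<forall>\<^sub>F n in sequentially. ?a n \<le> s"
      using a by auto
    show "(\<lambda>n. s - 1 / real (Suc n)) \<longlonglongrightarrow> s"
      using tendsto_diff[OF tendsto_const LIMSEQ_inverse_real_of_nat, of s] by (simp add: inverse_eq_divide)
  qed simp
  moreover have "min t (?a n) = ?a n" for n using a(1)[of n] s by auto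
  moreover have "?a n \<in> {0..t}" for n using a(1)[of n] s by auto
  ultimately have "(\<lambda>n. X (min t (?a n)) \<omega>) \<longlonglongrightarrow> X s \<omega>"
    using cont[OF \<omega>] s unfolding continuous_on_sequentially by (auto simp: o_def)
  then show "(\<lambda>n. X (min t (real (nat \<lfloor>fst z * real (Suc n)\<rfloor>) / real (Suc n))) (snd z)) \<longlonglongrightarrow> (case z of (s, \<omega>) \<Rightarrow> X s \<omega>)"
    by (simp add: z)
qed

section \<open>The product of Lebesgue measure on [0, T] with the probability\<close>

locale horizon = prob_space P for P :: "'a measure" + fixes T :: real assumes T_pos: "0 < T"
begin

abbreviation "\<Lambda> \<equiv> restrict_space lborel {0..T}"
abbreviation "\<mu> \<equiv> \<Lambda> \<Otimes>\<^sub>M P"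
abbreviation "L2 \<equiv> square_integrable P"

lemma space_Lambda [simp]: "space \<Lambda> = {0..T}"
  by (simp add: space_restrict_space)

lemma Icc_sets_Lambda [simp, measurable]: "{0..T} \<in> sets \<Lambda>"
  by (simp add: sets_restrict_space_iff)

sublocale L: finite_measure \<Lambda>
  by (rule finite_measureI) (use T_pos in \<open>simp add: emeasure_restrict_space\<close>)

lemma measure_Lambda [simp]: "measure \<Lambda> {0..T} = T"
proof -
  have "measure \<Lambda> {0..T} = measure lborel {0..T}"
    by (rule measure_restrict_space) simp_all
  then show ?thesis using T_pos by simp
qed

sublocale LP: pair_sigma_finite \<Lambda> P ..
sublocale LP_fin: finite_measure \<mu>
proof (rule finite_measureI)
  have "emeasure \<mu> (space \<Lambda> \<times> space P) = emeasure \<Lambda> (space \<Lambda>) * emeasure P (space P)"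
    by (rule emeasure_pair_measure_Times) auto
  then show "emeasure \<mu> (space \<mu>) \<noteq> \<infinity>"
    using L.emeasure_finite by (simp add: space_pair_measure emeasure_space_1)
qed

lemma fst_mu_measurable [measurable]: "fst \<in> borel_measurable \<mu>"
  by (intro measurable_compose[OF measurable_fst] measurable_restrict_space1) simp

lemma set_integral_eq_Lambda:
  fixes f :: "real \<Rightarrow> 'b::{banach, second_countable_topology}"
  assumes "A \<subseteq> {0..T}"
  shows "(LBINT s:A. f s) = (\<integral>s. indicator A s *\<^sub>R f s \<partial>\<Lambda>)"
proof -
  have "(\<integral>s. indicator A s *\<^sub>R f s \<partial>\<Lambda>) = (LBINT s:{0..T}. indicator A s *\<^sub>R f s)"
    by (simp add: integral_restrict_space set_lebesgue_integral_def)
  also have "\<dots> = (LBINT s:A. f s)"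
    unfolding set_lebesgue_integral_def
    by (rule Bochner_Integration.integral_cong) (use assms in \<open>auto simp: indicator_def\<close>)
  finally show ?thesis by simp
qed

lemma set_integral_eq_Lambda_full: "(LBINT s:{0..T}. f s) = (\<integral>s. f s \<partial>\<Lambda>)"
  for f :: "real \<Rightarrow> 'b::{banach, second_countable_topology}"
  by (simp add: integral_restrict_space set_lebesgue_integral_def)

lemma integral_mu:
  fixes f :: "real \<Rightarrow> 'a \<Rightarrow> real"
  assumes "integrable \<mu> (\<lambda>(s, \<omega>). f s \<omega>)"
  shows "(\<integral>z. (case z of (s, \<omega>) \<Rightarrow> f s \<omega>) \<partial>\<mu>) = (\<integral>s. (\<integral>\<omega>. f s \<omega> \<partial>P) \<partial>\<Lambda>)"
    and "(\<integral>z. (case z of (s, \<omega>) \<Rightarrow> f s \<omega>) \<partial>\<mu>) = (\<integral>\<omega>. (\<integral>s. f s \<omega> \<partial>\<Lambda>) \<partial>P)"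
  using LP.integral_fst[of f] LP.integral_snd[of f] assms by simp_all

lemma AE_mu_snd:
  assumes "AE \<omega> in P. Q \<omega>"
  shows "AE z in \<mu>. Q (snd z)"
proof -
  obtain N where N: "N \<in> null_sets P" "{\<omega> \<in> space P. \<not> Q \<omega>} \<subseteq> N"
    using assms by (auto elim: AE_E simp: null_sets_def)
  have "emeasure \<mu> (space \<Lambda> \<times> N) = emeasure \<Lambda> (space \<Lambda>) * emeasure P N"
    by (rule emeasure_pair_measure_Times) (use N in auto)
  then have "space \<Lambda> \<times> N \<in> null_sets \<mu>"
    using N by (auto simp: null_sets_def)
  then show ?thesis
    by (rule AE_I') (use N in \<open>auto simp: space_pair_measure\<close>)
qed

lemma square_integrable_sections:
  assumes sq: "square_integrable \<mu> (\<lambda>(s, \<omega>). f s \<omega>)"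
  shows "AE \<omega> in P. square_integrable \<Lambda> (\<lambda>s. f s \<omega>)" "AE s in \<Lambda>. L2 (f s)"
proof -
  have meas [measurable]: "(\<lambda>(s, \<omega>). f s \<omega>) \<in> borel_measurable \<mu>" using sq by (simp add: square_integrable_def)
  have int: "integrable \<mu> (\<lambda>(s, \<omega>). (f s \<omega>)\<^sup>2)"
    using sq by (simp add: square_integrable_def case_prod_beta')
  have "AE \<omega> in P. integrable \<Lambda> (\<lambda>s. (f s \<omega>)\<^sup>2)" "AE s in \<Lambda>. integrable P (\<lambda>\<omega>. (f s \<omega>)\<^sup>2)"
    using LP.AE_integrable_snd[of "\<lambda>s \<omega>. (f s \<omega>)\<^sup>2"] LP.AE_integrable_fst[of "\<lambda>s \<omega>. (f s \<omega>)\<^sup>2"] int by auto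
  then show "AE \<omega> in P. square_integrable \<Lambda> (\<lambda>s. f s \<omega>)" "AE s in \<Lambda>. L2 (f s)"
    unfolding square_integrable_def
    using measurable_compose[OF measurable_Pair1' meas] measurable_compose[OF measurable_Pair2' meas]
    by (auto elim!: AE_mp intro!: AE_I2 simp del: space_Lambda)
qed

lemma square_integrable_mu_const:
  assumes "L2 f"
  shows "square_integrable \<mu> (\<lambda>(s, \<omega>). f \<omega>)"
proof -
  have [measurable]: "f \<in> borel_measurable P" and int: "integrable P (\<lambda>\<omega>. (f \<omega>)\<^sup>2)"
    using assms by (auto simp: square_integrable_def)
  have "integrable \<mu> (\<lambda>(s, \<omega>). 1 * (f \<omega>)\<^sup>2)"
    by (rule LP.Fubini_integrable) (use int L.finite_measure_axioms in \<open>auto simp: abs_mult\<close>)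
  then show ?thesis by (simp add: square_integrable_def case_prod_beta')
qed

text \<open>Fubini's criterion with the expectation inside: the moments are bounded by
  \<open>K\<close> on an interval of length \<open>T\<close>.\<close>

lemma square_integrable_mu_bounded:
  assumes meas: "(\<lambda>(s, \<omega>). f s \<omega>) \<in> borel_measurable \<mu>"
    and sq: "\<And>s. s \<in> {0..T} \<Longrightarrow> L2 (f s)"
    and bd: "\<And>s. s \<in> {0..T} \<Longrightarrow> (\<integral>\<omega>. (f s \<omega>)\<^sup>2 \<partial>P) \<le> K"
  shows "square_integrable \<mu> (\<lambda>(s, \<omega>). f s \<omega>)" "(\<integral>z. (case z of (s, \<omega>) \<Rightarrow> (f s \<omega>)\<^sup>2) \<partial>\<mu>) \<le> T * K"
proof -
  have m2 [measurable]: "(\<lambda>(s, \<omega>). (f s \<omega>)\<^sup>2) \<in> borel_measurable \<mu>"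
    using borel_measurable_power[OF meas, of 2] by (simp add: case_prod_beta')
  have m3 [measurable]: "(\<lambda>s. \<integral>\<omega>. (f s \<omega>)\<^sup>2 \<partial>P) \<in> borel_measurable \<Lambda>"
    by (rule borel_measurable_lebesgue_integral) simp
  have intL: "integrable \<Lambda> (\<lambda>s. \<integral>\<omega>. (f s \<omega>)\<^sup>2 \<partial>P)"
    by (rule L.integrable_const_bound[where B = K]) (use bd in \<open>auto intro!: AE_I2\<close>)
  have int: "integrable \<mu> (\<lambda>(s, \<omega>). (f s \<omega>)\<^sup>2)"
    by (rule LP.Fubini_integrable) (use intL sq in \<open>auto intro!: AE_I2 simp: square_integrable_def\<close>)
  then show "square_integrable \<mu> (\<lambda>(s, \<omega>). f s \<omega>)"
    using meas by (simp add: square_integrable_def case_prod_beta')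
  have "(\<integral>z. (case z of (s, \<omega>) \<Rightarrow> (f s \<omega>)\<^sup>2) \<partial>\<mu>) = (\<integral>s. (\<integral>\<omega>. (f s \<omega>)\<^sup>2 \<partial>P) \<partial>\<Lambda>)"
    by (rule integral_mu[OF int])
  also have "\<dots> \<le> (\<integral>s. K \<partial>\<Lambda>)"
    by (intro integral_mono intL) (use bd in auto)
  finally show "(\<integral>z. (case z of (s, \<omega>) \<Rightarrow> (f s \<omega>)\<^sup>2) \<partial>\<mu>) \<le> T * K" by simp
qed

text \<open>The pairing of a backward process \<open>p\<close> with \<open>\<phi> = \<integral> f\<close>: it replaces Ito's product rule, the
  martingale part of \<open>p\<close> only entering through its orthogonality to the past.\<close>

lemma duality:
  assumes f: "square_integrable \<mu> (\<lambda>(s, \<omega>). f s \<omega>)" and p: "square_integrable \<mu> (\<lambda>(s, \<omega>). p s \<omega>)"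
    and k: "square_integrable \<mu> (\<lambda>(s, \<omega>). k s \<omega>)" and pT: "L2 (p T)"
    and \<phi>: "AE \<omega> in P. \<forall>t\<in>{0..T}. \<phi> t \<omega> = (LBINT s:{0..t}. f s \<omega>)"
    and \<phi>m: "(\<lambda>(s, \<omega>). \<phi> s \<omega>) \<in> borel_measurable \<mu>" "\<phi> T \<in> borel_measurable P"
    and orth: "\<And>t. t \<in> {0..T} \<Longrightarrow> L2 (f t) \<Longrightarrow>
        integrable P (\<lambda>\<omega>. (p T \<omega> - p t \<omega> + (LBINT s:{t..T}. k s \<omega>)) * f t \<omega>) \<and>
        (\<integral>\<omega>. (p T \<omega> - p t \<omega> + (LBINT s:{t..T}. k s \<omega>)) * f t \<omega> \<partial>P) = 0"
  shows "(\<integral>\<omega>. p T \<omega> * \<phi> T \<omega> \<partial>P) = (\<integral>z. (case z of (s, \<omega>) \<Rightarrow> p s \<omega> * f s \<omega>) \<partial>\<mu>) - (\<integral>z. (case z of (s, \<omega>) \<Rightarrow> k s \<omega> * \<phi> s \<omega>) \<partial>\<mu>)"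
proof -
  \<comment> \<open>The tail integral of \<open>k\<close>, written over the fixed space
    \<open>\<Lambda>\<close> with an indicator, so that joint measurability in time and path and
    Fubini are available.\<close>
  define K where "K t \<omega> = (\<integral>s. indicator {t..T} s * k s \<omega> \<partial>\<Lambda>)" for t \<omega>
  have K_eq: "(LBINT s:{t..T}. k s \<omega>) = K t \<omega>" if "t \<in> {0..T}" for t \<omega>
    using that by (subst set_integral_eq_Lambda) (auto simp: K_def)
  note [measurable] = pT[THEN square_integrable_measurable] f[THEN square_integrable_measurable] p[THEN square_integrable_measurable]
    k[THEN square_integrable_measurable] \<phi>m
  have Km [measurable]: "(\<lambda>(t, \<omega>). K t \<omega>) \<in> borel_measurable \<mu>"
  proof -
    have "(\<lambda>(z, s). indicator {fst z..T} s * k s (snd z)) \<in> borel_measurable (\<mu> \<Otimes>\<^sub>M \<Lambda>)"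
    proof -
      have [measurable]: "(\<lambda>z. k (snd z) (snd (fst z))) \<in> borel_measurable (\<mu> \<Otimes>\<^sub>M \<Lambda>)"
        using measurable_compose[of "\<lambda>z. (snd z, snd (fst z))" "\<mu> \<Otimes>\<^sub>M \<Lambda>" \<mu> "\<lambda>(s, \<omega>). k s \<omega>" borel] by simp
      have [measurable]: "(\<lambda>z. snd z) \<in> borel_measurable (\<mu> \<Otimes>\<^sub>M \<Lambda>)" "(\<lambda>z. fst (fst z)) \<in> borel_measurable (\<mu> \<Otimes>\<^sub>M \<Lambda>)"
        by (auto intro!: measurable_compose[OF measurable_snd] measurable_restrict_space1
            measurable_compose[OF measurable_fst fst_mu_measurable])
      have "(\<lambda>z. (if fst (fst z) \<le> snd z \<and> snd z \<le> T then 1 else 0) * k (snd z) (snd (fst z))) \<in> borel_measurable (\<mu> \<Otimes>\<^sub>M \<Lambda>)"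
        by measurable
      then show ?thesis by (simp add: case_prod_beta' indicator_def of_bool_def)
    qed
    then have "(\<lambda>z. K (fst z) (snd z)) \<in> borel_measurable \<mu>"
      unfolding K_def by (rule L.borel_measurable_lebesgue_integral)
    then show ?thesis by (simp add: case_prod_beta')
  qed
  have k_sec: "AE \<omega> in P. square_integrable \<Lambda> (\<lambda>s. k s \<omega>)" and f_sec: "AE \<omega> in P. square_integrable \<Lambda> (\<lambda>s. f s \<omega>)"
    using square_integrable_sections[OF k] square_integrable_sections[OF f] by auto
  \<comment> \<open>Cauchy-Schwarz in time for partial integrals; it gives square integrability both
    of the tails \<open>K\<close> of \<open>k\<close> and of the primitive \<open>\<phi>\<close> of
    \<open>f\<close>.\<close>
  have ind_sq: "square_integrable \<Lambda> (\<lambda>s. indicator A s * h s) \<and> (\<integral>s. indicator A s * h s \<partial>\<Lambda>)\<^sup>2 \<le> T * (\<integral>s. (h s)\<^sup>2 \<partial>\<Lambda>)"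
    if "square_integrable \<Lambda> h" "A \<in> sets borel" for A h
  proof -
    have [measurable]: "A \<in> sets borel" "h \<in> borel_measurable \<Lambda>"
      using that by (simp_all add: square_integrable_def)
    have [measurable]: "(\<lambda>s. s) \<in> borel_measurable \<Lambda>"
      by (rule measurable_restrict_space1) simp
    have m: "(\<lambda>s. indicator A s * h s) \<in> borel_measurable \<Lambda>" by measurable
    have sq: "square_integrable \<Lambda> (\<lambda>s. indicator A s * h s)"
      unfolding square_integrable_def
    proof (intro conjI m, rule Bochner_Integration.integrable_bound)
      show "integrable \<Lambda> (\<lambda>s. (h s)\<^sup>2)" using that by (simp add: square_integrable_def)
    qed (use m in \<open>auto intro!: AE_I2 simp: indicator_def\<close>)
    have "(\<integral>s. indicator A s * h s \<partial>\<Lambda>)\<^sup>2 \<le> T * (\<integral>s. (indicator A s * h s)\<^sup>2 \<partial>\<Lambda>)"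
      using L.integral_square_le[OF sq] by simp
    also have "\<dots> \<le> T * (\<integral>s. (h s)\<^sup>2 \<partial>\<Lambda>)"
      using T_pos sq that by (intro mult_left_mono integral_mono) (auto simp: square_integrable_def indicator_def)
    finally show ?thesis using sq by simp
  qed
  have int_k2: "integrable P (\<lambda>\<omega>. \<integral>s. (k s \<omega>)\<^sup>2 \<partial>\<Lambda>)" and int_f2: "integrable P (\<lambda>\<omega>. \<integral>s. (f s \<omega>)\<^sup>2 \<partial>\<Lambda>)"
    using LP.integrable_snd[of "\<lambda>s \<omega>. (k s \<omega>)\<^sup>2"] LP.integrable_snd[of "\<lambda>s \<omega>. (f s \<omega>)\<^sup>2"] k f
    by (simp_all add: square_integrable_def case_prod_beta')
  have K_sq: "square_integrable \<mu> (\<lambda>(t, \<omega>). K t \<omega>)"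
    unfolding square_integrable_def
  proof (intro conjI Km, rule Bochner_Integration.integrable_bound)
    have "square_integrable \<mu> (\<lambda>(s, \<omega>). sqrt (T * (\<integral>s. (k s \<omega>)\<^sup>2 \<partial>\<Lambda>)))"
      using int_k2 T_pos borel_measurable_integrable[OF int_k2]
      by (intro square_integrable_mu_const) (auto simp: square_integrable_def integral_nonneg_AE)
    then show "integrable \<mu> (\<lambda>z. (case z of (s, \<omega>) \<Rightarrow> sqrt (T * (\<integral>s. (k s \<omega>)\<^sup>2 \<partial>\<Lambda>)))\<^sup>2)"
      by (rule square_integrable_square)
    show "(\<lambda>z. (case z of (t, \<omega>) \<Rightarrow> K t \<omega>)\<^sup>2) \<in> borel_measurable \<mu>" by measurable
    have "AE z in \<mu>. square_integrable \<Lambda> (\<lambda>s. k s (snd z))"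
      using k_sec by (rule AE_mu_snd)
    then show "AE z in \<mu>. norm ((case z of (t, \<omega>) \<Rightarrow> K t \<omega>)\<^sup>2) \<le> norm ((case z of (s, \<omega>) \<Rightarrow> sqrt (T * (\<integral>s. (k s \<omega>)\<^sup>2 \<partial>\<Lambda>)))\<^sup>2)"
    proof eventually_elim
      case (elim z)
      show ?case
        using ind_sq[OF elim, of "{fst z..T}"] T_pos
        by (auto simp: case_prod_beta' K_def integral_nonneg_AE)
    qed
  qed
  have "AE \<omega> in P. \<phi> T \<omega> = (\<integral>s. f s \<omega> \<partial>\<Lambda>)"
    using \<phi> by eventually_elim (use T_pos in \<open>auto simp: set_integral_eq_Lambda_full\<close>)
  then have "(\<integral>\<omega>. p T \<omega> * \<phi> T \<omega> \<partial>P) = (\<integral>\<omega>. (\<integral>s. p T \<omega> * f s \<omega> \<partial>\<Lambda>) \<partial>P)"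
  proof (intro integral_cong_AE)
    assume "AE \<omega> in P. \<phi> T \<omega> = (\<integral>s. f s \<omega> \<partial>\<Lambda>)"
    then show "AE \<omega> in P. p T \<omega> * \<phi> T \<omega> = (\<integral>s. p T \<omega> * f s \<omega> \<partial>\<Lambda>)"
      by eventually_elim simp
  qed measurable
  also have "\<dots> = (\<integral>s. (\<integral>\<omega>. p T \<omega> * f s \<omega> \<partial>P) \<partial>\<Lambda>)"
  proof -
    have "integrable \<mu> (\<lambda>(s, \<omega>). p T \<omega> * f s \<omega>)"
      using square_integrable_mult[OF square_integrable_mu_const[OF pT] f] by (simp add: case_prod_beta')
    then show ?thesis by (rule LP.Fubini_integral)
  qed
  \<comment> \<open>At almost every time \<open>s\<close> the variable \<open>f s\<close> is square
    integrable and thus an admissible test variable, and \<open>p T\<close> may be replaced by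
    \<open>p s - K s\<close> in the pairing.\<close>
  also have "\<dots> = (\<integral>s. (\<integral>\<omega>. p s \<omega> * f s \<omega> \<partial>P) - (\<integral>\<omega>. K s \<omega> * f s \<omega> \<partial>P) \<partial>\<Lambda>)"
  proof (rule integral_cong_AE)
    show "AE s in \<Lambda>. (\<integral>\<omega>. p T \<omega> * f s \<omega> \<partial>P) = (\<integral>\<omega>. p s \<omega> * f s \<omega> \<partial>P) - (\<integral>\<omega>. K s \<omega> * f s \<omega> \<partial>P)"
      using square_integrable_sections(2)[OF f] square_integrable_sections(2)[OF p] square_integrable_sections(2)[OF K_sq]
        AE_space
    proof eventually_elim
      case (elim s)
      have "(\<integral>\<omega>. p T \<omega> * f s \<omega> \<partial>P) - (\<integral>\<omega>. p s \<omega> * f s \<omega> \<partial>P) + (\<integral>\<omega>. K s \<omega> * f s \<omega> \<partial>P)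
         = (\<integral>\<omega>. (p T \<omega> - p s \<omega> + K s \<omega>) * f s \<omega> \<partial>P)"
        using square_integrable_mult[OF pT elim(1)] square_integrable_mult[OF elim(2,1)] square_integrable_mult[OF elim(3,1)]
        by (simp add: algebra_simps)
      also have "\<dots> = 0"
        using orth[of s] elim by (simp add: K_eq)
      finally show ?case by simp
    qed
  qed measurable
  also have "\<dots> = (\<integral>s. (\<integral>\<omega>. p s \<omega> * f s \<omega> \<partial>P) \<partial>\<Lambda>) - (\<integral>s. (\<integral>\<omega>. K s \<omega> * f s \<omega> \<partial>P) \<partial>\<Lambda>)"
    using LP.integrable_fst[of "\<lambda>s \<omega>. p s \<omega> * f s \<omega>"] LP.integrable_fst[of "\<lambda>s \<omega>. K s \<omega> * f s \<omega>"]
      square_integrable_mult[OF p f] square_integrable_mult[OF K_sq f]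
    by (intro Bochner_Integration.integral_diff) (simp_all add: case_prod_beta')
  also have "\<dots> = (\<integral>z. (case z of (s, \<omega>) \<Rightarrow> p s \<omega> * f s \<omega>) \<partial>\<mu>) - (\<integral>\<omega>. (\<integral>s. K s \<omega> * f s \<omega> \<partial>\<Lambda>) \<partial>P)"
    using LP.integral_fst[of "\<lambda>s \<omega>. p s \<omega> * f s \<omega>"] LP.Fubini_integral[of "\<lambda>s \<omega>. K s \<omega> * f s \<omega>"]
      square_integrable_mult[OF p f] square_integrable_mult[OF K_sq f]
    by (simp add: case_prod_beta')
  \<comment> \<open>Exchange of the integrals over the triangle \<open>t \<le> s\<close>: the tail
    of \<open>k\<close> against \<open>f\<close> becomes \<open>k\<close> against the primitive of
    \<open>f\<close>.\<close>
  also have "(\<integral>\<omega>. (\<integral>s. K s \<omega> * f s \<omega> \<partial>\<Lambda>) \<partial>P) = (\<integral>\<omega>. (\<integral>s. k s \<omega> * \<phi> s \<omega> \<partial>\<Lambda>) \<partial>P)"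
  proof (rule integral_cong_AE)
    show "AE \<omega> in P. (\<integral>s. K s \<omega> * f s \<omega> \<partial>\<Lambda>) = (\<integral>s. k s \<omega> * \<phi> s \<omega> \<partial>\<Lambda>)"
      using k_sec f_sec \<phi>
    proof eventually_elim
      case (elim \<omega>)
      interpret LL: pair_sigma_finite \<Lambda> \<Lambda> ..
      have [measurable]: "(\<lambda>s. s) \<in> borel_measurable \<Lambda>"
        by (rule measurable_restrict_space1) simp
      have [measurable]: "(\<lambda>s. k s \<omega>) \<in> borel_measurable \<Lambda>" "(\<lambda>s. f s \<omega>) \<in> borel_measurable \<Lambda>"
        using elim by (auto simp: square_integrable_def)
      have kf: "integrable \<Lambda> (\<lambda>s. k s \<omega>)" "integrable \<Lambda> (\<lambda>s. f s \<omega>)"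
        using elim L.square_integrable_integrable by auto
      have "integrable (\<Lambda> \<Otimes>\<^sub>M \<Lambda>) (\<lambda>(t, s). f t \<omega> * k s \<omega>)"
      proof (rule LL.Fubini_integrable)
        show "integrable \<Lambda> (\<lambda>x. \<integral>y. norm (case (x, y) of (t, s) \<Rightarrow> f t \<omega> * k s \<omega>) \<partial>\<Lambda>)"
          using kf by (simp add: abs_mult)
      qed (use kf in auto)
      then have int: "integrable (\<Lambda> \<Otimes>\<^sub>M \<Lambda>) (\<lambda>(t, s). indicator {t..T} s * k s \<omega> * f t \<omega>)"
      proof (rule Bochner_Integration.integrable_bound)
        have [measurable]: "(\<lambda>z. fst z) \<in> borel_measurable (\<Lambda> \<Otimes>\<^sub>M \<Lambda>)" "(\<lambda>z. snd z) \<in> borel_measurable (\<Lambda> \<Otimes>\<^sub>M \<Lambda>)"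
          by (measurable, measurable)
        have "(\<lambda>z. (if fst z \<le> snd z \<and> snd z \<le> T then 1 else 0) * k (snd z) \<omega> * f (fst z) \<omega>) \<in> borel_measurable (\<Lambda> \<Otimes>\<^sub>M \<Lambda>)"
          by measurable
        then show "(\<lambda>(t, s). indicator {t..T} s * k s \<omega> * f t \<omega>) \<in> borel_measurable (\<Lambda> \<Otimes>\<^sub>M \<Lambda>)"
          by (simp add: case_prod_beta' indicator_def of_bool_def)
      qed (auto intro!: AE_I2 simp: indicator_def abs_mult)
      have "(\<integral>t. K t \<omega> * f t \<omega> \<partial>\<Lambda>) = (\<integral>t. (\<integral>s. indicator {t..T} s * k s \<omega> * f t \<omega> \<partial>\<Lambda>) \<partial>\<Lambda>)"
        by (simp add: K_def)
      also have "\<dots> = (\<integral>s. (\<integral>t. indicator {t..T} s * k s \<omega> * f t \<omega> \<partial>\<Lambda>) \<partial>\<Lambda>)"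
        by (rule LL.Fubini_integral[OF int, symmetric])
      also have "\<dots> = (\<integral>s. k s \<omega> * \<phi> s \<omega> \<partial>\<Lambda>)"
      proof (rule Bochner_Integration.integral_cong)
        fix s assume "s \<in> space \<Lambda>"
        then have s: "s \<in> {0..T}" by simp
        have "(\<integral>t. indicator {t..T} s * k s \<omega> * f t \<omega> \<partial>\<Lambda>) = (\<integral>t. k s \<omega> * (indicator {0..s} t * f t \<omega>) \<partial>\<Lambda>)"
          by (rule Bochner_Integration.integral_cong) (use s in \<open>auto simp: indicator_def\<close>)
        also have "\<dots> = k s \<omega> * \<phi> s \<omega>"
          using elim(3) s set_integral_eq_Lambda[of "{0..s}" "\<lambda>s. f s \<omega>"] by simp
        finally show "(\<integral>t. indicator {t..T} s * k s \<omega> * f t \<omega> \<partial>\<Lambda>) = k s \<omega> * \<phi> s \<omega>" .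
      qed simp
      finally show ?case .
    qed
  qed measurable
  also have "\<dots> = (\<integral>z. (case z of (s, \<omega>) \<Rightarrow> k s \<omega> * \<phi> s \<omega>) \<partial>\<mu>)"
  proof -
    have "integrable \<mu> (\<lambda>z. (case z of (s, \<omega>) \<Rightarrow> \<phi> s \<omega>)\<^sup>2)"
    proof (rule Bochner_Integration.integrable_bound)
      have "square_integrable \<mu> (\<lambda>(s, \<omega>). sqrt (T * (\<integral>s. (f s \<omega>)\<^sup>2 \<partial>\<Lambda>)))"
        using int_f2 T_pos borel_measurable_integrable[OF int_f2]
        by (intro square_integrable_mu_const) (auto simp: square_integrable_def integral_nonneg_AE)
      then show "integrable \<mu> (\<lambda>z. (case z of (s, \<omega>) \<Rightarrow> sqrt (T * (\<integral>s. (f s \<omega>)\<^sup>2 \<partial>\<Lambda>)))\<^sup>2)"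
        by (rule square_integrable_square)
      have "AE z in \<mu>. square_integrable \<Lambda> (\<lambda>s. f s (snd z)) \<and> (\<forall>t\<in>{0..T}. \<phi> t (snd z) = (LBINT s:{0..t}. f s (snd z)))"
        using AE_mu_snd[OF f_sec] AE_mu_snd[OF \<phi>] by eventually_elim blast
      then show "AE z in \<mu>. norm ((case z of (t, \<omega>) \<Rightarrow> \<phi> t \<omega>)\<^sup>2) \<le> norm ((case z of (s, \<omega>) \<Rightarrow> sqrt (T * (\<integral>s. (f s \<omega>)\<^sup>2 \<partial>\<Lambda>)))\<^sup>2)"
        using AE_space
      proof eventually_elim
        case (elim z)
        then have z: "fst z \<in> {0..T}" by (auto simp: space_pair_measure)
        then have "\<phi> (fst z) (snd z) = (\<integral>s. indicator {0..fst z} s * f s (snd z) \<partial>\<Lambda>)"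
          using elim set_integral_eq_Lambda[of "{0..fst z}" "\<lambda>s. f s (snd z)"] by simp
        then show ?case
          using ind_sq[of "\<lambda>s. f s (snd z)" "{0..fst z}"] elim T_pos
          by (auto simp: case_prod_beta' integral_nonneg_AE)
      qed
    qed measurable
    then have "square_integrable \<mu> (\<lambda>(s, \<omega>). \<phi> s \<omega>)" using \<phi>m by (simp add: square_integrable_def)
    from square_integrable_mult[OF k this] have "integrable \<mu> (\<lambda>(s, \<omega>). k s \<omega> * \<phi> s \<omega>)"
      by (simp add: case_prod_beta')
    from integral_mu(2)[OF this] show ?thesis by simp
  qed
  finally show ?thesis .
qed

end

section \<open>Noise and filtrations\<close>

lemma (in prob_space) indep_set_mono:
  "indep_set A B \<Longrightarrow> A' \<subseteq> A \<Longrightarrow> B' \<subseteq> B \<Longrightarrow> indep_set A' B'"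
  unfolding indep_sets2_eq by blast

text \<open>Independence is given between families of sets; the preimage families are stable under
  intersection, so it extends to the generated \<sigma>-algebras and the expectation
  factorises.\<close>

lemma (in prob_space) indep_set_integral:
  fixes X Y :: "'a \<Rightarrow> real"
  assumes ind: "indep_set A B" and A: "{X -` S \<inter> space M |S. S \<in> sets borel} \<subseteq> A"
    and B: "{Y -` S \<inter> space M |S. S \<in> sets borel} \<subseteq> B"
    and X: "integrable M X" and Y: "integrable M Y"
  shows "integrable M (\<lambda>\<omega>. X \<omega> * Y \<omega>)" "(\<integral>\<omega>. X \<omega> * Y \<omega> \<partial>M) = (\<integral>\<omega>. X \<omega> \<partial>M) * (\<integral>\<omega>. Y \<omega> \<partial>M)"
proof -
  have st: "Int_stable {Z -` S \<inter> space M |S. S \<in> sets borel}" for Z :: "'a \<Rightarrow> real"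
  proof (rule Int_stableI, clarsimp)
    fix S S' :: "real set" assume "S \<in> sets borel" "S' \<in> sets borel"
    then show "\<exists>S''. Z -` S \<inter> space M \<inter> (Z -` S' \<inter> space M) = Z -` S'' \<inter> space M \<and> S'' \<in> sets borel"
      by (intro exI[of _ "S \<inter> S'"]) auto
  qed
  have "indep_var borel X borel Y"
    unfolding indep_var_eq
    using X Y indep_set_sigma_sets[OF indep_set_mono[OF ind A B] st st] by auto
  then show "integrable M (\<lambda>\<omega>. X \<omega> * Y \<omega>)" "(\<integral>\<omega>. X \<omega> * Y \<omega> \<partial>M) = (\<integral>\<omega>. X \<omega> \<partial>M) * (\<integral>\<omega>. Y \<omega> \<partial>M)"
    using indep_var_integrable indep_var_lebesgue_integral X Y by blast+
qed

section \<open>The filtrations and their measurable functions\<close>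

lemma space_joint_filtration [simp]: "space (joint_filtration P W \<eta> S t) = space P"
  unfolding joint_filtration_def by (rule space_measure_of) auto

lemma sets_joint_filtration:
  "sets (joint_filtration P W \<eta> S t) = sigma_sets (space P)
     ({(\<lambda>\<omega>. \<eta> \<omega> $ \<gamma>) -` A \<inter> space P |\<gamma> A. \<gamma> \<in> S \<and> A \<in> sets borel} \<union>
      {W \<gamma> s -` A \<inter> space P |\<gamma> s A. \<gamma> \<in> S \<and> s \<in> {0..t} \<and> A \<in> sets borel})"
  unfolding joint_filtration_def by (rule sets_measure_of) auto

lemma joint_filtration_mono:
  assumes "S \<subseteq> S'" "s \<le> t"
  shows "sets (joint_filtration P W \<eta> S s) \<subseteq> sets (joint_filtration P W \<eta> S' t)"
proof -
  have "{0..s} \<subseteq> {0..t}" using assms by auto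
  then show ?thesis
    unfolding sets_joint_filtration using assms(1) by (intro sigma_sets_mono' Un_mono; blast)
qed

lemma joint_filtration_eta_measurable:
  "\<gamma> \<in> S \<Longrightarrow> (\<lambda>\<omega>. \<eta> \<omega> $ \<gamma>) \<in> borel_measurable (joint_filtration P W \<eta> S t)"
  by (rule measurableI) (simp, simp add: sets_joint_filtration, intro sigma_sets.Basic UnI1, blast)

lemma joint_filtration_W_measurable:
  "\<gamma> \<in> S \<Longrightarrow> s \<in> {0..t} \<Longrightarrow> W \<gamma> s \<in> borel_measurable (joint_filtration P W \<eta> S t)"
  by (rule measurableI) (simp, simp add: sets_joint_filtration, intro sigma_sets.Basic UnI2, blast)

lemma measurable_subset:
  assumes "f \<in> M \<rightarrow>\<^sub>M N" "sets M \<subseteq> sets M'" "space M = space M'"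
  shows "f \<in> M' \<rightarrow>\<^sub>M N"
  using assms by (auto simp: measurable_def)

locale game_space = horizon P T for P :: "'a measure" and T :: real +
  fixes W :: "'a noise"
  assumes wieners: "independent_wieners P W"
begin

abbreviation "leader_state m \<equiv> state_process P T (leader_filtration P W m)"
abbreviation "full_state m \<equiv> state_process P T (full_filtration P W m)"

abbreviation "mean\<^sub>1 m \<equiv> \<integral>\<omega>. eta m \<omega> $ Follower \<partial>P"

abbreviation process_nth :: "(real \<Rightarrow> 'a \<Rightarrow> real ^ 'n) \<Rightarrow> 'n \<Rightarrow> 'a process" (infixl "\<^bold>$" 90) where
  "X \<^bold>$ i \<equiv> \<lambda>t \<omega>. X t \<omega> $ i"

section \<open>Measurability and moments of the Wiener paths\<close>

lemma wiener_W: "wiener P (W \<gamma>)"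
  using wieners by (simp add: independent_wieners_def)

lemma W_measurable: "0 \<le> t \<Longrightarrow> W \<gamma> t \<in> borel_measurable P"
  using wiener_W by (simp add: wiener_def)

lemma W_continuous: "\<omega> \<in> space P \<Longrightarrow> continuous_on {0..t} (\<lambda>t. W \<gamma> t \<omega>)"
  using wiener_W[of \<gamma>] continuous_on_subset[of "{0..}" _ "{0..t}"] by (auto simp: wiener_def)

lemma increment_moments:
  assumes "0 \<le> s" "s < t"
  shows "L2 (\<lambda>\<omega>. W \<gamma> t \<omega> - W \<gamma> s \<omega>)" "(\<integral>\<omega>. W \<gamma> t \<omega> - W \<gamma> s \<omega> \<partial>P) = 0"
    "(\<integral>\<omega>. (W \<gamma> t \<omega> - W \<gamma> s \<omega>)\<^sup>2 \<partial>P) = t - s"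
proof -
  let ?X = "\<lambda>\<omega>. W \<gamma> t \<omega> - W \<gamma> s \<omega>" and ?\<sigma> = "sqrt (t - s)"
  have D: "distributed P lborel ?X (normal_density 0 ?\<sigma>)"
    using wiener_W[of \<gamma>] assms by (simp add: wiener_def)
  have \<sigma>: "0 < ?\<sigma>" using assms by simp
  show e: "(\<integral>\<omega>. ?X \<omega> \<partial>P) = 0"
    by (rule normal_distributed_expectation[OF \<sigma> D])
  show "(\<integral>\<omega>. (?X \<omega>)\<^sup>2 \<partial>P) = t - s"
    using normal_distributed_variance[OF \<sigma> D] assms unfolding e by simp
  have "integrable P (\<lambda>\<omega>. (?X \<omega>)\<^sup>2)"
    using integrable_normal_moment[OF \<sigma>, of 0 2] distributed_integrable[OF D, of "\<lambda>x. x\<^sup>2"] by simp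
  then show "L2 ?X"
    using W_measurable assms by (auto simp: square_integrable_def)
qed

text \<open>The law is prescribed only for increments over \<open>s < t\<close>, and
  \<open>W \<gamma> 0\<close> vanishes only almost surely; hence the detour over
  \<open>W \<gamma> t \<omega> - W \<gamma> 0 \<omega>\<close> and the separate case
  \<open>t = 0\<close>.\<close>

lemma W_moments:
  assumes "0 \<le> t"
  shows "L2 (W \<gamma> t)" "(\<integral>\<omega>. W \<gamma> t \<omega> \<partial>P) = 0" "(\<integral>\<omega>. (W \<gamma> t \<omega>)\<^sup>2 \<partial>P) = t"
proof -
  have [measurable]: "W \<gamma> t \<in> borel_measurable P" "W \<gamma> 0 \<in> borel_measurable P"
    using assms by (auto intro: W_measurable)
  have "AE \<omega> in P. W \<gamma> 0 \<omega> = 0" using wiener_W by (simp add: wiener_def)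
  then have ae: "AE \<omega> in P. W \<gamma> t \<omega> = W \<gamma> t \<omega> - W \<gamma> 0 \<omega>" "AE \<omega> in P. (W \<gamma> t \<omega>)\<^sup>2 = (W \<gamma> t \<omega> - W \<gamma> 0 \<omega>)\<^sup>2"
    by (eventually_elim, simp)+
  have m: "L2 (\<lambda>\<omega>. W \<gamma> t \<omega> - W \<gamma> 0 \<omega>) \<and> (\<integral>\<omega>. W \<gamma> t \<omega> - W \<gamma> 0 \<omega> \<partial>P) = 0 \<and>
    (\<integral>\<omega>. (W \<gamma> t \<omega> - W \<gamma> 0 \<omega>)\<^sup>2 \<partial>P) = t"
    using increment_moments[of 0 t \<gamma>] assms by (cases "t = 0") (auto simp: square_integrable_def)
  then show "L2 (W \<gamma> t)"
    using integrable_cong_AE[OF _ _ ae(2)] by (simp add: square_integrable_def)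
  show "(\<integral>\<omega>. W \<gamma> t \<omega> \<partial>P) = 0" "(\<integral>\<omega>. (W \<gamma> t \<omega>)\<^sup>2 \<partial>P) = t"
    using integral_cong_AE[OF _ _ ae(1)] integral_cong_AE[OF _ _ ae(2)] m by simp_all
qed

lemma generated_sets_events: "generated_sets P (W \<gamma>) I \<subseteq> events" if "I \<subseteq> {0..}"
  unfolding generated_sets_def
  by (rule sets.sigma_sets_subset) (use that W_measurable in \<open>auto intro!: measurable_sets\<close>)

lemma subalgebra_joint_filtration:
  assumes "\<And>\<gamma>. (\<lambda>\<omega>. \<eta> \<omega> $ \<gamma>) \<in> borel_measurable P"
  shows "subalgebra P (joint_filtration P W \<eta> S t)"
  unfolding subalgebra_def sets_joint_filtration space_joint_filtration
  by (intro conjI refl sets.sigma_sets_subset) (use assms W_measurable in \<open>auto intro!: measurable_sets\<close>)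

text \<open>The three initial values (\<open>Inl\<close>) and the three Wiener paths
  (\<open>Inr\<close>), that is, the independent family of \<open>is_model\<close>. Independence
  between the data of different agents comes from splitting this family in two.\<close>

definition sources :: "'a model \<Rightarrow> agent + agent \<Rightarrow> 'a set set" where
  "sources m i = (case i of
      Inl \<gamma> \<Rightarrow> {(\<lambda>\<omega>. eta m \<omega> $ \<gamma>) -` A \<inter> space P |A. A \<in> sets borel}
    | Inr \<gamma> \<Rightarrow> generated_sets P (W \<gamma>) {0..})"

lemma Int_stable_sources: "Int_stable (sources m i)"
proof (cases i)
  case (Inl \<gamma>)
  show ?thesis
  proof (rule Int_stableI, clarsimp simp: sources_def Inl)
    fix A B :: "real set" assume "A \<in> sets borel" "B \<in> sets borel"
    then show "\<exists>C. (\<lambda>\<omega>. eta m \<omega> $ \<gamma>) -` A \<inter> space P \<inter> ((\<lambda>\<omega>. eta m \<omega> $ \<gamma>) -` B \<inter> space P)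
        = (\<lambda>\<omega>. eta m \<omega> $ \<gamma>) -` C \<inter> space P \<and> C \<in> sets borel"
      by (intro exI[of _ "A \<inter> B"]) auto
  qed
next
  case (Inr \<gamma>)
  interpret sigma_algebra "space P" "generated_sets P (W \<gamma>) {0..}"
    unfolding generated_sets_def by (rule sigma_algebra_sigma_sets) auto
  show ?thesis using Int_stable by (simp add: sources_def Inr)
qed

context
  fixes m :: "'a model"
  assumes model: "is_model P W m"
begin

lemma eta_measurable: "(\<lambda>\<omega>. eta m \<omega> $ \<gamma>) \<in> borel_measurable P"
  and eta_square_integrable: "L2 (\<lambda>\<omega>. eta m \<omega> $ \<gamma>)"
  using model by (auto simp: is_model_def Let_def square_integrable_def)

lemma sources_indep: "indep_sets (sources m) UNIV"
  using model by (simp add: is_model_def Let_def sources_def[abs_def])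

text \<open>Grouping of independent \<sigma>-algebras, with the two groups indexed by the booleans;
  \<open>I\<close> singles out one Wiener path in one application and the two sources of the
  follower in another.\<close>

lemma sources_split:
  "indep_set (sigma_sets (space P) (\<Union>i\<in>I. sources m i)) (sigma_sets (space P) (\<Union>i\<in>- I. sources m i))"
proof -
  have "indep_sets (\<lambda>j. sigma_sets (space P) (\<Union>i\<in>case_bool I (- I) j. sources m i)) UNIV"
  proof (rule indep_sets_collect_sigma)
    have "(\<Union>j. case_bool I (- I) j) = UNIV" by (auto simp: UNIV_bool)
    then show "indep_sets (sources m) (\<Union>j. case_bool I (- I) j)" using sources_indep by simp
    show "disjoint_family_on (case_bool I (- I)) UNIV"
      by (auto simp: disjoint_family_on_def split: bool.split)
  qed (rule Int_stable_sources)
  then show ?thesis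
    unfolding indep_set_def by (rule indep_sets_cong[THEN iffD1, rotated 2]) (auto split: bool.split)
qed

lemma sources_subset: "sources m i \<subseteq> Pow (space P)"
proof (cases i)
  case (Inr \<gamma>)
  then show ?thesis
    using generated_sets_events[of "{0..}" \<gamma>] sets.space_closed[of P] by (simp add: sources_def)
qed (auto simp: sources_def)

lemma eta_source: "A \<in> sets borel \<Longrightarrow> (\<lambda>\<omega>. eta m \<omega> $ \<gamma>) -` A \<inter> space P \<in> sources m (Inl \<gamma>)"
  by (auto simp: sources_def)

lemma W_source: "A \<in> sets borel \<Longrightarrow> 0 \<le> s \<Longrightarrow> W \<gamma> s -` A \<inter> space P \<in> sources m (Inr \<gamma>)"
  unfolding sources_def generated_sets_def sum.case by (intro sigma_sets.Basic CollectI exI conjI refl) auto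

text \<open>The Wiener axiom only makes an increment independent of the past of its own path. The
  past of all agents is covered by the \<sigma>-algebra of the sets \<open>b \<inter> c\<close>,
  with \<open>b\<close> in the own past and \<open>c\<close> determined by all other sources. For
  these the probability factorises in two steps: the own path against the other sources, then the
  increment against the own past.\<close>

lemma increment_indep_past:
  assumes "0 \<le> t" "t < s"
  shows "indep_set {(\<lambda>\<omega>. W \<gamma> s \<omega> - W \<gamma> t \<omega>) -` A \<inter> space P |A. A \<in> sets borel} (sets (full_filtration P W m t))"
proof -
  let ?past = "generated_sets P (W \<gamma>) {0..t}" and ?own = "sigma_sets (space P) (\<Union>i\<in>{Inr \<gamma>}. sources m i)"
  let ?others = "sigma_sets (space P) (\<Union>i\<in>- {Inr \<gamma>}. sources m i)"
  let ?X = "\<lambda>\<omega>. W \<gamma> s \<omega> - W \<gamma> t \<omega>"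
  let ?inc = "{?X -` A \<inter> space P |A. A \<in> sets borel}"
  \<comment> \<open>An intersection-stable generator of a \<sigma>-algebra containing the full past;
    on it independence can be verified by hand.\<close>
  define gen where "gen = {b \<inter> c |b c. b \<in> ?past \<and> c \<in> ?others}"
  have ind1: "indep_set ?past ?inc"
    using wiener_W[of \<gamma>] assms by (simp add: wiener_def)
  have ind2: "indep_set ?own ?others" by (rule sources_split)
  interpret past: sigma_algebra "space P" ?past
    unfolding generated_sets_def by (rule sigma_algebra_sigma_sets) auto
  have src_sub: "(\<Union>i\<in>I. sources m i) \<subseteq> Pow (space P)" for I
    by (intro UN_least sources_subset)
  interpret own: sigma_algebra "space P" ?own
    by (rule sigma_algebra_sigma_sets) (rule src_sub)
  interpret others: sigma_algebra "space P" ?others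
    by (rule sigma_algebra_sigma_sets) (rule src_sub)
  have past_own: "?past \<subseteq> ?own"
    unfolding generated_sets_def
  proof (rule sigma_sets_mono, clarify)
    fix r and A :: "real set" assume "r \<in> {0..t}" "A \<in> sets borel"
    then show "W \<gamma> r -` A \<inter> space P \<in> ?own"
      by (intro sigma_sets.Basic UN_I[of "Inr \<gamma>"] W_source) auto
  qed
  have inc_own: "?inc \<subseteq> ?own"
  proof -
    let ?M = "sigma (space P) (\<Union>i\<in>{Inr \<gamma>}. sources m i)"
    have M: "space ?M = space P" "sets ?M = ?own"
      by (rule space_measure_of[OF src_sub], rule sets_measure_of[OF src_sub])
    have "W \<gamma> r \<in> borel_measurable ?M" if "0 \<le> r" for r
    proof (rule measurableI)
      fix A :: "real set" assume "A \<in> sets borel"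
      then have "W \<gamma> r -` A \<inter> space P \<in> (\<Union>i\<in>{Inr \<gamma>}. sources m i)"
        using W_source[OF _ that, of A \<gamma>] by simp
      then show "W \<gamma> r -` A \<inter> space ?M \<in> sets ?M"
        unfolding M by (rule sigma_sets.Basic)
    qed simp
    then have "?X \<in> borel_measurable ?M" using assms by (intro borel_measurable_diff) auto
    from measurable_sets[OF this] show ?thesis using M by auto
  qed
  have "indep_set ?inc gen"
  proof (rule indep_setI)
    have ev: "?past \<subseteq> events" "?others \<subseteq> events"
      by (rule ind1[unfolded indep_sets2_eq, THEN conjunct1],
          rule ind2[unfolded indep_sets2_eq, THEN conjunct2, THEN conjunct1])
    show "?inc \<subseteq> events" by (rule ind1[unfolded indep_sets2_eq, THEN conjunct2, THEN conjunct1])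
    show "gen \<subseteq> events" unfolding gen_def using ev by (clarify, intro sets.Int) (erule subsetD, assumption)+
    fix a u assume a: "a \<in> ?inc" and "u \<in> gen"
    then obtain b c where u: "u = b \<inter> c" and b: "b \<in> ?past" and c: "c \<in> ?others" by (auto simp: gen_def)
    have "prob (a \<inter> u) = prob ((b \<inter> a) \<inter> c)" by (simp add: u Int_ac)
    also have "\<dots> = prob (b \<inter> a) * prob c"
      by (intro indep_setD[OF ind2] own.Int subsetD[OF past_own b] subsetD[OF inc_own a] c)
    also have "\<dots> = prob b * prob a * prob c" using indep_setD[OF ind1 b a] by simp
    also have "\<dots> = prob a * (prob b * prob c)" by simp
    also have "prob b * prob c = prob u"
      unfolding u by (intro indep_setD[OF ind2, symmetric] subsetD[OF past_own b] c)
    finally show "prob (a \<inter> u) = prob a * prob u" .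
  qed
  moreover have "Int_stable ?inc"
  proof (rule Int_stableI, clarsimp)
    fix A B :: "real set" assume "A \<in> sets borel" "B \<in> sets borel"
    then show "\<exists>C. ?X -` A \<inter> space P \<inter> (?X -` B \<inter> space P) = ?X -` C \<inter> space P \<and> C \<in> sets borel"
      by (intro exI[of _ "A \<inter> B"]) auto
  qed
  moreover have "Int_stable gen"
  proof (rule Int_stableI, clarsimp simp: gen_def)
    fix b c b' c' assume *: "b \<in> ?past" "c \<in> ?others" "b' \<in> ?past" "c' \<in> ?others"
    have "b \<inter> c \<inter> (b' \<inter> c') = (b \<inter> b') \<inter> (c \<inter> c')" by blast
    then show "\<exists>b'' c''. b \<inter> c \<inter> (b' \<inter> c') = b'' \<inter> c'' \<and> b'' \<in> ?past \<and> c'' \<in> ?others"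
      using past.Int[OF *(1,3)] others.Int[OF *(2,4)] by blast
  qed
  ultimately have "indep_set (sigma_sets (space P) ?inc) (sigma_sets (space P) gen)"
    by (rule indep_set_sigma_sets)
  moreover have "sets (full_filtration P W m t) \<subseteq> sigma_sets (space P) gen"
    unfolding full_filtration_def sets_joint_filtration
  proof (rule sigma_sets_mono, rule Un_least; clarify)
    fix \<gamma>' and A :: "real set" assume "A \<in> sets borel"
    then have "(\<lambda>\<omega>. eta m \<omega> $ \<gamma>') -` A \<inter> space P \<in> ?others"
      by (intro sigma_sets.Basic UN_I[of "Inl \<gamma>'"] eta_source) auto
    then have "space P \<inter> ((\<lambda>\<omega>. eta m \<omega> $ \<gamma>') -` A \<inter> space P) \<in> gen"
      using past.top unfolding gen_def by blast
    then show "(\<lambda>\<omega>. eta m \<omega> $ \<gamma>') -` A \<inter> space P \<in> sigma_sets (space P) gen"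
      by (intro sigma_sets.Basic) (simp add: Int_ac)
  next
    fix \<gamma>' r and A :: "real set" assume r: "r \<in> {0..t}" and A: "A \<in> sets borel"
    show "W \<gamma>' r -` A \<inter> space P \<in> sigma_sets (space P) gen"
    proof (cases "\<gamma>' = \<gamma>")
      case True
      then have "W \<gamma>' r -` A \<inter> space P \<in> ?past"
        unfolding generated_sets_def using r A by (intro sigma_sets.Basic) auto
      then have "(W \<gamma>' r -` A \<inter> space P) \<inter> space P \<in> gen"
        using others.top unfolding gen_def by blast
      then show ?thesis by (intro sigma_sets.Basic) (simp add: Int_ac)
    next
      case False
      then have "W \<gamma>' r -` A \<inter> space P \<in> ?others"
        using r A by (intro sigma_sets.Basic UN_I[of "Inr \<gamma>'"] W_source) auto
      then have "space P \<inter> (W \<gamma>' r -` A \<inter> space P) \<in> gen"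
        using past.top unfolding gen_def by blast
      then show ?thesis by (intro sigma_sets.Basic) (simp add: Int_ac)
    qed
  qed
  ultimately show ?thesis
    by - (rule indep_set_mono, assumption, rule subsetI, erule sigma_sets.Basic)
qed

lemma subalgebra_full: "subalgebra P (full_filtration P W m t)"
  unfolding full_filtration_def by (intro subalgebra_joint_filtration eta_measurable)

lemma subalgebra_leader: "subalgebra P (leader_filtration P W m t)"
  unfolding leader_filtration_def by (intro subalgebra_joint_filtration eta_measurable)

lemma preimages_subset_sets:
  assumes "f \<in> borel_measurable N" "space N = space P"
  shows "{f -` A \<inter> space P |A. A \<in> sets borel} \<subseteq> sets N"
  by (clarify, subst assms(2)[symmetric]) (rule measurable_sets[OF assms(1)])

lemma increment_orthogonal:
  assumes t: "0 \<le> t" "t \<le> s" and \<zeta>: "\<zeta> \<in> borel_measurable (full_filtration P W m t)" "L2 \<zeta>"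
  shows "(\<integral>\<omega>. (W \<gamma> s \<omega> - W \<gamma> t \<omega>) * \<zeta> \<omega> \<partial>P) = 0"
proof (cases "t = s")
  case False
  then have ts: "t < s" using t by simp
  have "(\<integral>\<omega>. (W \<gamma> s \<omega> - W \<gamma> t \<omega>) * \<zeta> \<omega> \<partial>P) = (\<integral>\<omega>. W \<gamma> s \<omega> - W \<gamma> t \<omega> \<partial>P) * (\<integral>\<omega>. \<zeta> \<omega> \<partial>P)"
  proof (rule indep_set_integral(2)[OF increment_indep_past[OF t(1) ts] order_refl])
    show "{\<zeta> -` S \<inter> space P |S. S \<in> sets borel} \<subseteq> sets (full_filtration P W m t)"
      by (rule preimages_subset_sets[OF \<zeta>(1)]) (simp add: full_filtration_def)
  qed (use square_integrable_integrable \<zeta> increment_moments[OF t(1) ts] in auto)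
  then show ?thesis using increment_moments(2)[OF t(1) ts] by simp
qed simp

text \<open>The leaders' information is generated by sources other than the follower's initial value
  and Wiener path. This makes the follower's fluctuation invisible to the leaders.\<close>

lemma follower_noise_indep:
  assumes Y: "integrable P Y" and \<zeta>: "integrable P \<zeta>" "\<zeta> \<in> borel_measurable (leader_filtration P W m t)"
    and src: "Y = (\<lambda>\<omega>. eta m \<omega> $ Follower) \<or> (\<exists>s\<ge>0. Y = W Follower s)"
  shows "(\<integral>\<omega>. Y \<omega> * \<zeta> \<omega> \<partial>P) = (\<integral>\<omega>. Y \<omega> \<partial>P) * (\<integral>\<omega>. \<zeta> \<omega> \<partial>P)"
proof (rule indep_set_integral(2)[OF sources_split[of "{Inl Follower, Inr Follower}"]])
  show "{Y -` S \<inter> space P |S. S \<in> sets borel} \<subseteq> sigma_sets (space P) (\<Union>i\<in>{Inl Follower, Inr Follower}. sources m i)"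
  proof clarify
    fix A :: "real set" assume A: "A \<in> sets borel"
    have "Y -` A \<inter> space P \<in> (\<Union>i\<in>{Inl Follower, Inr Follower}. sources m i)"
      using src eta_source[OF A, of Follower] W_source[OF A, of _ Follower] by auto
    then show "Y -` A \<inter> space P \<in> sigma_sets (space P) (\<Union>i\<in>{Inl Follower, Inr Follower}. sources m i)"
      by (rule sigma_sets.Basic)
  qed
  have "sets (leader_filtration P W m t) \<subseteq> sigma_sets (space P) (\<Union>i\<in>- {Inl Follower, Inr Follower}. sources m i)"
    unfolding leader_filtration_def sets_joint_filtration
  proof (rule sigma_sets_mono, rule Un_least; clarify)
    fix \<gamma> and A :: "real set" assume "A \<in> sets borel" "\<gamma> \<in> {Alpha, Beta}"
    then show "(\<lambda>\<omega>. eta m \<omega> $ \<gamma>) -` A \<inter> space P \<in> sigma_sets (space P) (\<Union>i\<in>- {Inl Follower, Inr Follower}. sources m i)"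
      by (intro sigma_sets.Basic UN_I[of "Inl \<gamma>"] eta_source) auto
  next
    fix \<gamma> r and A :: "real set" assume "A \<in> sets borel" "\<gamma> \<in> {Alpha, Beta}" "r \<in> {0..t}"
    then show "W \<gamma> r -` A \<inter> space P \<in> sigma_sets (space P) (\<Union>i\<in>- {Inl Follower, Inr Follower}. sources m i)"
      by (intro sigma_sets.Basic UN_I[of "Inr \<gamma>"] W_source) auto
  qed
  then show "{\<zeta> -` S \<inter> space P |S. S \<in> sets borel} \<subseteq> sigma_sets (space P) (\<Union>i\<in>- {Inl Follower, Inr Follower}. sources m i)"
    by (rule subset_trans[rotated]) (rule preimages_subset_sets[OF \<zeta>(2)], simp add: leader_filtration_def)
qed (rule Y \<zeta>)+

end

end

section \<open>Linear state equations\<close>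

lemma uniform_limit_square_zero:
  fixes f :: "'p \<Rightarrow> 't \<Rightarrow> real"
  assumes "uniform_limit S f (\<lambda>_. 0) F"
  shows "uniform_limit S (\<lambda>p t. (f p t)\<^sup>2) (\<lambda>_. 0) F"
proof (rule uniform_limitI)
  fix e :: real assume e: "0 < e"
  have "\<forall>\<^sub>F p in F. \<forall>t\<in>S. dist (f p t) 0 < sqrt e"
    by (rule uniform_limitD[OF assms]) (use e in simp)
  then show "\<forall>\<^sub>F p in F. \<forall>t\<in>S. dist ((f p t)\<^sup>2) 0 < e"
  proof eventually_elim
    case (elim p)
    show ?case
    proof
      fix t assume "t \<in> S"
      then have "\<bar>f p t\<bar> < sqrt e" using elim by (simp add: dist_real_def)
      then have "\<bar>f p t\<bar>\<^sup>2 < (sqrt e)\<^sup>2" by (intro power_strict_mono) auto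
      then show "dist ((f p t)\<^sup>2) 0 < e" using e by (simp add: dist_real_def)
    qed
  qed
qed

lemma uniform_limit_diff_zero:
  fixes f :: "'p \<Rightarrow> 't \<Rightarrow> 'b::real_normed_vector"
  shows "uniform_limit S f l F \<Longrightarrow> uniform_limit S (\<lambda>p t. f p t - l t) (\<lambda>_. 0) F"
  by (simp add: uniform_limit_iff dist_norm)

lemma continuous_on_imp_measurable_lborel:
  "continuous_on A f \<Longrightarrow> f \<in> borel_measurable (restrict_space lborel A)"
  using borel_measurable_continuous_on_restrict[of A f]
    measurable_cong_sets[OF sets_restrict_space_cong[OF sets_lborel] refl, of A borel] by blast

context horizon
begin

lemma sets_mu: "sets \<mu> = sets (restrict_space borel {0..T} \<Otimes>\<^sub>M P)"
  by (intro sets_pair_measure_cong sets_restrict_space_cong) auto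

definition bounded_process :: "real \<Rightarrow> (real \<Rightarrow> 'a \<Rightarrow> real) \<Rightarrow> bool" where
  "bounded_process K w \<longleftrightarrow> (\<lambda>(s, \<omega>). w s \<omega>) \<in> borel_measurable \<mu> \<and>
     (\<forall>s\<in>{0..T}. L2 (w s) \<and> (\<integral>\<omega>. (w s \<omega>)\<^sup>2 \<partial>P) \<le> K)"

text \<open>An indicator under \<open>\<Lambda>\<close> instead of an integral over
  \<open>{0..t}\<close>: all times then share one measure, which suits Fubini and the moment bound.
  For continuous paths it is the usual integral.\<close>

definition path_int :: "(real \<Rightarrow> real) \<Rightarrow> (real \<Rightarrow> 'a \<Rightarrow> real) \<Rightarrow> real \<Rightarrow> 'a \<Rightarrow> real" where
  "path_int \<kappa> w t \<omega> = (\<integral>s. indicator {0..t} s * (\<kappa> s * w s \<omega>) \<partial>\<Lambda>)"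

lemma bounded_process_const: "bounded_process 1 (\<lambda>_ _. 1)"
  by (simp add: bounded_process_def square_integrable_const prob_space)

text \<open>Cauchy-Schwarz in time costs one factor \<open>T\<close>, the kernel
  \<open>C\<^sup>2\<close>, and integrating the moment bound over time another \<open>T\<close>. The
  Borel set \<open>A\<close> is free because both \<open>{0..t}\<close> and \<open>{t..T}\<close>
  occur.\<close>

lemma path_int_moment:
  assumes w: "bounded_process K w" and \<kappa>: "\<kappa> \<in> borel_measurable \<Lambda>" "\<And>s. s \<in> {0..T} \<Longrightarrow> \<bar>\<kappa> s\<bar> \<le> C"
    and A [measurable]: "A \<in> sets borel"
  shows "square_integrable \<mu> (\<lambda>(s, \<omega>). indicator A s * (\<kappa> s * w s \<omega>))"
    and "L2 (\<lambda>\<omega>. \<integral>s. indicator A s * (\<kappa> s * w s \<omega>) \<partial>\<Lambda>)"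
    and "(\<integral>\<omega>. (\<integral>s. indicator A s * (\<kappa> s * w s \<omega>) \<partial>\<Lambda>)\<^sup>2 \<partial>P) \<le> T * (C\<^sup>2 * (T * K))"
proof -
  have [measurable]: "(\<lambda>(s, \<omega>). w s \<omega>) \<in> borel_measurable \<mu>" "\<kappa> \<in> borel_measurable \<Lambda>"
    using w \<kappa> by (auto simp: bounded_process_def)
  note wsq = square_integrable_mu_bounded[of w K]
  have w1: "square_integrable \<mu> (\<lambda>(s, \<omega>). w s \<omega>)" and w2: "(\<integral>z. (case z of (s, \<omega>) \<Rightarrow> (w s \<omega>)\<^sup>2) \<partial>\<mu>) \<le> T * K"
    using wsq w by (auto simp: bounded_process_def)
  let ?h = "\<lambda>s \<omega>. indicator A s * (\<kappa> s * w s \<omega>)"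
  have hm [measurable]: "(\<lambda>(s, \<omega>). ?h s \<omega>) \<in> borel_measurable \<mu>" by measurable
  have hle: "(?h s \<omega>)\<^sup>2 \<le> C\<^sup>2 * (w s \<omega>)\<^sup>2" if "s \<in> {0..T}" for s \<omega>
  proof -
    have "(?h s \<omega>)\<^sup>2 \<le> \<bar>\<kappa> s\<bar>\<^sup>2 * (w s \<omega>)\<^sup>2"
      by (simp add: indicator_def power_mult_distrib)
    also have "\<dots> \<le> C\<^sup>2 * (w s \<omega>)\<^sup>2"
      using \<kappa>(2)[OF that] by (intro mult_right_mono power_mono) auto
    finally show ?thesis .
  qed
  have w2i: "integrable \<mu> (\<lambda>z. C\<^sup>2 * (case z of (s, \<omega>) \<Rightarrow> w s \<omega>)\<^sup>2)"
    using w1 by (simp add: square_integrable_def)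
  show h: "square_integrable \<mu> (\<lambda>(s, \<omega>). ?h s \<omega>)"
    unfolding square_integrable_def
  proof (intro conjI hm, rule Bochner_Integration.integrable_bound[OF w2i])
    show "AE z in \<mu>. norm ((case z of (s, \<omega>) \<Rightarrow> ?h s \<omega>)\<^sup>2) \<le> norm (C\<^sup>2 * (case z of (s, \<omega>) \<Rightarrow> w s \<omega>)\<^sup>2)"
      using hle by (intro AE_I2) (auto simp: space_pair_measure)
  qed measurable
  have hint: "integrable \<mu> (\<lambda>(s, \<omega>). (?h s \<omega>)\<^sup>2)"
    using h by (simp add: square_integrable_def case_prod_beta')
  have "(\<integral>z. (case z of (s, \<omega>) \<Rightarrow> (?h s \<omega>)\<^sup>2) \<partial>\<mu>) \<le> (\<integral>z. C\<^sup>2 * (case z of (s, \<omega>) \<Rightarrow> w s \<omega>)\<^sup>2 \<partial>\<mu>)"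
    by (rule integral_mono[OF hint w2i]) (use hle in \<open>auto simp: space_pair_measure\<close>)
  also have "\<dots> \<le> C\<^sup>2 * (T * K)"
    using w2 by (auto intro!: mult_left_mono simp: case_prod_beta')
  finally have hbd: "(\<integral>\<omega>. (\<integral>s. (?h s \<omega>)\<^sup>2 \<partial>\<Lambda>) \<partial>P) \<le> C\<^sup>2 * (T * K)"
    using integral_mu(2)[OF hint] by simp
  have Hm [measurable]: "(\<lambda>\<omega>. \<integral>s. ?h s \<omega> \<partial>\<Lambda>) \<in> borel_measurable P"
    using measurable_pair_swap[OF hm] by (intro L.borel_measurable_lebesgue_integral) (simp add: case_prod_beta')
  have Hint: "integrable P (\<lambda>\<omega>. T * (\<integral>s. (?h s \<omega>)\<^sup>2 \<partial>\<Lambda>))"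
    using LP.integrable_snd[OF hint] by simp
  have le: "AE \<omega> in P. (\<integral>s. ?h s \<omega> \<partial>\<Lambda>)\<^sup>2 \<le> T * (\<integral>s. (?h s \<omega>)\<^sup>2 \<partial>\<Lambda>)"
    using square_integrable_sections(1)[OF h] by eventually_elim (use L.integral_square_le in force)
  show H: "L2 (\<lambda>\<omega>. \<integral>s. ?h s \<omega> \<partial>\<Lambda>)"
    unfolding square_integrable_def
  proof (intro conjI Hm, rule Bochner_Integration.integrable_bound[OF Hint])
    show "AE \<omega> in P. norm ((\<integral>s. ?h s \<omega> \<partial>\<Lambda>)\<^sup>2) \<le> norm (T * (\<integral>s. (?h s \<omega>)\<^sup>2 \<partial>\<Lambda>))"
      using le by eventually_elim auto
  qed measurable
  have "(\<integral>\<omega>. (\<integral>s. ?h s \<omega> \<partial>\<Lambda>)\<^sup>2 \<partial>P) \<le> (\<integral>\<omega>. T * (\<integral>s. (?h s \<omega>)\<^sup>2 \<partial>\<Lambda>) \<partial>P)"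
    using H by (intro integral_mono_AE Hint le) (simp add: square_integrable_def)
  also have "\<dots> \<le> T * (C\<^sup>2 * (T * K))"
    using hbd T_pos by simp
  finally show "(\<integral>\<omega>. (\<integral>s. ?h s \<omega> \<partial>\<Lambda>)\<^sup>2 \<partial>P) \<le> T * (C\<^sup>2 * (T * K))" .
qed

text \<open>Only values up to \<open>t\<close> enter, so the integral is rewritten over
  \<open>{0..t}\<close>, where progressive measurability gives joint measurability with respect to
  \<open>N\<close>, the information at time \<open>t\<close>.\<close>

lemma path_int_adapted:
  assumes w: "(\<lambda>(s, \<omega>). w s \<omega>) \<in> borel_measurable (restrict_space borel {0..t} \<Otimes>\<^sub>M N)"
    and \<kappa>: "continuous_on {0..T} \<kappa>" and t: "t \<in> {0..T}"
  shows "path_int \<kappa> w t \<in> borel_measurable N"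
proof -
  let ?L = "restrict_space lborel {0..t}"
  interpret Lt: finite_measure ?L
    by (rule finite_measureI) (use t in \<open>simp add: emeasure_restrict_space space_restrict_space\<close>)
  have eq: "path_int \<kappa> w t \<omega> = (\<integral>s. \<kappa> s * w s \<omega> \<partial>?L)" for \<omega>
  proof -
    have "path_int \<kappa> w t \<omega> = (LBINT s:{0..t}. \<kappa> s * w s \<omega>)"
      using t by (subst set_integral_eq_Lambda) (auto simp: path_int_def)
    then show ?thesis by (simp add: integral_restrict_space set_lebesgue_integral_def)
  qed
  have "continuous_on {0..t} \<kappa>" using \<kappa> t by (auto intro: continuous_on_subset)
  then have [measurable]: "\<kappa> \<in> borel_measurable ?L"
    by (rule continuous_on_imp_measurable_lborel)
  have "sets (?L \<Otimes>\<^sub>M N) = sets (restrict_space borel {0..t} \<Otimes>\<^sub>M N)"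
    by (intro sets_pair_measure_cong sets_restrict_space_cong) auto
  then have [measurable]: "(\<lambda>(s, \<omega>). w s \<omega>) \<in> borel_measurable (?L \<Otimes>\<^sub>M N)"
    using w by (simp cong: measurable_cong_sets)
  have "(\<lambda>(s, \<omega>). \<kappa> s * w s \<omega>) \<in> borel_measurable (?L \<Otimes>\<^sub>M N)" by measurable
  from measurable_pair_swap[OF this]
  have "(\<lambda>\<omega>. \<integral>s. \<kappa> s * w s \<omega> \<partial>?L) \<in> borel_measurable N"
    by (intro Lt.borel_measurable_lebesgue_integral) (simp add: case_prod_beta')
  then show ?thesis by (simp add: eq[abs_def])
qed

text \<open>Mean-square convergence, uniform in time. Square integrability is asked only eventually,
  since Riccati solutions are available only eventually; the moment bound on the limit is what makes
  products with converging coefficients converge.\<close>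

definition l2_limit :: "'p filter \<Rightarrow> ('p \<Rightarrow> real \<Rightarrow> 'a \<Rightarrow> real) \<Rightarrow> (real \<Rightarrow> 'a \<Rightarrow> real) \<Rightarrow> bool" where
  "l2_limit F X X0 \<longleftrightarrow> (\<forall>\<^sub>F p in F. \<forall>t\<in>{0..T}. L2 (X p t)) \<and>
     (\<forall>t\<in>{0..T}. L2 (X0 t)) \<and> (\<exists>K. \<forall>t\<in>{0..T}. (\<integral>\<omega>. (X0 t \<omega>)\<^sup>2 \<partial>P) \<le> K) \<and>
     uniform_limit {0..T} (\<lambda>p t. \<integral>\<omega>. (X p t \<omega> - X0 t \<omega>)\<^sup>2 \<partial>P) (\<lambda>_. 0) F"

lemma l2_limit_const:
  assumes "\<And>t. t \<in> {0..T} \<Longrightarrow> L2 (X t)" "\<And>t. t \<in> {0..T} \<Longrightarrow> (\<integral>\<omega>. (X t \<omega>)\<^sup>2 \<partial>P) \<le> K"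
  shows "l2_limit F (\<lambda>_. X) X"
  unfolding l2_limit_def using assms by (intro conjI exI[of _ K]) (simp_all add: uniform_limit_const)

lemma l2_limit_add:
  assumes X: "l2_limit F X X0" and Y: "l2_limit F Y Y0"
  shows "l2_limit F (\<lambda>p t \<omega>. X p t \<omega> + Y p t \<omega>) (\<lambda>t \<omega>. X0 t \<omega> + Y0 t \<omega>)"
proof -
  have ex: "\<forall>\<^sub>F p in F. \<forall>t\<in>{0..T}. L2 (X p t)" and ey: "\<forall>\<^sub>F p in F. \<forall>t\<in>{0..T}. L2 (Y p t)"
    and x0: "\<And>t. t \<in> {0..T} \<Longrightarrow> L2 (X0 t)" and y0: "\<And>t. t \<in> {0..T} \<Longrightarrow> L2 (Y0 t)"
    using X Y by (auto simp: l2_limit_def)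
  obtain K1 K2 where K: "\<And>t. t \<in> {0..T} \<Longrightarrow> (\<integral>\<omega>. (X0 t \<omega>)\<^sup>2 \<partial>P) \<le> K1" "\<And>t. t \<in> {0..T} \<Longrightarrow> (\<integral>\<omega>. (Y0 t \<omega>)\<^sup>2 \<partial>P) \<le> K2"
    using X Y unfolding l2_limit_def by blast
  have lim: "uniform_limit {0..T} (\<lambda>p t. 2 * (\<integral>\<omega>. (X p t \<omega> - X0 t \<omega>)\<^sup>2 \<partial>P) + 2 * (\<integral>\<omega>. (Y p t \<omega> - Y0 t \<omega>)\<^sup>2 \<partial>P)) (\<lambda>_. 2 * 0 + 2 * 0) F"
    using X Y unfolding l2_limit_def
    by (intro uniform_limit_add bounded_linear.uniform_limit[OF bounded_linear_mult_right]) auto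
  show ?thesis
    unfolding l2_limit_def
  proof (intro conjI)
    show "\<forall>\<^sub>F p in F. \<forall>t\<in>{0..T}. L2 (\<lambda>\<omega>. X p t \<omega> + Y p t \<omega>)"
      using ex ey by eventually_elim (auto intro: square_integrable_add)
    show "\<forall>t\<in>{0..T}. L2 (\<lambda>\<omega>. X0 t \<omega> + Y0 t \<omega>)"
      using x0 y0 by (auto intro: square_integrable_add)
    show "\<exists>K. \<forall>t\<in>{0..T}. (\<integral>\<omega>. (X0 t \<omega> + Y0 t \<omega>)\<^sup>2 \<partial>P) \<le> K"
    proof (intro exI ballI)
      fix t assume t: "t \<in> {0..T}"
      show "(\<integral>\<omega>. (X0 t \<omega> + Y0 t \<omega>)\<^sup>2 \<partial>P) \<le> 2 * K1 + 2 * K2"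
        using integral_square_add_le[OF x0[OF t] y0[OF t]] K(1)[OF t] K(2)[OF t] by linarith
    qed
    show "uniform_limit {0..T} (\<lambda>p t. \<integral>\<omega>. (X p t \<omega> + Y p t \<omega> - (X0 t \<omega> + Y0 t \<omega>))\<^sup>2 \<partial>P) (\<lambda>_. 0) F"
    proof (rule uniform_limit_null_comparison)
      show "\<forall>\<^sub>F p in F. \<forall>t\<in>{0..T}. norm (\<integral>\<omega>. (X p t \<omega> + Y p t \<omega> - (X0 t \<omega> + Y0 t \<omega>))\<^sup>2 \<partial>P)
          \<le> 2 * (\<integral>\<omega>. (X p t \<omega> - X0 t \<omega>)\<^sup>2 \<partial>P) + 2 * (\<integral>\<omega>. (Y p t \<omega> - Y0 t \<omega>)\<^sup>2 \<partial>P)"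
        using ex ey
      proof eventually_elim
        case (elim p)
        show ?case
        proof
          fix t assume t: "t \<in> {0..T}"
          show "norm (\<integral>\<omega>. (X p t \<omega> + Y p t \<omega> - (X0 t \<omega> + Y0 t \<omega>))\<^sup>2 \<partial>P)
              \<le> 2 * (\<integral>\<omega>. (X p t \<omega> - X0 t \<omega>)\<^sup>2 \<partial>P) + 2 * (\<integral>\<omega>. (Y p t \<omega> - Y0 t \<omega>)\<^sup>2 \<partial>P)"
            using integral_square_add_le[OF square_integrable_diff[OF elim(1)[rule_format, OF t] x0[OF t]]
                square_integrable_diff[OF elim(2)[rule_format, OF t] y0[OF t]]]
            by (simp add: integral_nonneg_AE algebra_simps)
        qed
      qed
    qed (use lim in simp)
  qed
qed

lemma l2_limit_cmult:
  assumes X: "l2_limit F X X0" and c: "uniform_limit {0..T} c c0 F" and c0: "bounded (c0 ` {0..T})"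
  shows "l2_limit F (\<lambda>p t \<omega>. c p t * X p t \<omega>) (\<lambda>t \<omega>. c0 t * X0 t \<omega>)"
proof -
  have ex: "\<forall>\<^sub>F p in F. \<forall>t\<in>{0..T}. L2 (X p t)"
    and x0: "\<And>t. t \<in> {0..T} \<Longrightarrow> L2 (X0 t)"
    using X by (auto simp: l2_limit_def)
  obtain K where K: "\<And>t. t \<in> {0..T} \<Longrightarrow> (\<integral>\<omega>. (X0 t \<omega>)\<^sup>2 \<partial>P) \<le> K"
    using X unfolding l2_limit_def by blast
  obtain C where C: "0 < C" "\<And>t. t \<in> {0..T} \<Longrightarrow> \<bar>c0 t\<bar> \<le> C"
    using c0 by (auto simp: bounded_pos)
  \<comment> \<open>From \<open>c X - c0 X0 = c (X - X0) + (c - c0) X0\<close>: the first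
    coefficient is eventually below \<open>C + 1\<close>, the second meets the moment bound
    \<open>K\<close> of the limit.\<close>
  let ?b = "\<lambda>p t. 2 * ((C + 1)\<^sup>2 * (\<integral>\<omega>. (X p t \<omega> - X0 t \<omega>)\<^sup>2 \<partial>P)) + 2 * (K * (c p t - c0 t)\<^sup>2)"
  have lim: "uniform_limit {0..T} ?b (\<lambda>_. 2 * ((C + 1)\<^sup>2 * 0) + 2 * (K * 0)) F"
    using X unfolding l2_limit_def
    by (intro uniform_limit_add bounded_linear.uniform_limit[OF bounded_linear_mult_right]
        uniform_limit_square_zero uniform_limit_diff_zero c) auto
  show ?thesis
    unfolding l2_limit_def
  proof (intro conjI)
    show "\<forall>\<^sub>F p in F. \<forall>t\<in>{0..T}. L2 (\<lambda>\<omega>. c p t * X p t \<omega>)"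
      using ex by eventually_elim (auto intro: square_integrable_cmult)
    show "\<forall>t\<in>{0..T}. L2 (\<lambda>\<omega>. c0 t * X0 t \<omega>)"
      using x0 by (auto intro: square_integrable_cmult)
    show "\<exists>K. \<forall>t\<in>{0..T}. (\<integral>\<omega>. (c0 t * X0 t \<omega>)\<^sup>2 \<partial>P) \<le> K"
    proof (intro exI ballI)
      fix t assume t: "t \<in> {0..T}"
      have "(\<integral>\<omega>. (c0 t * X0 t \<omega>)\<^sup>2 \<partial>P) = \<bar>c0 t\<bar>\<^sup>2 * (\<integral>\<omega>. (X0 t \<omega>)\<^sup>2 \<partial>P)"
        by (simp add: power_mult_distrib)
      also have "\<dots> \<le> C\<^sup>2 * K"
        using C K t by (intro mult_mono power_mono) (auto simp: integral_nonneg_AE)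
      finally show "(\<integral>\<omega>. (c0 t * X0 t \<omega>)\<^sup>2 \<partial>P) \<le> C\<^sup>2 * K" .
    qed
    show "uniform_limit {0..T} (\<lambda>p t. \<integral>\<omega>. (c p t * X p t \<omega> - c0 t * X0 t \<omega>)\<^sup>2 \<partial>P) (\<lambda>_. 0) F"
    proof (rule uniform_limit_null_comparison)
      have ev: "\<forall>\<^sub>F p in F. \<forall>t\<in>{0..T}. dist (c p t) (c0 t) < 1" by (rule uniform_limitD[OF c]) simp
      show "\<forall>\<^sub>F p in F. \<forall>t\<in>{0..T}. norm (\<integral>\<omega>. (c p t * X p t \<omega> - c0 t * X0 t \<omega>)\<^sup>2 \<partial>P) \<le> ?b p t"
        using ex ev
      proof eventually_elim
        case (elim p)
        show ?case
        proof
          fix t assume t: "t \<in> {0..T}"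
          have cp: "\<bar>c p t\<bar> \<le> C + 1"
            using elim(2) C(2)[OF t] t by (force simp: dist_real_def)
          have d: "L2 (\<lambda>\<omega>. X p t \<omega> - X0 t \<omega>)"
            using elim t x0 by (auto intro: square_integrable_diff)
          have "(\<integral>\<omega>. (c p t * X p t \<omega> - c0 t * X0 t \<omega>)\<^sup>2 \<partial>P)
             = (\<integral>\<omega>. (c p t * (X p t \<omega> - X0 t \<omega>) + (c p t - c0 t) * X0 t \<omega>)\<^sup>2 \<partial>P)"
            by (simp add: algebra_simps)
          also have "\<dots> \<le> 2 * (\<integral>\<omega>. (c p t * (X p t \<omega> - X0 t \<omega>))\<^sup>2 \<partial>P) + 2 * (\<integral>\<omega>. ((c p t - c0 t) * X0 t \<omega>)\<^sup>2 \<partial>P)"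
            by (intro integral_square_add_le square_integrable_cmult d x0 t)
          also have "\<dots> = 2 * (\<bar>c p t\<bar>\<^sup>2 * (\<integral>\<omega>. (X p t \<omega> - X0 t \<omega>)\<^sup>2 \<partial>P)) + 2 * ((\<integral>\<omega>. (X0 t \<omega>)\<^sup>2 \<partial>P) * (c p t - c0 t)\<^sup>2)"
            by (simp add: power_mult_distrib)
          also have "\<dots> \<le> ?b p t"
            using cp K[OF t] C(1) by (intro add_mono mult_left_mono mult_right_mono power_mono) (auto simp: integral_nonneg_AE)
          finally show "norm (\<integral>\<omega>. (c p t * X p t \<omega> - c0 t * X0 t \<omega>)\<^sup>2 \<partial>P) \<le> ?b p t"
            by (simp add: integral_nonneg_AE)
        qed
      qed
    qed (use lim in simp)
  qed
qed

lemma l2_limit_sum: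
  assumes "finite I" "\<And>i. i \<in> I \<Longrightarrow> l2_limit F (X i) (X0 i)"
  shows "l2_limit F (\<lambda>p t \<omega>. \<Sum>i\<in>I. X i p t \<omega>) (\<lambda>t \<omega>. \<Sum>i\<in>I. X0 i t \<omega>)"
  using assms
proof (induction I rule: finite_induct)
  case empty
  show ?case using l2_limit_const[of "\<lambda>_ _. 0" 0] square_integrable_const[of 0] by simp
next
  case (insert i I)
  then show ?case by (simp add: l2_limit_add)
qed

lemma l2_limit_static:
  assumes "\<forall>\<^sub>F p in F. L2 (x p)" "L2 x0"
    and "((\<lambda>p. \<integral>\<omega>. (x p \<omega> - x0 \<omega>)\<^sup>2 \<partial>P) \<longlongrightarrow> 0) F"
  shows "l2_limit F (\<lambda>p t \<omega>. x p \<omega>) (\<lambda>t \<omega>. x0 \<omega>)"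
proof -
  have "uniform_limit {0..T} (\<lambda>p t. \<integral>\<omega>. (x p \<omega> - x0 \<omega>)\<^sup>2 \<partial>P) (\<lambda>_. 0) F"
    using assms(3) by (auto simp: uniform_limit_iff dest: tendstoD)
  then show ?thesis using assms by (auto simp: l2_limit_def)
qed

text \<open>The integrator \<open>w\<close> is the same for all models and only the kernel varies;
  by linearity the error is the path integral of the difference of the kernels, and the moment bound
  turns uniform smallness of that difference into mean-square smallness.\<close>

lemma l2_limit_path_int:
  assumes w: "bounded_process K w" and \<kappa>: "uniform_limit {0..T} \<kappa> \<kappa>0 F" and \<kappa>0: "continuous_on {0..T} \<kappa>0"
    and cont: "\<forall>\<^sub>F p in F. continuous_on {0..T} (\<kappa> p)"
  shows "l2_limit F (\<lambda>p. path_int (\<kappa> p) w) (path_int \<kappa>0 w)"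
proof -
  have meas: "f \<in> borel_measurable \<Lambda>" if "continuous_on {0..T} f" for f :: "real \<Rightarrow> real"
    by (rule continuous_on_imp_measurable_lborel[OF that])
  have bdd: "\<exists>C. \<forall>s\<in>{0..T}. \<bar>f s\<bar> \<le> C" if "continuous_on {0..T} f" for f :: "real \<Rightarrow> real"
    using compact_imp_bounded[OF compact_continuous_image[OF that compact_Icc]] by (auto simp: bounded_iff)
  have K: "0 \<le> K"
  proof -
    have "0 \<le> (\<integral>\<omega>. (w 0 \<omega>)\<^sup>2 \<partial>P)" by (simp add: integral_nonneg_AE)
    also have "\<dots> \<le> K" using w T_pos by (simp add: bounded_process_def)
    finally show ?thesis .
  qed
  have sq: "L2 (path_int f w t)" if "continuous_on {0..T} f" for f t
    using path_int_moment(2)[OF w meas[OF that], of _ "{0..t}"] bdd[OF that] by (force simp: path_int_def[abs_def])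
  show ?thesis
    unfolding l2_limit_def
  proof (intro conjI)
    show "\<forall>\<^sub>F p in F. \<forall>t\<in>{0..T}. L2 (path_int (\<kappa> p) w t)"
      using cont by eventually_elim (use sq in auto)
    show "\<forall>t\<in>{0..T}. L2 (path_int \<kappa>0 w t)" using sq[OF \<kappa>0] by auto
    obtain C where "\<forall>s\<in>{0..T}. \<bar>\<kappa>0 s\<bar> \<le> C" using bdd[OF \<kappa>0] by blast
    then have "(\<integral>\<omega>. (path_int \<kappa>0 w t \<omega>)\<^sup>2 \<partial>P) \<le> T * (C\<^sup>2 * (T * K))" for t
      using path_int_moment(3)[OF w meas[OF \<kappa>0], of C "{0..t}"] by (simp add: path_int_def)
    then show "\<exists>K. \<forall>t\<in>{0..T}. (\<integral>\<omega>. (path_int \<kappa>0 w t \<omega>)\<^sup>2 \<partial>P) \<le> K" by blast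
    show "uniform_limit {0..T} (\<lambda>p t. \<integral>\<omega>. (path_int (\<kappa> p) w t \<omega> - path_int \<kappa>0 w t \<omega>)\<^sup>2 \<partial>P) (\<lambda>_. 0) F"
    proof (rule uniform_limitI)
      fix e :: real assume e: "0 < e"
      \<comment> \<open>Chosen so that the moment bound with kernel size \<open>d\<close> is at most
        \<open>e / 2\<close>; the added 1 keeps the quotient meaningful when
        \<open>K = 0\<close>.\<close>
      define d where "d = sqrt (e / (2 * (T * (T * K) + 1)))"
      have TK: "0 \<le> T * (T * K)" using T_pos K by simp
      have d: "0 < d" "d\<^sup>2 = e / (2 * (T * (T * K) + 1))" using e TK by (auto simp: d_def)
      have "T * (d\<^sup>2 * (T * K)) = d\<^sup>2 * (T * (T * K))" by simp
      also have "\<dots> \<le> d\<^sup>2 * (T * (T * K) + 1)" by (intro mult_left_mono) auto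
      also have "\<dots> = e / 2" using TK by (simp add: d(2) field_simps)
      finally have small: "T * (d\<^sup>2 * (T * K)) < e" using e by simp
      show "\<forall>\<^sub>F p in F. \<forall>t\<in>{0..T}. dist (\<integral>\<omega>. (path_int (\<kappa> p) w t \<omega> - path_int \<kappa>0 w t \<omega>)\<^sup>2 \<partial>P) 0 < e"
        using uniform_limitD[OF \<kappa> d(1)] cont
      proof eventually_elim
        case (elim p)
        show ?case
        proof
          fix t assume t: "t \<in> {0..T}"
          have cd: "continuous_on {0..T} (\<lambda>s. \<kappa> p s - \<kappa>0 s)" by (intro continuous_intros elim \<kappa>0)
          have sec: "AE \<omega> in P. square_integrable \<Lambda> (\<lambda>s. indicator {0..t} s * (f s * w s \<omega>))" if "continuous_on {0..T} f" for f
            using bdd[OF that] square_integrable_sections(1)[OF path_int_moment(1)[OF w meas[OF that], of _ "{0..t}"]]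
            by force
          \<comment> \<open>Linearity needs integrable time sections, which are guaranteed only for
            almost every path.\<close>
          have ae: "AE \<omega> in P. path_int (\<kappa> p) w t \<omega> - path_int \<kappa>0 w t \<omega> = path_int (\<lambda>s. \<kappa> p s - \<kappa>0 s) w t \<omega>"
            using sec[OF elim(2)] sec[OF \<kappa>0]
          proof eventually_elim
            case (elim \<omega>)
            show ?case
              unfolding path_int_def
              by (subst Bochner_Integration.integral_diff[symmetric])
                (use elim L.square_integrable_integrable in \<open>auto simp: algebra_simps\<close>)
          qed
          have "(\<integral>\<omega>. (path_int (\<kappa> p) w t \<omega> - path_int \<kappa>0 w t \<omega>)\<^sup>2 \<partial>P) = (\<integral>\<omega>. (path_int (\<lambda>s. \<kappa> p s - \<kappa>0 s) w t \<omega>)\<^sup>2 \<partial>P)"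
          proof (rule integral_cong_AE)
            show "AE \<omega> in P. (path_int (\<kappa> p) w t \<omega> - path_int \<kappa>0 w t \<omega>)\<^sup>2 = (path_int (\<lambda>s. \<kappa> p s - \<kappa>0 s) w t \<omega>)\<^sup>2"
              using ae by eventually_elim simp
          qed (use sq[OF elim(2), of t] sq[OF \<kappa>0, of t] sq[OF cd, of t] in measurable)
          also have "\<dots> \<le> T * (d\<^sup>2 * (T * K))"
            using path_int_moment(3)[OF w meas[OF cd], of d "{0..t}"] elim(1)
            by (auto simp: path_int_def dist_real_def less_imp_le)
          finally show "dist (\<integral>\<omega>. (path_int (\<kappa> p) w t \<omega> - path_int \<kappa>0 w t \<omega>)\<^sup>2 \<partial>P) 0 < e"
            using small by (simp add: integral_nonneg_AE)
        qed
      qed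
    qed
  qed
qed

end

section \<open>Vector-valued measurability and time integrals\<close>

lemma borel_measurable_vecI:
  fixes f :: "'b \<Rightarrow> real ^ 'n"
  assumes "\<And>j. (\<lambda>x. f x $ j) \<in> borel_measurable M"
  shows "f \<in> borel_measurable M"
  by (subst borel_measurable_euclidean_space) (use assms in \<open>auto simp: Basis_vec_def inner_axis\<close>)

lemma borel_measurable_vec_nth [measurable (raw)]:
  fixes f :: "'b \<Rightarrow> real ^ 'n"
  assumes "f \<in> borel_measurable M"
  shows "(\<lambda>x. f x $ j) \<in> borel_measurable M"
  by (rule borel_measurable_continuous_on[OF _ assms]) (intro continuous_intros)

lemma norm_vec_square: "(norm (x :: real ^ 'n))\<^sup>2 = (\<Sum>j\<in>UNIV. (x $ j)\<^sup>2)"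
  unfolding power2_norm_eq_inner inner_vec_def by (simp add: power2_eq_square)

lemma set_integral_continuous_eq_integral:
  fixes f :: "real \<Rightarrow> 'b::euclidean_space"
  assumes "continuous_on {a..b} f"
  shows "(LBINT s:{a..b}. f s) = integral {a..b} f"
  by (rule set_borel_integral_eq_integral) (rule borel_integrable_atLeastAtMost'[OF assms])

lemma set_integral_vec_nth:
  fixes f :: "real \<Rightarrow> real ^ 'n"
  assumes "continuous_on {a..b} f"
  shows "(LBINT s:{a..b}. f s) $ i = (LBINT s:{a..b}. f s $ i)"
  using integral_bounded_linear[OF bounded_linear_vec_nth, of lborel "\<lambda>s. indicator {a..b} s *\<^sub>R f s" i]
    borel_integrable_atLeastAtMost'[OF assms]
  by (simp add: set_lebesgue_integral_def set_integrable_def)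

lemma set_integral_derivative:
  fixes F :: "real \<Rightarrow> 'b::euclidean_space"
  assumes "a \<le> b" "\<And>s. s \<in> {a..b} \<Longrightarrow> (F has_vector_derivative f s) (at s within {a..b})" "continuous_on {a..b} f"
  shows "(LBINT s:{a..b}. f s) = F b - F a"
  using integral_FTC_Icc[OF assms(1), of F f] assms(2,3) by (simp add: set_lebesgue_integral_def)

context game_space
begin

lemma W_progressive:
  assumes "\<And>s. s \<in> {0..t} \<Longrightarrow> W \<gamma> s \<in> borel_measurable N" "space N = space P" "0 \<le> t"
  shows "(\<lambda>(s, \<omega>). W \<gamma> s \<omega>) \<in> borel_measurable (restrict_space borel {0..t} \<Otimes>\<^sub>M N)"
  by (rule continuous_adapted_progressive) (use assms W_continuous in auto)

lemma mu_measurableI: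
  "f \<in> borel_measurable (restrict_space borel {0..T} \<Otimes>\<^sub>M P) \<Longrightarrow> f \<in> borel_measurable \<mu>"
  using measurable_cong_sets[OF sets_mu refl] by blast

lemma W_mu_measurable: "(\<lambda>(s, \<omega>). W \<gamma> s \<omega>) \<in> borel_measurable \<mu>"
  by (rule mu_measurableI[OF W_progressive]) (use W_measurable T_pos in auto)

lemma W_bounded_process: "bounded_process T (W \<gamma>)"
  using W_mu_measurable W_moments by (auto simp: bounded_process_def)

lemma path_int_eq_integral:
  assumes "continuous_on {0..T} \<kappa>" "continuous_on {0..T} (\<lambda>s. w s \<omega>)" "t \<in> {0..T}"
  shows "path_int \<kappa> w t \<omega> = integral {0..t} (\<lambda>s. \<kappa> s * w s \<omega>)"
proof -
  have "path_int \<kappa> w t \<omega> = (LBINT s:{0..t}. \<kappa> s * w s \<omega>)"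
    using assms(3) by (subst set_integral_eq_Lambda) (auto simp: path_int_def)
  also have "\<dots> = integral {0..t} (\<lambda>s. \<kappa> s * w s \<omega>)"
    by (intro set_integral_continuous_eq_integral continuous_intros continuous_on_subset[OF assms(1)]
        continuous_on_subset[OF assms(2)]) (use assms(3) in auto)
  finally show ?thesis .
qed

text \<open>Coordinate \<open>j\<close> is driven by the Wiener path of agent
  \<open>\<gamma> j\<close>; a coordinate without noise has coefficient 0.\<close>

definition noise :: "real ^ 'n \<Rightarrow> ('n \<Rightarrow> agent) \<Rightarrow> real \<Rightarrow> 'a \<Rightarrow> real ^ 'n" where
  "noise c \<gamma> t \<omega> = (\<chi> j. c $ j * W (\<gamma> j) t \<omega>)"

text \<open>Variation of constants for the difference of state and noise; no stochastic integral occurs. \<open>\<Psi>\<close> is the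
  inverse of the fundamental matrix \<open>\<Phi>\<close> of \<open>H\<close>.\<close>

definition lin_state ::
    "(real \<Rightarrow> real ^ 'n ^ 'n) \<Rightarrow> (real \<Rightarrow> real ^ 'n ^ 'n) \<Rightarrow> (real \<Rightarrow> real ^ 'n ^ 'n) \<Rightarrow> (real \<Rightarrow> real ^ 'n) \<Rightarrow>
     real ^ 'n \<Rightarrow> ('n \<Rightarrow> agent) \<Rightarrow> ('a \<Rightarrow> real ^ 'n) \<Rightarrow> real \<Rightarrow> 'a \<Rightarrow> real ^ 'n" where
  "lin_state \<Phi> \<Psi> H b c \<gamma> x0 t \<omega> = noise c \<gamma> t \<omega> +
     \<Phi> t *v (\<Psi> 0 *v x0 \<omega> + integral {0..t} (\<lambda>s. \<Psi> s *v (H s *v noise c \<gamma> s \<omega> + b s)))"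

lemma noise_continuous: "\<omega> \<in> space P \<Longrightarrow> continuous_on {0..t} (\<lambda>s. noise c \<gamma> s \<omega>)"
  unfolding noise_def
  by (subst continuous_on_componentwise) (auto intro!: continuous_intros W_continuous simp: Basis_vec_def inner_axis)

lemma lin_state_path:
  assumes \<omega>: "\<omega> \<in> space P" and H: "continuous_on {0..T} H" and b: "continuous_on {0..T} b"
    and \<Psi>: "continuous_on {0..T} \<Psi>"
    and \<Phi>: "\<And>t. t \<in> {0..T} \<Longrightarrow> (\<Phi> has_vector_derivative H t ** \<Phi> t) (at t within {0..T})"
    and inv: "\<And>t. t \<in> {0..T} \<Longrightarrow> \<Phi> t ** \<Psi> t = mat 1"
  shows "t \<in> {0..T} \<Longrightarrow> ((\<lambda>t. lin_state \<Phi> \<Psi> H b c \<gamma> x0 t \<omega> - noise c \<gamma> t \<omega>) has_vector_derivative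
      H t *v lin_state \<Phi> \<Psi> H b c \<gamma> x0 t \<omega> + b t) (at t within {0..T})"
    and "lin_state \<Phi> \<Psi> H b c \<gamma> x0 0 \<omega> - noise c \<gamma> 0 \<omega> = x0 \<omega>"
    and "continuous_on {0..T} (\<lambda>t. lin_state \<Phi> \<Psi> H b c \<gamma> x0 t \<omega>)"
proof -
  let ?x = "\<lambda>t. lin_state \<Phi> \<Psi> H b c \<gamma> x0 t \<omega>" and ?N = "\<lambda>t. noise c \<gamma> t \<omega>"
  let ?h = "\<lambda>s. \<Psi> s *v (H s *v ?N s + b s)"
  let ?I = "\<lambda>t. \<Psi> 0 *v x0 \<omega> + integral {0..t} ?h"
  have h: "continuous_on {0..T} ?h"
    by (intro vmult.continuous_on continuous_intros \<Psi> H b noise_continuous \<omega>)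
  have d: "((\<lambda>t. ?x t - ?N t) has_vector_derivative H t *v ?x t + b t) (at t within {0..T})" if t: "t \<in> {0..T}" for t
  proof -
    have "(?I has_vector_derivative 0 + ?h t) (at t within {0..T})"
      by (intro has_vector_derivative_add has_vector_derivative_const integral_has_vector_derivative h t)
    from vmult.has_vector_derivative[OF \<Phi>[OF t] this]
    have "((\<lambda>t. \<Phi> t *v ?I t) has_vector_derivative \<Phi> t *v ?h t + (H t ** \<Phi> t) *v ?I t) (at t within {0..T})" by simp
    moreover have "\<Phi> t *v ?h t = H t *v ?N t + b t"
      using inv[OF t] by (simp add: matrix_vector_mul_assoc)
    moreover have "(\<lambda>t. \<Phi> t *v ?I t) = (\<lambda>t. ?x t - ?N t)" by (simp add: lin_state_def)
    moreover have "H t *v ?x t + b t = (H t *v ?N t + b t) + (H t ** \<Phi> t) *v ?I t"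
      by (simp add: lin_state_def vmult.add_right matrix_vector_mul_assoc matrix_mul_assoc add_ac)
    ultimately show ?thesis by (simp only:)
  qed
  then show "t \<in> {0..T} \<Longrightarrow> ((\<lambda>t. ?x t - ?N t) has_vector_derivative H t *v ?x t + b t) (at t within {0..T})" .
  show "?x 0 - ?N 0 = x0 \<omega>"
    using inv[of 0] T_pos by (simp add: lin_state_def matrix_vector_mul_assoc)
  have "continuous_on {0..T} (\<lambda>t. (?x t - ?N t) + ?N t)"
    by (intro continuous_on_add noise_continuous \<omega> continuous_on_vector_derivative[OF d])
  then show "continuous_on {0..T} ?x" by simp
qed

text \<open>Expands the state into deterministic coefficients times Wiener values, initial values
  and path integrals. In this form moment bounds, mean-square limits and adaptedness all follow from
  closure under sums and multiples.\<close>

lemma lin_state_component: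
  assumes \<omega>: "\<omega> \<in> space P" and t: "t \<in> {0..T}" and H: "continuous_on {0..T} H" and b: "continuous_on {0..T} b"
    and \<Psi>: "continuous_on {0..T} \<Psi>"
  shows "lin_state \<Phi> \<Psi> H b c \<gamma> x0 t \<omega> $ j = c $ j * W (\<gamma> j) t \<omega> + (\<Sum>k\<in>UNIV. \<Phi> t $ j $ k *
      ((\<Sum>l\<in>UNIV. \<Psi> 0 $ k $ l * x0 \<omega> $ l) +
       ((\<Sum>l\<in>UNIV. path_int (\<lambda>s. (\<Psi> s ** H s) $ k $ l * c $ l) (W (\<gamma> l)) t \<omega>) +
         path_int (\<lambda>s. (\<Psi> s *v b s) $ k) (\<lambda>_ _. 1) t \<omega>)))"
proof -
  let ?h = "\<lambda>s. \<Psi> s *v (H s *v noise c \<gamma> s \<omega> + b s)"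
  have sub: "{0..t} \<subseteq> {0..T}" using t by auto
  note cs = continuous_on_subset[OF _ sub]
  have \<Psi>H: "continuous_on {0..T} (\<lambda>s. (\<Psi> s ** H s) $ k $ l * c $ l)" and \<Psi>b: "continuous_on {0..T} (\<lambda>s. (\<Psi> s *v b s) $ k)" for k l
    by (intro continuous_intros mmult.continuous_on vmult.continuous_on \<Psi> H b)+
  have h: "continuous_on {0..t} ?h"
    by (intro vmult.continuous_on continuous_intros cs[OF \<Psi>] cs[OF H] cs[OF b] noise_continuous \<omega>)
  have "integral {0..t} ?h $ k = (\<Sum>l\<in>UNIV. path_int (\<lambda>s. (\<Psi> s ** H s) $ k $ l * c $ l) (W (\<gamma> l)) t \<omega>) +
         path_int (\<lambda>s. (\<Psi> s *v b s) $ k) (\<lambda>_ _. 1) t \<omega>" for k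
  proof -
    have "?h s $ k = (\<Sum>l\<in>UNIV. ((\<Psi> s ** H s) $ k $ l * c $ l) * W (\<gamma> l) s \<omega>) + (\<Psi> s *v b s) $ k * 1" for s
    proof -
      have "?h s = (\<Psi> s ** H s) *v noise c \<gamma> s \<omega> + \<Psi> s *v b s"
        by (simp add: vmult.add_right matrix_vector_mul_assoc)
      then show ?thesis by (simp add: matrix_vector_mult_def[of "\<Psi> s ** H s"] noise_def mult.assoc)
    qed
    then have "integral {0..t} ?h $ k = integral {0..t} (\<lambda>s. (\<Sum>l\<in>UNIV. ((\<Psi> s ** H s) $ k $ l * c $ l) * W (\<gamma> l) s \<omega>) + (\<Psi> s *v b s) $ k * 1)"
      using integral_component_eq_cart[OF integrable_continuous_real[OF h], of k] by simp
    also have "\<dots> = (\<Sum>l\<in>UNIV. integral {0..t} (\<lambda>s. ((\<Psi> s ** H s) $ k $ l * c $ l) * W (\<gamma> l) s \<omega>)) + integral {0..t} (\<lambda>s. (\<Psi> s *v b s) $ k * 1)"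
      by (subst integral_add, (intro integrable_continuous_real continuous_intros cs[OF \<Psi>H] cs[OF \<Psi>b] W_continuous[OF \<omega>])+,
          subst integral_sum) (auto intro!: integrable_continuous_real continuous_intros cs[OF \<Psi>H] W_continuous[OF \<omega>])
    also have "\<dots> = (\<Sum>l\<in>UNIV. path_int (\<lambda>s. (\<Psi> s ** H s) $ k $ l * c $ l) (W (\<gamma> l)) t \<omega>) +
         path_int (\<lambda>s. (\<Psi> s *v b s) $ k) (\<lambda>_ _. 1) t \<omega>"
    proof -
      have "path_int (\<lambda>s. (\<Psi> s ** H s) $ k $ l * c $ l) (W (\<gamma> l)) t \<omega> = integral {0..t} (\<lambda>s. (\<Psi> s ** H s) $ k $ l * c $ l * W (\<gamma> l) s \<omega>)" for l
        by (rule path_int_eq_integral[where w = "W (\<gamma> l)"]) (rule \<Psi>H W_continuous[OF \<omega>] t)+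
      moreover have "path_int (\<lambda>s. (\<Psi> s *v b s) $ k) (\<lambda>_ _. 1) t \<omega> = integral {0..t} (\<lambda>s. (\<Psi> s *v b s) $ k * 1)"
        by (rule path_int_eq_integral[where w = "\<lambda>_ _. 1"]) (rule \<Psi>b continuous_on_const t)+
      ultimately show ?thesis by simp
    qed
    finally show ?thesis .
  qed
  then show ?thesis
    by (simp add: lin_state_def noise_def matrix_vector_mult_def)
qed

lemma l2_limit_cong:
  assumes "l2_limit F X X0" and "\<forall>\<^sub>F p in F. \<forall>t\<in>{0..T}. \<forall>\<omega>\<in>space P. Y p t \<omega> = X p t \<omega>"
    and 0: "\<And>t \<omega>. t \<in> {0..T} \<Longrightarrow> \<omega> \<in> space P \<Longrightarrow> Y0 t \<omega> = X0 t \<omega>"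
  shows "l2_limit F Y Y0"
proof -
  have sq: "L2 f \<Longrightarrow> L2 g" if "\<And>\<omega>. \<omega> \<in> space P \<Longrightarrow> g \<omega> = f \<omega>" for f g
    using that by (simp add: square_integrable_def cong: measurable_cong Bochner_Integration.integrable_cong)
  show ?thesis
    unfolding l2_limit_def
  proof (intro conjI)
    have "\<forall>\<^sub>F p in F. \<forall>t\<in>{0..T}. L2 (X p t)" using assms(1) by (simp add: l2_limit_def)
    then show "\<forall>\<^sub>F p in F. \<forall>t\<in>{0..T}. L2 (Y p t)"
      using assms(2) by eventually_elim (blast intro: sq)
    show "\<forall>t\<in>{0..T}. L2 (Y0 t)"
      using assms(1) 0 sq unfolding l2_limit_def by blast
    have "(\<integral>\<omega>. (Y0 t \<omega>)\<^sup>2 \<partial>P) = (\<integral>\<omega>. (X0 t \<omega>)\<^sup>2 \<partial>P)" if "t \<in> {0..T}" for t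
      by (rule Bochner_Integration.integral_cong) (use 0 that in auto)
    then show "\<exists>K. \<forall>t\<in>{0..T}. (\<integral>\<omega>. (Y0 t \<omega>)\<^sup>2 \<partial>P) \<le> K"
      using assms(1) unfolding l2_limit_def by auto
    have "\<forall>\<^sub>F p in F. \<forall>t\<in>{0..T}. (\<integral>\<omega>. (X p t \<omega> - X0 t \<omega>)\<^sup>2 \<partial>P) = (\<integral>\<omega>. (Y p t \<omega> - Y0 t \<omega>)\<^sup>2 \<partial>P)"
      using assms(2)
    proof eventually_elim
      case (elim p)
      then show ?case
        using 0 by (intro ballI Bochner_Integration.integral_cong) auto
    qed
    moreover have "uniform_limit {0..T} (\<lambda>p t. \<integral>\<omega>. (X p t \<omega> - X0 t \<omega>)\<^sup>2 \<partial>P) (\<lambda>_. 0) F"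
      using assms(1) by (simp add: l2_limit_def)
    ultimately show "uniform_limit {0..T} (\<lambda>p t. \<integral>\<omega>. (Y p t \<omega> - Y0 t \<omega>)\<^sup>2 \<partial>P) (\<lambda>_. 0) F"
      by (subst uniform_limit_cong[symmetric]) auto
  qed
qed

lemma bounded_continuous_image: "continuous_on {0..T} f \<Longrightarrow> bounded (f ` {0..T})"
  for f :: "real \<Rightarrow> 'b::metric_space"
  by (intro compact_imp_bounded compact_continuous_image) auto

text \<open>The uniform limits of the deterministic families come from the Riccati theory; on the
  random side only the initial data vary with \<open>p\<close>, the Wiener paths being common to all
  models.\<close>

lemma lin_state_l2_limit:
  fixes c :: "'p \<Rightarrow> real ^ 'n"
  assumes \<Phi>: "uniform_limit {0..T} \<Phi> \<Phi>0 F" and \<Psi>: "uniform_limit {0..T} \<Psi> \<Psi>0 F"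
    and H: "uniform_limit {0..T} H H0 F" and b: "uniform_limit {0..T} b b0 F" and c: "(c \<longlongrightarrow> c0) F"
    and cont0: "continuous_on {0..T} \<Phi>0" "continuous_on {0..T} \<Psi>0" "continuous_on {0..T} H0" "continuous_on {0..T} b0"
    and cont: "\<forall>\<^sub>F p in F. continuous_on {0..T} (\<Psi> p) \<and> continuous_on {0..T} (H p) \<and> continuous_on {0..T} (b p)"
    and x: "\<And>l. \<forall>\<^sub>F p in F. L2 (\<lambda>\<omega>. x p \<omega> $ l)" "\<And>l. L2 (\<lambda>\<omega>. x0 \<omega> $ l)"
      "\<And>l. ((\<lambda>p. \<integral>\<omega>. (x p \<omega> $ l - x0 \<omega> $ l)\<^sup>2 \<partial>P) \<longlongrightarrow> 0) F"
  shows "l2_limit F (\<lambda>p t \<omega>. lin_state (\<Phi> p) (\<Psi> p) (H p) (b p) (c p) \<gamma> (x p) t \<omega> $ j)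
     (\<lambda>t \<omega>. lin_state \<Phi>0 \<Psi>0 H0 b0 c0 \<gamma> x0 t \<omega> $ j)"
proof -
  note nth = bounded_linear.uniform_limit[OF bounded_linear_vec_nth]
  have cu: "uniform_limit {0..T} (\<lambda>p t. c p $ l) (\<lambda>t. c0 $ l) F" for l
    using tendstoD[OF tendsto_vec_nth[OF c, of l]] by (auto simp: uniform_limit_iff)
  \<comment> \<open>The initial value is multiplied by \<open>\<Psi> p 0\<close> at all times, so
    convergence at the single time 0 is recast as uniform convergence of functions constant in
    time.\<close>
  have \<Psi>_0: "uniform_limit {0..T} (\<lambda>p t. \<Psi> p 0 $ k $ l) (\<lambda>t. \<Psi>0 0 $ k $ l) F" for k l
  proof -
    have "\<forall>\<^sub>F p in F. \<forall>t\<in>{0..T}. dist (\<Psi> p t $ k $ l) (\<Psi>0 t $ k $ l) < e" if "0 < e" for e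
      by (rule uniform_limitD[OF nth[OF nth[OF \<Psi>]] that])
    then have "\<forall>\<^sub>F p in F. \<forall>t\<in>{0..T}. dist (\<Psi> p 0 $ k $ l) (\<Psi>0 0 $ k $ l) < e" if "0 < e" for e
      by (rule eventually_mono[OF _ ballI[OF bspec[of _ _ 0]]]) (use T_pos that in auto)
    then show ?thesis unfolding uniform_limit_iff by blast
  qed
  have \<Phi>kl: "uniform_limit {0..T} (\<lambda>p t. \<Phi> p t $ k $ l) (\<lambda>t. \<Phi>0 t $ k $ l) F" for k l
    by (intro nth \<Phi>)
  have \<Phi>b: "bounded ((\<lambda>t. \<Phi>0 t $ k $ l) ` {0..T})" for k l
    by (intro bounded_continuous_image continuous_intros cont0)
  have \<Psi>H0: "continuous_on {0..T} (\<lambda>t. \<Psi>0 t ** H0 t)" by (intro mmult.continuous_on cont0)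
  have \<Psi>H: "uniform_limit {0..T} (\<lambda>p t. (\<Psi> p t ** H p t) $ k $ l * c p $ l) (\<lambda>t. (\<Psi>0 t ** H0 t) $ k $ l * c0 $ l) F" for k l
    by (intro bounded_bilinear.bounded_uniform_limit[OF bounded_bilinear_mult] nth mmult.bounded_uniform_limit
        \<Psi> H cu bounded_continuous_image continuous_intros cont0 \<Psi>H0)
  have \<Psi>b: "uniform_limit {0..T} (\<lambda>p t. (\<Psi> p t *v b p t) $ k) (\<lambda>t. (\<Psi>0 t *v b0 t) $ k) F" for k
    by (intro nth vmult.bounded_uniform_limit \<Psi> b bounded_continuous_image cont0)
  have "l2_limit F (\<lambda>p t \<omega>. c p $ j * W (\<gamma> j) t \<omega> + (\<Sum>k\<in>UNIV. \<Phi> p t $ j $ k *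
      ((\<Sum>l\<in>UNIV. \<Psi> p 0 $ k $ l * x p \<omega> $ l) +
       ((\<Sum>l\<in>UNIV. path_int (\<lambda>s. (\<Psi> p s ** H p s) $ k $ l * c p $ l) (W (\<gamma> l)) t \<omega>) +
         path_int (\<lambda>s. (\<Psi> p s *v b p s) $ k) (\<lambda>_ _. 1) t \<omega>))))
     (\<lambda>t \<omega>. c0 $ j * W (\<gamma> j) t \<omega> + (\<Sum>k\<in>UNIV. \<Phi>0 t $ j $ k *
      ((\<Sum>l\<in>UNIV. \<Psi>0 0 $ k $ l * x0 \<omega> $ l) +
       ((\<Sum>l\<in>UNIV. path_int (\<lambda>s. (\<Psi>0 s ** H0 s) $ k $ l * c0 $ l) (W (\<gamma> l)) t \<omega>) +
         path_int (\<lambda>s. (\<Psi>0 s *v b0 s) $ k) (\<lambda>_ _. 1) t \<omega>))))"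
  proof (intro l2_limit_add l2_limit_sum l2_limit_cmult l2_limit_path_int \<Phi>kl \<Phi>b cu \<Psi>_0 \<Psi>H \<Psi>b
      l2_limit_static x W_bounded_process bounded_process_const)
    show "l2_limit F (\<lambda>_. W (\<gamma> j)) (W (\<gamma> j))"
      by (rule l2_limit_const[where K = T]) (use W_moments in auto)
    show "\<forall>\<^sub>F p in F. continuous_on {0..T} (\<lambda>s. (\<Psi> p s ** H p s) $ k $ l * c p $ l)" for k l
      using cont by eventually_elim (auto intro!: continuous_intros mmult.continuous_on)
    show "\<forall>\<^sub>F p in F. continuous_on {0..T} (\<lambda>s. (\<Psi> p s *v b p s) $ k)" for k
      using cont by eventually_elim (auto intro!: continuous_intros vmult.continuous_on)
    show "continuous_on {0..T} (\<lambda>s. (\<Psi>0 s ** H0 s) $ k $ l * c0 $ l)"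
      "continuous_on {0..T} (\<lambda>s. (\<Psi>0 s *v b0 s) $ k)" for k l
      by (intro continuous_intros vmult.continuous_on cont0 \<Psi>H0)+
  qed (rule W_bounded_process bounded_process_const bounded_continuous_image continuous_on_const finite_class.finite_UNIV)+
  then show ?thesis
  proof (rule l2_limit_cong)
    show "\<forall>\<^sub>F p in F. \<forall>t\<in>{0..T}. \<forall>\<omega>\<in>space P. lin_state (\<Phi> p) (\<Psi> p) (H p) (b p) (c p) \<gamma> (x p) t \<omega> $ j =
       c p $ j * W (\<gamma> j) t \<omega> + (\<Sum>k\<in>UNIV. \<Phi> p t $ j $ k *
      ((\<Sum>l\<in>UNIV. \<Psi> p 0 $ k $ l * x p \<omega> $ l) +
       ((\<Sum>l\<in>UNIV. path_int (\<lambda>s. (\<Psi> p s ** H p s) $ k $ l * c p $ l) (W (\<gamma> l)) t \<omega>) +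
         path_int (\<lambda>s. (\<Psi> p s *v b p s) $ k) (\<lambda>_ _. 1) t \<omega>)))"
      using cont by eventually_elim (intro ballI lin_state_component, auto)
  qed (intro lin_state_component cont0)
qed

lemma lin_state_adapted:
  assumes t: "t \<in> {0..T}" and H: "continuous_on {0..T} H" and b: "continuous_on {0..T} b"
    and \<Psi>: "continuous_on {0..T} \<Psi>" and N: "space N = space P"
    and W: "\<And>s l. s \<in> {0..t} \<Longrightarrow> W (\<gamma> l) s \<in> borel_measurable N"
    and x0: "\<And>l. (\<lambda>\<omega>. x0 \<omega> $ l) \<in> borel_measurable N"
  shows "lin_state \<Phi> \<Psi> H b c \<gamma> x0 t \<in> borel_measurable N"
proof (rule borel_measurable_vecI)
  fix j
  have prog: "(\<lambda>(s, \<omega>). W (\<gamma> l) s \<omega>) \<in> borel_measurable (restrict_space borel {0..t} \<Otimes>\<^sub>M N)" for l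
    by (rule W_progressive) (use W N t in auto)
  have [measurable]: "path_int (\<lambda>s. (\<Psi> s ** H s) $ k $ l * c $ l) (W (\<gamma> l)) t \<in> borel_measurable N"
      "path_int (\<lambda>s. (\<Psi> s *v b s) $ k) (\<lambda>_ _. 1) t \<in> borel_measurable N" for k l
  proof -
    show "path_int (\<lambda>s. (\<Psi> s ** H s) $ k $ l * c $ l) (W (\<gamma> l)) t \<in> borel_measurable N"
      by (intro path_int_adapted prog t continuous_intros mmult.continuous_on \<Psi> H)
    show "path_int (\<lambda>s. (\<Psi> s *v b s) $ k) (\<lambda>_ _. 1) t \<in> borel_measurable N"
      by (intro path_int_adapted t continuous_intros vmult.continuous_on \<Psi> b) simp
  qed
  have [measurable]: "W (\<gamma> j) t \<in> borel_measurable N" using W[of t j] t by auto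
  note [measurable] = x0
  have "(\<lambda>\<omega>. c $ j * W (\<gamma> j) t \<omega> + (\<Sum>k\<in>UNIV. \<Phi> t $ j $ k *
      ((\<Sum>l\<in>UNIV. \<Psi> 0 $ k $ l * x0 \<omega> $ l) +
       ((\<Sum>l\<in>UNIV. path_int (\<lambda>s. (\<Psi> s ** H s) $ k $ l * c $ l) (W (\<gamma> l)) t \<omega>) +
         path_int (\<lambda>s. (\<Psi> s *v b s) $ k) (\<lambda>_ _. 1) t \<omega>)))) \<in> borel_measurable N"
    by measurable
  then show "(\<lambda>\<omega>. lin_state \<Phi> \<Psi> H b c \<gamma> x0 t \<omega> $ j) \<in> borel_measurable N"
    by (rule measurable_cong[THEN iffD1, rotated]) (use lin_state_component[OF _ t H b \<Psi>] N in auto)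
qed

section \<open>Filtrations and construction of admissible processes\<close>

definition filtration :: "(real \<Rightarrow> 'a measure) \<Rightarrow> bool" where
  "filtration \<F> \<longleftrightarrow> (\<forall>t. subalgebra P (\<F> t)) \<and> (\<forall>s t. s \<le> t \<longrightarrow> sets (\<F> s) \<subseteq> sets (\<F> t))"

lemma filtration_measurable_mono:
  "filtration \<F> \<Longrightarrow> f \<in> borel_measurable (\<F> s) \<Longrightarrow> s \<le> t \<Longrightarrow> f \<in> borel_measurable (\<F> t)"
  by (rule measurable_subset[of f "\<F> s" borel "\<F> t"]) (simp_all add: filtration_def subalgebra_def)

lemma filtration_full: "is_model P W m \<Longrightarrow> filtration (full_filtration P W m)"
  unfolding filtration_def using subalgebra_full
  by (simp add: full_filtration_def joint_filtration_mono)

lemma filtration_leader: "is_model P W m \<Longrightarrow> filtration (leader_filtration P W m)"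
  unfolding filtration_def using subalgebra_leader
  by (simp add: leader_filtration_def joint_filtration_mono)

lemma leader_subset_full: "sets (leader_filtration P W m t) \<subseteq> sets (full_filtration P W m t)"
  unfolding leader_filtration_def full_filtration_def by (intro joint_filtration_mono) auto

lemma leader_measurable_full:
  "f \<in> borel_measurable (leader_filtration P W m t) \<Longrightarrow> f \<in> borel_measurable (full_filtration P W m t)"
  by (rule measurable_subset[OF _ leader_subset_full]) (simp_all add: leader_filtration_def full_filtration_def)

lemma progressive_mu_measurable:
  fixes X :: "real \<Rightarrow> 'a \<Rightarrow> 'b::euclidean_space"
  assumes \<F>: "filtration \<F>" and X: "(\<lambda>(s, \<omega>). X s \<omega>) \<in> borel_measurable (restrict_space borel {0..T} \<Otimes>\<^sub>M \<F> T)"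
  shows "(\<lambda>(s, \<omega>). X s \<omega>) \<in> borel_measurable \<mu>"
proof (rule mu_measurableI)
  have "sets (\<F> T) \<subseteq> sets P" "space (\<F> T) = space P"
    using \<F> by (auto simp: filtration_def subalgebra_def)
  then have "(\<lambda>\<omega>. \<omega>) \<in> P \<rightarrow>\<^sub>M \<F> T" by (auto simp: measurable_def)
  then have "(\<lambda>z. (fst z, snd z)) \<in> restrict_space borel {0..T} \<Otimes>\<^sub>M P \<rightarrow>\<^sub>M restrict_space borel {0..T} \<Otimes>\<^sub>M \<F> T"
    by (intro measurable_Pair measurable_fst measurable_compose[OF measurable_snd])
  from measurable_compose[OF this X]
  show "(\<lambda>(s, \<omega>). X s \<omega>) \<in> borel_measurable (restrict_space borel {0..T} \<Otimes>\<^sub>M P)"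
    by (simp add: case_prod_beta')
qed

text \<open>Continuity of every path upgrades adaptedness to progressive measurability, and the
  moment bound, uniform in time, gives square integrability over the product with [0, T].\<close>

lemma state_processI:
  fixes X :: "real \<Rightarrow> 'a \<Rightarrow> 'b::euclidean_space"
  assumes \<F>: "filtration \<F>" and cont: "\<And>\<omega>. \<omega> \<in> space P \<Longrightarrow> continuous_on {0..T} (\<lambda>t. X t \<omega>)"
    and ad: "\<And>t. t \<in> {0..T} \<Longrightarrow> X t \<in> borel_measurable (\<F> t)"
    and mom: "\<And>t. t \<in> {0..T} \<Longrightarrow> integrable P (\<lambda>\<omega>. (norm (X t \<omega>))\<^sup>2) \<and> (\<integral>\<omega>. (norm (X t \<omega>))\<^sup>2 \<partial>P) \<le> K"
  shows "state_process P T \<F> X"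
proof -
  have sp: "space (\<F> t) = space P" for t using \<F> by (simp add: filtration_def subalgebra_def)
  have prog: "(\<lambda>(s, \<omega>). X s \<omega>) \<in> borel_measurable (restrict_space borel {0..t} \<Otimes>\<^sub>M \<F> t)" if t: "t \<in> {0..T}" for t
  proof (rule continuous_adapted_progressive)
    fix \<omega> assume "\<omega> \<in> space (\<F> t)"
    then have "continuous_on {0..T} (\<lambda>s. X s \<omega>)" using cont sp by auto
    then show "continuous_on {0..t} (\<lambda>s. X s \<omega>)" by (rule continuous_on_subset) (use t in auto)
  next
    fix s assume "s \<in> {0..t}"
    then show "X s \<in> borel_measurable (\<F> t)"
      using filtration_measurable_mono[OF \<F> ad, of s t] t by auto
  qed (use t in auto)
  have mm: "(\<lambda>(s, \<omega>). X s \<omega>) \<in> borel_measurable \<mu>"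
    by (rule progressive_mu_measurable[OF \<F> prog]) (use T_pos in auto)
  have "square_integrable \<mu> (\<lambda>(s, \<omega>). norm (X s \<omega>))"
  proof (rule square_integrable_mu_bounded(1))
    show "(\<lambda>(s, \<omega>). norm (X s \<omega>)) \<in> borel_measurable \<mu>"
      using measurable_compose[OF mm borel_measurable_norm] by (simp add: case_prod_beta')
    fix s assume s: "s \<in> {0..T}"
    have "X s \<in> borel_measurable P"
      using ad[OF s] \<F> by (auto simp: filtration_def intro: measurable_from_subalg)
    then show "L2 (\<lambda>\<omega>. norm (X s \<omega>))" using mom[OF s] by (simp add: square_integrable_def)
    show "(\<integral>\<omega>. (norm (X s \<omega>))\<^sup>2 \<partial>P) \<le> K" using mom[OF s] by simp
  qed
  then have "integrable \<mu> (\<lambda>(s, \<omega>). (norm (X s \<omega>))\<^sup>2)"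
    by (simp add: square_integrable_def case_prod_beta')
  then show ?thesis
    unfolding state_process_def L2_process_def using prog cont mom by auto
qed

lemma state_process_vecI:
  fixes X :: "real \<Rightarrow> 'a \<Rightarrow> real ^ 'n"
  assumes \<F>: "filtration \<F>" and cont: "\<And>\<omega>. \<omega> \<in> space P \<Longrightarrow> continuous_on {0..T} (\<lambda>t. X t \<omega>)"
    and ad: "\<And>t. t \<in> {0..T} \<Longrightarrow> X t \<in> borel_measurable (\<F> t)"
    and mom: "\<And>t j. t \<in> {0..T} \<Longrightarrow> L2 (\<lambda>\<omega>. X t \<omega> $ j) \<and> (\<integral>\<omega>. (X t \<omega> $ j)\<^sup>2 \<partial>P) \<le> K j"
  shows "state_process P T \<F> X" "state_process P T \<F> (\<lambda>t \<omega>. X t \<omega> $ i)"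
proof -
  show "state_process P T \<F> X"
  proof (rule state_processI[OF \<F> cont ad])
    fix t assume t: "t \<in> {0..T}"
    show "integrable P (\<lambda>\<omega>. (norm (X t \<omega>))\<^sup>2) \<and> (\<integral>\<omega>. (norm (X t \<omega>))\<^sup>2 \<partial>P) \<le> (\<Sum>j\<in>UNIV. K j)"
      using mom[OF t] by (auto simp: norm_vec_square square_integrable_def intro!: sum_mono)
  qed auto
  show "state_process P T \<F> (\<lambda>t \<omega>. X t \<omega> $ i)"
    by (rule state_processI[OF \<F>, where K = "K i"])
      (use cont ad mom in \<open>auto intro!: continuous_intros simp: square_integrable_def\<close>)
qed

section \<open>Backward equations\<close>

lemma Lambda_eq_integral:
  fixes f :: "real \<Rightarrow> real"
  assumes "continuous_on {a..b} f" "{a..b} \<subseteq> {0..T}"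
  shows "(\<integral>s. indicator {a..b} s * f s \<partial>\<Lambda>) = integral {a..b} f"
  using set_integral_eq_Lambda[OF assms(2), of f] set_integral_continuous_eq_integral[OF assms(1)] by simp

text \<open>\<open>backward m p k\<close> expresses \<open>-dp = k dt - Z dW\<close>: the martingale increment
  \<open>p(T) - p(t) + \<integral>\<^sub>t\<^sup>T k\<close> is orthogonal to the past at time \<open>t\<close>.\<close>

definition backward :: "'a model \<Rightarrow> 'a process \<Rightarrow> 'a process \<Rightarrow> bool" where
  "backward m p k \<longleftrightarrow> (\<forall>t\<in>{0..T}. \<forall>\<zeta>. \<zeta> \<in> borel_measurable (full_filtration P W m t) \<longrightarrow> L2 \<zeta> \<longrightarrow>
     integrable P (\<lambda>\<omega>. (p T \<omega> - p t \<omega> + (LBINT s:{t..T}. k s \<omega>)) * \<zeta> \<omega>) \<and>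
     (\<integral>\<omega>. (p T \<omega> - p t \<omega> + (LBINT s:{t..T}. k s \<omega>)) * \<zeta> \<omega> \<partial>P) = 0)"

text \<open>Orthogonality of every time slice to \<open>\<zeta>\<close> passes to the time integral
  by Fubini. Used with increments after \<open>t\<close> for the backward equation, and with the
  follower's Wiener path before \<open>t\<close> for the conditional mean.\<close>

lemma process_integral_orthogonal:
  assumes w: "bounded_process K w" and \<kappa>: "continuous_on {0..T} \<kappa>" and \<zeta>: "L2 \<zeta>"
    and A: "A \<in> sets borel" and orth: "\<And>s. s \<in> A \<Longrightarrow> s \<in> {0..T} \<Longrightarrow> (\<integral>\<omega>. w s \<omega> * \<zeta> \<omega> \<partial>P) = 0"
  shows "L2 (\<lambda>\<omega>. \<integral>s. indicator A s * (\<kappa> s * w s \<omega>) \<partial>\<Lambda>)"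
    and "(\<integral>\<omega>. (\<integral>s. indicator A s * (\<kappa> s * w s \<omega>) \<partial>\<Lambda>) * \<zeta> \<omega> \<partial>P) = 0"
proof -
  have "\<exists>C. \<forall>s\<in>{0..T}. \<bar>\<kappa> s\<bar> \<le> C" using bounded_continuous_image[OF \<kappa>] by (auto simp: bounded_iff)
  then obtain C where C: "\<And>s. s \<in> {0..T} \<Longrightarrow> \<bar>\<kappa> s\<bar> \<le> C" by blast
  note mom = path_int_moment[OF w continuous_on_imp_measurable_lborel[OF \<kappa>] C A]
  show "L2 (\<lambda>\<omega>. \<integral>s. indicator A s * (\<kappa> s * w s \<omega>) \<partial>\<Lambda>)" by (rule mom(2))
  have "integrable \<mu> (\<lambda>(s, \<omega>). indicator A s * (\<kappa> s * w s \<omega>) * \<zeta> \<omega>)"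
    using square_integrable_mult[OF mom(1) square_integrable_mu_const[OF \<zeta>]] by (simp add: case_prod_beta')
  then have "(\<integral>\<omega>. (\<integral>s. indicator A s * (\<kappa> s * w s \<omega>) * \<zeta> \<omega> \<partial>\<Lambda>) \<partial>P)
      = (\<integral>s. (\<integral>\<omega>. indicator A s * (\<kappa> s * w s \<omega>) * \<zeta> \<omega> \<partial>P) \<partial>\<Lambda>)"
    by (rule LP.Fubini_integral)
  also have "\<dots> = (\<integral>s. 0 \<partial>\<Lambda>)"
  proof (rule Bochner_Integration.integral_cong)
    fix s assume "s \<in> space \<Lambda>"
    then have s: "s \<in> {0..T}" by (simp only: space_Lambda)
    have "(\<integral>\<omega>. indicator A s * (\<kappa> s * w s \<omega>) * \<zeta> \<omega> \<partial>P) = (\<integral>\<omega>. (indicator A s * \<kappa> s) * (w s \<omega> * \<zeta> \<omega>) \<partial>P)"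
      by (simp add: mult.assoc)
    then show "(\<integral>\<omega>. indicator A s * (\<kappa> s * w s \<omega>) * \<zeta> \<omega> \<partial>P) = 0"
      using orth[OF _ s] by (cases "s \<in> A") simp_all
  qed simp
  finally show "(\<integral>\<omega>. (\<integral>s. indicator A s * (\<kappa> s * w s \<omega>) \<partial>\<Lambda>) * \<zeta> \<omega> \<partial>P) = 0" by simp
qed

lemma increment_integral_orthogonal:
  assumes m: "is_model P W m" and t: "t \<in> {0..T}" and \<kappa>: "continuous_on {0..T} \<kappa>"
    and \<zeta>: "\<zeta> \<in> borel_measurable (full_filtration P W m t)" "L2 \<zeta>"
  shows "L2 (\<lambda>\<omega>. \<integral>s. indicator {t..T} s * (\<kappa> s * (W \<gamma> s \<omega> - W \<gamma> t \<omega>)) \<partial>\<Lambda>)"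
    and "(\<integral>\<omega>. (\<integral>s. indicator {t..T} s * (\<kappa> s * (W \<gamma> s \<omega> - W \<gamma> t \<omega>)) \<partial>\<Lambda>) * \<zeta> \<omega> \<partial>P) = 0"
proof -
  let ?w = "\<lambda>s \<omega>. W \<gamma> s \<omega> - W \<gamma> t \<omega>"
  have Wt: "L2 (W \<gamma> t)" and Wt2: "(\<integral>\<omega>. (W \<gamma> t \<omega>)\<^sup>2 \<partial>P) \<le> T"
    using W_moments[of t \<gamma>] t by auto
  \<comment> \<open>Two Wiener values with second moments at most \<open>T\<close>, and the factor 2
    of each in the square of a difference.\<close>
  have w: "bounded_process (4 * T) ?w"
    unfolding bounded_process_def
  proof (intro conjI ballI)
    have "(\<lambda>z. (case z of (s, \<omega>) \<Rightarrow> W \<gamma> s \<omega>) - (case z of (s, \<omega>) \<Rightarrow> W \<gamma> t \<omega>)) \<in> borel_measurable \<mu>"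
      by (intro borel_measurable_diff W_mu_measurable square_integrable_measurable square_integrable_mu_const Wt)
    then show "(\<lambda>(s, \<omega>). ?w s \<omega>) \<in> borel_measurable \<mu>" by (simp add: case_prod_beta')
    fix s assume s: "s \<in> {0..T}"
    then have Ws: "L2 (W \<gamma> s)" and Ws2: "(\<integral>\<omega>. (W \<gamma> s \<omega>)\<^sup>2 \<partial>P) \<le> T"
      using W_moments[of s \<gamma>] by auto
    show "L2 (?w s)" by (rule square_integrable_diff[OF Ws Wt])
    show "(\<integral>\<omega>. (?w s \<omega>)\<^sup>2 \<partial>P) \<le> 4 * T"
      using integral_square_add_le[OF Ws square_integrable_minus[OF Wt]] Ws2 Wt2 by simp
  qed
  have orth: "(\<integral>\<omega>. ?w s \<omega> * \<zeta> \<omega> \<partial>P) = 0" if "s \<in> {t..T}" for s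
    by (rule increment_orthogonal[OF m _ _ \<zeta>]) (use that t in simp_all)
  show "L2 (\<lambda>\<omega>. \<integral>s. indicator {t..T} s * (\<kappa> s * ?w s \<omega>) \<partial>\<Lambda>)"
    and "(\<integral>\<omega>. (\<integral>s. indicator {t..T} s * (\<kappa> s * ?w s \<omega>) \<partial>\<Lambda>) * \<zeta> \<omega> \<partial>P) = 0"
    by (rule process_integral_orthogonal[OF w \<kappa> \<zeta>(2) _ orth]; simp)+
qed

lemma mult_noise_diff:
  "(K *v (noise c \<gamma> s \<omega> - noise c \<gamma> t \<omega>)) $ i =
     (\<Sum>j\<in>UNIV. c $ j * (K $ i $ j * (W (\<gamma> j) s \<omega> - W (\<gamma> j) t \<omega>)))"
  unfolding matrix_vector_mult_def noise_def by (simp add: right_diff_distrib mult_ac)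

text \<open>The martingale part of \<open>p\<close> is identified without a stochastic integral:
  \<open>p T - p t\<close> plus the time integral of the driver equals \<open>\<Gamma> T\<close>
  applied to the noise increment after \<open>t\<close>, minus the time integral of the derivative
  of \<open>\<Gamma>\<close> applied to such increments. This is the integral of
  \<open>\<Gamma>\<close> against the noise after integration by parts. Only increments after
  \<open>t\<close> occur, so all of it is orthogonal to the past.\<close>

lemma riccati_backward:
  fixes \<Gamma> :: "real \<Rightarrow> real ^ 'n ^ 'l" and c :: "real ^ 'n" and \<gamma> :: "'n \<Rightarrow> agent" and x0 :: "'a \<Rightarrow> real ^ 'n"
  assumes m: "is_model P W m" and R: "riccati_data T A B C D E M h \<Gamma> g \<Phi> \<Psi>"
  defines "x \<equiv> lin_state \<Phi> \<Psi> (\<lambda>t. A - B ** \<Gamma> t) (\<lambda>t. - (B *v g t)) c \<gamma> x0"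
  defines "p \<equiv> \<lambda>t \<omega>. \<Gamma> t *v x t \<omega> + g t"
  shows "\<And>\<omega>. \<omega> \<in> space P \<Longrightarrow> continuous_on {0..T} (\<lambda>t. x t \<omega>)"
    and "\<And>\<omega>. \<omega> \<in> space P \<Longrightarrow> continuous_on {0..T} (\<lambda>t. p t \<omega>)"
    and "\<And>\<omega> t. \<omega> \<in> space P \<Longrightarrow> t \<in> {0..T} \<Longrightarrow>
       x t \<omega> = x0 \<omega> + (LBINT s:{0..t}. A *v x s \<omega> - B *v p s \<omega>) + noise c \<gamma> t \<omega>"
    and "backward m (\<lambda>t \<omega>. p t \<omega> $ i) (\<lambda>t \<omega>. (C *v p t \<omega> + D *v x t \<omega> + M) $ i)"
proof -
  let ?G = "\<lambda>t. - (\<Gamma> t ** A + C ** \<Gamma> t - \<Gamma> t ** B ** \<Gamma> t + D)" and ?H = "\<lambda>t. A - B ** \<Gamma> t"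
  have \<Gamma>: "(\<Gamma> has_vector_derivative ?G t) (at t within {0..T})"
    and g: "(g has_vector_derivative - ((C - \<Gamma> t ** B) *v g t + M)) (at t within {0..T})"
    and \<Phi>: "(\<Phi> has_vector_derivative ?H t ** \<Phi> t) (at t within {0..T})"
    and inv: "\<Phi> t ** \<Psi> t = mat 1" if "t \<in> {0..T}" for t
    using R that by (auto simp: riccati_data_def)
  have \<Psi>: "continuous_on {0..T} \<Psi>" using R by (simp add: riccati_data_def)
  have c\<Gamma>: "continuous_on {0..T} \<Gamma>" by (rule continuous_on_vector_derivative[OF \<Gamma>])
  have cg: "continuous_on {0..T} g" by (rule continuous_on_vector_derivative[OF g])
  have cH: "continuous_on {0..T} ?H" by (intro continuous_intros mmult.continuous_on c\<Gamma>)
  have cb: "continuous_on {0..T} (\<lambda>t. - (B *v g t))" by (intro continuous_intros vmult.continuous_on cg)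
  have cG: "continuous_on {0..T} ?G" by (intro continuous_intros mmult.continuous_on c\<Gamma>)
  have path: "((\<lambda>t. x t \<omega> - noise c \<gamma> t \<omega>) has_vector_derivative ?H t *v x t \<omega> + - (B *v g t)) (at t within {0..T})"
      "x 0 \<omega> - noise c \<gamma> 0 \<omega> = x0 \<omega>" "continuous_on {0..T} (\<lambda>t. x t \<omega>)"
    if "\<omega> \<in> space P" "t \<in> {0..T}" for \<omega> t
    unfolding x_def
    by (rule lin_state_path[OF that(1) cH cb \<Psi>]; (rule \<Phi> inv that(2) | assumption)+)+
  show cx: "continuous_on {0..T} (\<lambda>t. x t \<omega>)" if "\<omega> \<in> space P" for \<omega>
    by (rule path(3)[OF that, of T]) (use T_pos in simp)
  show cp: "continuous_on {0..T} (\<lambda>t. p t \<omega>)" if "\<omega> \<in> space P" for \<omega>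
    unfolding p_def by (intro continuous_intros vmult.continuous_on c\<Gamma> cx cg that)
  have xd: "((\<lambda>t. x t \<omega> - noise c \<gamma> t \<omega>) has_vector_derivative A *v x t \<omega> - B *v p t \<omega>) (at t within {0..T})"
    if "\<omega> \<in> space P" "t \<in> {0..T}" for \<omega> t
    using path(1)[OF that]
    by (simp add: p_def vmult.diff_left vmult.add_right matrix_vector_mul_assoc algebra_simps)
  show "x t \<omega> = x0 \<omega> + (LBINT s:{0..t}. A *v x s \<omega> - B *v p s \<omega>) + noise c \<gamma> t \<omega>"
    if \<omega>: "\<omega> \<in> space P" and t: "t \<in> {0..T}" for \<omega> t
  proof -
    have sub: "{0..t} \<subseteq> {0..T}" using t by auto
    have "(LBINT s:{0..t}. A *v x s \<omega> - B *v p s \<omega>) = (x t \<omega> - noise c \<gamma> t \<omega>) - (x 0 \<omega> - noise c \<gamma> 0 \<omega>)"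
    proof (rule set_integral_derivative)
      show "((\<lambda>t. x t \<omega> - noise c \<gamma> t \<omega>) has_vector_derivative A *v x s \<omega> - B *v p s \<omega>) (at s within {0..t})"
        if "s \<in> {0..t}" for s
        by (rule has_vector_derivative_within_subset[OF xd[OF \<omega>] sub]) (use that sub in auto)
      show "continuous_on {0..t} (\<lambda>s. A *v x s \<omega> - B *v p s \<omega>)"
        by (intro continuous_intros vmult.continuous_on continuous_on_subset[OF cx[OF \<omega>] sub] continuous_on_subset[OF cp[OF \<omega>] sub])
    qed (use t in auto)
    then show ?thesis using path(2)[OF \<omega> t] by simp
  qed
  let ?k = "\<lambda>t \<omega>. C *v p t \<omega> + D *v x t \<omega> + M"
  have ck: "continuous_on {0..T} (\<lambda>t. ?k t \<omega>)" if "\<omega> \<in> space P" for \<omega>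
    by (intro continuous_intros vmult.continuous_on cx cp that)
  have ident: "p T \<omega> $ i - p t \<omega> $ i + (LBINT s:{t..T}. ?k s \<omega> $ i) =
      (\<Sum>j\<in>UNIV. c $ j * (\<Gamma> T $ i $ j * (W (\<gamma> j) T \<omega> - W (\<gamma> j) t \<omega>) -
         (\<integral>s. indicator {t..T} s * (?G s $ i $ j * (W (\<gamma> j) s \<omega> - W (\<gamma> j) t \<omega>)) \<partial>\<Lambda>)))"
    if \<omega>: "\<omega> \<in> space P" and t: "t \<in> {0..T}" for \<omega> t
  proof -
    have sub: "{t..T} \<subseteq> {0..T}" using t by auto
    let ?N = "\<lambda>s. noise c \<gamma> s \<omega>"
    \<comment> \<open>The noise is frozen at its value at time \<open>t\<close>, which makes the
      path differentiable; by the Riccati and offset equations everything cancels except the driver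
      and the derivative of \<open>\<Gamma>\<close> applied to the noise gained since
      \<open>t\<close>.\<close>
    let ?f = "\<lambda>s. \<Gamma> s *v ((x s \<omega> - ?N s) + ?N t) + g s"
    have fd: "(?f has_vector_derivative - (?k s \<omega>) - ?G s *v (?N s - ?N t)) (at s within {t..T})" if s: "s \<in> {t..T}" for s
    proof -
      have s0: "s \<in> {0..T}" using s sub by auto
      have "(?f has_vector_derivative (\<Gamma> s *v (A *v x s \<omega> - B *v p s \<omega> + 0) + ?G s *v ((x s \<omega> - ?N s) + ?N t))
           + - ((C - \<Gamma> s ** B) *v g s + M)) (at s within {0..T})"
        by (intro has_vector_derivative_add vmult.has_vector_derivative \<Gamma> g xd has_vector_derivative_const s0 \<omega>)
      moreover have "(\<Gamma> s *v (A *v x s \<omega> - B *v p s \<omega> + 0) + ?G s *v ((x s \<omega> - ?N s) + ?N t))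
           + - ((C - \<Gamma> s ** B) *v g s + M) = - (?k s \<omega>) - ?G s *v (?N s - ?N t)"
        by (simp add: p_def vmult.add_left vmult.diff_left vmult.minus_left vmult.add_right vmult.diff_right
            matrix_vector_mul_assoc matrix_mul_assoc algebra_simps)
      ultimately have "(?f has_vector_derivative - (?k s \<omega>) - ?G s *v (?N s - ?N t)) (at s within {0..T})"
        by (simp only:)
      then show ?thesis by (rule has_vector_derivative_within_subset[OF _ sub])
    qed
    have cN: "continuous_on {t..T} (\<lambda>s. ?N s - ?N t)"
      by (intro continuous_intros continuous_on_subset[OF noise_continuous[OF \<omega>] sub])
    have cGN: "continuous_on {t..T} (\<lambda>s. ?G s *v (?N s - ?N t))"
      by (rule vmult.continuous_on[OF continuous_on_subset[OF cG sub] cN])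
    have ckt: "continuous_on {t..T} (\<lambda>s. ?k s \<omega>)" by (rule continuous_on_subset[OF ck[OF \<omega>] sub])
    have h1: "(LBINT s:{t..T}. - (?k s \<omega>) - ?G s *v (?N s - ?N t)) = ?f T - ?f t"
      by (rule set_integral_derivative[OF _ fd continuous_on_diff[OF continuous_on_minus[OF ckt] cGN]]) (use t in simp_all)
    have h2: "(LBINT s:{t..T}. - (?k s \<omega>) - ?G s *v (?N s - ?N t)) $ i =
        - (LBINT s:{t..T}. ?k s \<omega> $ i) - integral {t..T} (\<lambda>s. (?G s *v (?N s - ?N t)) $ i)"
    proof -
      have "(LBINT s:{t..T}. - (?k s \<omega>) - ?G s *v (?N s - ?N t)) $ i = (LBINT s:{t..T}. (- (?k s \<omega>) - ?G s *v (?N s - ?N t)) $ i)"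
        by (intro set_integral_vec_nth continuous_on_diff continuous_on_minus ckt cGN)
      also have "\<dots> = integral {t..T} (\<lambda>s. - (?k s \<omega> $ i) - (?G s *v (?N s - ?N t)) $ i)"
        unfolding vector_minus_component vector_uminus_component
        by (intro set_integral_continuous_eq_integral continuous_on_diff continuous_on_minus ckt cGN continuous_on_component)
      also have "\<dots> = - integral {t..T} (\<lambda>s. ?k s \<omega> $ i) - integral {t..T} (\<lambda>s. (?G s *v (?N s - ?N t)) $ i)"
        unfolding integral_neg[symmetric]
        by (intro integral_diff integrable_continuous_real continuous_on_minus continuous_on_component ckt cGN)
      also have "integral {t..T} (\<lambda>s. ?k s \<omega> $ i) = (LBINT s:{t..T}. ?k s \<omega> $ i)"
        by (rule set_integral_continuous_eq_integral[symmetric]) (intro continuous_on_component ckt)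
      finally show ?thesis .
    qed
    have h3: "integral {t..T} (\<lambda>s. (?G s *v (?N s - ?N t)) $ i) = (\<Sum>j\<in>UNIV. c $ j *
         (\<integral>s. indicator {t..T} s * (?G s $ i $ j * (W (\<gamma> j) s \<omega> - W (\<gamma> j) t \<omega>)) \<partial>\<Lambda>))"
    proof -
      have cj: "continuous_on {t..T} (\<lambda>s. ?G s $ i $ j * (W (\<gamma> j) s \<omega> - W (\<gamma> j) t \<omega>))" for j
        by (intro continuous_on_mult continuous_on_component continuous_on_subset[OF cG sub] continuous_on_diff
            continuous_on_subset[OF W_continuous[OF \<omega>] sub] continuous_on_const)
      have "(?G s *v (?N s - ?N t)) $ i = (\<Sum>j\<in>UNIV. c $ j * (?G s $ i $ j * (W (\<gamma> j) s \<omega> - W (\<gamma> j) t \<omega>)))" for s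
        by (rule mult_noise_diff)
      then have "integral {t..T} (\<lambda>s. (?G s *v (?N s - ?N t)) $ i) =
          (\<Sum>j\<in>UNIV. integral {t..T} (\<lambda>s. c $ j * (?G s $ i $ j * (W (\<gamma> j) s \<omega> - W (\<gamma> j) t \<omega>))))"
        by (simp only:) (intro integral_sum integrable_continuous_real continuous_on_mult continuous_on_const cj, simp)
      also have "\<dots> = (\<Sum>j\<in>UNIV. c $ j * integral {t..T} (\<lambda>s. ?G s $ i $ j * (W (\<gamma> j) s \<omega> - W (\<gamma> j) t \<omega>)))"
        by (simp only: integral_mult_right)
      finally show ?thesis by (simp only: Lambda_eq_integral[OF cj sub])
    qed
    have h4: "?f T - ?f t = p T \<omega> - p t \<omega> - \<Gamma> T *v (?N T - ?N t)"
      by (simp add: p_def vmult.add_right vmult.diff_right)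
    have h5: "(\<Gamma> T *v (?N T - ?N t)) $ i = (\<Sum>j\<in>UNIV. c $ j * (\<Gamma> T $ i $ j * (W (\<gamma> j) T \<omega> - W (\<gamma> j) t \<omega>)))"
      by (rule mult_noise_diff)
    have "- (LBINT s:{t..T}. ?k s \<omega> $ i) - (\<Sum>j\<in>UNIV. c $ j *
         (\<integral>s. indicator {t..T} s * (?G s $ i $ j * (W (\<gamma> j) s \<omega> - W (\<gamma> j) t \<omega>)) \<partial>\<Lambda>)) =
        p T \<omega> $ i - p t \<omega> $ i - (\<Sum>j\<in>UNIV. c $ j * (\<Gamma> T $ i $ j * (W (\<gamma> j) T \<omega> - W (\<gamma> j) t \<omega>)))"
      using h2 unfolding h1 h4 h3 vector_minus_component h5 by simp
    then show ?thesis
      by (simp only: right_diff_distrib sum_subtractf)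
  qed
  show "backward m (\<lambda>t \<omega>. p t \<omega> $ i) (\<lambda>t \<omega>. ?k t \<omega> $ i)"
    unfolding backward_def
  proof (intro ballI allI impI)
    fix t \<zeta> assume t: "t \<in> {0..T}" and \<zeta>: "\<zeta> \<in> borel_measurable (full_filtration P W m t)" "L2 \<zeta>"
    let ?h = "\<lambda>j \<omega>. \<integral>s. indicator {t..T} s * (?G s $ i $ j * (W (\<gamma> j) s \<omega> - W (\<gamma> j) t \<omega>)) \<partial>\<Lambda>"
    have cGj: "continuous_on {0..T} (\<lambda>s. ?G s $ i $ j)" for j by (intro continuous_on_component cG)
    note hj = increment_integral_orthogonal[OF m t cGj \<zeta>]
    have dW: "L2 (\<lambda>\<omega>. W (\<gamma> j) T \<omega> - W (\<gamma> j) t \<omega>)" for j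
      using W_moments t T_pos by (intro square_integrable_diff) auto
    have 1: "integrable P (\<lambda>\<omega>. (W (\<gamma> j) T \<omega> - W (\<gamma> j) t \<omega>) * \<zeta> \<omega>)" for j
      by (rule square_integrable_mult[OF dW \<zeta>(2)])
    have 2: "integrable P (\<lambda>\<omega>. ?h j \<omega> * \<zeta> \<omega>)" for j
      by (rule square_integrable_mult[OF hj(1) \<zeta>(2)])
    have eq: "(p T \<omega> $ i - p t \<omega> $ i + (LBINT s:{t..T}. ?k s \<omega> $ i)) * \<zeta> \<omega> =
        (\<Sum>j\<in>UNIV. c $ j * \<Gamma> T $ i $ j * ((W (\<gamma> j) T \<omega> - W (\<gamma> j) t \<omega>) * \<zeta> \<omega>) - c $ j * (?h j \<omega> * \<zeta> \<omega>))"
      if "\<omega> \<in> space P" for \<omega>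
      unfolding ident[OF that t] sum_distrib_right by (rule sum.cong) (simp_all add: algebra_simps)
    have int: "integrable P (\<lambda>\<omega>. \<Sum>j\<in>UNIV. c $ j * \<Gamma> T $ i $ j * ((W (\<gamma> j) T \<omega> - W (\<gamma> j) t \<omega>) * \<zeta> \<omega>) - c $ j * (?h j \<omega> * \<zeta> \<omega>))"
      by (intro Bochner_Integration.integrable_sum Bochner_Integration.integrable_diff integrable_mult_right 1 2)
    have "(\<integral>\<omega>. (p T \<omega> $ i - p t \<omega> $ i + (LBINT s:{t..T}. ?k s \<omega> $ i)) * \<zeta> \<omega> \<partial>P) =
        (\<integral>\<omega>. (\<Sum>j\<in>UNIV. c $ j * \<Gamma> T $ i $ j * ((W (\<gamma> j) T \<omega> - W (\<gamma> j) t \<omega>) * \<zeta> \<omega>) - c $ j * (?h j \<omega> * \<zeta> \<omega>)) \<partial>P)"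
      by (rule Bochner_Integration.integral_cong) (use eq in auto)
    also have "\<dots> = (\<Sum>j\<in>UNIV. c $ j * \<Gamma> T $ i $ j * (\<integral>\<omega>. (W (\<gamma> j) T \<omega> - W (\<gamma> j) t \<omega>) * \<zeta> \<omega> \<partial>P) - c $ j * (\<integral>\<omega>. ?h j \<omega> * \<zeta> \<omega> \<partial>P))"
      by (subst Bochner_Integration.integral_sum)
        (simp_all only: Bochner_Integration.integral_diff Bochner_Integration.integrable_diff integrable_mult_right
          integral_mult_right_zero 1 2)
    also have "\<dots> = 0"
      using hj(2) increment_orthogonal[OF m _ _ \<zeta>, of T] t by simp
    finally show "integrable P (\<lambda>\<omega>. (p T \<omega> $ i - p t \<omega> $ i + (LBINT s:{t..T}. ?k s \<omega> $ i)) * \<zeta> \<omega>) \<and>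
       (\<integral>\<omega>. (p T \<omega> $ i - p t \<omega> $ i + (LBINT s:{t..T}. ?k s \<omega> $ i)) * \<zeta> \<omega> \<partial>P) = 0"
      using int eq by (simp cong: Bochner_Integration.integrable_cong)
  qed
qed

section \<open>First-order conditions\<close>

definition sqp :: "'a process \<Rightarrow> bool" where
  "sqp a \<longleftrightarrow> square_integrable \<mu> (\<lambda>(s, \<omega>). a s \<omega>)"

definition ip :: "'a process \<Rightarrow> 'a process \<Rightarrow> real" where
  "ip a b = (\<integral>z. (case z of (s, \<omega>) \<Rightarrow> a s \<omega> * b s \<omega>) \<partial>\<mu>)"

definition ex :: "('a \<Rightarrow> real) \<Rightarrow> ('a \<Rightarrow> real) \<Rightarrow> real" where
  "ex f g = (\<integral>\<omega>. f \<omega> * g \<omega> \<partial>P)"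

lemma sqp_add: "sqp a \<Longrightarrow> sqp b \<Longrightarrow> sqp (\<lambda>s \<omega>. a s \<omega> + b s \<omega>)"
  using square_integrable_add[of \<mu> "\<lambda>(s, \<omega>). a s \<omega>" "\<lambda>(s, \<omega>). b s \<omega>"] by (simp add: sqp_def case_prod_beta')

lemma sqp_diff: "sqp a \<Longrightarrow> sqp b \<Longrightarrow> sqp (\<lambda>s \<omega>. a s \<omega> - b s \<omega>)"
  using square_integrable_diff[of \<mu> "\<lambda>(s, \<omega>). a s \<omega>" "\<lambda>(s, \<omega>). b s \<omega>"] by (simp add: sqp_def case_prod_beta')

lemma sqp_cmult: "sqp a \<Longrightarrow> sqp (\<lambda>s \<omega>. c * a s \<omega>)"
  using square_integrable_cmult[of \<mu> "\<lambda>(s, \<omega>). a s \<omega>" c] by (simp add: sqp_def case_prod_beta')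

lemma sqp_const: "sqp (\<lambda>s \<omega>. c)"
  using LP_fin.square_integrable_const[of c] by (simp add: sqp_def case_prod_beta')

lemmas sqp_intros = sqp_add sqp_diff sqp_cmult sqp_const

lemma ip_integrable: "sqp a \<Longrightarrow> sqp b \<Longrightarrow> integrable \<mu> (\<lambda>(s, \<omega>). a s \<omega> * b s \<omega>)"
  using square_integrable_mult[of \<mu> "\<lambda>(s, \<omega>). a s \<omega>" "\<lambda>(s, \<omega>). b s \<omega>"] by (simp add: sqp_def case_prod_beta')

lemma ip_commute: "ip a b = ip b a"
  by (simp add: ip_def mult.commute)

lemma ip_add: "sqp a \<Longrightarrow> sqp b \<Longrightarrow> sqp c \<Longrightarrow> ip (\<lambda>s \<omega>. a s \<omega> + b s \<omega>) c = ip a c + ip b c"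
  using Bochner_Integration.integral_add[OF ip_integrable[of a c] ip_integrable[of b c]]
  by (simp add: ip_def case_prod_beta' distrib_right)

lemma ip_diff: "sqp a \<Longrightarrow> sqp b \<Longrightarrow> sqp c \<Longrightarrow> ip (\<lambda>s \<omega>. a s \<omega> - b s \<omega>) c = ip a c - ip b c"
  using Bochner_Integration.integral_diff[OF ip_integrable[of a c] ip_integrable[of b c]]
  by (simp add: ip_def case_prod_beta' left_diff_distrib)

lemma ip_cmult: "ip (\<lambda>s \<omega>. k * a s \<omega>) c = k * ip a c"
  by (simp add: ip_def case_prod_beta' mult.assoc)

lemma ip_add': "sqp a \<Longrightarrow> sqp b \<Longrightarrow> sqp c \<Longrightarrow> ip c (\<lambda>s \<omega>. a s \<omega> + b s \<omega>) = ip c a + ip c b"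
  by (simp add: ip_commute[of c] ip_add)

lemma ip_diff': "sqp a \<Longrightarrow> sqp b \<Longrightarrow> sqp c \<Longrightarrow> ip c (\<lambda>s \<omega>. a s \<omega> - b s \<omega>) = ip c a - ip c b"
  by (simp add: ip_commute[of c] ip_diff)

lemma ip_cmult': "ip c (\<lambda>s \<omega>. k * a s \<omega>) = k * ip c a"
  by (simp add: ip_commute[of c] ip_cmult)

lemmas ip_simps = ip_add ip_diff ip_cmult ip_add' ip_diff' ip_cmult'

lemma ip_nonneg: "0 \<le> ip a a"
  unfolding ip_def by (rule integral_nonneg_AE) (simp add: case_prod_beta')

lemma ex_commute: "ex f g = ex g f"
  by (simp add: ex_def mult.commute)

lemma ex_add: "L2 f \<Longrightarrow> L2 g \<Longrightarrow> L2 h \<Longrightarrow> ex (\<lambda>\<omega>. f \<omega> + g \<omega>) h = ex f h + ex g h"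
  by (simp add: ex_def distrib_right square_integrable_mult)

lemma ex_diff: "L2 f \<Longrightarrow> L2 g \<Longrightarrow> L2 h \<Longrightarrow> ex (\<lambda>\<omega>. f \<omega> - g \<omega>) h = ex f h - ex g h"
  by (simp add: ex_def left_diff_distrib square_integrable_mult)

lemma ex_cmult: "ex (\<lambda>\<omega>. k * f \<omega>) h = k * ex f h"
  by (simp add: ex_def mult.assoc)

lemma ex_add': "L2 f \<Longrightarrow> L2 g \<Longrightarrow> L2 h \<Longrightarrow> ex h (\<lambda>\<omega>. f \<omega> + g \<omega>) = ex h f + ex h g"
  by (simp add: ex_commute[of h] ex_add)

lemma ex_diff': "L2 f \<Longrightarrow> L2 g \<Longrightarrow> L2 h \<Longrightarrow> ex h (\<lambda>\<omega>. f \<omega> - g \<omega>) = ex h f - ex h g"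
  by (simp add: ex_commute[of h] ex_diff)

lemma ex_cmult': "ex h (\<lambda>\<omega>. k * f \<omega>) = k * ex h f"
  by (simp add: ex_commute[of h] ex_cmult)

lemmas ex_simps = ex_add ex_diff ex_cmult ex_add' ex_diff' ex_cmult'

lemma ex_nonneg: "0 \<le> ex f f"
  unfolding ex_def by (rule integral_nonneg_AE) simp

section \<open>Vector space structure of the admissible processes\<close>

lemma L2_process_iff:
  fixes v :: "'a process"
  assumes "filtration \<F>"
  shows "L2_process P T \<F> v \<longleftrightarrow>
    (\<forall>t\<in>{0..T}. (\<lambda>(s, \<omega>). v s \<omega>) \<in> borel_measurable (restrict_space borel {0..t} \<Otimes>\<^sub>M \<F> t)) \<and> sqp v"
proof -
  have eq: "integrable \<mu> (\<lambda>(s, \<omega>). (norm (v s \<omega>))\<^sup>2) \<longleftrightarrow> integrable \<mu> (\<lambda>z. (case z of (s, \<omega>) \<Rightarrow> v s \<omega>)\<^sup>2)"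
    by (simp add: case_prod_beta')
  have "(\<lambda>(s, \<omega>). v s \<omega>) \<in> borel_measurable \<mu>"
    if "\<forall>t\<in>{0..T}. (\<lambda>(s, \<omega>). v s \<omega>) \<in> borel_measurable (restrict_space borel {0..t} \<Otimes>\<^sub>M \<F> t)"
    by (rule progressive_mu_measurable[OF assms bspec[OF that]]) (use T_pos in simp)
  then show ?thesis
    unfolding L2_process_def sqp_def square_integrable_def eq by blast
qed

lemma L2_process_sqp: "filtration \<F> \<Longrightarrow> L2_process P T \<F> v \<Longrightarrow> sqp v"
  for v :: "'a process" by (simp add: L2_process_iff)

lemma L2_process_adapted:
  assumes "L2_process P T \<F> v" "t \<in> {0..T}"
  shows "v t \<in> borel_measurable (\<F> t)"
proof -
  have "(\<lambda>(s, \<omega>). v s \<omega>) \<in> borel_measurable (restrict_space borel {0..t} \<Otimes>\<^sub>M \<F> t)"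
    using assms by (simp add: L2_process_def)
  from measurable_compose[OF measurable_Pair1' this, of t] show ?thesis
    using assms(2) by (simp add: space_restrict_space)
qed

lemma L2_process_add:
  fixes v w :: "'a process"
  assumes \<F>: "filtration \<F>" and "L2_process P T \<F> v" "L2_process P T \<F> w"
  shows "L2_process P T \<F> (\<lambda>t \<omega>. v t \<omega> + w t \<omega>)"
  unfolding L2_process_iff[OF \<F>]
proof (intro conjI ballI)
  fix t assume "t \<in> {0..T}"
  then have "(\<lambda>(s, \<omega>). v s \<omega>) \<in> borel_measurable (restrict_space borel {0..t} \<Otimes>\<^sub>M \<F> t)"
    "(\<lambda>(s, \<omega>). w s \<omega>) \<in> borel_measurable (restrict_space borel {0..t} \<Otimes>\<^sub>M \<F> t)"
    using assms by (auto simp: L2_process_iff)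
  from borel_measurable_add[OF this]
  show "(\<lambda>(s, \<omega>). v s \<omega> + w s \<omega>) \<in> borel_measurable (restrict_space borel {0..t} \<Otimes>\<^sub>M \<F> t)"
    by (simp add: case_prod_beta')
qed (use assms in \<open>auto simp: L2_process_iff intro: sqp_add\<close>)

lemma L2_process_cmult:
  fixes v :: "'a process"
  assumes \<F>: "filtration \<F>" and "L2_process P T \<F> v"
  shows "L2_process P T \<F> (\<lambda>t \<omega>. c * v t \<omega>)"
  unfolding L2_process_iff[OF \<F>]
proof (intro conjI ballI)
  fix t assume "t \<in> {0..T}"
  then have "(\<lambda>(s, \<omega>). v s \<omega>) \<in> borel_measurable (restrict_space borel {0..t} \<Otimes>\<^sub>M \<F> t)"
    using assms by (auto simp: L2_process_iff)
  from borel_measurable_times[OF borel_measurable_const[of c] this]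
  show "(\<lambda>(s, \<omega>). c * v s \<omega>) \<in> borel_measurable (restrict_space borel {0..t} \<Otimes>\<^sub>M \<F> t)"
    by (simp add: case_prod_beta')
qed (use assms in \<open>auto simp: L2_process_iff intro: sqp_cmult\<close>)

lemma state_process_iff:
  fixes v :: "'a process"
  assumes \<F>: "filtration \<F>"
  shows "state_process P T \<F> v \<longleftrightarrow> L2_process P T \<F> v \<and> (AE \<omega> in P. continuous_on {0..T} (\<lambda>t. v t \<omega>)) \<and>
     (\<forall>t\<in>{0..T}. L2 (v t))"
proof -
  have "v t \<in> borel_measurable P" if "L2_process P T \<F> v" "t \<in> {0..T}" for t
    by (rule measurable_from_subalg[OF _ L2_process_adapted[OF that]]) (use \<F> in \<open>simp add: filtration_def\<close>)
  then show ?thesis unfolding state_process_def square_integrable_def real_norm_def power2_abs by blast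
qed

lemma state_process_add:
  fixes v w :: "'a process"
  assumes \<F>: "filtration \<F>" and v: "state_process P T \<F> v" and w: "state_process P T \<F> w"
  shows "state_process P T \<F> (\<lambda>t \<omega>. v t \<omega> + w t \<omega>)"
proof -
  have "AE \<omega> in P. continuous_on {0..T} (\<lambda>t. v t \<omega>)" "AE \<omega> in P. continuous_on {0..T} (\<lambda>t. w t \<omega>)"
    using v w by (simp_all add: state_process_def)
  then have "AE \<omega> in P. continuous_on {0..T} (\<lambda>t. v t \<omega> + w t \<omega>)"
    by eventually_elim (intro continuous_intros)
  then show ?thesis
    using v w L2_process_add[OF \<F>] square_integrable_add unfolding state_process_iff[OF \<F>] by blast
qed

lemma state_process_cmult:
  fixes v :: "'a process"
  assumes \<F>: "filtration \<F>" and v: "state_process P T \<F> v"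
  shows "state_process P T \<F> (\<lambda>t \<omega>. c * v t \<omega>)"
proof -
  have "AE \<omega> in P. continuous_on {0..T} (\<lambda>t. v t \<omega>)"
    using v by (simp add: state_process_def)
  then have "AE \<omega> in P. continuous_on {0..T} (\<lambda>t. c * v t \<omega>)"
    by eventually_elim (intro continuous_intros)
  then show ?thesis
    using v L2_process_cmult[OF \<F>] square_integrable_cmult unfolding state_process_iff[OF \<F>] by blast
qed

lemma state_process_sqp: "filtration \<F> \<Longrightarrow> state_process P T \<F> v \<Longrightarrow> sqp v"
  for v :: "'a process" by (simp add: state_process_iff L2_process_sqp)

lemma state_process_sq: "filtration \<F> \<Longrightarrow> state_process P T \<F> v \<Longrightarrow> t \<in> {0..T} \<Longrightarrow> L2 (v t)"
  for v :: "'a process" by (simp add: state_process_iff)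

text \<open>What the leaders observe is part of the full filtration, in which the backward equations
  are tested; the identity is measurable from the larger \<sigma>-algebra to the smaller
  one.\<close>

lemma L2_process_leader_full:
  assumes "L2_process P T (leader_filtration P W m) v"
  shows "L2_process P T (full_filtration P W m) v"
proof -
  have "(\<lambda>(s, \<omega>). v s \<omega>) \<in> borel_measurable (restrict_space borel {0..t} \<Otimes>\<^sub>M full_filtration P W m t)" if "t \<in> {0..T}" for t
  proof -
    have "(\<lambda>\<omega>. \<omega>) \<in> full_filtration P W m t \<rightarrow>\<^sub>M leader_filtration P W m t"
    proof (rule measurableI)
      fix A assume A: "A \<in> sets (leader_filtration P W m t)"
      have sp: "space (full_filtration P W m t) = space (leader_filtration P W m t)"
        by (simp add: leader_filtration_def full_filtration_def)
      have "(\<lambda>\<omega>. \<omega>) -` A \<inter> space (full_filtration P W m t) = A"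
        using sets.sets_into_space[OF A] by (auto simp: sp)
      then show "(\<lambda>\<omega>. \<omega>) -` A \<inter> space (full_filtration P W m t) \<in> sets (full_filtration P W m t)"
        using subsetD[OF leader_subset_full A] by simp
    next
      fix \<omega> assume "\<omega> \<in> space (full_filtration P W m t)"
      then show "\<omega> \<in> space (leader_filtration P W m t)" by (simp add: leader_filtration_def full_filtration_def)
    qed
    then have id: "(\<lambda>z. (fst z, snd z)) \<in> restrict_space borel {0..t} \<Otimes>\<^sub>M full_filtration P W m t \<rightarrow>\<^sub>M
        restrict_space borel {0..t} \<Otimes>\<^sub>M leader_filtration P W m t"
      by (intro measurable_Pair measurable_fst measurable_compose[OF measurable_snd])
    have "(\<lambda>(s, \<omega>). v s \<omega>) \<in> borel_measurable (restrict_space borel {0..t} \<Otimes>\<^sub>M leader_filtration P W m t)"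
      using assms that by (simp add: L2_process_def)
    from measurable_compose[OF id this] show ?thesis by simp
  qed
  then show ?thesis using assms by (auto simp: L2_process_def)
qed

lemma state_process_leader_full:
  "leader_state m v \<Longrightarrow> full_state m v"
  by (auto simp: state_process_def L2_process_leader_full)

lemma sqp_sections: "sqp a \<Longrightarrow> AE \<omega> in P. integrable \<Lambda> (\<lambda>s. a s \<omega>)"
  unfolding sqp_def by (drule square_integrable_sections(1), erule eventually_mono) (rule L.square_integrable_integrable)

lemma Lambda_integrable_set:
  fixes f :: "real \<Rightarrow> real"
  assumes "integrable \<Lambda> f" "t \<in> {0..T}"
  shows "set_integrable lborel {0..t} f"
proof (rule set_integrable_subset)
  show "set_integrable lborel {0..T} f"
    using assms(1) by (simp add: integrable_restrict_space set_integrable_def)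
qed (use assms(2) in auto)

text \<open>Linearity of time integrals may fail on paths whose sections are not integrable; one
  null set serves all \<open>t\<close> at once.\<close>

lemma path_integral_diff:
  assumes "sqp a" "sqp b"
  shows "AE \<omega> in P. \<forall>t\<in>{0..T}. (LBINT s:{0..t}. a s \<omega> - b s \<omega>) = (LBINT s:{0..t}. a s \<omega>) - (LBINT s:{0..t}. b s \<omega>)"
  using sqp_sections[OF assms(1)] sqp_sections[OF assms(2)]
  by eventually_elim (intro ballI set_integral_diff(2) Lambda_integrable_set)

lemma path_integral_add_cmult:
  assumes "sqp a" "sqp b"
  shows "AE \<omega> in P. \<forall>t\<in>{0..T}. (LBINT s:{0..t}. a s \<omega> + c * b s \<omega>) = (LBINT s:{0..t}. a s \<omega>) + c * (LBINT s:{0..t}. b s \<omega>)"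
  using sqp_sections[OF assms(1)] sqp_sections[OF assms(2)]
proof eventually_elim
  case (elim \<omega>)
  show ?case
  proof
    fix t assume t: "t \<in> {0..T}"
    show "(LBINT s:{0..t}. a s \<omega> + c * b s \<omega>) = (LBINT s:{0..t}. a s \<omega>) + c * (LBINT s:{0..t}. b s \<omega>)"
      using Lambda_integrable_set[OF elim(1) t] Lambda_integrable_set[OF elim(2) t]
      by (subst set_integral_add(2)) auto
  qed
qed

text \<open>Initial value and noise cancel in the difference of two states, which is therefore a
  primitive in time, as the duality pairing demands.\<close>

lemma path_diff:
  assumes "sqp a" "sqp a'"
    and "AE \<omega> in P. \<forall>t\<in>{0..T}. X t \<omega> = n \<omega> + (LBINT s:{0..t}. a s \<omega>) + n' t \<omega>"
    and "AE \<omega> in P. \<forall>t\<in>{0..T}. X' t \<omega> = n \<omega> + (LBINT s:{0..t}. a' s \<omega>) + n' t \<omega>"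
    and "\<And>s \<omega>. f s \<omega> = a' s \<omega> - a s \<omega>"
  shows "AE \<omega> in P. \<forall>t\<in>{0..T}. X' t \<omega> - X t \<omega> = (LBINT s:{0..t}. f s \<omega>)"
  using assms(3,4) path_integral_diff[OF assms(2,1)] by eventually_elim (simp add: assms(5))

section \<open>Expansion of the quadratic costs and the follower's stationarity\<close>

lemma lq_cost_eq:
  assumes v: "sqp v" and e: "sqp e" and f: "L2 f"
  shows "lq_cost P T q r qb v e f = q * ip e e + r * ip v v + qb * ex f f"
proof -
  have int: "integrable \<mu> (\<lambda>(s, \<omega>). q * (e s \<omega>)\<^sup>2 + r * (v s \<omega>)\<^sup>2)"
    using ip_integrable[OF e e] ip_integrable[OF v v] by (simp add: case_prod_beta' power2_eq_square)
  have "lq_cost P T q r qb v e f = (\<integral>\<omega>. (\<integral>s. q * (e s \<omega>)\<^sup>2 + r * (v s \<omega>)\<^sup>2 \<partial>\<Lambda>) + qb * (f \<omega>)\<^sup>2 \<partial>P)"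
    by (simp add: lq_cost_def set_integral_eq_Lambda_full)
  also have "\<dots> = (\<integral>\<omega>. (\<integral>s. q * (e s \<omega>)\<^sup>2 + r * (v s \<omega>)\<^sup>2 \<partial>\<Lambda>) \<partial>P) + qb * (\<integral>\<omega>. (f \<omega>)\<^sup>2 \<partial>P)"
    using LP.integrable_snd[OF int] f by (simp add: square_integrable_def)
  also have "(\<integral>\<omega>. (\<integral>s. q * (e s \<omega>)\<^sup>2 + r * (v s \<omega>)\<^sup>2 \<partial>\<Lambda>) \<partial>P) = q * ip e e + r * ip v v"
    using integral_mu(2)[OF int] ip_integrable[OF e e] ip_integrable[OF v v]
    by (simp add: ip_def case_prod_beta' power2_eq_square)
  finally show ?thesis by (simp add: ex_def power2_eq_square)
qed

text \<open>The cost is a quadratic functional, so the expansion is exact: the coefficient of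
  \<open>2 * c\<close> is a directional derivative up to the factor 2, the one of
  \<open>c\<^sup>2\<close> is the cost of the direction itself.\<close>

lemma lq_cost_expand:
  assumes "sqp v" "sqp e" "L2 f" "sqp dv" "sqp de" "L2 df"
  shows "lq_cost P T q r qb (\<lambda>s \<omega>. v s \<omega> + c * dv s \<omega>) (\<lambda>s \<omega>. e s \<omega> + c * de s \<omega>) (\<lambda>\<omega>. f \<omega> + c * df \<omega>) =
    lq_cost P T q r qb v e f + 2 * c * (q * ip e de + r * ip v dv + qb * ex f df)
      + c\<^sup>2 * (q * ip de de + r * ip dv dv + qb * ex df df)"
  by (subst (1 2) lq_cost_eq)
    (simp_all add: assms sqp_intros square_integrable_add square_integrable_cmult ip_simps ex_simps
      ip_commute[of de e] ip_commute[of dv v] ex_commute[of df f] power2_eq_square algebra_simps)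

lemma quadratic_min_linear_zero:
  fixes L S :: real
  assumes "\<And>c. 0 \<le> 2 * c * L + c\<^sup>2 * S"
  shows "L = 0"
proof (rule ccontr)
  assume "L \<noteq> 0"
  \<comment> \<open>The vertex of the parabola with curvature \<open>\<bar>S\<bar> + 1\<close>,
    which is positive and dominates \<open>S\<close>.\<close>
  let ?c = "- L / (\<bar>S\<bar> + 1)"
  have "2 * ?c * L + ?c\<^sup>2 * S \<le> 2 * ?c * L + ?c\<^sup>2 * (\<bar>S\<bar> + 1)"
    by (intro add_left_mono mult_left_mono) auto
  also have "\<dots> = - L\<^sup>2 / (\<bar>S\<bar> + 1)"
    by (simp add: power2_eq_square divide_simps)
  also have "\<dots> < 0" using \<open>L \<noteq> 0\<close> by (simp add: divide_neg_pos)
  finally show False using assms[of ?c] by simp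
qed

definition follower_error :: "real ^ param \<Rightarrow> 'a process \<Rightarrow> 'a process \<Rightarrow> 'a process \<Rightarrow> 'a process \<Rightarrow> 'a process" where
  "follower_error \<theta> xa xb z x1 t \<omega> = x1 t \<omega> - \<theta> $ F\<^sub>1 * z t \<omega> - \<theta> $ G\<^sub>1 * xa t \<omega> - \<theta> $ H\<^sub>1 * xb t \<omega> - \<theta> $ M\<^sub>1"

definition follower_final_error :: "real ^ param \<Rightarrow> 'a process \<Rightarrow> 'a process \<Rightarrow> 'a process \<Rightarrow> 'a process \<Rightarrow> 'a \<Rightarrow> real" where
  "follower_final_error \<theta> xa xb z x1 \<omega> = x1 T \<omega> - \<theta> $ Fb\<^sub>1 * z T \<omega> - \<theta> $ Gb\<^sub>1 * xa T \<omega> - \<theta> $ Hb\<^sub>1 * xb T \<omega> - \<theta> $ Mb\<^sub>1"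

lemma J_follower_eq:
  "J_follower P T \<theta> xa xb z x1 v = lq_cost P T (\<theta> $ Q\<^sub>1) (\<theta> $ R\<^sub>1) (\<theta> $ Qb\<^sub>1) v
     (follower_error \<theta> xa xb z x1) (follower_final_error \<theta> xa xb z x1)"
  by (simp add: J_follower_def follower_error_def[abs_def] follower_final_error_def[abs_def])

lemma follower_error_sqp:
  "sqp xa \<Longrightarrow> sqp xb \<Longrightarrow> sqp z \<Longrightarrow> sqp x1 \<Longrightarrow> sqp (follower_error \<theta> xa xb z x1)"
  unfolding follower_error_def[abs_def] by (intro sqp_intros)

lemma follower_final_error_sq:
  "L2 (xa T) \<Longrightarrow> L2 (xb T) \<Longrightarrow> L2 (z T) \<Longrightarrow> L2 (x1 T) \<Longrightarrow>
    L2 (follower_final_error \<theta> xa xb z x1)"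
  unfolding follower_final_error_def[abs_def] by (intro square_integrable_intros square_integrable_const)

text \<open>\<open>(v, y)\<close> solves the homogeneous equation with zero initial value, so adding
  any multiple of it to the optimal pair gives another response to the same
  \<open>(xa, xb, z)\<close>. The term with \<open>B\<^sub>1\<close> does not vary because the
  follower takes the mean field as given. The cost increment is a quadratic in \<open>c\<close>
  without constant term, nonnegative for all \<open>c\<close>, and so has no linear part.\<close>

lemma follower_stationary:
  assumes m: "is_model P W m" and opt: "follower_optimal P W T m xa xb z u x1"
    and st: "sqp xa" "sqp xb" "sqp z" "L2 (xa T)" "L2 (xb T)" "L2 (z T)"
    and v: "L2_process P T (full_filtration P W m) v" and y: "full_state m y"
    and path: "AE \<omega> in P. \<forall>t\<in>{0..T}. y t \<omega> = (LBINT s:{0..t}. par m $ A\<^sub>1 * y s \<omega> + par m $ E\<^sub>1 * v s \<omega>)"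
  shows "par m $ Q\<^sub>1 * ip (follower_error (par m) xa xb z x1) y + par m $ R\<^sub>1 * ip u v
     + par m $ Qb\<^sub>1 * ex (follower_final_error (par m) xa xb z x1) (y T) = 0"
proof (rule quadratic_min_linear_zero)
  fix c
  let ?\<theta> = "par m" and ?F = "full_filtration P W m"
  note \<F> = filtration_full[OF m]
  let ?e = "follower_error ?\<theta> xa xb z x1" and ?f = "follower_final_error ?\<theta> xa xb z x1"
  have resp: "L2_process P T ?F u" "state_process P T ?F x1"
    and x1: "AE \<omega> in P. \<forall>t\<in>{0..T}. x1 t \<omega> = eta m \<omega> $ Follower +
          (LBINT s:{0..t}. ?\<theta> $ A\<^sub>1 * x1 s \<omega> + ?\<theta> $ B\<^sub>1 * z s \<omega> + ?\<theta> $ C\<^sub>1 * xa s \<omega>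
             + ?\<theta> $ D\<^sub>1 * xb s \<omega> + ?\<theta> $ E\<^sub>1 * u s \<omega>) + ?\<theta> $ \<sigma>\<^sub>1 * W Follower t \<omega>"
    using opt by (auto simp: follower_optimal_def follower_response_def Let_def)
  have sq: "sqp u" "sqp x1" "sqp v" "sqp y"
    using resp v y \<F> L2_process_sqp state_process_sqp by blast+
  have sqT: "L2 (x1 T)" "L2 (y T)"
    using state_process_sq[OF \<F>] resp y T_pos by auto
  let ?u = "\<lambda>t \<omega>. u t \<omega> + c * v t \<omega>" and ?x = "\<lambda>t \<omega>. x1 t \<omega> + c * y t \<omega>"
  have "follower_response P W T m xa xb z ?u ?x"
    unfolding follower_response_def Let_def
  proof (intro conjI)
    show "L2_process P T ?F ?u" by (intro L2_process_add L2_process_cmult \<F> resp v)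
    show "state_process P T ?F ?x" by (intro state_process_add state_process_cmult \<F> resp y)
    let ?a = "\<lambda>s \<omega>. ?\<theta> $ A\<^sub>1 * x1 s \<omega> + ?\<theta> $ B\<^sub>1 * z s \<omega> + ?\<theta> $ C\<^sub>1 * xa s \<omega> + ?\<theta> $ D\<^sub>1 * xb s \<omega> + ?\<theta> $ E\<^sub>1 * u s \<omega>"
    let ?b = "\<lambda>s \<omega>. ?\<theta> $ A\<^sub>1 * y s \<omega> + ?\<theta> $ E\<^sub>1 * v s \<omega>"
    have ab: "sqp ?a" "sqp ?b" by (intro sqp_intros sq st)+
    have eq: "?\<theta> $ A\<^sub>1 * ?x s \<omega> + ?\<theta> $ B\<^sub>1 * z s \<omega> + ?\<theta> $ C\<^sub>1 * xa s \<omega> + ?\<theta> $ D\<^sub>1 * xb s \<omega> + ?\<theta> $ E\<^sub>1 * ?u s \<omega> = ?a s \<omega> + c * ?b s \<omega>" for s \<omega>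
      by (simp add: algebra_simps)
    show "AE \<omega> in P. \<forall>t\<in>{0..T}. ?x t \<omega> = eta m \<omega> $ Follower +
          (LBINT s:{0..t}. ?\<theta> $ A\<^sub>1 * ?x s \<omega> + ?\<theta> $ B\<^sub>1 * z s \<omega> + ?\<theta> $ C\<^sub>1 * xa s \<omega>
             + ?\<theta> $ D\<^sub>1 * xb s \<omega> + ?\<theta> $ E\<^sub>1 * ?u s \<omega>) + ?\<theta> $ \<sigma>\<^sub>1 * W Follower t \<omega>"
      unfolding eq using x1 path path_integral_add_cmult[OF ab, of c] by eventually_elim simp
  qed
  then have "J_follower P T ?\<theta> xa xb z x1 u \<le> J_follower P T ?\<theta> xa xb z ?x ?u"
    using opt by (simp add: follower_optimal_def)
  also have "J_follower P T ?\<theta> xa xb z ?x ?u =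
      lq_cost P T (?\<theta> $ Q\<^sub>1) (?\<theta> $ R\<^sub>1) (?\<theta> $ Qb\<^sub>1) ?u (\<lambda>s \<omega>. ?e s \<omega> + c * y s \<omega>) (\<lambda>\<omega>. ?f \<omega> + c * y T \<omega>)"
    by (simp add: J_follower_def follower_error_def follower_final_error_def algebra_simps)
  also have "\<dots> = J_follower P T ?\<theta> xa xb z x1 u + 2 * c * (?\<theta> $ Q\<^sub>1 * ip ?e y + ?\<theta> $ R\<^sub>1 * ip u v + ?\<theta> $ Qb\<^sub>1 * ex ?f (y T))
      + c\<^sup>2 * (?\<theta> $ Q\<^sub>1 * ip y y + ?\<theta> $ R\<^sub>1 * ip v v + ?\<theta> $ Qb\<^sub>1 * ex (y T) (y T))"
    unfolding J_follower_eq
    by (rule lq_cost_expand) (intro sq sqT follower_error_sqp follower_final_error_sq st)+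
  finally show "0 \<le> 2 * c * (?\<theta> $ Q\<^sub>1 * ip ?e y + ?\<theta> $ R\<^sub>1 * ip u v + ?\<theta> $ Qb\<^sub>1 * ex ?f (y T))
      + c\<^sup>2 * (?\<theta> $ Q\<^sub>1 * ip y y + ?\<theta> $ R\<^sub>1 * ip v v + ?\<theta> $ Qb\<^sub>1 * ex (y T) (y T))" by simp
qed

text \<open>The values \<open>f t\<close> of the density of the paired process are adapted and serve
  themselves as the test variables in \<open>backward\<close>.\<close>

lemma backward_duality:
  assumes m: "is_model P W m" and p: "full_state m p" and k: "sqp k" and bw: "backward m p k"
    and f: "\<And>t. t \<in> {0..T} \<Longrightarrow> f t \<in> borel_measurable (full_filtration P W m t)" "sqp f"
    and \<phi>: "sqp \<phi>" "L2 (\<phi> T)" "AE \<omega> in P. \<forall>t\<in>{0..T}. \<phi> t \<omega> = (LBINT s:{0..t}. f s \<omega>)"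
  shows "ex (p T) (\<phi> T) = ip p f - ip k \<phi>"
  unfolding ex_def ip_def
proof (rule duality)
  note \<F> = filtration_full[OF m]
  show "square_integrable \<mu> (\<lambda>(s, \<omega>). p s \<omega>)" using state_process_sqp[OF \<F> p] by (simp add: sqp_def)
  show "L2 (p T)" using state_process_sq[OF \<F> p] T_pos by simp
  show "integrable P (\<lambda>\<omega>. (p T \<omega> - p t \<omega> + (LBINT s:{t..T}. k s \<omega>)) * f t \<omega>) \<and>
        (\<integral>\<omega>. (p T \<omega> - p t \<omega> + (LBINT s:{t..T}. k s \<omega>)) * f t \<omega> \<partial>P) = 0"
    if "t \<in> {0..T}" "L2 (f t)" for t
    using bw f(1)[OF that(1)] that by (simp add: backward_def)
qed (use k f \<phi> in \<open>auto simp: sqp_def square_integrable_def\<close>)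

lemma conditional_mean_ex:
  assumes m: "is_model P W m" and z: "AE \<omega> in P. z \<omega> = real_cond_exp P (leader_filtration P W m t) x \<omega>"
    and x: "L2 x" "L2 z"
    and \<zeta>: "\<zeta> \<in> borel_measurable (leader_filtration P W m t)" "L2 \<zeta>"
  shows "ex \<zeta> z = ex \<zeta> x"
proof -
  interpret finite_measure_subalgebra P "leader_filtration P W m t"
    by unfold_locales (rule subalgebra_leader[OF m])
  have [measurable]: "x \<in> borel_measurable P" "\<zeta> \<in> borel_measurable P" "z \<in> borel_measurable P"
    using x \<zeta> by (auto simp: square_integrable_def)
  have "ex \<zeta> z = (\<integral>\<omega>. \<zeta> \<omega> * real_cond_exp P (leader_filtration P W m t) x \<omega> \<partial>P)"
    unfolding ex_def by (rule integral_cong_AE) (use z in \<open>auto elim!: eventually_mono\<close>)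
  also have "\<dots> = ex \<zeta> x"
    unfolding ex_def using square_integrable_mult[OF \<zeta>(2) x(1)] \<zeta>(1) x(1)
    by (intro real_cond_exp_intg(2)) (auto simp: square_integrable_def)
  finally show ?thesis .
qed

text \<open>The conditional mean identity holds at each time up to its own null set, so it is
  applied to time slices under Fubini. Tested against leader-adapted processes, the follower's state
  and the mean field cannot be told apart.\<close>

lemma conditional_mean_ip:
  assumes m: "is_model P W m"
    and z: "\<And>t. t \<in> {0..T} \<Longrightarrow> AE \<omega> in P. z t \<omega> = real_cond_exp P (leader_filtration P W m t) (x t) \<omega>"
    and x: "sqp x" "sqp z" "\<And>t. t \<in> {0..T} \<Longrightarrow> L2 (x t)" "\<And>t. t \<in> {0..T} \<Longrightarrow> L2 (z t)"
    and \<kappa>: "\<And>t. t \<in> {0..T} \<Longrightarrow> \<kappa> t \<in> borel_measurable (leader_filtration P W m t)" "sqp \<kappa>"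
  shows "ip \<kappa> z = ip \<kappa> x"
proof -
  have "ip \<kappa> z = (\<integral>s. ex (\<kappa> s) (z s) \<partial>\<Lambda>)" "ip \<kappa> x = (\<integral>s. ex (\<kappa> s) (x s) \<partial>\<Lambda>)"
    using integral_mu(1)[OF ip_integrable[OF \<kappa>(2) x(2)]] integral_mu(1)[OF ip_integrable[OF \<kappa>(2) x(1)]]
    by (simp_all add: ip_def ex_def)
  moreover have "(\<integral>s. ex (\<kappa> s) (z s) \<partial>\<Lambda>) = (\<integral>s. ex (\<kappa> s) (x s) \<partial>\<Lambda>)"
  proof (rule integral_cong_AE)
    have "AE s in \<Lambda>. L2 (\<kappa> s)"
      using square_integrable_sections(2) \<kappa>(2) by (simp add: sqp_def)
    then show "AE s in \<Lambda>. ex (\<kappa> s) (z s) = ex (\<kappa> s) (x s)"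
      using AE_space by eventually_elim (auto intro!: conditional_mean_ex[OF m z x(3,4) \<kappa>(1)])
    show "(\<lambda>s. ex (\<kappa> s) (z s)) \<in> borel_measurable \<Lambda>" "(\<lambda>s. ex (\<kappa> s) (x s)) \<in> borel_measurable \<Lambda>"
      unfolding ex_def
      using borel_measurable_integrable[OF ip_integrable[OF \<kappa>(2) x(2)]] borel_measurable_integrable[OF ip_integrable[OF \<kappa>(2) x(1)]]
      by (auto intro: borel_measurable_lebesgue_integral)
  qed
  ultimately show ?thesis by simp
qed

lemma L2_process_diff:
  fixes v w :: "'a process"
  assumes \<F>: "filtration \<F>" and "L2_process P T \<F> v" "L2_process P T \<F> w"
  shows "L2_process P T \<F> (\<lambda>t \<omega>. v t \<omega> - w t \<omega>)"
  using L2_process_add[OF \<F> assms(2) L2_process_cmult[OF \<F> assms(3), of "-1"]] by simp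

lemma ex_minus: "ex (\<lambda>\<omega>. - f \<omega>) h = - ex f h"
  by (simp add: ex_def)

lemma ex_cong_AE:
  assumes "AE \<omega> in P. f \<omega> = f' \<omega>" "L2 f" "L2 f'" "L2 g"
  shows "ex f g = ex f' g"
  unfolding ex_def
proof (rule integral_cong_AE)
  show "AE \<omega> in P. f \<omega> * g \<omega> = f' \<omega> * g \<omega>" using assms(1) by eventually_elim simp
qed (use assms in \<open>auto simp: square_integrable_def\<close>)

text \<open>The second-order part of the exact expansion is a cost with nonnegative weights and may
  be dropped. Hence a vanishing first-order term proves minimality.\<close>

lemma lq_cost_convex:
  assumes sq: "sqp v" "sqp v'" "sqp e" "sqp e'" "L2 f" "L2 f'"
    and nn: "0 \<le> q" "0 \<le> r" "0 \<le> qb"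
  shows "lq_cost P T q r qb v e f + 2 * (q * ip e (\<lambda>t \<omega>. e' t \<omega> - e t \<omega>) + r * ip v (\<lambda>t \<omega>. v' t \<omega> - v t \<omega>)
     + qb * ex f (\<lambda>\<omega>. f' \<omega> - f \<omega>)) \<le> lq_cost P T q r qb v' e' f'"
proof -
  have "lq_cost P T q r qb v' e' f' = lq_cost P T q r qb (\<lambda>s \<omega>. v s \<omega> + 1 * (v' s \<omega> - v s \<omega>))
      (\<lambda>s \<omega>. e s \<omega> + 1 * (e' s \<omega> - e s \<omega>)) (\<lambda>\<omega>. f \<omega> + 1 * (f' \<omega> - f \<omega>))" by simp
  also have "\<dots> = lq_cost P T q r qb v e f + 2 * 1 * (q * ip e (\<lambda>t \<omega>. e' t \<omega> - e t \<omega>) + r * ip v (\<lambda>t \<omega>. v' t \<omega> - v t \<omega>)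
     + qb * ex f (\<lambda>\<omega>. f' \<omega> - f \<omega>)) + 1\<^sup>2 * (q * ip (\<lambda>t \<omega>. e' t \<omega> - e t \<omega>) (\<lambda>t \<omega>. e' t \<omega> - e t \<omega>)
     + r * ip (\<lambda>t \<omega>. v' t \<omega> - v t \<omega>) (\<lambda>t \<omega>. v' t \<omega> - v t \<omega>) + qb * ex (\<lambda>\<omega>. f' \<omega> - f \<omega>) (\<lambda>\<omega>. f' \<omega> - f \<omega>))"
    by (rule lq_cost_expand) (intro sq sqp_diff square_integrable_diff)+
  finally show ?thesis
    using mult_nonneg_nonneg[OF nn(1) ip_nonneg] mult_nonneg_nonneg[OF nn(2) ip_nonneg] mult_nonneg_nonneg[OF nn(3) ex_nonneg]
    by (simp add: add_nonneg_nonneg)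
qed

section \<open>The leaders' minimisation problems\<close>

definition error_alpha :: "real ^ param \<Rightarrow> 'a process \<Rightarrow> 'a process \<Rightarrow> 'a process \<Rightarrow> 'a process" where
  "error_alpha \<theta> xa xb z t \<omega> = xa t \<omega> - \<theta> $ F\<^sub>\<alpha> * z t \<omega> - \<theta> $ G\<^sub>\<alpha> * xb t \<omega> - \<theta> $ M\<^sub>\<alpha>"

definition error_beta :: "real ^ param \<Rightarrow> 'a process \<Rightarrow> 'a process \<Rightarrow> 'a process \<Rightarrow> 'a process" where
  "error_beta \<theta> xa xb z t \<omega> = xb t \<omega> - \<theta> $ F\<^sub>\<beta> * z t \<omega> - \<theta> $ G\<^sub>\<beta> * xa t \<omega> - \<theta> $ M\<^sub>\<beta>"

definition final_error_alpha :: "real ^ param \<Rightarrow> 'a process \<Rightarrow> 'a process \<Rightarrow> 'a process \<Rightarrow> 'a \<Rightarrow> real" where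
  "final_error_alpha \<theta> xa xb z \<omega> = xa T \<omega> - \<theta> $ Fb\<^sub>\<alpha> * z T \<omega> - \<theta> $ Gb\<^sub>\<alpha> * xb T \<omega> - \<theta> $ Mb\<^sub>\<alpha>"

definition final_error_beta :: "real ^ param \<Rightarrow> 'a process \<Rightarrow> 'a process \<Rightarrow> 'a process \<Rightarrow> 'a \<Rightarrow> real" where
  "final_error_beta \<theta> xa xb z \<omega> = xb T \<omega> - \<theta> $ Fb\<^sub>\<beta> * z T \<omega> - \<theta> $ Gb\<^sub>\<beta> * xa T \<omega> - \<theta> $ Mb\<^sub>\<beta>"

lemma J_alpha_eq:
  "J_alpha P T \<theta> xa xb z v = lq_cost P T (\<theta> $ Q\<^sub>\<alpha>) (\<theta> $ R\<^sub>\<alpha>) (\<theta> $ Qb\<^sub>\<alpha>) v (error_alpha \<theta> xa xb z) (final_error_alpha \<theta> xa xb z)"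
  by (simp add: J_alpha_def error_alpha_def[abs_def] final_error_alpha_def[abs_def])

lemma J_beta_eq:
  "J_beta P T \<theta> xa xb z v = lq_cost P T (\<theta> $ Q\<^sub>\<beta>) (\<theta> $ R\<^sub>\<beta>) (\<theta> $ Qb\<^sub>\<beta>) v (error_beta \<theta> xa xb z) (final_error_beta \<theta> xa xb z)"
  by (simp add: J_beta_def error_beta_def[abs_def] final_error_beta_def[abs_def])

lemma error_sqp:
  assumes "sqp xa" "sqp xb" "sqp z"
  shows "sqp (error_alpha \<theta> xa xb z)" "sqp (error_beta \<theta> xa xb z)"
  unfolding error_alpha_def[abs_def] error_beta_def[abs_def] by (intro sqp_intros assms)+

lemma final_error_sq:
  assumes "L2 (xa T)" "L2 (xb T)" "L2 (z T)"
  shows "L2 (final_error_alpha \<theta> xa xb z)" "L2 (final_error_beta \<theta> xa xb z)"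
  unfolding final_error_alpha_def[abs_def] final_error_beta_def[abs_def]
  by (intro square_integrable_intros square_integrable_const assms)+

text \<open>First-order condition for a weighted sum of the leaders' costs. \<open>\<pi>a\<close>, \<open>\<pi>b\<close>, \<open>\<pi>z\<close> are adjoint
  to \<open>x\<^sub>\<alpha>\<close>, \<open>x\<^sub>\<beta>\<close>, \<open>z\<close>; \<open>lam\<close> is adjoint to the follower's costate, and enters as a test direction in
  the follower's own first-order condition, for both outcomes that are compared.\<close>

lemma leader_variation:
  fixes wa wb :: real
  assumes m: "is_model P W m" and w: "0 \<le> wa" "0 \<le> wb"
    and out: "leader_outcome P W T m va vb xa xb z" and out': "leader_outcome P W T m va' vb' xa' xb' z'"
    and st: "leader_state m \<pi>a" "leader_state m \<pi>b"
      "leader_state m \<pi>z" "leader_state m lam"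
    and bwa: "backward m \<pi>a (\<lambda>t \<omega>. par m $ A\<^sub>\<alpha> * \<pi>a t \<omega> + par m $ A\<^sub>\<beta> * \<pi>b t \<omega> + par m $ C\<^sub>1 * \<pi>z t \<omega>
       + wa * par m $ Q\<^sub>\<alpha> * error_alpha (par m) xa xb z t \<omega> - wb * par m $ Q\<^sub>\<beta> * par m $ G\<^sub>\<beta> * error_beta (par m) xa xb z t \<omega>
       - par m $ Q\<^sub>1 * par m $ G\<^sub>1 * lam t \<omega>)"
    and bwb: "backward m \<pi>b (\<lambda>t \<omega>. par m $ B\<^sub>\<alpha> * \<pi>a t \<omega> + par m $ B\<^sub>\<beta> * \<pi>b t \<omega> + par m $ D\<^sub>1 * \<pi>z t \<omega>
       - wa * par m $ Q\<^sub>\<alpha> * par m $ G\<^sub>\<alpha> * error_alpha (par m) xa xb z t \<omega> + wb * par m $ Q\<^sub>\<beta> * error_beta (par m) xa xb z t \<omega>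
       - par m $ Q\<^sub>1 * par m $ H\<^sub>1 * lam t \<omega>)"
    and bwz: "backward m \<pi>z (\<lambda>t \<omega>. par m $ C\<^sub>\<alpha> * \<pi>a t \<omega> + par m $ C\<^sub>\<beta> * \<pi>b t \<omega> + (par m $ A\<^sub>1 + par m $ B\<^sub>1) * \<pi>z t \<omega>
       - wa * par m $ Q\<^sub>\<alpha> * par m $ F\<^sub>\<alpha> * error_alpha (par m) xa xb z t \<omega> - wb * par m $ Q\<^sub>\<beta> * par m $ F\<^sub>\<beta> * error_beta (par m) xa xb z t \<omega>
       + par m $ Q\<^sub>1 * (1 - par m $ F\<^sub>1) * lam t \<omega>)"
    and fa: "AE \<omega> in P. \<pi>a T \<omega> = wa * par m $ Qb\<^sub>\<alpha> * final_error_alpha (par m) xa xb z \<omega>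
       - wb * par m $ Qb\<^sub>\<beta> * par m $ Gb\<^sub>\<beta> * final_error_beta (par m) xa xb z \<omega> - par m $ Qb\<^sub>1 * par m $ Gb\<^sub>1 * lam T \<omega>"
    and fb: "AE \<omega> in P. \<pi>b T \<omega> = - (wa * par m $ Qb\<^sub>\<alpha> * par m $ Gb\<^sub>\<alpha> * final_error_alpha (par m) xa xb z \<omega>)
       + wb * par m $ Qb\<^sub>\<beta> * final_error_beta (par m) xa xb z \<omega> - par m $ Qb\<^sub>1 * par m $ Hb\<^sub>1 * lam T \<omega>"
    and fz: "AE \<omega> in P. \<pi>z T \<omega> = - (wa * par m $ Qb\<^sub>\<alpha> * par m $ Fb\<^sub>\<alpha> * final_error_alpha (par m) xa xb z \<omega>)
       - wb * par m $ Qb\<^sub>\<beta> * par m $ Fb\<^sub>\<beta> * final_error_beta (par m) xa xb z \<omega> + par m $ Qb\<^sub>1 * (1 - par m $ Fb\<^sub>1) * lam T \<omega>"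
    and lam: "AE \<omega> in P. \<forall>t\<in>{0..T}. lam t \<omega> = (LBINT s:{0..t}. par m $ A\<^sub>1 * lam s \<omega>
       + par m $ E\<^sub>1 * (- (par m $ E\<^sub>1 / par m $ R\<^sub>1) * \<pi>z s \<omega>))"
    and ca: "wa * par m $ R\<^sub>\<alpha> * ip va (\<lambda>t \<omega>. va' t \<omega> - va t \<omega>) + par m $ D\<^sub>\<alpha> * ip \<pi>a (\<lambda>t \<omega>. va' t \<omega> - va t \<omega>) = 0"
    and cb: "wb * par m $ R\<^sub>\<beta> * ip vb (\<lambda>t \<omega>. vb' t \<omega> - vb t \<omega>) + par m $ D\<^sub>\<beta> * ip \<pi>b (\<lambda>t \<omega>. vb' t \<omega> - vb t \<omega>) = 0"
  shows "wa * J_alpha P T (par m) xa xb z va + wb * J_beta P T (par m) xa xb z vb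
    \<le> wa * J_alpha P T (par m) xa' xb' z' va' + wb * J_beta P T (par m) xa' xb' z' vb'"
proof -
  let ?\<theta> = "par m" and ?F = "full_filtration P W m" and ?G = "leader_filtration P W m"
  note \<F> = filtration_full[OF m] and \<G> = filtration_leader[OF m]
  have T0: "T \<in> {0..T}" using T_pos by simp
  from out obtain u x1 where opt: "follower_optimal P W T m xa xb z u x1"
    and zm: "\<And>t. t \<in> {0..T} \<Longrightarrow> AE \<omega> in P. z t \<omega> = real_cond_exp P (?G t) (x1 t) \<omega>"
    unfolding leader_outcome_def Let_def by blast
  from out' obtain u' x1' where opt': "follower_optimal P W T m xa' xb' z' u' x1'"
    and zm': "\<And>t. t \<in> {0..T} \<Longrightarrow> AE \<omega> in P. z' t \<omega> = real_cond_exp P (?G t) (x1' t) \<omega>"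
    unfolding leader_outcome_def Let_def by blast
  have L2: "L2_process P T ?G va" "L2_process P T ?G vb" "L2_process P T ?G va'" "L2_process P T ?G vb'"
    and sx: "state_process P T ?G xa" "state_process P T ?G xb" "state_process P T ?G z"
      "state_process P T ?G xa'" "state_process P T ?G xb'" "state_process P T ?G z'"
    using out out' unfolding leader_outcome_def Let_def by blast+
  have xa: "AE \<omega> in P. \<forall>t\<in>{0..T}. xa t \<omega> = eta m \<omega> $ Alpha +
          (LBINT s:{0..t}. ?\<theta> $ A\<^sub>\<alpha> * xa s \<omega> + ?\<theta> $ B\<^sub>\<alpha> * xb s \<omega> + ?\<theta> $ C\<^sub>\<alpha> * z s \<omega> + ?\<theta> $ D\<^sub>\<alpha> * va s \<omega>)
          + ?\<theta> $ \<sigma>\<^sub>\<alpha> * W Alpha t \<omega>"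
    and xb: "AE \<omega> in P. \<forall>t\<in>{0..T}. xb t \<omega> = eta m \<omega> $ Beta +
          (LBINT s:{0..t}. ?\<theta> $ A\<^sub>\<beta> * xa s \<omega> + ?\<theta> $ B\<^sub>\<beta> * xb s \<omega> + ?\<theta> $ C\<^sub>\<beta> * z s \<omega> + ?\<theta> $ D\<^sub>\<beta> * vb s \<omega>)
          + ?\<theta> $ \<sigma>\<^sub>\<beta> * W Beta t \<omega>"
    using out unfolding leader_outcome_def Let_def by blast+
  have xa': "AE \<omega> in P. \<forall>t\<in>{0..T}. xa' t \<omega> = eta m \<omega> $ Alpha +
          (LBINT s:{0..t}. ?\<theta> $ A\<^sub>\<alpha> * xa' s \<omega> + ?\<theta> $ B\<^sub>\<alpha> * xb' s \<omega> + ?\<theta> $ C\<^sub>\<alpha> * z' s \<omega> + ?\<theta> $ D\<^sub>\<alpha> * va' s \<omega>)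
          + ?\<theta> $ \<sigma>\<^sub>\<alpha> * W Alpha t \<omega>"
    and xb': "AE \<omega> in P. \<forall>t\<in>{0..T}. xb' t \<omega> = eta m \<omega> $ Beta +
          (LBINT s:{0..t}. ?\<theta> $ A\<^sub>\<beta> * xa' s \<omega> + ?\<theta> $ B\<^sub>\<beta> * xb' s \<omega> + ?\<theta> $ C\<^sub>\<beta> * z' s \<omega> + ?\<theta> $ D\<^sub>\<beta> * vb' s \<omega>)
          + ?\<theta> $ \<sigma>\<^sub>\<beta> * W Beta t \<omega>"
    using out' unfolding leader_outcome_def Let_def by blast+
  have ux: "L2_process P T ?F u" "L2_process P T ?F u'" "state_process P T ?F x1" "state_process P T ?F x1'"
    and px1: "AE \<omega> in P. \<forall>t\<in>{0..T}. x1 t \<omega> = eta m \<omega> $ Follower +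
          (LBINT s:{0..t}. ?\<theta> $ A\<^sub>1 * x1 s \<omega> + ?\<theta> $ B\<^sub>1 * z s \<omega> + ?\<theta> $ C\<^sub>1 * xa s \<omega>
             + ?\<theta> $ D\<^sub>1 * xb s \<omega> + ?\<theta> $ E\<^sub>1 * u s \<omega>) + ?\<theta> $ \<sigma>\<^sub>1 * W Follower t \<omega>"
    and px1': "AE \<omega> in P. \<forall>t\<in>{0..T}. x1' t \<omega> = eta m \<omega> $ Follower +
          (LBINT s:{0..t}. ?\<theta> $ A\<^sub>1 * x1' s \<omega> + ?\<theta> $ B\<^sub>1 * z' s \<omega> + ?\<theta> $ C\<^sub>1 * xa' s \<omega>
             + ?\<theta> $ D\<^sub>1 * xb' s \<omega> + ?\<theta> $ E\<^sub>1 * u' s \<omega>) + ?\<theta> $ \<sigma>\<^sub>1 * W Follower t \<omega>"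
    using opt opt' unfolding follower_optimal_def follower_response_def Let_def by blast+
  have fullL: "L2_process P T ?F v" if "L2_process P T ?G v" for v by (rule L2_process_leader_full[OF that])
  have sLG: "L2_process P T ?G v" if "state_process P T ?G v" for v using that by (simp add: state_process_def)
  have sLF: "L2_process P T ?F v" if "state_process P T ?F v" for v using that by (simp add: state_process_def)
  have S: "sqp xa" "sqp xb" "sqp z" "sqp xa'" "sqp xb'" "sqp z'" "sqp va" "sqp vb" "sqp va'" "sqp vb'"
      "sqp \<pi>a" "sqp \<pi>b" "sqp \<pi>z" "sqp lam"
    by (rule L2_process_sqp[OF \<G>], (rule L2 sLG sx st)+)+
  have S1: "sqp u" "sqp u'" "sqp x1" "sqp x1'"
    by (rule L2_process_sqp[OF \<F>], (rule ux sLF)+)+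
  have Q: "L2 (xa t)" "L2 (xb t)" "L2 (z t)"
      "L2 (xa' t)" "L2 (xb' t)" "L2 (z' t)"
      "L2 (\<pi>a t)" "L2 (\<pi>b t)" "L2 (\<pi>z t)" "L2 (lam t)"
      if "t \<in> {0..T}" for t
    by (rule state_process_sq[OF \<G> _ that], rule sx st)+
  have Q1: "L2 (x1 t)" "L2 (x1' t)" if "t \<in> {0..T}" for t
    by (rule state_process_sq[OF \<F> _ that], rule ux)+
  define da where "da = (\<lambda>t \<omega>. xa' t \<omega> - xa t \<omega>)"
  define db where "db = (\<lambda>t \<omega>. xb' t \<omega> - xb t \<omega>)"
  define dz where "dz = (\<lambda>t \<omega>. z' t \<omega> - z t \<omega>)"
  define d1 where "d1 = (\<lambda>t \<omega>. x1' t \<omega> - x1 t \<omega>)"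
  define dva where "dva = (\<lambda>t \<omega>. va' t \<omega> - va t \<omega>)"
  define dvb where "dvb = (\<lambda>t \<omega>. vb' t \<omega> - vb t \<omega>)"
  define du where "du = (\<lambda>t \<omega>. u' t \<omega> - u t \<omega>)"
  define ea where "ea = error_alpha ?\<theta> xa xb z"
  define eb where "eb = error_beta ?\<theta> xa xb z"
  define ga where "ga = final_error_alpha ?\<theta> xa xb z"
  define gb where "gb = final_error_beta ?\<theta> xa xb z"
  note dd = da_def db_def dz_def d1_def dva_def dvb_def du_def
  have D: "sqp da" "sqp db" "sqp dz" "sqp d1" "sqp dva" "sqp dvb" "sqp du" "sqp ea" "sqp eb"
    unfolding dd ea_def eb_def by (intro sqp_diff error_sqp S S1)+
  have DT: "L2 (da T)" "L2 (db T)" "L2 (dz T)" "L2 (d1 T)"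
      "L2 ga" "L2 gb"
    unfolding dd ga_def gb_def by (intro square_integrable_diff final_error_sq Q[OF T0] Q1[OF T0])+
  note QT = Q[OF T0]
  have L2d: "L2_process P T ?G da" "L2_process P T ?G db" "L2_process P T ?G dz" "L2_process P T ?G dva" "L2_process P T ?G dvb"
    unfolding dd
    by (rule L2_process_diff[OF \<G>]; (rule L2 | rule sLG, rule sx))+
  have L2f: "L2_process P T ?F d1" "L2_process P T ?F du"
    unfolding dd
    by (rule L2_process_diff[OF \<F>]; (rule ux(1,2) | rule sLF, rule ux(3,4)))+
  have meas_lin: "(\<lambda>\<omega>. f t \<omega>) \<in> borel_measurable (?F t)" if "t \<in> {0..T}" "L2_process P T ?F f" for f t
    by (rule L2_process_adapted[OF that(2,1)])
  note lin = L2_process_add[OF \<F>] L2_process_cmult[OF \<F>]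
  let ?fa = "\<lambda>s \<omega>. ?\<theta> $ A\<^sub>\<alpha> * da s \<omega> + ?\<theta> $ B\<^sub>\<alpha> * db s \<omega> + ?\<theta> $ C\<^sub>\<alpha> * dz s \<omega> + ?\<theta> $ D\<^sub>\<alpha> * dva s \<omega>"
  let ?fb = "\<lambda>s \<omega>. ?\<theta> $ A\<^sub>\<beta> * da s \<omega> + ?\<theta> $ B\<^sub>\<beta> * db s \<omega> + ?\<theta> $ C\<^sub>\<beta> * dz s \<omega> + ?\<theta> $ D\<^sub>\<beta> * dvb s \<omega>"
  let ?f1 = "\<lambda>s \<omega>. ?\<theta> $ A\<^sub>1 * d1 s \<omega> + ?\<theta> $ B\<^sub>1 * dz s \<omega> + ?\<theta> $ C\<^sub>1 * da s \<omega> + ?\<theta> $ D\<^sub>1 * db s \<omega> + ?\<theta> $ E\<^sub>1 * du s \<omega>"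
  have fL: "L2_process P T ?F ?fa" "L2_process P T ?F ?fb" "L2_process P T ?F ?f1"
    by (intro lin fullL L2d L2f)+
  have fS: "sqp ?fa" "sqp ?fb" "sqp ?f1" by (intro sqp_intros D)+
  have pda: "AE \<omega> in P. \<forall>t\<in>{0..T}. da t \<omega> = (LBINT s:{0..t}. ?fa s \<omega>)"
    unfolding da_def
    by (rule path_diff[OF _ _ xa xa']) (intro sqp_intros S, intro sqp_intros S, simp add: dd algebra_simps)
  have pdb: "AE \<omega> in P. \<forall>t\<in>{0..T}. db t \<omega> = (LBINT s:{0..t}. ?fb s \<omega>)"
    unfolding db_def
    by (rule path_diff[OF _ _ xb xb']) (intro sqp_intros S, intro sqp_intros S, simp add: dd algebra_simps)
  have pd1: "AE \<omega> in P. \<forall>t\<in>{0..T}. d1 t \<omega> = (LBINT s:{0..t}. ?f1 s \<omega>)"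
    unfolding d1_def
    by (rule path_diff[OF _ _ px1 px1']) (intro sqp_intros S S1, intro sqp_intros S S1, simp add: dd algebra_simps)
  let ?ka = "\<lambda>t \<omega>. ?\<theta> $ A\<^sub>\<alpha> * \<pi>a t \<omega> + ?\<theta> $ A\<^sub>\<beta> * \<pi>b t \<omega> + ?\<theta> $ C\<^sub>1 * \<pi>z t \<omega>
       + wa * ?\<theta> $ Q\<^sub>\<alpha> * ea t \<omega> - wb * ?\<theta> $ Q\<^sub>\<beta> * ?\<theta> $ G\<^sub>\<beta> * eb t \<omega> - ?\<theta> $ Q\<^sub>1 * ?\<theta> $ G\<^sub>1 * lam t \<omega>"
  let ?kb = "\<lambda>t \<omega>. ?\<theta> $ B\<^sub>\<alpha> * \<pi>a t \<omega> + ?\<theta> $ B\<^sub>\<beta> * \<pi>b t \<omega> + ?\<theta> $ D\<^sub>1 * \<pi>z t \<omega>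
       - wa * ?\<theta> $ Q\<^sub>\<alpha> * ?\<theta> $ G\<^sub>\<alpha> * ea t \<omega> + wb * ?\<theta> $ Q\<^sub>\<beta> * eb t \<omega> - ?\<theta> $ Q\<^sub>1 * ?\<theta> $ H\<^sub>1 * lam t \<omega>"
  let ?kz = "\<lambda>t \<omega>. ?\<theta> $ C\<^sub>\<alpha> * \<pi>a t \<omega> + ?\<theta> $ C\<^sub>\<beta> * \<pi>b t \<omega> + (?\<theta> $ A\<^sub>1 + ?\<theta> $ B\<^sub>1) * \<pi>z t \<omega>
       - wa * ?\<theta> $ Q\<^sub>\<alpha> * ?\<theta> $ F\<^sub>\<alpha> * ea t \<omega> - wb * ?\<theta> $ Q\<^sub>\<beta> * ?\<theta> $ F\<^sub>\<beta> * eb t \<omega> + ?\<theta> $ Q\<^sub>1 * (1 - ?\<theta> $ F\<^sub>1) * lam t \<omega>"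
  have kS: "sqp ?ka" "sqp ?kb" "sqp ?kz" by (intro sqp_intros D S)+
  have dual_a: "ex (\<pi>a T) (da T) = ip \<pi>a ?fa - ip ?ka da"
    by (rule backward_duality[OF m state_process_leader_full[OF st(1)] kS(1) bwa[folded ea_def eb_def] meas_lin[OF _ fL(1)] fS(1) D(1) DT(1) pda])
  have dual_b: "ex (\<pi>b T) (db T) = ip \<pi>b ?fb - ip ?kb db"
    by (rule backward_duality[OF m state_process_leader_full[OF st(2)] kS(2) bwb[folded ea_def eb_def] meas_lin[OF _ fL(2)] fS(2) D(2) DT(2) pdb])
  \<comment> \<open>\<open>\<pi>z\<close> is paired with the change \<open>d1\<close> of the
    follower's state, since that state has an equation, whereas the change of \<open>z\<close> is
    known only as its conditional mean.\<close>
  have dual_z: "ex (\<pi>z T) (d1 T) = ip \<pi>z ?f1 - ip ?kz d1"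
    by (rule backward_duality[OF m state_process_leader_full[OF st(3)] kS(3) bwz[folded ea_def eb_def] meas_lin[OF _ fL(3)] fS(3) D(4) DT(4) pd1])
  have sG: "\<kappa> t \<in> borel_measurable (?G t)" if "L2_process P T ?G \<kappa>" "t \<in> {0..T}" for \<kappa> t
    by (rule L2_process_adapted[OF that])
  \<comment> \<open>Replaces \<open>d1\<close> by the change of the mean field against anything the
    leaders can observe: the adjoints, \<open>lam\<close> and both errors.\<close>
  have proj: "ip \<kappa> d1 = ip \<kappa> dz" if "L2_process P T ?G \<kappa>" for \<kappa>
  proof -
    have k: "sqp \<kappa>" by (rule L2_process_sqp[OF \<G> that])
    have "ip \<kappa> z = ip \<kappa> x1" "ip \<kappa> z' = ip \<kappa> x1'"
      by (rule conditional_mean_ip[OF m zm S1(3) S(3) Q1(1) Q(3) sG[OF that] k]; assumption)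
        (rule conditional_mean_ip[OF m zm' S1(4) S(6) Q1(2) Q(6) sG[OF that] k]; assumption)
    then show ?thesis unfolding dd by (simp add: ip_diff' k S S1)
  qed
  have projT: "ex \<zeta> (d1 T) = ex \<zeta> (dz T)" if "\<zeta> \<in> borel_measurable (?G T)" "L2 \<zeta>" for \<zeta>
    unfolding dd
    using conditional_mean_ex[OF m zm[OF T0] Q1(1)[OF T0] Q(3)[OF T0] that] conditional_mean_ex[OF m zm'[OF T0] Q1(2)[OF T0] Q(6)[OF T0] that]
    by (simp add: ex_diff' that QT Q1[OF T0])
  have L2ea: "L2_process P T ?G ea" "L2_process P T ?G eb"
  proof -
    have c: "L2_process P T ?G (\<lambda>t \<omega>. c)" for c :: real
      unfolding L2_process_iff[OF \<G>] by (simp add: sqp_const case_prod_beta')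
    have "ea = (\<lambda>t \<omega>. xa t \<omega> + (- ?\<theta> $ F\<^sub>\<alpha>) * z t \<omega> + (- ?\<theta> $ G\<^sub>\<alpha>) * xb t \<omega> + - ?\<theta> $ M\<^sub>\<alpha>)"
      "eb = (\<lambda>t \<omega>. xb t \<omega> + (- ?\<theta> $ F\<^sub>\<beta>) * z t \<omega> + (- ?\<theta> $ G\<^sub>\<beta>) * xa t \<omega> + - ?\<theta> $ M\<^sub>\<beta>)"
      by (simp_all add: ea_def eb_def error_alpha_def[abs_def] error_beta_def[abs_def])
    then show "L2_process P T ?G ea" "L2_process P T ?G eb"
      by (simp_all only:) (intro L2_process_add[OF \<G>] L2_process_cmult[OF \<G>] sLG sx c)+
  qed
  have projs: "ip \<pi>z d1 = ip \<pi>z dz" "ip lam d1 = ip lam dz" "ip \<pi>a d1 = ip \<pi>a dz" "ip \<pi>b d1 = ip \<pi>b dz"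
      "ip ea d1 = ip ea dz" "ip eb d1 = ip eb dz"
    by (rule proj, (rule L2ea sLG st)+)+
  have projTs: "ex (lam T) (d1 T) = ex (lam T) (dz T)" "ex (\<pi>z T) (d1 T) = ex (\<pi>z T) (dz T)"
    by (rule projT, rule sG, rule sLG, rule st, rule T0, rule QT)+
  \<comment> \<open>The control that generates \<open>lam\<close>. Its factor is tuned so that
    \<open>R\<^sub>1\<close> times its pairing with \<open>du\<close> equals
    \<open>- E\<^sub>1\<close> times the pairing of \<open>\<pi>z\<close> with
    \<open>du\<close>.\<close>
  let ?v = "\<lambda>s \<omega>. - (?\<theta> $ E\<^sub>1 / ?\<theta> $ R\<^sub>1) * \<pi>z s \<omega>"
  have vL: "L2_process P T ?F ?v" by (intro lin fullL sLG st)
  have vS: "sqp ?v" by (intro sqp_intros S)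
  note lamF = state_process_leader_full[OF st(4)]
  have s1: "?\<theta> $ Q\<^sub>1 * ip (follower_error ?\<theta> xa xb z x1) lam + ?\<theta> $ R\<^sub>1 * ip u ?v
     + ?\<theta> $ Qb\<^sub>1 * ex (follower_final_error ?\<theta> xa xb z x1) (lam T) = 0"
    by (rule follower_stationary[OF m opt S(1-3) QT(1-3) vL lamF lam])
  have s2: "?\<theta> $ Q\<^sub>1 * ip (follower_error ?\<theta> xa' xb' z' x1') lam + ?\<theta> $ R\<^sub>1 * ip u' ?v
     + ?\<theta> $ Qb\<^sub>1 * ex (follower_final_error ?\<theta> xa' xb' z' x1') (lam T) = 0"
    by (rule follower_stationary[OF m opt' S(4-6) QT(4-6) vL lamF lam])
  have e1: "sqp (follower_error ?\<theta> xa xb z x1)" "L2 (follower_final_error ?\<theta> xa xb z x1)"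
    by (intro follower_error_sqp follower_final_error_sq S S1 QT Q1[OF T0])+
  have "follower_error ?\<theta> xa' xb' z' x1' = (\<lambda>t \<omega>. follower_error ?\<theta> xa xb z x1 t \<omega> +
      (d1 t \<omega> - ?\<theta> $ F\<^sub>1 * dz t \<omega> - ?\<theta> $ G\<^sub>1 * da t \<omega> - ?\<theta> $ H\<^sub>1 * db t \<omega>))"
    by (simp add: fun_eq_iff follower_error_def dd algebra_simps)
  then have err: "ip (follower_error ?\<theta> xa' xb' z' x1') lam = ip (follower_error ?\<theta> xa xb z x1) lam +
      (ip lam dz - ?\<theta> $ F\<^sub>1 * ip lam dz - ?\<theta> $ G\<^sub>1 * ip lam da - ?\<theta> $ H\<^sub>1 * ip lam db)"
    by (simp add: ip_simps sqp_intros D S e1 projs flip: ip_commute[of lam])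
  have "follower_final_error ?\<theta> xa' xb' z' x1' = (\<lambda>\<omega>. follower_final_error ?\<theta> xa xb z x1 \<omega> +
      (d1 T \<omega> - ?\<theta> $ Fb\<^sub>1 * dz T \<omega> - ?\<theta> $ Gb\<^sub>1 * da T \<omega> - ?\<theta> $ Hb\<^sub>1 * db T \<omega>))"
    by (simp add: fun_eq_iff follower_final_error_def dd algebra_simps)
  then have errT: "ex (follower_final_error ?\<theta> xa' xb' z' x1') (lam T) = ex (follower_final_error ?\<theta> xa xb z x1) (lam T) +
      (ex (lam T) (dz T) - ?\<theta> $ Fb\<^sub>1 * ex (lam T) (dz T) - ?\<theta> $ Gb\<^sub>1 * ex (lam T) (da T) - ?\<theta> $ Hb\<^sub>1 * ex (lam T) (db T))"
    by (simp add: ex_simps square_integrable_diff square_integrable_cmult DT QT e1 projTs flip: ex_commute[of "lam T"])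
  have "u' = (\<lambda>t \<omega>. u t \<omega> + du t \<omega>)" by (simp add: du_def)
  then have "ip u' ?v = ip u ?v + ip du ?v" by (simp only: ip_add[OF S1(1) D(7) vS])
  moreover have "?\<theta> $ R\<^sub>1 * ip du ?v = - (?\<theta> $ E\<^sub>1 * ip \<pi>z du)"
  proof -
    have "?\<theta> $ R\<^sub>1 \<noteq> 0" using m by (auto simp: is_model_def Let_def)
    moreover have "ip du ?v = - (?\<theta> $ E\<^sub>1 / ?\<theta> $ R\<^sub>1) * ip du \<pi>z" by (rule ip_cmult')
    ultimately show ?thesis by (simp add: ip_commute[of du \<pi>z])
  qed
  \<comment> \<open>Difference of the follower's two stationarity conditions. It evaluates
    \<open>E\<^sub>1\<close> times the pairing of \<open>\<pi>z\<close> with \<open>du\<close>, the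
    only term in the duality identities that contains the unknown reaction of the follower's
    control.\<close>
  ultimately have stat: "?\<theta> $ Q\<^sub>1 * (ip lam dz - ?\<theta> $ F\<^sub>1 * ip lam dz - ?\<theta> $ G\<^sub>1 * ip lam da - ?\<theta> $ H\<^sub>1 * ip lam db)
      - ?\<theta> $ E\<^sub>1 * ip \<pi>z du
      + ?\<theta> $ Qb\<^sub>1 * (ex (lam T) (dz T) - ?\<theta> $ Fb\<^sub>1 * ex (lam T) (dz T) - ?\<theta> $ Gb\<^sub>1 * ex (lam T) (da T) - ?\<theta> $ Hb\<^sub>1 * ex (lam T) (db T)) = 0"
    using s1 s2 unfolding err errT by (simp add: distrib_left)
  have Ta: "ex (\<pi>a T) (da T) = wa * ?\<theta> $ Qb\<^sub>\<alpha> * ex ga (da T) - wb * ?\<theta> $ Qb\<^sub>\<beta> * ?\<theta> $ Gb\<^sub>\<beta> * ex gb (da T)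
      - ?\<theta> $ Qb\<^sub>1 * ?\<theta> $ Gb\<^sub>1 * ex (lam T) (da T)"
    by (subst ex_cong_AE[OF fa[folded ga_def gb_def]])
      (simp_all add: ex_simps square_integrable_diff square_integrable_cmult DT QT)
  have Tb: "ex (\<pi>b T) (db T) = - (wa * ?\<theta> $ Qb\<^sub>\<alpha> * ?\<theta> $ Gb\<^sub>\<alpha> * ex ga (db T)) + wb * ?\<theta> $ Qb\<^sub>\<beta> * ex gb (db T)
      - ?\<theta> $ Qb\<^sub>1 * ?\<theta> $ Hb\<^sub>1 * ex (lam T) (db T)"
    by (subst ex_cong_AE[OF fb[folded ga_def gb_def]])
      (simp_all add: ex_simps ex_minus square_integrable_minus square_integrable_add square_integrable_diff square_integrable_cmult DT QT)
  have Tz: "ex (\<pi>z T) (dz T) = - (wa * ?\<theta> $ Qb\<^sub>\<alpha> * ?\<theta> $ Fb\<^sub>\<alpha> * ex ga (dz T)) - wb * ?\<theta> $ Qb\<^sub>\<beta> * ?\<theta> $ Fb\<^sub>\<beta> * ex gb (dz T)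
      + ?\<theta> $ Qb\<^sub>1 * (1 - ?\<theta> $ Fb\<^sub>1) * ex (lam T) (dz T)"
    by (subst ex_cong_AE[OF fz[folded ga_def gb_def]])
      (simp_all add: ex_simps ex_minus square_integrable_minus square_integrable_add square_integrable_diff square_integrable_cmult DT QT)
  have fexp: "ip \<pi>a ?fa = ?\<theta> $ A\<^sub>\<alpha> * ip \<pi>a da + ?\<theta> $ B\<^sub>\<alpha> * ip \<pi>a db + ?\<theta> $ C\<^sub>\<alpha> * ip \<pi>a dz + ?\<theta> $ D\<^sub>\<alpha> * ip \<pi>a dva"
    "ip \<pi>b ?fb = ?\<theta> $ A\<^sub>\<beta> * ip \<pi>b da + ?\<theta> $ B\<^sub>\<beta> * ip \<pi>b db + ?\<theta> $ C\<^sub>\<beta> * ip \<pi>b dz + ?\<theta> $ D\<^sub>\<beta> * ip \<pi>b dvb"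
    "ip \<pi>z ?f1 = ?\<theta> $ A\<^sub>1 * ip \<pi>z dz + ?\<theta> $ B\<^sub>1 * ip \<pi>z dz + ?\<theta> $ C\<^sub>1 * ip \<pi>z da + ?\<theta> $ D\<^sub>1 * ip \<pi>z db + ?\<theta> $ E\<^sub>1 * ip \<pi>z du"
    by (simp_all add: ip_simps sqp_intros D S projs)
  have kexp: "ip ?ka da = ?\<theta> $ A\<^sub>\<alpha> * ip \<pi>a da + ?\<theta> $ A\<^sub>\<beta> * ip \<pi>b da + ?\<theta> $ C\<^sub>1 * ip \<pi>z da
       + wa * ?\<theta> $ Q\<^sub>\<alpha> * ip ea da - wb * ?\<theta> $ Q\<^sub>\<beta> * ?\<theta> $ G\<^sub>\<beta> * ip eb da - ?\<theta> $ Q\<^sub>1 * ?\<theta> $ G\<^sub>1 * ip lam da"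
    "ip ?kb db = ?\<theta> $ B\<^sub>\<alpha> * ip \<pi>a db + ?\<theta> $ B\<^sub>\<beta> * ip \<pi>b db + ?\<theta> $ D\<^sub>1 * ip \<pi>z db
       - wa * ?\<theta> $ Q\<^sub>\<alpha> * ?\<theta> $ G\<^sub>\<alpha> * ip ea db + wb * ?\<theta> $ Q\<^sub>\<beta> * ip eb db - ?\<theta> $ Q\<^sub>1 * ?\<theta> $ H\<^sub>1 * ip lam db"
    "ip ?kz d1 = ?\<theta> $ C\<^sub>\<alpha> * ip \<pi>a dz + ?\<theta> $ C\<^sub>\<beta> * ip \<pi>b dz + (?\<theta> $ A\<^sub>1 + ?\<theta> $ B\<^sub>1) * ip \<pi>z dz
       - wa * ?\<theta> $ Q\<^sub>\<alpha> * ?\<theta> $ F\<^sub>\<alpha> * ip ea dz - wb * ?\<theta> $ Q\<^sub>\<beta> * ?\<theta> $ F\<^sub>\<beta> * ip eb dz + ?\<theta> $ Q\<^sub>1 * (1 - ?\<theta> $ F\<^sub>1) * ip lam dz"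
    by (simp_all add: ip_simps sqp_intros D S projs)
  have ca': "wa * ?\<theta> $ R\<^sub>\<alpha> * ip va dva + ?\<theta> $ D\<^sub>\<alpha> * ip \<pi>a dva = 0" using ca by (simp add: dva_def)
  have cb': "wb * ?\<theta> $ R\<^sub>\<beta> * ip vb dvb + ?\<theta> $ D\<^sub>\<beta> * ip \<pi>b dvb = 0" using cb by (simp add: dvb_def)
  \<comment> \<open>The three duality identities, the stationarity difference and the two control
    conditions are combined: all adjoint terms cancel and the directional derivative of the weighted
    cost remains.\<close>
  have lin0: "wa * (?\<theta> $ Q\<^sub>\<alpha> * (ip ea da - ?\<theta> $ F\<^sub>\<alpha> * ip ea dz - ?\<theta> $ G\<^sub>\<alpha> * ip ea db) + ?\<theta> $ R\<^sub>\<alpha> * ip va dva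
        + ?\<theta> $ Qb\<^sub>\<alpha> * (ex ga (da T) - ?\<theta> $ Fb\<^sub>\<alpha> * ex ga (dz T) - ?\<theta> $ Gb\<^sub>\<alpha> * ex ga (db T)))
    + wb * (?\<theta> $ Q\<^sub>\<beta> * (ip eb db - ?\<theta> $ F\<^sub>\<beta> * ip eb dz - ?\<theta> $ G\<^sub>\<beta> * ip eb da) + ?\<theta> $ R\<^sub>\<beta> * ip vb dvb
        + ?\<theta> $ Qb\<^sub>\<beta> * (ex gb (db T) - ?\<theta> $ Fb\<^sub>\<beta> * ex gb (dz T) - ?\<theta> $ Gb\<^sub>\<beta> * ex gb (da T))) = 0"
    using dual_a dual_b dual_z stat ca' cb'
    unfolding Ta Tb projTs(2) Tz fexp kexp
    by (simp add: algebra_simps)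
  have nn: "0 \<le> ?\<theta> $ Q\<^sub>\<alpha>" "0 \<le> ?\<theta> $ R\<^sub>\<alpha>" "0 \<le> ?\<theta> $ Qb\<^sub>\<alpha>" "0 \<le> ?\<theta> $ Q\<^sub>\<beta>" "0 \<le> ?\<theta> $ R\<^sub>\<beta>" "0 \<le> ?\<theta> $ Qb\<^sub>\<beta>"
    using m by (auto simp: is_model_def Let_def)
  have Ja: "J_alpha P T ?\<theta> xa xb z va + 2 * (?\<theta> $ Q\<^sub>\<alpha> * (ip ea da - ?\<theta> $ F\<^sub>\<alpha> * ip ea dz - ?\<theta> $ G\<^sub>\<alpha> * ip ea db) + ?\<theta> $ R\<^sub>\<alpha> * ip va dva
        + ?\<theta> $ Qb\<^sub>\<alpha> * (ex ga (da T) - ?\<theta> $ Fb\<^sub>\<alpha> * ex ga (dz T) - ?\<theta> $ Gb\<^sub>\<alpha> * ex ga (db T))) \<le> J_alpha P T ?\<theta> xa' xb' z' va'"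
  proof -
    have "(\<lambda>t \<omega>. error_alpha ?\<theta> xa' xb' z' t \<omega> - ea t \<omega>) = (\<lambda>t \<omega>. da t \<omega> - ?\<theta> $ F\<^sub>\<alpha> * dz t \<omega> - ?\<theta> $ G\<^sub>\<alpha> * db t \<omega>)"
      "(\<lambda>\<omega>. final_error_alpha ?\<theta> xa' xb' z' \<omega> - ga \<omega>) = (\<lambda>\<omega>. da T \<omega> - ?\<theta> $ Fb\<^sub>\<alpha> * dz T \<omega> - ?\<theta> $ Gb\<^sub>\<alpha> * db T \<omega>)"
      by (simp_all add: fun_eq_iff ea_def ga_def error_alpha_def final_error_alpha_def dd algebra_simps)
    then have "ip ea (\<lambda>t \<omega>. error_alpha ?\<theta> xa' xb' z' t \<omega> - ea t \<omega>) = ip ea da - ?\<theta> $ F\<^sub>\<alpha> * ip ea dz - ?\<theta> $ G\<^sub>\<alpha> * ip ea db"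
      "ex ga (\<lambda>\<omega>. final_error_alpha ?\<theta> xa' xb' z' \<omega> - ga \<omega>) = ex ga (da T) - ?\<theta> $ Fb\<^sub>\<alpha> * ex ga (dz T) - ?\<theta> $ Gb\<^sub>\<alpha> * ex ga (db T)"
      by (simp_all add: ip_simps ex_simps sqp_intros square_integrable_diff square_integrable_cmult D DT)
    moreover have "ip va (\<lambda>t \<omega>. va' t \<omega> - va t \<omega>) = ip va dva" by (simp add: dva_def)
    ultimately show ?thesis
      using lq_cost_convex[OF S(7,9) D(8) error_sqp(1)[OF S(4-6), of ?\<theta>] DT(5) final_error_sq(1)[of xa' xb' z' ?\<theta>, OF QT(4-6)] nn(1-3)]
      unfolding J_alpha_eq ea_def[symmetric] ga_def[symmetric] by simp
  qed
  have Jb: "J_beta P T ?\<theta> xa xb z vb + 2 * (?\<theta> $ Q\<^sub>\<beta> * (ip eb db - ?\<theta> $ F\<^sub>\<beta> * ip eb dz - ?\<theta> $ G\<^sub>\<beta> * ip eb da) + ?\<theta> $ R\<^sub>\<beta> * ip vb dvb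
        + ?\<theta> $ Qb\<^sub>\<beta> * (ex gb (db T) - ?\<theta> $ Fb\<^sub>\<beta> * ex gb (dz T) - ?\<theta> $ Gb\<^sub>\<beta> * ex gb (da T))) \<le> J_beta P T ?\<theta> xa' xb' z' vb'"
  proof -
    have "(\<lambda>t \<omega>. error_beta ?\<theta> xa' xb' z' t \<omega> - eb t \<omega>) = (\<lambda>t \<omega>. db t \<omega> - ?\<theta> $ F\<^sub>\<beta> * dz t \<omega> - ?\<theta> $ G\<^sub>\<beta> * da t \<omega>)"
      "(\<lambda>\<omega>. final_error_beta ?\<theta> xa' xb' z' \<omega> - gb \<omega>) = (\<lambda>\<omega>. db T \<omega> - ?\<theta> $ Fb\<^sub>\<beta> * dz T \<omega> - ?\<theta> $ Gb\<^sub>\<beta> * da T \<omega>)"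
      by (simp_all add: fun_eq_iff eb_def gb_def error_beta_def final_error_beta_def dd algebra_simps)
    then have "ip eb (\<lambda>t \<omega>. error_beta ?\<theta> xa' xb' z' t \<omega> - eb t \<omega>) = ip eb db - ?\<theta> $ F\<^sub>\<beta> * ip eb dz - ?\<theta> $ G\<^sub>\<beta> * ip eb da"
      "ex gb (\<lambda>\<omega>. final_error_beta ?\<theta> xa' xb' z' \<omega> - gb \<omega>) = ex gb (db T) - ?\<theta> $ Fb\<^sub>\<beta> * ex gb (dz T) - ?\<theta> $ Gb\<^sub>\<beta> * ex gb (da T)"
      by (simp_all add: ip_simps ex_simps sqp_intros square_integrable_diff square_integrable_cmult D DT)
    moreover have "ip vb (\<lambda>t \<omega>. vb' t \<omega> - vb t \<omega>) = ip vb dvb" by (simp add: dvb_def)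
    ultimately show ?thesis
      using lq_cost_convex[OF S(8,10) D(9) error_sqp(2)[OF S(4-6), of ?\<theta>] DT(6) final_error_sq(2)[of xa' xb' z' ?\<theta>, OF QT(4-6)] nn(4-6)]
      unfolding J_beta_eq eb_def[symmetric] gb_def[symmetric] by simp
  qed
  show ?thesis
    using mult_left_mono[OF Ja w(1)] mult_left_mono[OF Jb w(2)] lin0 by (simp add: distrib_left)
qed

end

section \<open>Existence of the equilibria\<close>

lemma mat_A_rows:
  "(mat_A \<theta> *v y) $ 1 = \<theta> $ A\<^sub>\<alpha> * y $ 1 + \<theta> $ B\<^sub>\<alpha> * y $ 2 + \<theta> $ C\<^sub>\<alpha> * y $ 3"
  "(mat_A \<theta> *v y) $ 2 = \<theta> $ A\<^sub>\<beta> * y $ 1 + \<theta> $ B\<^sub>\<beta> * y $ 2 + \<theta> $ C\<^sub>\<beta> * y $ 3"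
  "(mat_A \<theta> *v y) $ 3 = \<theta> $ C\<^sub>1 * y $ 1 + \<theta> $ D\<^sub>1 * y $ 2 + (\<theta> $ A\<^sub>1 + \<theta> $ B\<^sub>1) * y $ 3"
  "(mat_A \<theta> *v y) $ 4 = \<theta> $ A\<^sub>1 * y $ 4"
  "(mat_A \<theta> *v y) $ 5 = \<theta> $ A\<^sub>1 * y $ 5"
  by (simp_all add: mat_A_def matrix_vector_mult_def sum_5)

text \<open>What the follower's problem uses of either system: \<open>p\<^sub>3\<close> is its costate, averaged over the leaders' information.\<close>

definition system_rows :: "real ^ param \<Rightarrow> ('l::{finite, numeral}) system \<Rightarrow> bool" where
  "system_rows \<theta> S \<longleftrightarrow>
     (\<forall>q. (mB S *v q) $ 1 = (\<theta> $ D\<^sub>\<alpha>)\<^sup>2 / \<theta> $ R\<^sub>\<alpha> * q $ 1 \<and> (mB S *v q) $ 2 = (\<theta> $ D\<^sub>\<beta>)\<^sup>2 / \<theta> $ R\<^sub>\<beta> * q $ 2 \<and>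
       (mB S *v q) $ 3 = (\<theta> $ E\<^sub>1)\<^sup>2 / \<theta> $ R\<^sub>1 * q $ 3 \<and> (mB S *v q) $ 4 = (\<theta> $ E\<^sub>1)\<^sup>2 / \<theta> $ R\<^sub>1 * q $ 4 \<and>
       (mB S *v q) $ 5 = (\<theta> $ E\<^sub>1)\<^sup>2 / \<theta> $ R\<^sub>1 * q $ 5) \<and>
     (\<forall>q y. (mC S *v q + mD S *v y + mM S) $ 3 = \<theta> $ A\<^sub>1 * q $ 3 +
       \<theta> $ Q\<^sub>1 * ((1 - \<theta> $ F\<^sub>1) * y $ 3 - \<theta> $ G\<^sub>1 * y $ 1 - \<theta> $ H\<^sub>1 * y $ 2 - \<theta> $ M\<^sub>1)) \<and>
     (\<forall>y. (mE S *v y + mh S) $ 3 =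
       \<theta> $ Qb\<^sub>1 * ((1 - \<theta> $ Fb\<^sub>1) * y $ 3 - \<theta> $ Gb\<^sub>1 * y $ 1 - \<theta> $ Hb\<^sub>1 * y $ 2 - \<theta> $ Mb\<^sub>1))"

lemma barred_nth:
  "barred \<theta> $ Q\<^sub>\<alpha> = \<theta> $ Qb\<^sub>\<alpha>" "barred \<theta> $ F\<^sub>\<alpha> = \<theta> $ Fb\<^sub>\<alpha>" "barred \<theta> $ G\<^sub>\<alpha> = \<theta> $ Gb\<^sub>\<alpha>" "barred \<theta> $ M\<^sub>\<alpha> = \<theta> $ Mb\<^sub>\<alpha>"
  "barred \<theta> $ Q\<^sub>\<beta> = \<theta> $ Qb\<^sub>\<beta>" "barred \<theta> $ F\<^sub>\<beta> = \<theta> $ Fb\<^sub>\<beta>" "barred \<theta> $ G\<^sub>\<beta> = \<theta> $ Gb\<^sub>\<beta>" "barred \<theta> $ M\<^sub>\<beta> = \<theta> $ Mb\<^sub>\<beta>"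
  "barred \<theta> $ Q\<^sub>1 = \<theta> $ Qb\<^sub>1" "barred \<theta> $ F\<^sub>1 = \<theta> $ Fb\<^sub>1" "barred \<theta> $ G\<^sub>1 = \<theta> $ Gb\<^sub>1" "barred \<theta> $ H\<^sub>1 = \<theta> $ Hb\<^sub>1"
  "barred \<theta> $ M\<^sub>1 = \<theta> $ Mb\<^sub>1"
  by (simp_all add: barred_def)

lemma system_rows_nash: "system_rows \<theta> (nash_system \<theta>)"
  by (simp add: system_rows_def nash_system_def mat_BN_def mat_CN_def mat_DN_def vec_MN_def Let_def
      matrix_vector_mult_def sum_5 sum_7 barred_nth algebra_simps)

lemma mat_I1_rows:
  "(mat_I1 *v v) $ 1 = v $ 1 + v $ 7" "(mat_I1 *v v) $ 2 = v $ 2 + v $ 6" "(mat_I1 *v v) $ 3 = v $ 3"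
  "(mat_I1 *v v) $ 4 = v $ 4" "(mat_I1 *v v) $ 5 = v $ 5"
  by (simp_all add: mat_I1_def matrix_vector_mult_def sum_7)

lemma mat_I2_rows:
  "(mat_I2 *v v) $ 1 = v $ 1" "(mat_I2 *v v) $ 2 = v $ 2" "(mat_I2 *v v) $ 3 = v $ 3"
  "(mat_I2 *v v) $ 4 = v $ 4" "(mat_I2 *v v) $ 5 = v $ 5" "(mat_I2 *v v) $ 6 = 0" "(mat_I2 *v v) $ 7 = 0"
  by (simp_all add: mat_I2_def matrix_vector_mult_def sum_5)

lemma mat_CN_rows:
  "(mat_CN \<theta> *v q) $ 1 = \<theta> $ A\<^sub>\<alpha> * q $ 1 + \<theta> $ C\<^sub>1 * q $ 4 + \<theta> $ A\<^sub>\<beta> * q $ 6"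
  "(mat_CN \<theta> *v q) $ 2 = \<theta> $ B\<^sub>\<beta> * q $ 2 + \<theta> $ D\<^sub>1 * q $ 5 + \<theta> $ B\<^sub>\<alpha> * q $ 7"
  "(mat_CN \<theta> *v q) $ 3 = \<theta> $ A\<^sub>1 * q $ 3"
  "(mat_CN \<theta> *v q) $ 4 = \<theta> $ C\<^sub>\<alpha> * q $ 1 + (\<theta> $ A\<^sub>1 + \<theta> $ B\<^sub>1) * q $ 4 + \<theta> $ C\<^sub>\<beta> * q $ 6"
  "(mat_CN \<theta> *v q) $ 5 = \<theta> $ C\<^sub>\<beta> * q $ 2 + (\<theta> $ A\<^sub>1 + \<theta> $ B\<^sub>1) * q $ 5 + \<theta> $ C\<^sub>\<alpha> * q $ 7"
  "(mat_CN \<theta> *v q) $ 6 = \<theta> $ B\<^sub>\<alpha> * q $ 1 + \<theta> $ D\<^sub>1 * q $ 4 + \<theta> $ B\<^sub>\<beta> * q $ 6"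
  "(mat_CN \<theta> *v q) $ 7 = \<theta> $ A\<^sub>\<beta> * q $ 2 + \<theta> $ C\<^sub>1 * q $ 5 + \<theta> $ A\<^sub>\<alpha> * q $ 7"
  by (simp_all add: mat_CN_def matrix_vector_mult_def sum_7)

lemma mat_DN_rows:
  "(mat_DN \<theta> *v y + vec_MN \<theta>) $ 1 = \<theta> $ Q\<^sub>\<alpha> * (y $ 1 - \<theta> $ F\<^sub>\<alpha> * y $ 3 - \<theta> $ G\<^sub>\<alpha> * y $ 2 - \<theta> $ M\<^sub>\<alpha>) - \<theta> $ Q\<^sub>1 * \<theta> $ G\<^sub>1 * y $ 4"
  "(mat_DN \<theta> *v y + vec_MN \<theta>) $ 2 = \<theta> $ Q\<^sub>\<beta> * (y $ 2 - \<theta> $ F\<^sub>\<beta> * y $ 3 - \<theta> $ G\<^sub>\<beta> * y $ 1 - \<theta> $ M\<^sub>\<beta>) - \<theta> $ Q\<^sub>1 * \<theta> $ H\<^sub>1 * y $ 5"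
  "(mat_DN \<theta> *v y + vec_MN \<theta>) $ 3 = \<theta> $ Q\<^sub>1 * ((1 - \<theta> $ F\<^sub>1) * y $ 3 - \<theta> $ G\<^sub>1 * y $ 1 - \<theta> $ H\<^sub>1 * y $ 2 - \<theta> $ M\<^sub>1)"
  "(mat_DN \<theta> *v y + vec_MN \<theta>) $ 4 = - (\<theta> $ Q\<^sub>\<alpha> * \<theta> $ F\<^sub>\<alpha> * (y $ 1 - \<theta> $ F\<^sub>\<alpha> * y $ 3 - \<theta> $ G\<^sub>\<alpha> * y $ 2 - \<theta> $ M\<^sub>\<alpha>)) + \<theta> $ Q\<^sub>1 * (1 - \<theta> $ F\<^sub>1) * y $ 4"
  "(mat_DN \<theta> *v y + vec_MN \<theta>) $ 5 = - (\<theta> $ Q\<^sub>\<beta> * \<theta> $ F\<^sub>\<beta> * (y $ 2 - \<theta> $ F\<^sub>\<beta> * y $ 3 - \<theta> $ G\<^sub>\<beta> * y $ 1 - \<theta> $ M\<^sub>\<beta>)) + \<theta> $ Q\<^sub>1 * (1 - \<theta> $ F\<^sub>1) * y $ 5"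
  "(mat_DN \<theta> *v y + vec_MN \<theta>) $ 6 = - (\<theta> $ Q\<^sub>\<alpha> * \<theta> $ G\<^sub>\<alpha> * (y $ 1 - \<theta> $ F\<^sub>\<alpha> * y $ 3 - \<theta> $ G\<^sub>\<alpha> * y $ 2 - \<theta> $ M\<^sub>\<alpha>)) - \<theta> $ Q\<^sub>1 * \<theta> $ H\<^sub>1 * y $ 4"
  "(mat_DN \<theta> *v y + vec_MN \<theta>) $ 7 = - (\<theta> $ Q\<^sub>\<beta> * \<theta> $ G\<^sub>\<beta> * (y $ 2 - \<theta> $ F\<^sub>\<beta> * y $ 3 - \<theta> $ G\<^sub>\<beta> * y $ 1 - \<theta> $ M\<^sub>\<beta>)) - \<theta> $ Q\<^sub>1 * \<theta> $ G\<^sub>1 * y $ 5"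
  by (simp_all add: mat_DN_def vec_MN_def Let_def matrix_vector_mult_def sum_5 algebra_simps power2_eq_square)

lemma mat_BP_rows: "(mat_BP \<theta> *v q) $ i = (vector [(\<theta> $ D\<^sub>\<alpha>)\<^sup>2 / \<theta> $ R\<^sub>\<alpha>, (\<theta> $ D\<^sub>\<beta>)\<^sup>2 / \<theta> $ R\<^sub>\<beta>, (\<theta> $ E\<^sub>1)\<^sup>2 / \<theta> $ R\<^sub>1,
              (\<theta> $ E\<^sub>1)\<^sup>2 / \<theta> $ R\<^sub>1, (\<theta> $ E\<^sub>1)\<^sup>2 / \<theta> $ R\<^sub>1] :: real ^ 5) $ i * q $ i"
  by (simp add: mat_BP_def matrix_vector_mult_def if_distrib if_distribR sum.delta' cong: if_cong)

lemma system_rows_pareto: "system_rows \<theta> (pareto_system \<theta>)"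
proof -
  \<comment> \<open>\<open>mat_I1\<close> is pulled to the front so that the rows of the Nash
    matrices can be reused.\<close>
  have 1: "mat_I1 *v (mat_CN \<theta> *v (mat_I2 *v q)) + mat_I1 *v (mat_DN \<theta> *v y) + mat_I1 *v vec_MN \<theta>
      = mat_I1 *v (mat_CN \<theta> *v (mat_I2 *v q) + (mat_DN \<theta> *v y + vec_MN \<theta>))" for q y
    by (simp add: vmult.add_right)
  have 2: "mat_I1 *v (mat_DN \<theta>' *v y) + mat_I1 *v vec_MN \<theta>' = mat_I1 *v (mat_DN \<theta>' *v y + vec_MN \<theta>')" for \<theta>' y
    by (simp add: vmult.add_right)
  show ?thesis
    unfolding system_rows_def pareto_system_def system.simps matrix_vector_mul_assoc[symmetric] 1 2
    by (simp only: mat_I1_rows mat_BP_rows vector_add_component[of "_ *v _" "_ + _"] mat_DN_rows mat_CN_rows mat_I2_rows barred_nth vector_5)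
      simp
qed

context game_space
begin

definition moment_bounded :: "'a process \<Rightarrow> bool" where
  "moment_bounded X \<longleftrightarrow> (\<exists>K. \<forall>t\<in>{0..T}. L2 (X t) \<and> (\<integral>\<omega>. (X t \<omega>)\<^sup>2 \<partial>P) \<le> K)"

text \<open>Convergence along the trivial filter carries no information except the moment bound of the limit, so that the closure
  properties of \<open>l2_limit\<close> apply to \<open>moment_bounded\<close>.\<close>

lemma moment_bounded_l2_limit: "moment_bounded X \<longleftrightarrow> l2_limit (bot :: unit filter) (\<lambda>_. X) X"
  by (auto simp: moment_bounded_def l2_limit_def uniform_limit_iff)

lemma l2_limit_one: "l2_limit F (\<lambda>_ _ _. 1) (\<lambda>_ _. 1)"
  by (rule l2_limit_const[where K = 1]) (simp_all add: square_integrable_const prob_space)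

lemma l2_limit_lincomb:
  assumes X: "\<And>j. l2_limit F (\<lambda>p t \<omega>. X p t \<omega> $ j) (\<lambda>t \<omega>. X0 t \<omega> $ j)"
    and K: "uniform_limit {0..T} K K0 F" "continuous_on {0..T} K0" and g: "uniform_limit {0..T} g g0 F" "continuous_on {0..T} g0"
  shows "l2_limit F (\<lambda>p t \<omega>. (K p t *v X p t \<omega> + g p t) $ i) (\<lambda>t \<omega>. (K0 t *v X0 t \<omega> + g0 t) $ i)"
proof -
  note nth = bounded_linear.uniform_limit[OF bounded_linear_vec_nth]
  have "l2_limit F (\<lambda>p t \<omega>. (\<Sum>j\<in>UNIV. K p t $ i $ j * X p t \<omega> $ j) + g p t $ i * 1)
     (\<lambda>t \<omega>. (\<Sum>j\<in>UNIV. K0 t $ i $ j * X0 t \<omega> $ j) + g0 t $ i * 1)"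
    by (intro l2_limit_add l2_limit_sum l2_limit_cmult bounded_continuous_image continuous_on_component K g X nth l2_limit_one) simp
  then show ?thesis by (simp add: matrix_vector_mult_def)
qed

lemma moment_bounded_lincomb:
  fixes X :: "real \<Rightarrow> 'a \<Rightarrow> real ^ 'n"
  assumes X: "\<And>j. moment_bounded (\<lambda>t \<omega>. X t \<omega> $ j)" and K: "continuous_on {0..T} K" and g: "continuous_on {0..T} g"
  shows "moment_bounded (\<lambda>t \<omega>. (K t *v X t \<omega> + g t) $ i)"
  using l2_limit_lincomb[OF X[unfolded moment_bounded_l2_limit] uniform_limit_const K uniform_limit_const g]
  by (simp add: moment_bounded_l2_limit)

lemma lin_state_moment_bounded:
  assumes "continuous_on {0..T} \<Phi>" "continuous_on {0..T} \<Psi>" "continuous_on {0..T} H" "continuous_on {0..T} b"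
    and "\<And>l. L2 (\<lambda>\<omega>. x0 \<omega> $ l)"
  shows "moment_bounded (\<lambda>t \<omega>. lin_state \<Phi> \<Psi> H b c \<gamma> x0 t \<omega> $ j)"
  unfolding moment_bounded_l2_limit
  by (rule lin_state_l2_limit) (use assms in \<open>auto intro: uniform_limit_const\<close>)

lemma moment_bounded_state_process:
  fixes X :: "real \<Rightarrow> 'a \<Rightarrow> real ^ 'n"
  assumes "filtration \<F>" "\<And>\<omega>. \<omega> \<in> space P \<Longrightarrow> continuous_on {0..T} (\<lambda>t. X t \<omega>)"
    and "\<And>t. t \<in> {0..T} \<Longrightarrow> X t \<in> borel_measurable (\<F> t)" and "\<And>j. moment_bounded (\<lambda>t \<omega>. X t \<omega> $ j)"
  shows "state_process P T \<F> X" "state_process P T \<F> (\<lambda>t \<omega>. X t \<omega> $ i)"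
proof -
  obtain K where K: "\<forall>j. \<forall>t\<in>{0..T}. L2 (\<lambda>\<omega>. X t \<omega> $ j) \<and> (\<integral>\<omega>. (X t \<omega> $ j)\<^sup>2 \<partial>P) \<le> K j"
    using choice[of "\<lambda>j K. \<forall>t\<in>{0..T}. L2 (\<lambda>\<omega>. X t \<omega> $ j) \<and> (\<integral>\<omega>. (X t \<omega> $ j)\<^sup>2 \<partial>P) \<le> K"]
      assms(4) unfolding moment_bounded_def by blast
  show "state_process P T \<F> X" "state_process P T \<F> (\<lambda>t \<omega>. X t \<omega> $ i)"
    by (rule state_process_vecI[OF assms(1-3), where K = K]; use K in blast)+
qed

text \<open>The follower's best reply to the mean field: \<open>z\<close> plus an independent centred fluctuation \<open>y\<close>, which is
  itself the optimal state of a scalar regulator with costate \<open>q\<close>.\<close>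

lemma follower_optimal_construct:
  assumes m: "is_model P W m"
    and st: "leader_state m xa" "leader_state m xb"
      "leader_state m z" "leader_state m pz"
    and sy: "full_state m y" "full_state m q"
    and pz: "AE \<omega> in P. \<forall>t\<in>{0..T}. z t \<omega> = mean\<^sub>1 m + (LBINT s:{0..t}. par m $ C\<^sub>1 * xa s \<omega>
        + par m $ D\<^sub>1 * xb s \<omega> + (par m $ A\<^sub>1 + par m $ B\<^sub>1) * z s \<omega> - (par m $ E\<^sub>1)\<^sup>2 / par m $ R\<^sub>1 * pz s \<omega>)"
    and bz: "backward m pz (\<lambda>t \<omega>. par m $ A\<^sub>1 * pz t \<omega> + par m $ Q\<^sub>1 * ((1 - par m $ F\<^sub>1) * z t \<omega> - par m $ G\<^sub>1 * xa t \<omega>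
        - par m $ H\<^sub>1 * xb t \<omega> - par m $ M\<^sub>1))"
    and fz: "AE \<omega> in P. pz T \<omega> = par m $ Qb\<^sub>1 * ((1 - par m $ Fb\<^sub>1) * z T \<omega> - par m $ Gb\<^sub>1 * xa T \<omega>
        - par m $ Hb\<^sub>1 * xb T \<omega> - par m $ Mb\<^sub>1)"
    and py: "AE \<omega> in P. \<forall>t\<in>{0..T}. y t \<omega> = (eta m \<omega> $ Follower - mean\<^sub>1 m) +
        (LBINT s:{0..t}. par m $ A\<^sub>1 * y s \<omega> - (par m $ E\<^sub>1)\<^sup>2 / par m $ R\<^sub>1 * q s \<omega>) + par m $ \<sigma>\<^sub>1 * W Follower t \<omega>"
    and bq: "backward m q (\<lambda>t \<omega>. par m $ A\<^sub>1 * q t \<omega> + par m $ Q\<^sub>1 * y t \<omega>)"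
    and fq: "AE \<omega> in P. q T \<omega> = par m $ Qb\<^sub>1 * y T \<omega>"
  shows "follower_optimal P W T m xa xb z (\<lambda>t \<omega>. - (par m $ E\<^sub>1 / par m $ R\<^sub>1) * (pz t \<omega> + q t \<omega>)) (\<lambda>t \<omega>. z t \<omega> + y t \<omega>)"
proof -
  let ?\<theta> = "par m" and ?F = "full_filtration P W m"
  let ?u = "\<lambda>t \<omega>. - (?\<theta> $ E\<^sub>1 / ?\<theta> $ R\<^sub>1) * (pz t \<omega> + q t \<omega>)" and ?x = "\<lambda>t \<omega>. z t \<omega> + y t \<omega>"
  note \<F> = filtration_full[OF m]
  have T0: "T \<in> {0..T}" using T_pos by simp
  note stF = st[THEN state_process_leader_full]
  have L2: "L2_process P T ?F v" if "state_process P T ?F v" for v using that by (simp add: state_process_def)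
  have S: "sqp xa" "sqp xb" "sqp z" "sqp pz" "sqp y" "sqp q"
    by (rule state_process_sqp[OF \<F>], rule stF sy)+
  have Q: "L2 (xa T)" "L2 (xb T)" "L2 (z T)" "L2 (pz T)"
      "L2 (y T)" "L2 (q T)"
    by (rule state_process_sq[OF \<F> _ T0], rule stF sy)+
  have uL: "L2_process P T ?F ?u"
    by (intro L2_process_cmult[OF \<F>] L2_process_add[OF \<F>] L2 stF sy)
  have xs: "state_process P T ?F ?x" by (intro state_process_add[OF \<F>] stF sy)
  have uS: "sqp ?u" "sqp ?x" by (intro sqp_intros S)+
  have xT: "L2 (?x T)" by (intro square_integrable_add Q)
  have R1: "?\<theta> $ R\<^sub>1 \<noteq> 0" and nn: "0 \<le> ?\<theta> $ Q\<^sub>1" "0 \<le> ?\<theta> $ R\<^sub>1" "0 \<le> ?\<theta> $ Qb\<^sub>1"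
    using m by (auto simp: is_model_def Let_def)
  let ?a = "\<lambda>s \<omega>. ?\<theta> $ A\<^sub>1 * ?x s \<omega> + ?\<theta> $ B\<^sub>1 * z s \<omega> + ?\<theta> $ C\<^sub>1 * xa s \<omega> + ?\<theta> $ D\<^sub>1 * xb s \<omega> + ?\<theta> $ E\<^sub>1 * ?u s \<omega>"
  have resp: "follower_response P W T m xa xb z ?u ?x"
    unfolding follower_response_def Let_def
  proof (intro conjI uL xs)
    let ?a1 = "\<lambda>s \<omega>. ?\<theta> $ C\<^sub>1 * xa s \<omega> + ?\<theta> $ D\<^sub>1 * xb s \<omega> + (?\<theta> $ A\<^sub>1 + ?\<theta> $ B\<^sub>1) * z s \<omega> - (?\<theta> $ E\<^sub>1)\<^sup>2 / ?\<theta> $ R\<^sub>1 * pz s \<omega>"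
    let ?a2 = "\<lambda>s \<omega>. ?\<theta> $ A\<^sub>1 * y s \<omega> - (?\<theta> $ E\<^sub>1)\<^sup>2 / ?\<theta> $ R\<^sub>1 * q s \<omega>"
    have a: "sqp ?a1" "sqp ?a2" by (intro sqp_intros S)+
    \<comment> \<open>The follower's drift splits into that of the mean field and that of the
      fluctuation; \<open>B\<^sub>1\<close>, \<open>C\<^sub>1\<close> and \<open>D\<^sub>1\<close>
      occur in the first part only.\<close>
    have eq: "?a s \<omega> = ?a1 s \<omega> + 1 * ?a2 s \<omega>" for s \<omega>
      by (simp add: power2_eq_square algebra_simps add_divide_distrib)
    show "AE \<omega> in P. \<forall>t\<in>{0..T}. ?x t \<omega> = eta m \<omega> $ Follower + (LBINT s:{0..t}. ?a s \<omega>) + ?\<theta> $ \<sigma>\<^sub>1 * W Follower t \<omega>"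
      unfolding eq using pz py path_integral_add_cmult[OF a, of 1] by eventually_elim simp
  qed
  define e where "e = follower_error ?\<theta> xa xb z ?x"
  define f where "f = follower_final_error ?\<theta> xa xb z ?x"
  have eS: "sqp e" and fQ: "L2 f"
    unfolding e_def f_def by (intro follower_error_sqp follower_final_error_sq S Q uS xT)+
  show ?thesis
    unfolding follower_optimal_def
  proof (intro conjI resp allI impI)
    fix v x' assume r: "follower_response P W T m xa xb z v x'"
    have vL: "L2_process P T ?F v" and x's: "state_process P T ?F x'"
      and px': "AE \<omega> in P. \<forall>t\<in>{0..T}. x' t \<omega> = eta m \<omega> $ Follower +
          (LBINT s:{0..t}. ?\<theta> $ A\<^sub>1 * x' s \<omega> + ?\<theta> $ B\<^sub>1 * z s \<omega> + ?\<theta> $ C\<^sub>1 * xa s \<omega>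
             + ?\<theta> $ D\<^sub>1 * xb s \<omega> + ?\<theta> $ E\<^sub>1 * v s \<omega>) + ?\<theta> $ \<sigma>\<^sub>1 * W Follower t \<omega>"
      using r unfolding follower_response_def Let_def by blast+
    have px: "AE \<omega> in P. \<forall>t\<in>{0..T}. ?x t \<omega> = eta m \<omega> $ Follower + (LBINT s:{0..t}. ?a s \<omega>) + ?\<theta> $ \<sigma>\<^sub>1 * W Follower t \<omega>"
      using resp unfolding follower_response_def Let_def by blast
    have vS: "sqp v" "sqp x'" by (rule L2_process_sqp[OF \<F>], rule vL L2[OF x's])+
    have x'T: "L2 (x' T)" by (rule state_process_sq[OF \<F> x's T0])
    define dx where "dx = (\<lambda>t \<omega>. x' t \<omega> - ?x t \<omega>)"
    define du where "du = (\<lambda>t \<omega>. v t \<omega> - ?u t \<omega>)"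
    have dS: "sqp dx" "sqp du" unfolding dx_def du_def by (intro sqp_diff vS uS)+
    have dT: "L2 (dx T)" unfolding dx_def by (intro square_integrable_diff x'T xT)
    have dL: "L2_process P T ?F dx" "L2_process P T ?F du"
      unfolding dx_def du_def by (intro L2_process_diff[OF \<F>] L2 x's xs vL uL)+
    let ?f = "\<lambda>s \<omega>. ?\<theta> $ A\<^sub>1 * dx s \<omega> + ?\<theta> $ E\<^sub>1 * du s \<omega>"
    have fL: "L2_process P T ?F ?f" by (intro L2_process_add[OF \<F>] L2_process_cmult[OF \<F>] dL)
    have fS: "sqp ?f" by (intro sqp_intros dS)
    have pd: "AE \<omega> in P. \<forall>t\<in>{0..T}. dx t \<omega> = (LBINT s:{0..t}. ?f s \<omega>)"
      unfolding dx_def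
      by (rule path_diff[OF _ _ px px']) (intro sqp_intros S, intro sqp_intros S vS, simp add: dx_def du_def algebra_simps)
    let ?kz = "\<lambda>t \<omega>. ?\<theta> $ A\<^sub>1 * pz t \<omega> + ?\<theta> $ Q\<^sub>1 * ((1 - ?\<theta> $ F\<^sub>1) * z t \<omega> - ?\<theta> $ G\<^sub>1 * xa t \<omega>
        - ?\<theta> $ H\<^sub>1 * xb t \<omega> - ?\<theta> $ M\<^sub>1)"
    let ?kq = "\<lambda>t \<omega>. ?\<theta> $ A\<^sub>1 * q t \<omega> + ?\<theta> $ Q\<^sub>1 * y t \<omega>"
    have kS: "sqp ?kz" "sqp ?kq" by (intro sqp_intros S)+
    note ad = L2_process_adapted[OF fL]
    have d1: "ex (pz T) (dx T) = ip pz ?f - ip ?kz dx"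
      by (rule backward_duality[OF m stF(4) kS(1) bz ad fS dS(1) dT pd])
    have d2: "ex (q T) (dx T) = ip q ?f - ip ?kq dx"
      by (rule backward_duality[OF m sy(2) kS(2) bq ad fS dS(1) dT pd])
    \<comment> \<open>The running error at \<open>z + y\<close> is the bracket in the driver of
      \<open>pz\<close> plus \<open>y\<close>, so the two drivers add up to one adjoint equation for
      \<open>pz + q\<close>.\<close>
    have "(\<lambda>t \<omega>. ?kz t \<omega> + ?kq t \<omega>) = (\<lambda>t \<omega>. ?\<theta> $ A\<^sub>1 * pz t \<omega> + ?\<theta> $ A\<^sub>1 * q t \<omega> + ?\<theta> $ Q\<^sub>1 * e t \<omega>)"
      by (simp add: fun_eq_iff e_def follower_error_def algebra_simps)
    then have k: "ip ?kz dx + ip ?kq dx = ?\<theta> $ A\<^sub>1 * ip pz dx + ?\<theta> $ A\<^sub>1 * ip q dx + ?\<theta> $ Q\<^sub>1 * ip e dx"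
      by (simp only: ip_add[OF kS dS(1), symmetric]) (simp add: ip_simps sqp_intros S dS eS)
    have ff: "ip pz ?f = ?\<theta> $ A\<^sub>1 * ip pz dx + ?\<theta> $ E\<^sub>1 * ip pz du" "ip q ?f = ?\<theta> $ A\<^sub>1 * ip q dx + ?\<theta> $ E\<^sub>1 * ip q du"
      by (simp_all add: ip_simps sqp_intros S dS)
    have "ex (pz T) (dx T) + ex (q T) (dx T) = ex (\<lambda>\<omega>. pz T \<omega> + q T \<omega>) (dx T)"
      by (rule ex_add[symmetric]) (rule Q dT)+
    also have "\<dots> = ex (\<lambda>\<omega>. ?\<theta> $ Qb\<^sub>1 * f \<omega>) (dx T)"
    proof (rule ex_cong_AE)
      show "AE \<omega> in P. pz T \<omega> + q T \<omega> = ?\<theta> $ Qb\<^sub>1 * f \<omega>"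
        using fz fq by eventually_elim (simp add: f_def follower_final_error_def algebra_simps)
    qed (intro square_integrable_add square_integrable_cmult Q fQ dT)+
    finally have t: "ex (pz T) (dx T) + ex (q T) (dx T) = ?\<theta> $ Qb\<^sub>1 * ex f (dx T)" by (simp add: ex_cmult)
    have uu: "?\<theta> $ R\<^sub>1 * ip ?u du = - (?\<theta> $ E\<^sub>1 * (ip pz du + ip q du))"
    proof -
      have "ip ?u du = - (?\<theta> $ E\<^sub>1 / ?\<theta> $ R\<^sub>1) * (ip pz du + ip q du)"
        by (simp only: ip_cmult ip_add[OF S(4,6) dS(2)])
      then show ?thesis using R1 by simp
    qed
    \<comment> \<open>The first-order term of the cost at the candidate; it vanishes by the two
      dualities and the choice of \<open>?u\<close>, and convexity then gives optimality among all
      responses to the same leaders and mean field.\<close>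
    have lin0: "?\<theta> $ Q\<^sub>1 * ip e dx + ?\<theta> $ R\<^sub>1 * ip ?u du + ?\<theta> $ Qb\<^sub>1 * ex f (dx T) = 0"
      using d1 d2 k t ff uu by (simp add: algebra_simps)
    have e': "sqp (follower_error ?\<theta> xa xb z x')" "L2 (follower_final_error ?\<theta> xa xb z x')"
      by (intro follower_error_sqp follower_final_error_sq S Q vS x'T)+
    have "(\<lambda>t \<omega>. follower_error ?\<theta> xa xb z x' t \<omega> - e t \<omega>) = dx"
      "(\<lambda>\<omega>. follower_final_error ?\<theta> xa xb z x' \<omega> - f \<omega>) = dx T" "(\<lambda>t \<omega>. v t \<omega> - ?u t \<omega>) = du"
      by (simp_all add: fun_eq_iff e_def f_def follower_error_def follower_final_error_def dx_def du_def)
    then show "J_follower P T ?\<theta> xa xb z ?x ?u \<le> J_follower P T ?\<theta> xa xb z x' v"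
      using lq_cost_convex[OF uS(1) vS(1) eS e'(1) fQ e'(2) nn] lin0
      unfolding J_follower_eq e_def[symmetric] f_def[symmetric] by simp
  qed
qed

text \<open>A known part plus a remainder orthogonal to all known square-integrable variables:
  testing on indicators shows that the known part is the conditional expectation. Used for the
  backward equation, where the remainder is a martingale increment, and for the mean field, where it
  is the follower's fluctuation.\<close>

lemma centred_conditional_mean:
  assumes m: "is_model P W m" and z: "integrable P z" "z \<in> borel_measurable (leader_filtration P W m t)"
    and orth: "\<And>\<zeta>. \<zeta> \<in> borel_measurable (leader_filtration P W m t) \<Longrightarrow> L2 \<zeta> \<Longrightarrow>
      integrable P (\<lambda>\<omega>. y \<omega> * \<zeta> \<omega>) \<and> (\<integral>\<omega>. y \<omega> * \<zeta> \<omega> \<partial>P) = 0"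
    and x: "\<And>\<omega>. \<omega> \<in> space P \<Longrightarrow> x \<omega> = z \<omega> + y \<omega>"
  shows "AE \<omega> in P. z \<omega> = real_cond_exp P (leader_filtration P W m t) x \<omega>"
proof -
  interpret finite_measure_subalgebra P "leader_filtration P W m t"
    by unfold_locales (rule subalgebra_leader[OF m])
  have y: "integrable P y" using orth[OF _ square_integrable_const[of 1]] by simp
  have xi: "integrable P x"
    by (subst Bochner_Integration.integrable_cong[OF refl x]) (simp_all add: z y)
  have "AE \<omega> in P. real_cond_exp P (leader_filtration P W m t) x \<omega> = z \<omega>"
  proof (rule real_cond_exp_charact)
    fix A assume A: "A \<in> sets (leader_filtration P W m t)"
    then have AP: "A \<in> sets P" using subalg by (auto simp: subalgebra_def)
    have i: "L2 (indicator A)"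
      using AP by (auto simp: square_integrable_def power2_eq_square less_top[symmetric] simp flip: indicator_inter_arith
          intro!: integrable_real_indicator emeasure_finite)
    have zi: "integrable P (\<lambda>\<omega>. z \<omega> * indicator A \<omega>)"
      using integrable_mult_indicator[OF AP z(1)] by (simp add: mult.commute)
    have o: "integrable P (\<lambda>\<omega>. y \<omega> * indicator A \<omega>) \<and> (\<integral>\<omega>. y \<omega> * indicator A \<omega> \<partial>P) = 0"
      by (rule orth[OF _ i]) (use A in simp)
    have "(LINT \<omega>:A|P. x \<omega>) = (\<integral>\<omega>. z \<omega> * indicator A \<omega> + y \<omega> * indicator A \<omega> \<partial>P)"
      unfolding set_lebesgue_integral_def by (rule Bochner_Integration.integral_cong) (simp_all add: x algebra_simps)
    then show "(LINT \<omega>:A|P. x \<omega>) = (LINT \<omega>:A|P. z \<omega>)"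
      using zi o by (simp add: set_lebesgue_integral_def mult.commute[of "indicator A _"])
  qed (use z xi in auto)
  then show ?thesis by eventually_elim simp
qed

end

section \<open>State processes built from Riccati data\<close>

lemma riccati_data_continuous:
  fixes A :: "real ^ 'n ^ 'n" and C :: "real ^ 'l ^ 'l"
  assumes R: "riccati_data T A B C D E M h \<Gamma> g \<Phi> \<Psi>"
  shows "continuous_on {0..T} \<Gamma>" "continuous_on {0..T} g" "continuous_on {0..T} \<Phi>" "continuous_on {0..T} \<Psi>"
    "continuous_on {0..T} (\<lambda>t. A - B ** \<Gamma> t)" "continuous_on {0..T} (\<lambda>t. - (B *v g t))"
proof -
  have d: "(\<Gamma> has_vector_derivative - (\<Gamma> t ** A + C ** \<Gamma> t - \<Gamma> t ** B ** \<Gamma> t + D)) (at t within {0..T})"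
    "(g has_vector_derivative - ((C - \<Gamma> t ** B) *v g t + M)) (at t within {0..T})"
    "(\<Phi> has_vector_derivative (A - B ** \<Gamma> t) ** \<Phi> t) (at t within {0..T})" if "t \<in> {0..T}" for t
    using R that by (auto simp: riccati_data_def)
  show \<Gamma>: "continuous_on {0..T} \<Gamma>" and g: "continuous_on {0..T} g" and "continuous_on {0..T} \<Phi>"
    by (rule continuous_on_vector_derivative[OF d(1)] continuous_on_vector_derivative[OF d(2)]
        continuous_on_vector_derivative[OF d(3)]; assumption)+
  show "continuous_on {0..T} \<Psi>" using R by (simp add: riccati_data_def)
  show "continuous_on {0..T} (\<lambda>t. A - B ** \<Gamma> t)" by (intro continuous_intros mmult.continuous_on \<Gamma>)
  show "continuous_on {0..T} (\<lambda>t. - (B *v g t))" by (intro continuous_intros vmult.continuous_on g)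
qed

context game_space
begin

lemma path_int_orthogonal:
  assumes w: "bounded_process K w" and \<kappa>: "continuous_on {0..T} \<kappa>" and \<zeta>: "L2 \<zeta>" and t: "t \<in> {0..T}"
    and orth: "\<And>s. s \<in> {0..t} \<Longrightarrow> (\<integral>\<omega>. w s \<omega> * \<zeta> \<omega> \<partial>P) = 0"
  shows "L2 (path_int \<kappa> w t)" "(\<integral>\<omega>. path_int \<kappa> w t \<omega> * \<zeta> \<omega> \<partial>P) = 0"
  using process_integral_orthogonal[OF w \<kappa> \<zeta> _ orth, of "{0..t}"] by (simp_all add: path_int_def[abs_def])

text \<open>The filtration is a parameter: the leaders' one for the equilibrium systems, the full
  one for the follower's fluctuation.\<close>

lemma riccati_state_process:
  fixes \<Gamma> :: "real \<Rightarrow> real ^ 'n ^ 'l" and c :: "real ^ 'n" and \<gamma> :: "'n \<Rightarrow> agent" and x0 :: "'a \<Rightarrow> real ^ 'n"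
  assumes m: "is_model P W m" and R: "riccati_data T A B C D E M h \<Gamma> g \<Phi> \<Psi>" and \<F>: "filtration \<F>"
    and W: "\<And>s t l. t \<in> {0..T} \<Longrightarrow> s \<in> {0..t} \<Longrightarrow> W (\<gamma> l) s \<in> borel_measurable (\<F> t)"
    and x0: "\<And>t l. t \<in> {0..T} \<Longrightarrow> (\<lambda>\<omega>. x0 \<omega> $ l) \<in> borel_measurable (\<F> t)" "\<And>l. L2 (\<lambda>\<omega>. x0 \<omega> $ l)"
  defines "x \<equiv> lin_state \<Phi> \<Psi> (\<lambda>t. A - B ** \<Gamma> t) (\<lambda>t. - (B *v g t)) c \<gamma> x0"
  defines "p \<equiv> \<lambda>t \<omega>. \<Gamma> t *v x t \<omega> + g t"
  shows "state_process P T \<F> x" "state_process P T \<F> (\<lambda>t \<omega>. x t \<omega> $ j)"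
    and "state_process P T \<F> p" "state_process P T \<F> (\<lambda>t \<omega>. p t \<omega> $ i)"
    and "\<And>\<omega> t. \<omega> \<in> space P \<Longrightarrow> t \<in> {0..T} \<Longrightarrow>
       x t \<omega> $ j = x0 \<omega> $ j + (LBINT s:{0..t}. (A *v x s \<omega> - B *v p s \<omega>) $ j) + noise c \<gamma> t \<omega> $ j"
proof -
  note cont = riccati_data_continuous[OF R]
  note rb = riccati_backward(1-3)[OF m R, where c = c and \<gamma> = \<gamma> and ?x0.0 = x0, folded x_def]
  have cp: "continuous_on {0..T} (\<lambda>t. p t \<omega>)" if "\<omega> \<in> space P" for \<omega>
    unfolding p_def by (rule rb(2)[OF that])
  have mb: "moment_bounded (\<lambda>t \<omega>. x t \<omega> $ j)" for j
    unfolding x_def by (intro lin_state_moment_bounded cont x0)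
  have mp: "moment_bounded (\<lambda>t \<omega>. p t \<omega> $ i)" for i
    unfolding p_def by (intro moment_bounded_lincomb mb cont)
  have sp: "space (\<F> t) = space P" for t using \<F> by (simp add: filtration_def subalgebra_def)
  have ax: "x t \<in> borel_measurable (\<F> t)" if "t \<in> {0..T}" for t
    unfolding x_def by (rule lin_state_adapted[OF that cont(5,6,4) sp W[OF that] x0(1)[OF that]])
  have ap: "p t \<in> borel_measurable (\<F> t)" if "t \<in> {0..T}" for t
    unfolding p_def
    by (intro borel_measurable_vecI) (use borel_measurable_vec_nth[OF ax[OF that]] in \<open>simp add: matrix_vector_mult_def\<close>)
  show "state_process P T \<F> x" "state_process P T \<F> (\<lambda>t \<omega>. x t \<omega> $ j)"
    by (rule moment_bounded_state_process[OF \<F> rb(1) ax mb]; assumption)+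
  show "state_process P T \<F> p" "state_process P T \<F> (\<lambda>t \<omega>. p t \<omega> $ i)"
    by (rule moment_bounded_state_process[OF \<F> cp ap mp]; assumption)+
  fix \<omega> t assume \<omega>: "\<omega> \<in> space P" and t: "t \<in> {0..T}"
  have sub: "{0..t} \<subseteq> {0..T}" using t by auto
  have "(LBINT s:{0..t}. A *v x s \<omega> - B *v p s \<omega>) $ j = (LBINT s:{0..t}. (A *v x s \<omega> - B *v p s \<omega>) $ j)"
    by (intro set_integral_vec_nth continuous_intros vmult.continuous_on continuous_on_subset[OF rb(1)[OF \<omega>] sub]
        continuous_on_subset[OF cp[OF \<omega>] sub])
  moreover have "x t \<omega> = x0 \<omega> + (LBINT s:{0..t}. A *v x s \<omega> - B *v p s \<omega>) + noise c \<gamma> t \<omega>"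
    unfolding p_def by (rule rb(3)[OF \<omega> t])
  ultimately show "x t \<omega> $ j = x0 \<omega> $ j + (LBINT s:{0..t}. (A *v x s \<omega> - B *v p s \<omega>) $ j) + noise c \<gamma> t \<omega> $ j"
    by (simp only: vector_add_component)
qed

text \<open>The regulator problem of the follower's deviation \<open>x\<^sub>1 - z\<close> from the mean field.\<close>

definition fluct_data :: "real ^ param \<Rightarrow> (real \<Rightarrow> real ^ 1 ^ 1) \<Rightarrow> (real \<Rightarrow> real ^ 1) \<Rightarrow> (real \<Rightarrow> real ^ 1 ^ 1) \<Rightarrow> (real \<Rightarrow> real ^ 1 ^ 1) \<Rightarrow> bool" where
  "fluct_data \<theta> = riccati_data T (\<chi> i j. \<theta> $ A\<^sub>1) (\<chi> i j. (\<theta> $ E\<^sub>1)\<^sup>2 / \<theta> $ R\<^sub>1) (\<chi> i j. \<theta> $ A\<^sub>1) (\<chi> i j. \<theta> $ Q\<^sub>1) (\<chi> i j. \<theta> $ Qb\<^sub>1) 0 0"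

definition fluct_state :: "'a model \<Rightarrow> (real \<Rightarrow> real ^ 1 ^ 1) \<Rightarrow> (real \<Rightarrow> real ^ 1) \<Rightarrow> (real \<Rightarrow> real ^ 1 ^ 1) \<Rightarrow> (real \<Rightarrow> real ^ 1 ^ 1) \<Rightarrow> real \<Rightarrow> 'a \<Rightarrow> real ^ 1" where
  "fluct_state m \<Gamma> g \<Phi> \<Psi> = lin_state \<Phi> \<Psi> (\<lambda>t. (\<chi> i j. par m $ A\<^sub>1) - (\<chi> i j. (par m $ E\<^sub>1)\<^sup>2 / par m $ R\<^sub>1) ** \<Gamma> t)
     (\<lambda>t. - ((\<chi> i j. (par m $ E\<^sub>1)\<^sup>2 / par m $ R\<^sub>1) *v g t)) (\<chi> i. par m $ \<sigma>\<^sub>1) (\<lambda>_. Follower)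
     (\<lambda>\<omega>. \<chi> i. eta m \<omega> $ Follower - mean\<^sub>1 m)"

text \<open>The fluctuation is driven only by the follower's centred initial value and Wiener path,
  both independent of the leaders' information. Hence it is orthogonal to that information, which
  makes \<open>z\<close> the conditional mean of \<open>z\<close> plus fluctuation.\<close>

lemma fluctuation:
  assumes m: "is_model P W m" and R: "fluct_data (par m) \<Gamma> g \<Phi> \<Psi>"
  defines "y \<equiv> \<lambda>t \<omega>. fluct_state m \<Gamma> g \<Phi> \<Psi> t \<omega> $ 1"
  defines "q \<equiv> \<lambda>t \<omega>. (\<Gamma> t *v fluct_state m \<Gamma> g \<Phi> \<Psi> t \<omega> + g t) $ 1"
  shows "full_state m y" "full_state m q"
    and "\<And>\<omega> t. \<omega> \<in> space P \<Longrightarrow> t \<in> {0..T} \<Longrightarrow> y t \<omega> = (eta m \<omega> $ Follower - mean\<^sub>1 m) +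
        (LBINT s:{0..t}. par m $ A\<^sub>1 * y s \<omega> - (par m $ E\<^sub>1)\<^sup>2 / par m $ R\<^sub>1 * q s \<omega>) + par m $ \<sigma>\<^sub>1 * W Follower t \<omega>"
    and "backward m q (\<lambda>t \<omega>. par m $ A\<^sub>1 * q t \<omega> + par m $ Q\<^sub>1 * y t \<omega>)"
    and "q T \<omega> = par m $ Qb\<^sub>1 * y T \<omega>"
    and "\<And>t \<zeta>. t \<in> {0..T} \<Longrightarrow> \<zeta> \<in> borel_measurable (leader_filtration P W m t) \<Longrightarrow> L2 \<zeta> \<Longrightarrow>
      (\<integral>\<omega>. y t \<omega> * \<zeta> \<omega> \<partial>P) = 0"
proof -
  note R' = R[unfolded fluct_data_def]
  let ?\<theta> = "par m" and ?\<eta> = "\<lambda>\<omega>. eta m \<omega> $ Follower - mean\<^sub>1 m"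
  have \<eta>m: "(\<lambda>\<omega>. eta m \<omega> $ Follower) \<in> borel_measurable (full_filtration P W m t)" for t
    unfolding full_filtration_def by (rule joint_filtration_eta_measurable) simp
  have Wm: "W Follower s \<in> borel_measurable (full_filtration P W m t)" if "s \<in> {0..t}" for s t
    unfolding full_filtration_def by (rule joint_filtration_W_measurable) (use that in simp_all)
  have \<eta>sq: "L2 ?\<eta>"
    by (intro square_integrable_diff eta_square_integrable[OF m] square_integrable_const)
  note sp = riccati_state_process[OF m R' filtration_full[OF m], where \<gamma> = "\<lambda>_. Follower" and c = "\<chi> i. ?\<theta> $ \<sigma>\<^sub>1"
      and ?x0.0 = "\<lambda>\<omega>. \<chi> i. ?\<eta> \<omega>", folded fluct_state_def]
  have prem: "(\<lambda>\<omega>. (\<chi> i. ?\<eta> \<omega>) $ l) \<in> borel_measurable (full_filtration P W m t)" "L2 (\<lambda>\<omega>. (\<chi> i. ?\<eta> \<omega>) $ l)"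
    for t and l :: 1
    using \<eta>m[of t] \<eta>sq by simp_all
  show "full_state m y" "full_state m q"
    unfolding y_def q_def by (rule sp(2,4); rule Wm prem; assumption)+
  have row: "((\<chi> i j. a) *v v) $ 1 = a * v $ 1" for a :: real and v :: "real ^ 1"
    by (simp add: matrix_vector_mult_def)
  show "y t \<omega> = ?\<eta> \<omega> + (LBINT s:{0..t}. ?\<theta> $ A\<^sub>1 * y s \<omega> - (?\<theta> $ E\<^sub>1)\<^sup>2 / ?\<theta> $ R\<^sub>1 * q s \<omega>) + ?\<theta> $ \<sigma>\<^sub>1 * W Follower t \<omega>"
    if "\<omega> \<in> space P" "t \<in> {0..T}" for \<omega> t
    using sp(5)[OF Wm prem that, of 1] by (simp add: y_def q_def noise_def row)
  show "backward m q (\<lambda>t \<omega>. ?\<theta> $ A\<^sub>1 * q t \<omega> + ?\<theta> $ Q\<^sub>1 * y t \<omega>)"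
    using riccati_backward(4)[OF m R', of "\<chi> i. ?\<theta> $ \<sigma>\<^sub>1" "\<lambda>_. Follower" "\<lambda>\<omega>. \<chi> i. ?\<eta> \<omega>" 1, folded fluct_state_def]
    unfolding y_def q_def by (simp add: row)
  show "q T \<omega> = ?\<theta> $ Qb\<^sub>1 * y T \<omega>"
    using R' T_pos by (simp add: q_def y_def riccati_data_def row)
  fix t \<zeta> assume t: "t \<in> {0..T}" and \<zeta>: "\<zeta> \<in> borel_measurable (leader_filtration P W m t)" "L2 \<zeta>"
  have gd: "(g has_vector_derivative - (((\<chi> i j. ?\<theta> $ A\<^sub>1) - \<Gamma> s ** (\<chi> i j. (?\<theta> $ E\<^sub>1)\<^sup>2 / ?\<theta> $ R\<^sub>1)) *v g s)) (at s within {0..T})"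
    and gT: "g T = 0" if "s \<in> {0..T}" for s
    using R' that by (simp_all add: riccati_data_def)
  have c\<Gamma>: "continuous_on {0..T} \<Gamma>" by (rule riccati_data_continuous[OF R'])
  \<comment> \<open>The regulator has no affine data, so its offset vanishes, and with it the
    deterministic part of the fluctuation, which would spoil the zero mean.\<close>
  have g0: "g s = 0" if "s \<in> {0..T}" for s
    by (rule linear_ode_zero_backward[where L = "\<lambda>s v. - (((\<chi> i j. ?\<theta> $ A\<^sub>1) - \<Gamma> s ** (\<chi> i j. (?\<theta> $ E\<^sub>1)\<^sup>2 / ?\<theta> $ R\<^sub>1)) *v v)", OF _ _ gd gT[OF that] that])
      (auto intro!: linear_compose_neg matrix_vector_mul_linear vmult.continuous_on continuous_intros mmult.continuous_on c\<Gamma>)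
  have \<zeta>i: "integrable P \<zeta>" by (rule square_integrable_integrable[OF \<zeta>(2)])
  have W0: "(\<integral>\<omega>. W Follower s \<omega> * \<zeta> \<omega> \<partial>P) = 0" if "s \<in> {0..t}" for s
    using follower_noise_indep[OF m _ \<zeta>i \<zeta>(1), of "W Follower s"] W_moments(1,2)[of s Follower] that
    by (auto intro: square_integrable_integrable)
  have \<eta>0: "(\<integral>\<omega>. ?\<eta> \<omega> * \<zeta> \<omega> \<partial>P) = 0"
  proof -
    have i: "integrable P (\<lambda>\<omega>. eta m \<omega> $ Follower * \<zeta> \<omega>)" by (rule square_integrable_mult[OF eta_square_integrable[OF m] \<zeta>(2)])
    have "(\<integral>\<omega>. ?\<eta> \<omega> * \<zeta> \<omega> \<partial>P) = (\<integral>\<omega>. eta m \<omega> $ Follower * \<zeta> \<omega> \<partial>P) - mean\<^sub>1 m * (\<integral>\<omega>. \<zeta> \<omega> \<partial>P)"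
      using i \<zeta>i by (simp add: left_diff_distrib)
    then show ?thesis
      using follower_noise_indep[OF m square_integrable_integrable[OF eta_square_integrable[OF m]] \<zeta>i \<zeta>(1)] by simp
  qed
  let ?H = "\<lambda>t. (\<chi> i j. par m $ A\<^sub>1) - (\<chi> i j. (par m $ E\<^sub>1)\<^sup>2 / par m $ R\<^sub>1) ** \<Gamma> t :: real ^ 1 ^ 1"
  let ?\<kappa> = "\<lambda>s. (\<Psi> s ** ?H s) $ 1 $ 1 * ?\<theta> $ \<sigma>\<^sub>1"
  note cont = riccati_data_continuous[OF R']
  have \<kappa>: "continuous_on {0..T} ?\<kappa>"
    by (intro continuous_intros mmult.continuous_on cont(4,5))
  note pi = path_int_orthogonal[OF W_bounded_process \<kappa> \<zeta>(2) t W0]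
  have y: "y t \<omega> = ?\<theta> $ \<sigma>\<^sub>1 * W Follower t \<omega> + \<Phi> t $ 1 $ 1 * (\<Psi> 0 $ 1 $ 1 * ?\<eta> \<omega> + path_int ?\<kappa> (W Follower) t \<omega>)"
    if "\<omega> \<in> space P" for \<omega>
  proof -
    have "path_int (\<lambda>s. (\<Psi> s *v - ((\<chi> i j. (?\<theta> $ E\<^sub>1)\<^sup>2 / ?\<theta> $ R\<^sub>1) *v g s)) $ 1) (\<lambda>_ _. 1) t \<omega> = 0"
      unfolding path_int_def
      by (rule trans[OF Bochner_Integration.integral_cong[of _ _ _ "\<lambda>_. 0"]]) (auto simp: g0)
    then show ?thesis
      unfolding y_def fluct_state_def lin_state_component[OF that t cont(5,6,4)] by simp
  qed
  have "(\<integral>\<omega>. y t \<omega> * \<zeta> \<omega> \<partial>P) = (\<integral>\<omega>. ?\<theta> $ \<sigma>\<^sub>1 * (W Follower t \<omega> * \<zeta> \<omega>) + \<Phi> t $ 1 $ 1 * (\<Psi> 0 $ 1 $ 1 * (?\<eta> \<omega> * \<zeta> \<omega>)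
      + path_int ?\<kappa> (W Follower) t \<omega> * \<zeta> \<omega>) \<partial>P)"
    by (rule Bochner_Integration.integral_cong) (simp_all add: y algebra_simps)
  also have "\<dots> = ?\<theta> $ \<sigma>\<^sub>1 * (\<integral>\<omega>. W Follower t \<omega> * \<zeta> \<omega> \<partial>P) + \<Phi> t $ 1 $ 1 * (\<Psi> 0 $ 1 $ 1 * (\<integral>\<omega>. ?\<eta> \<omega> * \<zeta> \<omega> \<partial>P)
      + (\<integral>\<omega>. path_int ?\<kappa> (W Follower) t \<omega> * \<zeta> \<omega> \<partial>P))"
  proof -
    have "integrable P (\<lambda>\<omega>. W Follower t \<omega> * \<zeta> \<omega>)" "integrable P (\<lambda>\<omega>. ?\<eta> \<omega> * \<zeta> \<omega>)"
      "integrable P (\<lambda>\<omega>. path_int ?\<kappa> (W Follower) t \<omega> * \<zeta> \<omega>)"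
      by (rule square_integrable_mult[OF _ \<zeta>(2)], rule W_moments \<eta>sq pi(1), (use t in simp)?)+
    then show ?thesis by simp
  qed
  also have "\<dots> = 0" using W0[of t] \<eta>0 pi(2) t by simp
  finally show "(\<integral>\<omega>. y t \<omega> * \<zeta> \<omega> \<partial>P) = 0" .
qed

end

definition noise_coef :: "real ^ param \<Rightarrow> real ^ 5" where
  "noise_coef \<theta> = vector [\<theta> $ \<sigma>\<^sub>\<alpha>, \<theta> $ \<sigma>\<^sub>\<beta>, 0, 0, 0]"

text \<open>Coordinates 3 to 5 have coefficient 0 in \<open>noise_coef\<close>; sending them to a
  leader keeps every coordinate measurable with respect to the leaders' filtration.\<close>

definition noise_agent :: "5 \<Rightarrow> agent" where
  "noise_agent j = (if j = 2 then Beta else Alpha)"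

context game_space
begin

lemma noise_Sigma: "noise (noise_coef \<theta>) noise_agent t \<omega> = mat_Sigma \<theta> *v vector [W Alpha t \<omega>, W Beta t \<omega>]"
  by (simp add: vec_eq_iff forall_5 noise_def noise_coef_def noise_agent_def mat_Sigma_def matrix_vector_mult_def sum_2)

lemma x_init_component:
  assumes "is_model P W m"
  shows "(\<lambda>\<omega>. x_init P m \<omega> $ l) \<in> borel_measurable (leader_filtration P W m t)" "L2 (\<lambda>\<omega>. x_init P m \<omega> $ l)"
proof -
  have "\<forall>l. (\<lambda>\<omega>. x_init P m \<omega> $ l) \<in> borel_measurable (leader_filtration P W m t) \<and> L2 (\<lambda>\<omega>. x_init P m \<omega> $ l)"
    unfolding forall_5 x_init_def leader_filtration_def
    by (simp add: joint_filtration_eta_measurable eta_square_integrable[OF assms] square_integrable_const)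
  then show "(\<lambda>\<omega>. x_init P m \<omega> $ l) \<in> borel_measurable (leader_filtration P W m t)" "L2 (\<lambda>\<omega>. x_init P m \<omega> $ l)"
    by auto
qed

definition system_data where
  "system_data \<theta> S = riccati_data T (mat_A \<theta>) (mB S) (mC S) (mD S) (mE S) (mM S) (mh S)"

definition system_state where
  "system_state m S \<Gamma> g \<Phi> \<Psi> = lin_state \<Phi> \<Psi> (\<lambda>t. mat_A (par m) - mB S ** \<Gamma> t) (\<lambda>t. - (mB S *v g t))
     (noise_coef (par m)) noise_agent (x_init P m)"

lemma system_process:
  fixes S :: "('l::finite) system"
  assumes m: "is_model P W m" and R: "system_data (par m) S \<Gamma> g \<Phi> \<Psi>"
    and x_def: "x = system_state m S \<Gamma> g \<Phi> \<Psi>" and p_def: "p = (\<lambda>t \<omega>. \<Gamma> t *v x t \<omega> + g t)"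
  shows "leader_state m x" "leader_state m (\<lambda>t \<omega>. x t \<omega> $ j)"
    and "leader_state m p" "leader_state m (\<lambda>t \<omega>. p t \<omega> $ i)"
    and "\<And>\<omega> t j. \<omega> \<in> space P \<Longrightarrow> t \<in> {0..T} \<Longrightarrow> x t \<omega> $ j = x_init P m \<omega> $ j +
       (LBINT s:{0..t}. (mat_A (par m) *v x s \<omega> - mB S *v p s \<omega>) $ j) + noise (noise_coef (par m)) noise_agent t \<omega> $ j"
    and "backward m (\<lambda>t \<omega>. p t \<omega> $ i) (\<lambda>t \<omega>. (mC S *v p t \<omega> + mD S *v x t \<omega> + mM S) $ i)"
    and "\<And>\<omega>. p T \<omega> = mE S *v x T \<omega> + mh S"
    and "fbsde_solution P W T m S x p" "riccati_solution T (mat_A (par m)) S \<Gamma>" "offset_solution T S \<Gamma> g"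
proof -
  note R' = R[unfolded system_data_def]
  note \<G> = filtration_leader[OF m]
  have ag: "noise_agent l \<in> {Alpha, Beta}" for l by (simp add: noise_agent_def)
  have Wm: "W (noise_agent l) s \<in> borel_measurable (leader_filtration P W m t)" if "s \<in> {0..t}" for l s t
    unfolding leader_filtration_def by (rule joint_filtration_W_measurable[OF ag that])
  note sp = riccati_state_process[OF m R' \<G>, where \<gamma> = noise_agent and c = "noise_coef (par m)"
      and ?x0.0 = "x_init P m", folded system_state_def, folded x_def]
  show st: "leader_state m x" "leader_state m (\<lambda>t \<omega>. x t \<omega> $ j)"
      "leader_state m p" for j
    unfolding p_def by (rule sp(1-3); rule Wm x_init_component[OF m]; assumption)+
  show pst: "leader_state m (\<lambda>t \<omega>. p t \<omega> $ i)" for i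
    unfolding p_def by (rule sp(4); rule Wm x_init_component[OF m]; assumption)
  show "x t \<omega> $ j = x_init P m \<omega> $ j +
       (LBINT s:{0..t}. (mat_A (par m) *v x s \<omega> - mB S *v p s \<omega>) $ j) + noise (noise_coef (par m)) noise_agent t \<omega> $ j"
    if "\<omega> \<in> space P" "t \<in> {0..T}" for \<omega> t j
    unfolding p_def by (rule sp(5); (rule Wm x_init_component[OF m] that | assumption))
  note rb = riccati_backward[OF m R', where \<gamma> = noise_agent and c = "noise_coef (par m)"
      and ?x0.0 = "x_init P m", folded system_state_def, folded x_def]
  show bw: "backward m (\<lambda>t \<omega>. p t \<omega> $ i) (\<lambda>t \<omega>. (mC S *v p t \<omega> + mD S *v x t \<omega> + mM S) $ i)" for i
    unfolding p_def by (rule rb(4))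
  show pT: "p T \<omega> = mE S *v x T \<omega> + mh S" for \<omega>
    using R' by (simp add: p_def riccati_data_def)
  show "riccati_solution T (mat_A (par m)) S \<Gamma>" "offset_solution T S \<Gamma> g"
    using R' by (auto simp: riccati_solution_def offset_solution_def riccati_data_def)
  have cx: "continuous_on {0..T} (\<lambda>t. x t \<omega>)" and cp: "continuous_on {0..T} (\<lambda>t. p t \<omega>)" if "\<omega> \<in> space P" for \<omega>
    unfolding p_def by (rule rb(1)[OF that], rule rb(2)[OF that])
  show "fbsde_solution P W T m S x p"
    unfolding fbsde_solution_def Let_def
  proof (intro conjI st ballI allI)
    have "x t \<omega> = x_init P m \<omega> + (LBINT s:{0..t}. mat_A (par m) *v x s \<omega> - mB S *v p s \<omega>) +
        mat_Sigma (par m) *v vector [W Alpha t \<omega>, W Beta t \<omega>]" if "\<omega> \<in> space P" "t \<in> {0..T}" for \<omega> t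
      unfolding p_def noise_Sigma[symmetric] by (rule rb(3)[OF that])
    then show "AE \<omega> in P. \<forall>t\<in>{0..T}. x t \<omega> = x_init P m \<omega> + (LBINT s:{0..t}. mat_A (par m) *v x s \<omega> - mB S *v p s \<omega>) +
        mat_Sigma (par m) *v vector [W Alpha t \<omega>, W Beta t \<omega>]"
      by (intro AE_I2 ballI)
  next
    fix t i assume t: "t \<in> {0..T}"
    have sub: "{t..T} \<subseteq> {0..T}" using t by auto
    \<comment> \<open>Passage from the orthogonality form to the conditional expectation form of the
      backward equation: the remainder is \<open>p T - p t\<close> plus the integral of the driver,
      orthogonal even to the full past.\<close>
    show "AE \<omega> in P. p t \<omega> $ i = real_cond_exp P (leader_filtration P W m t)
        (\<lambda>\<omega>'. (mE S *v x T \<omega>' + mh S + (LBINT s:{t..T}. mC S *v p s \<omega>' + mD S *v x s \<omega>' + mM S)) $ i) \<omega>"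
    proof (rule centred_conditional_mean[OF m])
      show "integrable P (\<lambda>\<omega>. p t \<omega> $ i)"
        by (rule square_integrable_integrable[OF state_process_sq[OF \<G> pst t]])
      show "(\<lambda>\<omega>. p t \<omega> $ i) \<in> borel_measurable (leader_filtration P W m t)"
        by (rule L2_process_adapted[OF _ t]) (use pst in \<open>simp add: state_process_def\<close>)
      show "integrable P (\<lambda>\<omega>. (p T \<omega> $ i - p t \<omega> $ i + (LBINT s:{t..T}. (mC S *v p s \<omega> + mD S *v x s \<omega> + mM S) $ i)) * \<zeta> \<omega>) \<and>
          (\<integral>\<omega>. (p T \<omega> $ i - p t \<omega> $ i + (LBINT s:{t..T}. (mC S *v p s \<omega> + mD S *v x s \<omega> + mM S) $ i)) * \<zeta> \<omega> \<partial>P) = 0"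
        if "\<zeta> \<in> borel_measurable (leader_filtration P W m t)" "L2 \<zeta>" for \<zeta>
        using bw[of i, unfolded backward_def] leader_measurable_full[OF that(1)] that(2) t by blast
      fix \<omega> assume \<omega>: "\<omega> \<in> space P"
      have "(LBINT s:{t..T}. mC S *v p s \<omega> + mD S *v x s \<omega> + mM S) $ i = (LBINT s:{t..T}. (mC S *v p s \<omega> + mD S *v x s \<omega> + mM S) $ i)"
        by (intro set_integral_vec_nth continuous_intros vmult.continuous_on continuous_on_subset[OF cx[OF \<omega>] sub]
            continuous_on_subset[OF cp[OF \<omega>] sub])
      then show "(mE S *v x T \<omega> + mh S + (LBINT s:{t..T}. mC S *v p s \<omega> + mD S *v x s \<omega> + mM S)) $ i =
          p t \<omega> $ i + (p T \<omega> $ i - p t \<omega> $ i + (LBINT s:{t..T}. (mC S *v p s \<omega> + mD S *v x s \<omega> + mM S) $ i))"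
        by (simp only: vector_add_component pT)
    qed
  qed
qed

text \<open>Rows 4 and 5 start at 0, carry no noise, and involve only \<open>A\<^sub>1\<close> and
  the costate with the same index. They are thus directions of the kind that
  \<open>leader_variation\<close> takes as \<open>lam\<close>.\<close>

lemma adjoint_path:
  fixes S :: "('l::{finite, numeral}) system"
  assumes m: "is_model P W m" and R: "system_data (par m) S \<Gamma> g \<Phi> \<Psi>"
    and x_def: "x = system_state m S \<Gamma> g \<Phi> \<Psi>" and p_def: "p = (\<lambda>t \<omega>. \<Gamma> t *v x t \<omega> + g t)"
    and rows: "system_rows (par m) S" and \<omega>: "\<omega> \<in> space P" and t: "t \<in> {0..T}"
  shows "x t \<omega> $ 4 = (LBINT s:{0..t}. par m $ A\<^sub>1 * (x s \<omega> $ 4) + par m $ E\<^sub>1 * (- (par m $ E\<^sub>1 / par m $ R\<^sub>1) * (p s \<omega> $ 4)))"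
    and "x t \<omega> $ 5 = (LBINT s:{0..t}. par m $ A\<^sub>1 * (x s \<omega> $ 5) + par m $ E\<^sub>1 * (- (par m $ E\<^sub>1 / par m $ R\<^sub>1) * (p s \<omega> $ 5)))"
proof -
  have rB: "(mB S *v v) $ 4 = (par m $ E\<^sub>1)\<^sup>2 / par m $ R\<^sub>1 * v $ 4" "(mB S *v v) $ 5 = (par m $ E\<^sub>1)\<^sup>2 / par m $ R\<^sub>1 * v $ 5" for v
    using rows unfolding system_rows_def by blast+
  have e: "a - d\<^sup>2 / r * v = a + d * (- (d / r) * v)" for a d r v :: real
    by (simp add: power2_eq_square)
  note path = system_process(5)[OF m R x_def p_def \<omega> t]
  show "x t \<omega> $ 4 = (LBINT s:{0..t}. par m $ A\<^sub>1 * (x s \<omega> $ 4) + par m $ E\<^sub>1 * (- (par m $ E\<^sub>1 / par m $ R\<^sub>1) * (p s \<omega> $ 4)))"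
    "x t \<omega> $ 5 = (LBINT s:{0..t}. par m $ A\<^sub>1 * (x s \<omega> $ 5) + par m $ E\<^sub>1 * (- (par m $ E\<^sub>1 / par m $ R\<^sub>1) * (p s \<omega> $ 5)))"
    using path[of 4] path[of 5]
    by (simp_all only: vector_minus_component mat_A_rows rB e) (simp_all add: x_init_def noise_def noise_coef_def)
qed

text \<open>Consistency of the mean field, common to both games: the optimal reply to the third
  state is that state plus a fluctuation orthogonal to the leaders' information, so its conditional
  mean is the third state again.\<close>

lemma system_outcome:
  fixes S :: "('l::{finite, numeral}) system"
  assumes m: "is_model P W m" and R: "system_data (par m) S \<Gamma> g \<Phi> \<Psi>" and rows: "system_rows (par m) S"
    and F: "fluct_data (par m) \<Gamma>f gf \<Phi>f \<Psi>f"
  defines "x \<equiv> system_state m S \<Gamma> g \<Phi> \<Psi>"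
  defines "p \<equiv> \<lambda>t \<omega>. \<Gamma> t *v x t \<omega> + g t"
  defines "y \<equiv> \<lambda>t \<omega>. fluct_state m \<Gamma>f gf \<Phi>f \<Psi>f t \<omega> $ 1"
  defines "q \<equiv> \<lambda>t \<omega>. (\<Gamma>f t *v fluct_state m \<Gamma>f gf \<Phi>f \<Psi>f t \<omega> + gf t) $ 1"
  defines "u \<equiv> \<lambda>t \<omega>. - (par m $ E\<^sub>1 / par m $ R\<^sub>1) * (p t \<omega> $ 3 + q t \<omega>)"
  shows "follower_optimal P W T m (x \<^bold>$ 1) (x \<^bold>$ 2) (x \<^bold>$ 3) u (\<lambda>t \<omega>. x t \<omega> $ 3 + y t \<omega>)"
    and "leader_outcome P W T m (\<lambda>t \<omega>. - (par m $ D\<^sub>\<alpha> / par m $ R\<^sub>\<alpha>) * (p t \<omega> $ 1)) (\<lambda>t \<omega>. - (par m $ D\<^sub>\<beta> / par m $ R\<^sub>\<beta>) * (p t \<omega> $ 2))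
       (x \<^bold>$ 1) (x \<^bold>$ 2) (x \<^bold>$ 3)"
proof -
  let ?\<theta> = "par m"
  note sp = system_process[OF m R x_def[THEN meta_eq_to_obj_eq] p_def[THEN meta_eq_to_obj_eq]]
  note fl = fluctuation[OF m F, folded y_def q_def] and pst = sp(4) and path = sp(5) and bw = sp(6) and pT = sp(7)
  have rB: "(mB S *v v) $ 1 = (?\<theta> $ D\<^sub>\<alpha>)\<^sup>2 / ?\<theta> $ R\<^sub>\<alpha> * v $ 1" "(mB S *v v) $ 2 = (?\<theta> $ D\<^sub>\<beta>)\<^sup>2 / ?\<theta> $ R\<^sub>\<beta> * v $ 2"
      "(mB S *v v) $ 3 = (?\<theta> $ E\<^sub>1)\<^sup>2 / ?\<theta> $ R\<^sub>1 * v $ 3" for v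
    using rows unfolding system_rows_def by blast+
  have rC: "(mC S *v v + mD S *v w + mM S) $ 3 = ?\<theta> $ A\<^sub>1 * v $ 3 +
       ?\<theta> $ Q\<^sub>1 * ((1 - ?\<theta> $ F\<^sub>1) * w $ 3 - ?\<theta> $ G\<^sub>1 * w $ 1 - ?\<theta> $ H\<^sub>1 * w $ 2 - ?\<theta> $ M\<^sub>1)" for v w
    using rows unfolding system_rows_def by blast
  have rE: "(mE S *v w + mh S) $ 3 = ?\<theta> $ Qb\<^sub>1 * ((1 - ?\<theta> $ Fb\<^sub>1) * w $ 3 - ?\<theta> $ Gb\<^sub>1 * w $ 1 - ?\<theta> $ Hb\<^sub>1 * w $ 2 - ?\<theta> $ Mb\<^sub>1)" for w
    using rows unfolding system_rows_def by blast
  show fo: "follower_optimal P W T m (x \<^bold>$ 1) (x \<^bold>$ 2) (x \<^bold>$ 3) u (\<lambda>t \<omega>. x t \<omega> $ 3 + y t \<omega>)"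
    unfolding u_def
  proof (rule follower_optimal_construct[OF m sp(2) sp(2) sp(2) pst fl(1,2)])
    show "AE \<omega> in P. \<forall>t\<in>{0..T}. x t \<omega> $ 3 = mean\<^sub>1 m + (LBINT s:{0..t}. par m $ C\<^sub>1 * (x s \<omega> $ 1)
        + par m $ D\<^sub>1 * (x s \<omega> $ 2) + (par m $ A\<^sub>1 + par m $ B\<^sub>1) * (x s \<omega> $ 3) - (par m $ E\<^sub>1)\<^sup>2 / par m $ R\<^sub>1 * (p s \<omega> $ 3))"
    proof (intro AE_I2 ballI)
      fix \<omega> t assume "\<omega> \<in> space P" "t \<in> {0..T}"
      from path[OF this, of 3] show "x t \<omega> $ 3 = mean\<^sub>1 m + (LBINT s:{0..t}. par m $ C\<^sub>1 * (x s \<omega> $ 1)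
        + par m $ D\<^sub>1 * (x s \<omega> $ 2) + (par m $ A\<^sub>1 + par m $ B\<^sub>1) * (x s \<omega> $ 3) - (par m $ E\<^sub>1)\<^sup>2 / par m $ R\<^sub>1 * (p s \<omega> $ 3))"
        by (simp only: vector_minus_component mat_A_rows rB) (simp add: x_init_def noise_def noise_coef_def)
    qed
    show "backward m (p \<^bold>$ 3) (\<lambda>t \<omega>. par m $ A\<^sub>1 * (p t \<omega> $ 3) + par m $ Q\<^sub>1 * ((1 - par m $ F\<^sub>1) * (x t \<omega> $ 3) - par m $ G\<^sub>1 * (x t \<omega> $ 1)
        - par m $ H\<^sub>1 * (x t \<omega> $ 2) - par m $ M\<^sub>1))"
      using bw[of 3] by (simp only: rC)
    show "AE \<omega> in P. p T \<omega> $ 3 = par m $ Qb\<^sub>1 * ((1 - par m $ Fb\<^sub>1) * (x T \<omega> $ 3) - par m $ Gb\<^sub>1 * (x T \<omega> $ 1)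
        - par m $ Hb\<^sub>1 * (x T \<omega> $ 2) - par m $ Mb\<^sub>1)"
      by (simp only: pT rE) simp
    show "AE \<omega> in P. \<forall>t\<in>{0..T}. y t \<omega> = (eta m \<omega> $ Follower - mean\<^sub>1 m) +
        (LBINT s:{0..t}. par m $ A\<^sub>1 * y s \<omega> - (par m $ E\<^sub>1)\<^sup>2 / par m $ R\<^sub>1 * q s \<omega>) + par m $ \<sigma>\<^sub>1 * W Follower t \<omega>"
      unfolding y_def q_def by (intro AE_I2 ballI fluctuation(3)[OF m F])
    show "backward m q (\<lambda>t \<omega>. par m $ A\<^sub>1 * q t \<omega> + par m $ Q\<^sub>1 * y t \<omega>)"
      unfolding y_def q_def by (rule fluctuation(4)[OF m F])
    show "AE \<omega> in P. q T \<omega> = par m $ Qb\<^sub>1 * y T \<omega>"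
      unfolding y_def q_def by (intro AE_I2 fluctuation(5)[OF m F])
  qed
  have st: "leader_state m (\<lambda>t \<omega>. x t \<omega> $ j)" for j by (rule sp(2))
  show "leader_outcome P W T m (\<lambda>t \<omega>. - (par m $ D\<^sub>\<alpha> / par m $ R\<^sub>\<alpha>) * (p t \<omega> $ 1)) (\<lambda>t \<omega>. - (par m $ D\<^sub>\<beta> / par m $ R\<^sub>\<beta>) * (p t \<omega> $ 2))
       (x \<^bold>$ 1) (x \<^bold>$ 2) (x \<^bold>$ 3)"
    unfolding leader_outcome_def Let_def
  proof (intro conjI st)
    note \<G> = filtration_leader[OF m]
    show "L2_process P T (leader_filtration P W m) (\<lambda>t \<omega>. - (par m $ D\<^sub>\<alpha> / par m $ R\<^sub>\<alpha>) * (p t \<omega> $ 1))"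
      "L2_process P T (leader_filtration P W m) (\<lambda>t \<omega>. - (par m $ D\<^sub>\<beta> / par m $ R\<^sub>\<beta>) * (p t \<omega> $ 2))"
      by (rule L2_process_cmult[OF \<G>]; use pst in \<open>simp add: state_process_def\<close>)+
  next
    have e: "a - d\<^sup>2 / r * v = a + d * (- (d / r) * v)" for a d r v :: real
      by (simp add: power2_eq_square)
    show "AE \<omega> in P. \<forall>t\<in>{0..T}. x t \<omega> $ 1 = eta m \<omega> $ Alpha + (LBINT s:{0..t}. ?\<theta> $ A\<^sub>\<alpha> * (x s \<omega> $ 1) + ?\<theta> $ B\<^sub>\<alpha> * (x s \<omega> $ 2)
        + ?\<theta> $ C\<^sub>\<alpha> * (x s \<omega> $ 3) + ?\<theta> $ D\<^sub>\<alpha> * (- (?\<theta> $ D\<^sub>\<alpha> / ?\<theta> $ R\<^sub>\<alpha>) * (p s \<omega> $ 1))) + ?\<theta> $ \<sigma>\<^sub>\<alpha> * W Alpha t \<omega>"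
    proof (intro AE_I2 ballI)
      fix \<omega> t assume "\<omega> \<in> space P" "t \<in> {0..T}"
      from path[OF this, of 1] show "x t \<omega> $ 1 = eta m \<omega> $ Alpha + (LBINT s:{0..t}. ?\<theta> $ A\<^sub>\<alpha> * (x s \<omega> $ 1) + ?\<theta> $ B\<^sub>\<alpha> * (x s \<omega> $ 2)
        + ?\<theta> $ C\<^sub>\<alpha> * (x s \<omega> $ 3) + ?\<theta> $ D\<^sub>\<alpha> * (- (?\<theta> $ D\<^sub>\<alpha> / ?\<theta> $ R\<^sub>\<alpha>) * (p s \<omega> $ 1))) + ?\<theta> $ \<sigma>\<^sub>\<alpha> * W Alpha t \<omega>"
        by (simp only: vector_minus_component mat_A_rows rB e) (simp add: x_init_def noise_def noise_coef_def noise_agent_def)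
    qed
    show "AE \<omega> in P. \<forall>t\<in>{0..T}. x t \<omega> $ 2 = eta m \<omega> $ Beta + (LBINT s:{0..t}. ?\<theta> $ A\<^sub>\<beta> * (x s \<omega> $ 1) + ?\<theta> $ B\<^sub>\<beta> * (x s \<omega> $ 2)
        + ?\<theta> $ C\<^sub>\<beta> * (x s \<omega> $ 3) + ?\<theta> $ D\<^sub>\<beta> * (- (?\<theta> $ D\<^sub>\<beta> / ?\<theta> $ R\<^sub>\<beta>) * (p s \<omega> $ 2))) + ?\<theta> $ \<sigma>\<^sub>\<beta> * W Beta t \<omega>"
    proof (intro AE_I2 ballI)
      fix \<omega> t assume "\<omega> \<in> space P" "t \<in> {0..T}"
      from path[OF this, of 2] show "x t \<omega> $ 2 = eta m \<omega> $ Beta + (LBINT s:{0..t}. ?\<theta> $ A\<^sub>\<beta> * (x s \<omega> $ 1) + ?\<theta> $ B\<^sub>\<beta> * (x s \<omega> $ 2)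
        + ?\<theta> $ C\<^sub>\<beta> * (x s \<omega> $ 3) + ?\<theta> $ D\<^sub>\<beta> * (- (?\<theta> $ D\<^sub>\<beta> / ?\<theta> $ R\<^sub>\<beta>) * (p s \<omega> $ 2))) + ?\<theta> $ \<sigma>\<^sub>\<beta> * W Beta t \<omega>"
        by (simp only: vector_minus_component mat_A_rows rB e) (simp add: x_init_def noise_def noise_coef_def noise_agent_def)
    qed
  next
    have "AE \<omega> in P. x t \<omega> $ 3 = real_cond_exp P (leader_filtration P W m t) (\<lambda>\<omega>. x t \<omega> $ 3 + y t \<omega>) \<omega>"
      if t: "t \<in> {0..T}" for t
    proof -
    have ysq: "L2 (y t)" by (rule state_process_sq[OF filtration_full[OF m] fl(1) t])
    show ?thesis
    proof (rule centred_conditional_mean[OF m _ _ _ refl])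
      show "integrable P (\<lambda>\<omega>. x t \<omega> $ 3)"
        by (rule square_integrable_integrable[OF state_process_sq[OF filtration_leader[OF m] st t]])
      show "(\<lambda>\<omega>. x t \<omega> $ 3) \<in> borel_measurable (leader_filtration P W m t)"
        by (rule L2_process_adapted[OF _ t]) (use st in \<open>simp add: state_process_def\<close>)
      show "integrable P (\<lambda>\<omega>. y t \<omega> * \<zeta> \<omega>) \<and> (\<integral>\<omega>. y t \<omega> * \<zeta> \<omega> \<partial>P) = 0"
        if "\<zeta> \<in> borel_measurable (leader_filtration P W m t)" "L2 \<zeta>" for \<zeta>
        using fluctuation(6)[OF m F t that] square_integrable_mult[OF ysq that(2)] by (simp add: y_def)
    qed
    qed
    note ce = this
    show "\<exists>u x1. follower_optimal P W T m (x \<^bold>$ 1) (x \<^bold>$ 2) (x \<^bold>$ 3) u x1 \<and>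
        (\<forall>t\<in>{0..T}. AE \<omega> in P. x t \<omega> $ 3 = real_cond_exp P (leader_filtration P W m t) (x1 t) \<omega>)"
      by (rule exI[where x = u], rule exI[where x = "\<lambda>t \<omega>. x t \<omega> $ 3 + y t \<omega>"]) (intro conjI ballI fo ce)
  qed
qed

text \<open>Serves the Pareto game, where the sum of costates 4 and 5 is the adjoint of the mean
  field. Continuous drivers make the time integral additive path by path.\<close>

lemma backward_add:
  assumes b: "backward m p k" "backward m p' k'"
    and k: "\<And>\<omega>. \<omega> \<in> space P \<Longrightarrow> continuous_on {0..T} (\<lambda>t. k t \<omega>)" "\<And>\<omega>. \<omega> \<in> space P \<Longrightarrow> continuous_on {0..T} (\<lambda>t. k' t \<omega>)"
  shows "backward m (\<lambda>t \<omega>. p t \<omega> + p' t \<omega>) (\<lambda>t \<omega>. k t \<omega> + k' t \<omega>)"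
  unfolding backward_def
proof (intro ballI allI impI)
  fix t \<zeta> assume t: "t \<in> {0..T}" and \<zeta>: "\<zeta> \<in> borel_measurable (full_filtration P W m t)" "L2 \<zeta>"
  let ?f = "\<lambda>\<omega>. (p T \<omega> - p t \<omega> + (LBINT s:{t..T}. k s \<omega>)) * \<zeta> \<omega>" and ?f' = "\<lambda>\<omega>. (p' T \<omega> - p' t \<omega> + (LBINT s:{t..T}. k' s \<omega>)) * \<zeta> \<omega>"
  have f: "integrable P ?f \<and> (\<integral>\<omega>. ?f \<omega> \<partial>P) = 0" "integrable P ?f' \<and> (\<integral>\<omega>. ?f' \<omega> \<partial>P) = 0"
    using b t \<zeta> unfolding backward_def by blast+
  have eq: "(p T \<omega> + p' T \<omega> - (p t \<omega> + p' t \<omega>) + (LBINT s:{t..T}. k s \<omega> + k' s \<omega>)) * \<zeta> \<omega> = ?f \<omega> + ?f' \<omega>"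
    if \<omega>: "\<omega> \<in> space P" for \<omega>
  proof -
    have sub: "{t..T} \<subseteq> {0..T}" using t by auto
    have "(LBINT s:{t..T}. k s \<omega> + k' s \<omega>) = (LBINT s:{t..T}. k s \<omega>) + (LBINT s:{t..T}. k' s \<omega>)"
      by (intro set_integral_add(2) borel_integrable_atLeastAtMost' continuous_on_subset[OF k(1)[OF \<omega>] sub] continuous_on_subset[OF k(2)[OF \<omega>] sub])
    then show ?thesis by (simp add: algebra_simps)
  qed
  have "integrable P (\<lambda>\<omega>. ?f \<omega> + ?f' \<omega>) \<and> (\<integral>\<omega>. ?f \<omega> + ?f' \<omega> \<partial>P) = 0"
    using f by simp
  then show "integrable P (\<lambda>\<omega>. (p T \<omega> + p' T \<omega> - (p t \<omega> + p' t \<omega>) + (LBINT s:{t..T}. k s \<omega> + k' s \<omega>)) * \<zeta> \<omega>) \<and>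
      (\<integral>\<omega>. (p T \<omega> + p' T \<omega> - (p t \<omega> + p' t \<omega>) + (LBINT s:{t..T}. k s \<omega> + k' s \<omega>)) * \<zeta> \<omega> \<partial>P) = 0"
    by (simp only: Bochner_Integration.integrable_cong[OF refl eq] Bochner_Integration.integral_cong[OF refl eq])
qed

lemma backward_cong: "backward m p k \<Longrightarrow> (\<And>t \<omega>. k' t \<omega> = k t \<omega>) \<Longrightarrow> backward m p k'"
  by (simp add: backward_def)

text \<open>Stationarity in the leader's own control: the feedback \<open>- (d / r) * a\<close>
  balances the control cost against the adjoint.\<close>

lemma ip_feedback:
  assumes "r \<noteq> 0"
  shows "r * ip (\<lambda>t \<omega>. - (d / r) * a t \<omega>) b + d * ip a b = 0"
  using assms by (simp only: ip_cmult) simp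

lemma ip_zero: "ip a (\<lambda>t \<omega>. v t \<omega> - v t \<omega>) = 0"
  by (simp add: ip_def case_prod_beta')

text \<open>This is where seven costates are needed. Leader \<alpha> has the adjoints 1, 6, 4 for
  the states of \<alpha>, of \<beta> and the mean field, and tests the follower in direction 4 of
  the state; leader \<beta> has 7, 2, 5 and direction 5. Costates 6 and 7 are the leaders'
  sensitivities to the rival's state, and the weights (1, 0) and (0, 1) express that each leader
  minimises only the own cost.\<close>

lemma nash_construct:
  assumes m: "is_model P W m" and R: "system_data (par m) (nash_system (par m)) \<Gamma> g \<Phi> \<Psi>"
    and F: "fluct_data (par m) \<Gamma>f gf \<Phi>f \<Psi>f"
  defines "x \<equiv> system_state m (nash_system (par m)) \<Gamma> g \<Phi> \<Psi>"
  defines "p \<equiv> \<lambda>t \<omega>. \<Gamma> t *v x t \<omega> + g t"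
  shows "nash P W T m (\<lambda>t \<omega>. - (par m $ D\<^sub>\<alpha> / par m $ R\<^sub>\<alpha>) * (p t \<omega> $ 1)) (\<lambda>t \<omega>. - (par m $ D\<^sub>\<beta> / par m $ R\<^sub>\<beta>) * (p t \<omega> $ 2))
       (x \<^bold>$ 1) (x \<^bold>$ 2) (x \<^bold>$ 3)"
proof -
  let ?\<theta> = "par m" and ?S = "nash_system (par m)"
  let ?ua = "\<lambda>t \<omega>. - (par m $ D\<^sub>\<alpha> / par m $ R\<^sub>\<alpha>) * (p t \<omega> $ 1)" and ?ub = "\<lambda>t \<omega>. - (par m $ D\<^sub>\<beta> / par m $ R\<^sub>\<beta>) * (p t \<omega> $ 2)"
  note sp = system_process[OF m R x_def[THEN meta_eq_to_obj_eq] p_def[THEN meta_eq_to_obj_eq]]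
  note st = sp(2) and pst = sp(4)
  have bw: "backward m (\<lambda>t \<omega>. p t \<omega> $ i) (\<lambda>t \<omega>. (mat_CN ?\<theta> *v p t \<omega>) $ i + (mat_DN ?\<theta> *v x t \<omega> + vec_MN ?\<theta>) $ i)" for i
    using sp(6)[of i] by (simp add: nash_system_def add.assoc)
  have pT: "p T \<omega> = mat_DN (barred ?\<theta>) *v x T \<omega> + vec_MN (barred ?\<theta>)" for \<omega>
    using sp(7)[of \<omega>] by (simp add: nash_system_def)
  note adj = adjoint_path[OF m R x_def[THEN meta_eq_to_obj_eq] p_def[THEN meta_eq_to_obj_eq] system_rows_nash]
  have lam: "AE \<omega> in P. \<forall>t\<in>{0..T}. x t \<omega> $ 4 = (LBINT s:{0..t}. ?\<theta> $ A\<^sub>1 * (x s \<omega> $ 4) + ?\<theta> $ E\<^sub>1 * (- (?\<theta> $ E\<^sub>1 / ?\<theta> $ R\<^sub>1) * (p s \<omega> $ 4)))"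
      "AE \<omega> in P. \<forall>t\<in>{0..T}. x t \<omega> $ 5 = (LBINT s:{0..t}. ?\<theta> $ A\<^sub>1 * (x s \<omega> $ 5) + ?\<theta> $ E\<^sub>1 * (- (?\<theta> $ E\<^sub>1 / ?\<theta> $ R\<^sub>1) * (p s \<omega> $ 5)))"
    by (rule AE_I2, rule ballI, rule adj, assumption, assumption)+
  have r: "?\<theta> $ R\<^sub>\<alpha> \<noteq> 0" "?\<theta> $ R\<^sub>\<beta> \<noteq> 0" using m by (auto simp: is_model_def Let_def)
  have out: "leader_outcome P W T m ?ua ?ub (x \<^bold>$ 1) (x \<^bold>$ 2) (x \<^bold>$ 3)"
    unfolding p_def x_def by (rule system_outcome(2)[OF m R system_rows_nash F])
  note rows = mat_CN_rows mat_DN_rows error_alpha_def error_beta_def final_error_alpha_def final_error_beta_def pT barred_nth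
  show ?thesis
    unfolding nash_def
  proof (intro conjI out allI impI)
    fix va xa' xb' z' assume out': "leader_outcome P W T m va ?ub xa' xb' z'"
    have "1 * J_alpha P T ?\<theta> (x \<^bold>$ 1) (x \<^bold>$ 2) (x \<^bold>$ 3) ?ua
        + 0 * J_beta P T ?\<theta> (x \<^bold>$ 1) (x \<^bold>$ 2) (x \<^bold>$ 3) ?ub
        \<le> 1 * J_alpha P T ?\<theta> xa' xb' z' va + 0 * J_beta P T ?\<theta> xa' xb' z' ?ub"
    proof (rule leader_variation[OF m _ _ out out' pst[of 1] pst[of 6] pst[of 4] st[of 4] _ _ _ _ _ _ lam(1)])
      show "1 * ?\<theta> $ R\<^sub>\<alpha> * ip ?ua (\<lambda>t \<omega>. va t \<omega> - ?ua t \<omega>) + ?\<theta> $ D\<^sub>\<alpha> * ip (p \<^bold>$ 1) (\<lambda>t \<omega>. va t \<omega> - ?ua t \<omega>) = 0"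
        using ip_feedback[OF r(1)] by simp
      show "0 * ?\<theta> $ R\<^sub>\<beta> * ip ?ub (\<lambda>t \<omega>. ?ub t \<omega> - ?ub t \<omega>) + ?\<theta> $ D\<^sub>\<beta> * ip (p \<^bold>$ 6) (\<lambda>t \<omega>. ?ub t \<omega> - ?ub t \<omega>) = 0"
        by (simp only: ip_zero mult_zero_left mult_zero_right add_0)
    qed (rule zero_le_one order_refl backward_cong[OF bw] AE_I2 | (simp only: rows, simp add: algebra_simps))+
    then show "J_alpha P T ?\<theta> (x \<^bold>$ 1) (x \<^bold>$ 2) (x \<^bold>$ 3) ?ua \<le> J_alpha P T ?\<theta> xa' xb' z' va" by simp
  next
    fix vb xa' xb' z' assume out': "leader_outcome P W T m ?ua vb xa' xb' z'"
    have "0 * J_alpha P T ?\<theta> (x \<^bold>$ 1) (x \<^bold>$ 2) (x \<^bold>$ 3) ?ua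
        + 1 * J_beta P T ?\<theta> (x \<^bold>$ 1) (x \<^bold>$ 2) (x \<^bold>$ 3) ?ub
        \<le> 0 * J_alpha P T ?\<theta> xa' xb' z' ?ua + 1 * J_beta P T ?\<theta> xa' xb' z' vb"
    proof (rule leader_variation[OF m _ _ out out' pst[of 7] pst[of 2] pst[of 5] st[of 5] _ _ _ _ _ _ lam(2)])
      show "0 * ?\<theta> $ R\<^sub>\<alpha> * ip ?ua (\<lambda>t \<omega>. ?ua t \<omega> - ?ua t \<omega>) + ?\<theta> $ D\<^sub>\<alpha> * ip (p \<^bold>$ 7) (\<lambda>t \<omega>. ?ua t \<omega> - ?ua t \<omega>) = 0"
        by (simp only: ip_zero mult_zero_left mult_zero_right add_0)
      show "1 * ?\<theta> $ R\<^sub>\<beta> * ip ?ub (\<lambda>t \<omega>. vb t \<omega> - ?ub t \<omega>) + ?\<theta> $ D\<^sub>\<beta> * ip (p \<^bold>$ 2) (\<lambda>t \<omega>. vb t \<omega> - ?ub t \<omega>) = 0"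
        using ip_feedback[OF r(2)] by simp
    qed (rule zero_le_one order_refl backward_cong[OF bw] AE_I2 | (simp only: rows, simp add: algebra_simps))+
    then show "J_beta P T ?\<theta> (x \<^bold>$ 1) (x \<^bold>$ 2) (x \<^bold>$ 3) ?ub \<le> J_beta P T ?\<theta> xa' xb' z' vb" by simp
  qed
qed

text \<open>Multiplication by \<open>mat_I1\<close> adds the rows that the two leaders contribute
  for the same state: costates 1 and 2 are joint sensitivities. The mean field has the sum of
  costates 4 and 5 as adjoint and the sum of state components 4 and 5 as test direction; the system
  keeps the summands apart, and the first-order condition with weights (1, 1) uses the sums.\<close>

lemma pareto_construct:
  assumes m: "is_model P W m" and R: "system_data (par m) (pareto_system (par m)) \<Gamma> g \<Phi> \<Psi>"
    and F: "fluct_data (par m) \<Gamma>f gf \<Phi>f \<Psi>f"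
  defines "x \<equiv> system_state m (pareto_system (par m)) \<Gamma> g \<Phi> \<Psi>"
  defines "p \<equiv> \<lambda>t \<omega>. \<Gamma> t *v x t \<omega> + g t"
  shows "pareto P W T m (\<lambda>t \<omega>. - (par m $ D\<^sub>\<alpha> / par m $ R\<^sub>\<alpha>) * (p t \<omega> $ 1)) (\<lambda>t \<omega>. - (par m $ D\<^sub>\<beta> / par m $ R\<^sub>\<beta>) * (p t \<omega> $ 2))
       (x \<^bold>$ 1) (x \<^bold>$ 2) (x \<^bold>$ 3)"
proof -
  let ?\<theta> = "par m" and ?S = "pareto_system (par m)"
  let ?ua = "\<lambda>t \<omega>. - (par m $ D\<^sub>\<alpha> / par m $ R\<^sub>\<alpha>) * (p t \<omega> $ 1)" and ?ub = "\<lambda>t \<omega>. - (par m $ D\<^sub>\<beta> / par m $ R\<^sub>\<beta>) * (p t \<omega> $ 2)"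
  note sp = system_process[OF m R x_def[THEN meta_eq_to_obj_eq] p_def[THEN meta_eq_to_obj_eq]]
  note st = sp(2) and pst = sp(4)
  note \<G> = filtration_leader[OF m]
  let ?k = "\<lambda>t \<omega>. mat_I1 *v (mat_CN ?\<theta> *v (mat_I2 *v p t \<omega>) + (mat_DN ?\<theta> *v x t \<omega> + vec_MN ?\<theta>))"
  have bw: "backward m (\<lambda>t \<omega>. p t \<omega> $ i) (\<lambda>t \<omega>. ?k t \<omega> $ i)" for i
    using sp(6)[of i]
    by (simp add: pareto_system_def matrix_vector_mul_assoc[symmetric] vmult.add_right add.assoc)
  have pT: "p T \<omega> = mat_I1 *v (mat_DN (barred ?\<theta>) *v x T \<omega> + vec_MN (barred ?\<theta>))" for \<omega>
    using sp(7)[of \<omega>] by (simp add: pareto_system_def matrix_vector_mul_assoc[symmetric] vmult.add_right)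
  note rb = riccati_backward(1,2)[OF m R[unfolded system_data_def], where \<gamma> = noise_agent and c = "noise_coef (par m)"
      and ?x0.0 = "x_init P m", folded system_state_def, folded x_def]
  have cx: "continuous_on {0..T} (\<lambda>t. x t \<omega>)" and cp: "continuous_on {0..T} (\<lambda>t. p t \<omega>)" if "\<omega> \<in> space P" for \<omega>
    unfolding p_def by (rule rb(1)[OF that], rule rb(2)[OF that])
  have ck: "continuous_on {0..T} (\<lambda>t. ?k t \<omega> $ i)" if "\<omega> \<in> space P" for \<omega> i
    by (intro continuous_intros vmult.continuous_on cx cp that)
  let ?z = "\<lambda>t \<omega>. p t \<omega> $ 4 + p t \<omega> $ 5" and ?l = "\<lambda>t \<omega>. x t \<omega> $ 4 + x t \<omega> $ 5"
  have lam: "AE \<omega> in P. \<forall>t\<in>{0..T}. ?l t \<omega> = (LBINT s:{0..t}. ?\<theta> $ A\<^sub>1 * ?l s \<omega> + ?\<theta> $ E\<^sub>1 * (- (?\<theta> $ E\<^sub>1 / ?\<theta> $ R\<^sub>1) * ?z s \<omega>))"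
  proof (intro AE_I2 ballI)
    fix \<omega> t assume \<omega>: "\<omega> \<in> space P" and t: "t \<in> {0..T}"
    have sub: "{0..t} \<subseteq> {0..T}" using t by auto
    let ?f = "\<lambda>a b s. ?\<theta> $ A\<^sub>1 * a s + ?\<theta> $ E\<^sub>1 * (- (?\<theta> $ E\<^sub>1 / ?\<theta> $ R\<^sub>1) * b s)"
    let ?f4 = "?f (\<lambda>s. x s \<omega> $ 4) (\<lambda>s. p s \<omega> $ 4)" and ?f5 = "?f (\<lambda>s. x s \<omega> $ 5) (\<lambda>s. p s \<omega> $ 5)"
    have c: "continuous_on {0..t} ?f4" "continuous_on {0..t} ?f5"
      by (rule continuous_on_subset[OF _ sub], intro continuous_intros cx cp \<omega>)+
    have "?l t \<omega> = (LBINT s:{0..t}. ?f4 s) + (LBINT s:{0..t}. ?f5 s)"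
      using adjoint_path[OF m R x_def[THEN meta_eq_to_obj_eq] p_def[THEN meta_eq_to_obj_eq] system_rows_pareto \<omega> t] by (simp only:)
    also have "\<dots> = (LBINT s:{0..t}. ?f4 s + ?f5 s)"
      by (rule set_integral_add(2)[symmetric]; rule borel_integrable_atLeastAtMost', rule c)
    also have "(\<lambda>s. ?f4 s + ?f5 s) = (\<lambda>s. ?\<theta> $ A\<^sub>1 * ?l s \<omega> + ?\<theta> $ E\<^sub>1 * (- (?\<theta> $ E\<^sub>1 / ?\<theta> $ R\<^sub>1) * ?z s \<omega>))"
      by (simp add: fun_eq_iff algebra_simps add_divide_distrib)
    finally show "?l t \<omega> = (LBINT s:{0..t}. ?\<theta> $ A\<^sub>1 * ?l s \<omega> + ?\<theta> $ E\<^sub>1 * (- (?\<theta> $ E\<^sub>1 / ?\<theta> $ R\<^sub>1) * ?z s \<omega>))" .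
  qed
  have r: "?\<theta> $ R\<^sub>\<alpha> \<noteq> 0" "?\<theta> $ R\<^sub>\<beta> \<noteq> 0" using m by (auto simp: is_model_def Let_def)
  have out: "leader_outcome P W T m ?ua ?ub (x \<^bold>$ 1) (x \<^bold>$ 2) (x \<^bold>$ 3)"
    unfolding p_def x_def by (rule system_outcome(2)[OF m R system_rows_pareto F])
  have bz: "backward m ?z (\<lambda>t \<omega>. ?k t \<omega> $ 4 + ?k t \<omega> $ 5)"
    by (rule backward_add[OF bw bw]; rule ck; assumption)
  note rows = vector_add_component[of "_ *v _" "_ + _"] mat_I1_rows mat_I2_rows mat_CN_rows mat_DN_rows error_alpha_def error_beta_def final_error_alpha_def final_error_beta_def pT barred_nth
  show ?thesis
    unfolding pareto_def
  proof (intro conjI out allI impI)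
    fix va vb xa' xb' z' assume out': "leader_outcome P W T m va vb xa' xb' z'"
    have "1 * J_alpha P T ?\<theta> (x \<^bold>$ 1) (x \<^bold>$ 2) (x \<^bold>$ 3) ?ua
        + 1 * J_beta P T ?\<theta> (x \<^bold>$ 1) (x \<^bold>$ 2) (x \<^bold>$ 3) ?ub
        \<le> 1 * J_alpha P T ?\<theta> xa' xb' z' va + 1 * J_beta P T ?\<theta> xa' xb' z' vb"
    proof (rule leader_variation[OF m _ _ out out' pst[of 1] pst[of 2] state_process_add[OF \<G> pst[of 4] pst[of 5]]
          state_process_add[OF \<G> st[of 4] st[of 5]] _ _ _ _ _ _ lam])
      show "1 * ?\<theta> $ R\<^sub>\<alpha> * ip ?ua (\<lambda>t \<omega>. va t \<omega> - ?ua t \<omega>) + ?\<theta> $ D\<^sub>\<alpha> * ip (p \<^bold>$ 1) (\<lambda>t \<omega>. va t \<omega> - ?ua t \<omega>) = 0"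
        using ip_feedback[OF r(1)] by simp
      show "1 * ?\<theta> $ R\<^sub>\<beta> * ip ?ub (\<lambda>t \<omega>. vb t \<omega> - ?ub t \<omega>) + ?\<theta> $ D\<^sub>\<beta> * ip (p \<^bold>$ 2) (\<lambda>t \<omega>. vb t \<omega> - ?ub t \<omega>) = 0"
        using ip_feedback[OF r(2)] by simp
    qed (rule zero_le_one order_refl backward_cong[OF bw] backward_cong[OF bz] AE_I2 | (simp only: rows, simp add: algebra_simps))+
    then show "J_alpha P T ?\<theta> (x \<^bold>$ 1) (x \<^bold>$ 2) (x \<^bold>$ 3) ?ua
        + J_beta P T ?\<theta> (x \<^bold>$ 1) (x \<^bold>$ 2) (x \<^bold>$ 3) ?ub
        \<le> J_alpha P T ?\<theta> xa' xb' z' va + J_beta P T ?\<theta> xa' xb' z' vb" by simp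
  qed
qed

end

section \<open>Uniqueness of the follower's cost\<close>

text \<open>\<open>n\<close> collects initial value and noise and need not be differentiable;
  \<open>x - n\<close> is, and in the difference of two solutions \<open>n\<close> cancels, leaving
  a homogeneous linear equation with value 0 at time 0.\<close>

lemma closed_loop_unique:
  fixes x x' :: "real \<Rightarrow> real ^ 'n"
  assumes K: "continuous_on {0..T} K" and b: "continuous_on {0..T} b"
    and c: "continuous_on {0..T} x" "continuous_on {0..T} x'"
    and x: "\<And>t. t \<in> {0..T} \<Longrightarrow> x t = n t + (LBINT s:{0..t}. K s *v x s + b s)"
    and x': "\<And>t. t \<in> {0..T} \<Longrightarrow> x' t = n t + (LBINT s:{0..t}. K s *v x' s + b s)"
    and t: "t \<in> {0..T}"
  shows "x t = x' t"
proof -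
  have d: "((\<lambda>t. y t - n t) has_vector_derivative K t *v y t + b t) (at t within {0..T})"
    if y: "\<And>t. t \<in> {0..T} \<Longrightarrow> y t = n t + (LBINT s:{0..t}. K s *v y s + b s)" and cy: "continuous_on {0..T} y"
      and t: "t \<in> {0..T}" for y t
  proof (rule has_vector_derivative_transform[OF t])
    have cf: "continuous_on {0..T} (\<lambda>s. K s *v y s + b s)"
      by (intro continuous_intros vmult.continuous_on K b cy)
    show "((\<lambda>t. integral {0..t} (\<lambda>s. K s *v y s + b s)) has_vector_derivative K t *v y t + b t) (at t within {0..T})"
      by (rule integral_has_vector_derivative[OF cf t])
    show "y s - n s = integral {0..s} (\<lambda>s. K s *v y s + b s)" if s: "s \<in> {0..T}" for s
    proof -
      have "{0..s} \<subseteq> {0..T}" using s by auto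
      then show ?thesis
        using y[OF s] set_integral_continuous_eq_integral[OF continuous_on_subset[OF cf]] by simp
    qed
  qed
  have "x t - x' t = 0"
  proof (rule linear_ode_zero_forward[where L = "\<lambda>s v. K s *v v" and D = "\<lambda>t. x t - x' t", OF _ _ _ _ t])
    show "((\<lambda>t. x t - x' t) has_vector_derivative K t *v (x t - x' t)) (at t within {0..T})" if "t \<in> {0..T}" for t
      using has_vector_derivative_diff[OF d[OF x c(1) that] d[OF x' c(2) that]] by (simp add: vmult.diff_right)
    have "(LBINT s:{0..0}. f s) = 0" for f :: "real \<Rightarrow> real ^ 'n"
      using set_integral_continuous_eq_integral[of 0 0 f] by (simp add: continuous_on_sing)
    then show "x 0 - x' 0 = 0" using x[of 0] x'[of 0] t by simp
    show "continuous_on {0..T} (\<lambda>t. K t *v v)" for v by (intro vmult.continuous_on K continuous_intros)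
  qed (rule matrix_vector_mul_linear)
  then show ?thesis by simp
qed

context game_space
begin

text \<open>Both equilibria carry a Riccati solution and an offset, and these are unique on [0, T];
  the states then solve one and the same closed-loop equation along almost every path.\<close>

lemma equilibrium_state_unique:
  fixes S :: "('l::{finite, numeral}) system"
  assumes 1: "equilibrium P W T sol S m x p" and 2: "equilibrium P W T sol S m x' p'"
  shows "AE \<omega> in P. \<forall>t\<in>{0..T}. x t \<omega> = x' t \<omega>"
proof -
  obtain \<Gamma> g where r: "riccati_solution T (mat_A (par m)) S \<Gamma>" "offset_solution T S \<Gamma> g"
      "AE \<omega> in P. \<forall>t\<in>{0..T}. p t \<omega> = \<Gamma> t *v x t \<omega> + g t"
    using 1 unfolding equilibrium_def by blast
  obtain \<Gamma>' g' where r': "riccati_solution T (mat_A (par m)) S \<Gamma>'" "offset_solution T S \<Gamma>' g'"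
      "AE \<omega> in P. \<forall>t\<in>{0..T}. p' t \<omega> = \<Gamma>' t *v x' t \<omega> + g' t"
    using 2 unfolding equilibrium_def by blast
  have c\<Gamma>: "continuous_on {0..T} \<Gamma>"
    by (rule continuous_on_vector_derivative) (use r(1) in \<open>unfold riccati_solution_def, blast\<close>)
  have cg: "continuous_on {0..T} g"
    by (rule continuous_on_vector_derivative) (use r(2) in \<open>unfold offset_solution_def, blast\<close>)
  have \<Gamma>: "\<Gamma>' t = \<Gamma> t" if "t \<in> {0..T}" for t by (rule riccati_solution_unique[OF r'(1) r(1) that])
  have g: "g' t = g t" if "t \<in> {0..T}" for t by (rule offset_solution_unique[OF r'(2) r(2) that \<Gamma> c\<Gamma>])
  let ?K = "\<lambda>t. mat_A (par m) - mB S ** \<Gamma> t" and ?b = "\<lambda>t. - (mB S *v g t)"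
  have K: "continuous_on {0..T} ?K" by (intro continuous_intros mmult.continuous_on c\<Gamma>)
  have b: "continuous_on {0..T} ?b" by (intro continuous_intros vmult.continuous_on cg)
  have eq: "(LBINT s:{0..t}. mat_A (par m) *v y s - mB S *v q s) = (LBINT s:{0..t}. ?K s *v y s + ?b s)"
    if "\<And>s. s \<in> {0..T} \<Longrightarrow> q s = \<Gamma> s *v y s + g s" "t \<in> {0..T}" for q and y :: "real \<Rightarrow> real ^ 5" and t
    by (rule set_lebesgue_integral_cong)
      (use that in \<open>auto simp: vmult.diff_left vmult.add_right matrix_vector_mul_assoc\<close>)
  have f: "AE \<omega> in P. continuous_on {0..T} (\<lambda>t. y t \<omega>)" "AE \<omega> in P. \<forall>t\<in>{0..T}. y t \<omega> = x_init P m \<omega>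
          + (LBINT s:{0..t}. mat_A (par m) *v y s \<omega> - mB S *v q s \<omega>)
          + mat_Sigma (par m) *v vector [W Alpha t \<omega>, W Beta t \<omega>]" if "equilibrium P W T sol S m y q" for y q
    using that unfolding equilibrium_def fbsde_solution_def state_process_def Let_def by blast+
  show ?thesis
    using f[OF 1] f[OF 2] r(3) r'(3)
  proof eventually_elim
    fix \<omega> assume c: "continuous_on {0..T} (\<lambda>t. x t \<omega>)" "continuous_on {0..T} (\<lambda>t. x' t \<omega>)"
      and e: "\<forall>t\<in>{0..T}. x t \<omega> = x_init P m \<omega> + (LBINT s:{0..t}. mat_A (par m) *v x s \<omega> - mB S *v p s \<omega>)
          + mat_Sigma (par m) *v vector [W Alpha t \<omega>, W Beta t \<omega>]"
        "\<forall>t\<in>{0..T}. x' t \<omega> = x_init P m \<omega> + (LBINT s:{0..t}. mat_A (par m) *v x' s \<omega> - mB S *v p' s \<omega>)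
          + mat_Sigma (par m) *v vector [W Alpha t \<omega>, W Beta t \<omega>]"
      and p: "\<forall>t\<in>{0..T}. p t \<omega> = \<Gamma> t *v x t \<omega> + g t" "\<forall>t\<in>{0..T}. p' t \<omega> = \<Gamma>' t *v x' t \<omega> + g' t"
    have p': "p' t \<omega> = \<Gamma> t *v x' t \<omega> + g t" if "t \<in> {0..T}" for t using p(2) \<Gamma>[OF that] g[OF that] that by simp
    let ?n = "\<lambda>t. x_init P m \<omega> + mat_Sigma (par m) *v vector [W Alpha t \<omega>, W Beta t \<omega>]"
    show "\<forall>t\<in>{0..T}. x t \<omega> = x' t \<omega>"
    proof
      fix t assume t: "t \<in> {0..T}"
      show "x t \<omega> = x' t \<omega>"
      proof (rule closed_loop_unique[OF K b c _ _ t, where n = ?n])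
        fix s assume s: "s \<in> {0..T}"
        show "x s \<omega> = ?n s + (LBINT r:{0..s}. ?K r *v x r \<omega> + ?b r)"
          using e(1) s eq[of "\<lambda>s. p s \<omega>" "\<lambda>s. x s \<omega>", OF p(1)[rule_format] s] by (simp add: add_ac)
        show "x' s \<omega> = ?n s + (LBINT r:{0..s}. ?K r *v x' r \<omega> + ?b r)"
          using e(2) s eq[of "\<lambda>s. p' s \<omega>" "\<lambda>s. x' s \<omega>", OF p' s] by (simp add: add_ac)
      qed
    qed
  qed
qed

lemma follower_response_cong:
  assumes "AE \<omega> in P. \<forall>t\<in>{0..T}. xa t \<omega> = xa' t \<omega> \<and> xb t \<omega> = xb' t \<omega> \<and> z t \<omega> = z' t \<omega>"
    and "follower_response P W T m xa xb z v y"
  shows "follower_response P W T m xa' xb' z' v y"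
proof -
  let ?\<theta> = "par m"
  let ?d = "\<lambda>xa xb z s \<omega>. ?\<theta> $ A\<^sub>1 * y s \<omega> + ?\<theta> $ B\<^sub>1 * z s \<omega> + ?\<theta> $ C\<^sub>1 * xa s \<omega> + ?\<theta> $ D\<^sub>1 * xb s \<omega> + ?\<theta> $ E\<^sub>1 * v s \<omega>"
  have y: "L2_process P T (full_filtration P W m) v" "full_state m y"
      "AE \<omega> in P. \<forall>t\<in>{0..T}. y t \<omega> = eta m \<omega> $ Follower + (LBINT s:{0..t}. ?d xa xb z s \<omega>) + ?\<theta> $ \<sigma>\<^sub>1 * W Follower t \<omega>"
    using assms(2) unfolding follower_response_def Let_def by blast+
  have "AE \<omega> in P. \<forall>t\<in>{0..T}. y t \<omega> = eta m \<omega> $ Follower + (LBINT s:{0..t}. ?d xa' xb' z' s \<omega>) + ?\<theta> $ \<sigma>\<^sub>1 * W Follower t \<omega>"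
    using y(3) assms(1)
  proof eventually_elim
    fix \<omega> assume e: "\<forall>t\<in>{0..T}. xa t \<omega> = xa' t \<omega> \<and> xb t \<omega> = xb' t \<omega> \<and> z t \<omega> = z' t \<omega>"
      and y: "\<forall>t\<in>{0..T}. y t \<omega> = eta m \<omega> $ Follower + (LBINT s:{0..t}. ?d xa xb z s \<omega>) + ?\<theta> $ \<sigma>\<^sub>1 * W Follower t \<omega>"
    have "(LBINT s:{0..t}. ?d xa xb z s \<omega>) = (LBINT s:{0..t}. ?d xa' xb' z' s \<omega>)" if "t \<in> {0..T}" for t
      by (rule set_lebesgue_integral_cong) (use e that in auto)
    with y show "\<forall>t\<in>{0..T}. y t \<omega> = eta m \<omega> $ Follower + (LBINT s:{0..t}. ?d xa' xb' z' s \<omega>) + ?\<theta> $ \<sigma>\<^sub>1 * W Follower t \<omega>"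
      by simp
  qed
  with y(1,2) show ?thesis unfolding follower_response_def Let_def by blast
qed

lemma J_follower_cong:
  assumes ae: "AE \<omega> in P. \<forall>t\<in>{0..T}. xa t \<omega> = xa' t \<omega> \<and> xb t \<omega> = xb' t \<omega> \<and> z t \<omega> = z' t \<omega>"
    and st: "sqp xa" "sqp xb" "sqp z" "sqp xa'" "sqp xb'" "sqp z'" "sqp y" "sqp v"
      "L2 (xa T)" "L2 (xb T)" "L2 (z T)"
      "L2 (xa' T)" "L2 (xb' T)" "L2 (z' T)" "L2 (y T)"
  shows "J_follower P T \<theta> xa xb z y v = J_follower P T \<theta> xa' xb' z' y v"
proof -
  let ?e = "follower_error \<theta> xa xb z y" and ?e' = "follower_error \<theta> xa' xb' z' y"
  let ?f = "follower_final_error \<theta> xa xb z y" and ?f' = "follower_final_error \<theta> xa' xb' z' y"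
  have e: "sqp ?e" "sqp ?e'" and f: "L2 ?f" "L2 ?f'"
    by (intro follower_error_sqp follower_final_error_sq st)+
  have "ip ?e ?e = ip ?e' ?e'"
    unfolding ip_def
  proof (rule integral_cong_AE)
    show "(\<lambda>(s, \<omega>). ?e s \<omega> * ?e s \<omega>) \<in> borel_measurable \<mu>" "(\<lambda>(s, \<omega>). ?e' s \<omega> * ?e' s \<omega>) \<in> borel_measurable \<mu>"
      by (intro borel_measurable_integrable ip_integrable e)+
    show "AE z in \<mu>. (case z of (s, \<omega>) \<Rightarrow> ?e s \<omega> * ?e s \<omega>) = (case z of (s, \<omega>) \<Rightarrow> ?e' s \<omega> * ?e' s \<omega>)"
      using AE_mu_snd[OF ae] AE_space by eventually_elim (auto simp: space_pair_measure follower_error_def)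
  qed
  moreover have "ex ?f ?f = ex ?f' ?f'"
    unfolding ex_def
  proof (rule integral_cong_AE)
    show "AE \<omega> in P. ?f \<omega> * ?f \<omega> = ?f' \<omega> * ?f' \<omega>"
      using ae by eventually_elim (use T_pos in \<open>simp add: follower_final_error_def\<close>)
  qed (use f in measurable)
  ultimately show ?thesis
    unfolding J_follower_eq lq_cost_eq[OF st(8) e(1) f(1)] lq_cost_eq[OF st(8) e(2) f(2)] by simp
qed

text \<open>The follower's optimal pair of one equilibrium is a competitor in the other one, since
  the leaders' states and the mean field agree almost surely. Comparing both ways gives equality of
  the costs without identifying the optimal pairs.\<close>

lemma equilibrium_cost_unique:
  fixes S :: "('l::{finite, numeral}) system"
  assumes m: "is_model P W m" and sol: "\<And>ua ub xa xb z. sol P W T m ua ub xa xb z \<Longrightarrow> leader_outcome P W T m ua ub xa xb z"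
    and 1: "equilibrium_cost P W T sol S m c" and 2: "equilibrium_cost P W T sol S m c'"
  shows "c = c'"
proof -
  have "c \<le> c'" if c: "equilibrium_cost P W T sol S m c" "equilibrium_cost P W T sol S m c'" for c c'
  proof -
    obtain x p u y where a: "equilibrium P W T sol S m x p"
        "follower_optimal P W T m (x \<^bold>$ 1) (x \<^bold>$ 2) (x \<^bold>$ 3) u y"
        "c = J_follower P T (par m) (x \<^bold>$ 1) (x \<^bold>$ 2) (x \<^bold>$ 3) y u"
      using c(1) unfolding equilibrium_cost_def by blast
    obtain x' p' u' y' where a': "equilibrium P W T sol S m x' p'"
        "follower_optimal P W T m (x' \<^bold>$ 1) (x' \<^bold>$ 2) (x' \<^bold>$ 3) u' y'"
        "c' = J_follower P T (par m) (x' \<^bold>$ 1) (x' \<^bold>$ 2) (x' \<^bold>$ 3) y' u'"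
      using c(2) unfolding equilibrium_cost_def by blast
    have ae: "AE \<omega> in P. \<forall>t\<in>{0..T}. x' t \<omega> $ 1 = x t \<omega> $ 1 \<and> x' t \<omega> $ 2 = x t \<omega> $ 2 \<and> x' t \<omega> $ 3 = x t \<omega> $ 3"
      using equilibrium_state_unique[OF a'(1) a(1)] by eventually_elim simp
    have r': "follower_response P W T m (x' \<^bold>$ 1) (x' \<^bold>$ 2) (x' \<^bold>$ 3) u' y'"
      using a'(2) unfolding follower_optimal_def by blast
    note \<G> = filtration_leader[OF m] and \<F> = filtration_full[OF m]
    have T0: "T \<in> {0..T}" using T_pos by simp
    have st: "leader_state m (x \<^bold>$ 1)"
        "leader_state m (x \<^bold>$ 2)"
        "leader_state m (x \<^bold>$ 3)" if "equilibrium P W T sol S m x p" for x p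
    proof -
      have "leader_outcome P W T m (\<lambda>t \<omega>. - (par m $ D\<^sub>\<alpha> / par m $ R\<^sub>\<alpha>) * (p t \<omega> $ 1))
          (\<lambda>t \<omega>. - (par m $ D\<^sub>\<beta> / par m $ R\<^sub>\<beta>) * (p t \<omega> $ 2)) (x \<^bold>$ 1) (x \<^bold>$ 2) (x \<^bold>$ 3)"
        by (rule sol) (use that in \<open>unfold equilibrium_def, blast\<close>)
      then show "leader_state m (x \<^bold>$ 1)"
        "leader_state m (x \<^bold>$ 2)"
        "leader_state m (x \<^bold>$ 3)"
        unfolding leader_outcome_def Let_def by blast+
    qed
    have y': "L2_process P T (full_filtration P W m) u'" "full_state m y'"
      using r' unfolding follower_response_def Let_def by blast+
    have "c \<le> J_follower P T (par m) (x \<^bold>$ 1) (x \<^bold>$ 2) (x \<^bold>$ 3) y' u'"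
      using a(2) follower_response_cong[OF ae r'] unfolding a(3) follower_optimal_def by blast
    also have "\<dots> = c'"
      unfolding a'(3)
    proof (rule J_follower_cong[OF ae, symmetric])
    qed (rule state_process_sqp[OF \<G> st(1)[OF a(1)]] state_process_sqp[OF \<G> st(2)[OF a(1)]] state_process_sqp[OF \<G> st(3)[OF a(1)]]
        state_process_sqp[OF \<G> st(1)[OF a'(1)]] state_process_sqp[OF \<G> st(2)[OF a'(1)]] state_process_sqp[OF \<G> st(3)[OF a'(1)]]
        state_process_sq[OF \<G> st(1)[OF a(1)] T0] state_process_sq[OF \<G> st(2)[OF a(1)] T0] state_process_sq[OF \<G> st(3)[OF a(1)] T0]
        state_process_sq[OF \<G> st(1)[OF a'(1)] T0] state_process_sq[OF \<G> st(2)[OF a'(1)] T0] state_process_sq[OF \<G> st(3)[OF a'(1)] T0]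
        state_process_sqp[OF \<F> y'(2)] state_process_sq[OF \<F> y'(2) T0] L2_process_sqp[OF \<F> y'(1)])+
    finally show "c \<le> c'" .
  qed
  from this[OF 1 2] this[OF 2 1] show ?thesis by simp
qed

lemma equilibrium_cost_construct:
  fixes S :: "('l::{finite, numeral}) system"
  assumes m: "is_model P W m" and R: "system_data (par m) S \<Gamma> g \<Phi> \<Psi>" and rows: "system_rows (par m) S"
    and F: "fluct_data (par m) \<Gamma>f gf \<Phi>f \<Psi>f"
  defines "x \<equiv> system_state m S \<Gamma> g \<Phi> \<Psi>"
  defines "p \<equiv> \<lambda>t \<omega>. \<Gamma> t *v x t \<omega> + g t"
  defines "y \<equiv> \<lambda>t \<omega>. fluct_state m \<Gamma>f gf \<Phi>f \<Psi>f t \<omega> $ 1"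
  defines "q \<equiv> \<lambda>t \<omega>. (\<Gamma>f t *v fluct_state m \<Gamma>f gf \<Phi>f \<Psi>f t \<omega> + gf t) $ 1"
  assumes sol: "sol P W T m (\<lambda>t \<omega>. - (par m $ D\<^sub>\<alpha> / par m $ R\<^sub>\<alpha>) * (p t \<omega> $ 1)) (\<lambda>t \<omega>. - (par m $ D\<^sub>\<beta> / par m $ R\<^sub>\<beta>) * (p t \<omega> $ 2))
       (x \<^bold>$ 1) (x \<^bold>$ 2) (x \<^bold>$ 3)"
  shows "equilibrium_cost P W T sol S m (J_follower P T (par m) (x \<^bold>$ 1) (x \<^bold>$ 2) (x \<^bold>$ 3)
    (\<lambda>t \<omega>. x t \<omega> $ 3 + y t \<omega>) (\<lambda>t \<omega>. - (par m $ E\<^sub>1 / par m $ R\<^sub>1) * (p t \<omega> $ 3 + q t \<omega>)))"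
proof -
  note sp = system_process(8-10)[OF m R x_def[THEN meta_eq_to_obj_eq] p_def[THEN meta_eq_to_obj_eq]]
  have "equilibrium P W T sol S m x p"
    unfolding equilibrium_def
  proof (intro conjI sol)
    show "fbsde_solution P W T m S x p" by (rule sp(1))
    have "AE \<omega> in P. \<forall>t\<in>{0..T}. p t \<omega> = \<Gamma> t *v x t \<omega> + g t" by (simp add: p_def)
    with sp(2,3) show "\<exists>\<Gamma> g. riccati_solution T (mat_A (par m)) S \<Gamma> \<and> offset_solution T S \<Gamma> g \<and>
        (AE \<omega> in P. \<forall>t\<in>{0..T}. p t \<omega> = \<Gamma> t *v x t \<omega> + g t)" by blast
  qed
  moreover have "follower_optimal P W T m (x \<^bold>$ 1) (x \<^bold>$ 2) (x \<^bold>$ 3)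
      (\<lambda>t \<omega>. - (par m $ E\<^sub>1 / par m $ R\<^sub>1) * (p t \<omega> $ 3 + q t \<omega>)) (\<lambda>t \<omega>. x t \<omega> $ 3 + y t \<omega>)"
    unfolding p_def q_def y_def x_def by (rule system_outcome(1)[OF m R rows F])
  ultimately show ?thesis unfolding equilibrium_cost_def by blast
qed

end

section \<open>Continuity of the cost in the model\<close>

text \<open>For fixed \<open>r\<close> the bound tends to \<open>r * K\<close>, and \<open>r\<close>
  is arbitrary; so \<open>r\<close> is chosen before the limit is taken.\<close>

lemma quadratic_limit:
  fixes a c :: "'p \<Rightarrow> real"
  assumes a: "(a \<longlongrightarrow> 0) F" and K: "0 \<le> K"
    and c: "\<forall>\<^sub>F p in F. \<forall>r>0. \<bar>c p\<bar> \<le> a p + r * K + a p / r"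
  shows "(c \<longlongrightarrow> 0) F"
proof (rule tendstoI)
  fix e :: real assume e: "0 < e"
  \<comment> \<open>Makes \<open>r * K\<close> less than \<open>e / 2\<close>, also if
    \<open>K = 0\<close>.\<close>
  define r where "r = e / (2 * (K + 1))"
  have r: "0 < r" "r * K < e / 2" using e K by (simp_all add: r_def field_simps)
  have "((\<lambda>p. a p + a p / r) \<longlongrightarrow> 0 + 0 / r) F" by (intro tendsto_intros a) (use r in simp)
  then have "\<forall>\<^sub>F p in F. dist (a p + a p / r) 0 < e / 2" using e by (auto dest: tendstoD[where e = "e / 2"])
  with c show "\<forall>\<^sub>F p in F. dist (c p) 0 < e"
  proof eventually_elim
    fix p assume c: "\<forall>r>0. \<bar>c p\<bar> \<le> a p + r * K + a p / r" and a: "dist (a p + a p / r) 0 < e / 2"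
    have "\<bar>c p\<bar> \<le> (a p + a p / r) + r * K" using c r(1) by (auto simp: algebra_simps)
    also have "\<dots> < e" using a r(2) unfolding dist_real_def by linarith
    finally show "dist (c p) 0 < e" by simp
  qed
qed

text \<open>Here \<open>dd\<close> is the squared norm of a difference D = Y - X, \<open>dx\<close>
  its pairing with X, and \<open>xx\<close>, \<open>yy\<close> are the squared norms of X and Y. The
  squares of D + r X and D - r X are nonnegative and bound the cross term; the free parameter
  \<open>r\<close> replaces the square roots of Cauchy-Schwarz.\<close>

lemma square_difference_bound:
  fixes dd dx xx yy r :: real
  assumes "yy = dd + 2 * dx + xx" "0 \<le> dd + 2 * r * dx + r\<^sup>2 * xx" "0 \<le> dd - 2 * r * dx + r\<^sup>2 * xx" "0 < r" "0 \<le> dd"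
  shows "\<bar>yy - xx\<bar> \<le> dd + r * xx + dd / r"
proof -
  have "2 * r * \<bar>dx\<bar> \<le> dd + r\<^sup>2 * xx" using assms(2-4) by (simp add: abs_if)
  then have "2 * \<bar>dx\<bar> \<le> dd / r + r * xx"
    using assms(4) by (simp add: field_simps power2_eq_square)
  then show ?thesis using assms(1,5) by (simp add: abs_if split: if_splits)
qed

context game_space
begin

section \<open>Continuity of quadratic functionals of processes\<close>

lemma ip_square_difference:
  assumes s: "sqp X" "sqp X0" and r: "0 < r"
  defines "D \<equiv> \<lambda>s \<omega>. X s \<omega> - X0 s \<omega>"
  shows "\<bar>ip X X - ip X0 X0\<bar> \<le> ip D D + r * ip X0 X0 + ip D D / r"
proof (rule square_difference_bound[OF _ _ _ r ip_nonneg])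
  have D: "sqp D" unfolding D_def by (intro sqp_intros s)
  show "ip X X = ip D D + 2 * ip D X0 + ip X0 X0"
    unfolding D_def by (simp add: ip_diff ip_diff' s sqp_intros ip_commute[of X0 X])
  show "0 \<le> ip D D + 2 * r * ip D X0 + r\<^sup>2 * ip X0 X0"
    using ip_nonneg[of "\<lambda>s \<omega>. D s \<omega> + r * X0 s \<omega>"]
    by (simp add: ip_simps s D sqp_intros ip_commute[of X0 D] power2_eq_square algebra_simps)
  show "0 \<le> ip D D - 2 * r * ip D X0 + r\<^sup>2 * ip X0 X0"
    using ip_nonneg[of "\<lambda>s \<omega>. D s \<omega> - r * X0 s \<omega>"]
    by (simp add: ip_simps s D sqp_intros ip_commute[of X0 D] power2_eq_square algebra_simps)
qed

lemma ex_square_difference: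
  assumes s: "L2 X" "L2 X0" and r: "0 < r"
  defines "D \<equiv> \<lambda>\<omega>. X \<omega> - X0 \<omega>"
  shows "\<bar>ex X X - ex X0 X0\<bar> \<le> ex D D + r * ex X0 X0 + ex D D / r"
proof (rule square_difference_bound[OF _ _ _ r ex_nonneg])
  have D: "L2 D" unfolding D_def by (intro square_integrable_intros s)
  show "ex X X = ex D D + 2 * ex D X0 + ex X0 X0"
    unfolding D_def by (simp add: ex_diff ex_diff' s square_integrable_diff ex_commute[of X0 X])
  show "0 \<le> ex D D + 2 * r * ex D X0 + r\<^sup>2 * ex X0 X0"
    using ex_nonneg[of "\<lambda>\<omega>. D \<omega> + r * X0 \<omega>"]
    by (simp add: ex_simps s D square_integrable_add square_integrable_cmult ex_commute[of X0 D] power2_eq_square algebra_simps)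
  show "0 \<le> ex D D - 2 * r * ex D X0 + r\<^sup>2 * ex X0 X0"
    using ex_nonneg[of "\<lambda>\<omega>. D \<omega> - r * X0 \<omega>"]
    by (simp add: ex_simps s D square_integrable_diff square_integrable_cmult ex_commute[of X0 D] power2_eq_square algebra_simps)
qed

text \<open>Uniform smallness of the time slices integrates to smallness over the product space at
  the cost of a factor \<open>T\<close>, whence the tolerance \<open>e / (2 * T)\<close>.\<close>

lemma l2_limit_ip:
  assumes X: "l2_limit F X X0" and s: "\<forall>\<^sub>F p in F. sqp (X p)" "sqp X0"
  shows "((\<lambda>p. ip (X p) (X p)) \<longlongrightarrow> ip X0 X0) F"
proof -
  let ?D = "\<lambda>p s \<omega>. X p s \<omega> - X0 s \<omega>"
  have ev: "\<forall>\<^sub>F p in F. \<forall>t\<in>{0..T}. L2 (X p t)" and x0: "\<And>t. t \<in> {0..T} \<Longrightarrow> L2 (X0 t)"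
    and u: "uniform_limit {0..T} (\<lambda>p t. \<integral>\<omega>. (?D p t \<omega>)\<^sup>2 \<partial>P) (\<lambda>_. 0) F"
    using X by (auto simp: l2_limit_def)
  have lim: "((\<lambda>p. ip (?D p) (?D p)) \<longlongrightarrow> 0) F"
  proof (rule tendstoI)
    fix e :: real assume e: "0 < e"
    have "\<forall>\<^sub>F p in F. \<forall>t\<in>{0..T}. dist (\<integral>\<omega>. (?D p t \<omega>)\<^sup>2 \<partial>P) 0 < e / (2 * T)"
      using u e T_pos by (auto simp: uniform_limit_iff)
    with ev s(1) show "\<forall>\<^sub>F p in F. dist (ip (?D p) (?D p)) 0 < e"
    proof eventually_elim
      fix p assume x: "\<forall>t\<in>{0..T}. L2 (X p t)" and sp: "sqp (X p)"
        and d: "\<forall>t\<in>{0..T}. dist (\<integral>\<omega>. (?D p t \<omega>)\<^sup>2 \<partial>P) 0 < e / (2 * T)"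
      have "sqp (?D p)" by (intro sqp_intros sp s(2))
      then have "(\<lambda>(s, \<omega>). ?D p s \<omega>) \<in> borel_measurable \<mu>" by (simp add: sqp_def square_integrable_measurable)
      then have "(\<integral>z. (case z of (s, \<omega>) \<Rightarrow> (?D p s \<omega>)\<^sup>2) \<partial>\<mu>) \<le> T * (e / (2 * T))"
      proof (rule square_integrable_mu_bounded(2))
        fix t assume t: "t \<in> {0..T}"
        show "L2 (?D p t)" using x x0 t by (intro square_integrable_diff) auto
        show "(\<integral>\<omega>. (?D p t \<omega>)\<^sup>2 \<partial>P) \<le> e / (2 * T)" using bspec[OF d t] by (simp add: dist_real_def abs_if split: if_splits)
      qed
      then have "ip (?D p) (?D p) \<le> e / 2" using T_pos by (simp add: ip_def power2_eq_square)
      then show "dist (ip (?D p) (?D p)) 0 < e" using e ip_nonneg[of "?D p"] by (simp add: dist_real_def)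
    qed
  qed
  have "((\<lambda>p. ip (X p) (X p) - ip X0 X0) \<longlongrightarrow> 0) F"
    by (rule quadratic_limit[OF lim ip_nonneg[of X0]]) (use s(1) in eventually_elim, intro allI impI ip_square_difference s(2))
  then show ?thesis by (rule LIM_zero_cancel)
qed

lemma l2_limit_ex:
  assumes X: "l2_limit F X X0" and t: "t \<in> {0..T}"
  shows "((\<lambda>p. ex (X p t) (X p t)) \<longlongrightarrow> ex (X0 t) (X0 t)) F"
proof -
  let ?D = "\<lambda>p \<omega>. X p t \<omega> - X0 t \<omega>"
  have ev: "\<forall>\<^sub>F p in F. L2 (X p t)" and x0: "L2 (X0 t)"
    and u: "uniform_limit {0..T} (\<lambda>p t. \<integral>\<omega>. (X p t \<omega> - X0 t \<omega>)\<^sup>2 \<partial>P) (\<lambda>_. 0) F"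
    using X t by (auto simp: l2_limit_def elim: eventually_mono)
  have lim: "((\<lambda>p. ex (?D p) (?D p)) \<longlongrightarrow> 0) F"
    using tendsto_uniform_limitI[OF u t] by (simp add: ex_def power2_eq_square)
  have "((\<lambda>p. ex (X p t) (X p t) - ex (X0 t) (X0 t)) \<longlongrightarrow> 0) F"
    by (rule quadratic_limit[OF lim ex_nonneg[of "X0 t"]]) (use ev in eventually_elim, intro allI impI ex_square_difference x0)
  then show ?thesis by (rule LIM_zero_cancel)
qed

lemma l2_limit_scale:
  assumes "l2_limit F X X0" "(c \<longlongrightarrow> c0) F"
  shows "l2_limit F (\<lambda>p t \<omega>. c p * X p t \<omega>) (\<lambda>t \<omega>. c0 * X0 t \<omega>)"
proof (rule l2_limit_cmult[OF assms(1)])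
  show "uniform_limit {0..T} (\<lambda>p t. c p) (\<lambda>t. c0) F"
    using tendstoD[OF assms(2)] by (auto simp: uniform_limit_iff)
qed (rule bounded_continuous_image, simp)

lemma l2_limit_follower_error:
  assumes "l2_limit F xa xa0" "l2_limit F xb xb0" "l2_limit F z z0" "l2_limit F x1 x10" and \<theta>: "(\<theta> \<longlongrightarrow> \<theta>0) F"
  shows "l2_limit F (\<lambda>p. follower_error (\<theta> p) (xa p) (xb p) (z p) (x1 p)) (follower_error \<theta>0 xa0 xb0 z0 x10)"
proof -
  have "l2_limit F (\<lambda>p t \<omega>. x1 p t \<omega> + (- \<theta> p $ F\<^sub>1) * z p t \<omega> + (- \<theta> p $ G\<^sub>1) * xa p t \<omega> + (- \<theta> p $ H\<^sub>1) * xb p t \<omega> + (- \<theta> p $ M\<^sub>1) * 1)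
     (\<lambda>t \<omega>. x10 t \<omega> + (- \<theta>0 $ F\<^sub>1) * z0 t \<omega> + (- \<theta>0 $ G\<^sub>1) * xa0 t \<omega> + (- \<theta>0 $ H\<^sub>1) * xb0 t \<omega> + (- \<theta>0 $ M\<^sub>1) * 1)"
    by (intro l2_limit_add l2_limit_scale assms l2_limit_one tendsto_minus tendsto_vec_nth)
  then show ?thesis by (simp add: follower_error_def[abs_def])
qed

text \<open>The terminal error is a running error with barred parameters, so one convergence
  statement covers both parts of the cost.\<close>

lemma follower_final_error_barred:
  "follower_final_error \<theta> xa xb z x1 = follower_error (barred \<theta>) xa xb z x1 T"
  by (simp add: fun_eq_iff follower_error_def follower_final_error_def barred_nth)

lemma J_follower_limit:
  assumes L: "l2_limit F xa xa0" "l2_limit F xb xb0" "l2_limit F z z0" "l2_limit F x1 x10" "l2_limit F u u0"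
    and \<theta>: "(\<theta> \<longlongrightarrow> \<theta>0) F"
    and s: "\<forall>\<^sub>F p in F. sqp (xa p) \<and> sqp (xb p) \<and> sqp (z p) \<and> sqp (x1 p) \<and> sqp (u p)"
      "sqp xa0 \<and> sqp xb0 \<and> sqp z0 \<and> sqp x10 \<and> sqp u0"
  shows "((\<lambda>p. J_follower P T (\<theta> p) (xa p) (xb p) (z p) (x1 p) (u p)) \<longlongrightarrow> J_follower P T \<theta>0 xa0 xb0 z0 x10 u0) F"
proof -
  let ?e = "\<lambda>p. follower_error (\<theta> p) (xa p) (xb p) (z p) (x1 p)" and ?f = "\<lambda>p. follower_error (barred (\<theta> p)) (xa p) (xb p) (z p) (x1 p)"
  let ?E = "follower_error \<theta>0 xa0 xb0 z0 x10" and ?G = "follower_error (barred \<theta>0) xa0 xb0 z0 x10"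
  have e: "l2_limit F ?e ?E" and f: "l2_limit F ?f ?G"
    by (intro l2_limit_follower_error L \<theta> tendsto_barred)+
  have es: "\<forall>\<^sub>F p in F. sqp (?e p)" using s(1) by eventually_elim (blast intro: follower_error_sqp)
  have e0s: "sqp ?E" using s(2) by (blast intro: follower_error_sqp)
  have us: "\<forall>\<^sub>F p in F. sqp (u p)" using s(1) by eventually_elim blast
  have u0s: "sqp u0" using s(2) by blast
  have T0: "T \<in> {0..T}" using T_pos by simp
  have fs: "\<forall>\<^sub>F p in F. L2 (?f p T)" and f0s: "L2 (?G T)"
    using f T0 by (auto simp: l2_limit_def elim: eventually_mono)
  have "((\<lambda>p. \<theta> p $ Q\<^sub>1 * ip (?e p) (?e p) + \<theta> p $ R\<^sub>1 * ip (u p) (u p) + \<theta> p $ Qb\<^sub>1 * ex (?f p T) (?f p T)) \<longlongrightarrow>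
      \<theta>0 $ Q\<^sub>1 * ip ?E ?E + \<theta>0 $ R\<^sub>1 * ip u0 u0 + \<theta>0 $ Qb\<^sub>1 * ex (?G T) (?G T)) F"
    by (intro tendsto_intros \<theta> l2_limit_ip[OF e es e0s] l2_limit_ip[OF L(5) us u0s] l2_limit_ex[OF f T0])
  moreover have "\<forall>\<^sub>F p in F. \<theta> p $ Q\<^sub>1 * ip (?e p) (?e p) + \<theta> p $ R\<^sub>1 * ip (u p) (u p) + \<theta> p $ Qb\<^sub>1 * ex (?f p T) (?f p T)
      = J_follower P T (\<theta> p) (xa p) (xb p) (z p) (x1 p) (u p)"
    using es us fs by eventually_elim (simp add: J_follower_eq lq_cost_eq follower_final_error_barred)
  moreover have "J_follower P T \<theta>0 xa0 xb0 z0 x10 u0 = \<theta>0 $ Q\<^sub>1 * ip ?E ?E + \<theta>0 $ R\<^sub>1 * ip u0 u0 + \<theta>0 $ Qb\<^sub>1 * ex (?G T) (?G T)"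
    using e0s u0s f0s by (simp add: J_follower_eq lq_cost_eq follower_final_error_barred)
  ultimately show ?thesis by (simp add: tendsto_cong)
qed

text \<open>Neighbourhoods of \<open>m0\<close> within the admissible models. A filter is used
  because \<open>model_dist\<close> contains a squared mean-square distance and is not itself a
  metric.\<close>

definition models_near :: "'a model \<Rightarrow> 'a model filter" where
  "models_near m0 = (INF e\<in>{0<..}. principal {m. is_model P W m \<and> model_dist P m m0 < e})"

lemma eventually_models_near:
  "eventually Q (models_near m0) \<longleftrightarrow> (\<exists>e>0. \<forall>m. is_model P W m \<longrightarrow> model_dist P m m0 < e \<longrightarrow> Q m)"
  unfolding models_near_def
proof (subst eventually_INF_base)
  show "\<exists>x\<in>{0<..}. principal {m. is_model P W m \<and> model_dist P m m0 < x}
      \<le> inf (principal {m. is_model P W m \<and> model_dist P m m0 < a}) (principal {m. is_model P W m \<and> model_dist P m m0 < b})"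
    if "a \<in> {0<..}" "b \<in> {0<..}" for a b :: real
    using that by (intro bexI[of _ "min a b"]) auto
qed (auto simp: eventually_principal greaterThan_def gt_ex)

text \<open>The mean of the follower's initial value enters \<open>x_init\<close> as a number, so
  its convergence is needed besides the mean-square one; it follows by Cauchy-Schwarz.\<close>

lemma models_near_limits:
  assumes m0: "is_model P W m0"
  shows "\<forall>\<^sub>F m in models_near m0. is_model P W m" "(par \<longlongrightarrow> par m0) (models_near m0)"
    and "((\<lambda>m. \<integral>\<omega>. (eta m \<omega> $ \<gamma> - eta m0 \<omega> $ \<gamma>)\<^sup>2 \<partial>P) \<longlongrightarrow> 0) (models_near m0)"
    and "((\<lambda>m. \<integral>\<omega>. eta m \<omega> $ \<gamma> \<partial>P) \<longlongrightarrow> (\<integral>\<omega>. eta m0 \<omega> $ \<gamma> \<partial>P)) (models_near m0)"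
proof -
  let ?N = "models_near m0"
  show ev: "\<forall>\<^sub>F m in ?N. is_model P W m" unfolding eventually_models_near by (auto intro: exI[of _ 1])
  have small: "\<forall>\<^sub>F m in ?N. is_model P W m \<and> model_dist P m m0 < e" if "0 < e" for e
    unfolding eventually_models_near using that by blast
  show "(par \<longlongrightarrow> par m0) ?N"
  proof (rule vec_tendstoI, rule tendstoI)
    fix k and e :: real assume "0 < e"
    show "\<forall>\<^sub>F m in ?N. dist (par m $ k) (par m0 $ k) < e"
      using small[OF \<open>0 < e\<close>]
    proof eventually_elim
      fix m assume "is_model P W m \<and> model_dist P m m0 < e"
      then show "dist (par m $ k) (par m0 $ k) < e"
        using component_le_infnorm_cart[of "par m - par m0" k] by (simp add: model_dist_def dist_real_def)
    qed
  qed
  have sq: "L2 (\<lambda>\<omega>. eta m \<omega> $ \<gamma> - eta m0 \<omega> $ \<gamma>)" if "is_model P W m" for m \<gamma>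
    by (intro square_integrable_diff eta_square_integrable[OF that] eta_square_integrable[OF m0])
  have le: "(\<integral>\<omega>. (eta m \<omega> $ \<gamma> - eta m0 \<omega> $ \<gamma>)\<^sup>2 \<partial>P) \<le> model_dist P m m0" if m: "is_model P W m" for m
  proof -
    have "(\<integral>\<omega>. (eta m \<omega> $ \<gamma> - eta m0 \<omega> $ \<gamma>)\<^sup>2 \<partial>P) \<le> (\<integral>\<omega>. (norm (eta m \<omega> - eta m0 \<omega>))\<^sup>2 \<partial>P)"
    proof (rule integral_mono)
      show "integrable P (\<lambda>\<omega>. (eta m \<omega> $ \<gamma> - eta m0 \<omega> $ \<gamma>)\<^sup>2)" by (rule square_integrable_square[OF sq[OF m]])
      show "integrable P (\<lambda>\<omega>. (norm (eta m \<omega> - eta m0 \<omega>))\<^sup>2)"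
        unfolding norm_vec_square vector_minus_component
        by (intro Bochner_Integration.integrable_sum square_integrable_square sq m)
      show "(eta m \<omega> $ \<gamma> - eta m0 \<omega> $ \<gamma>)\<^sup>2 \<le> (norm (eta m \<omega> - eta m0 \<omega>))\<^sup>2" for \<omega>
        using component_le_norm_cart[of "eta m \<omega> - eta m0 \<omega>" \<gamma>] by (simp add: abs_le_square_iff[symmetric])
    qed
    then show ?thesis by (simp add: model_dist_def)
  qed
  show lim: "((\<lambda>m. \<integral>\<omega>. (eta m \<omega> $ \<gamma> - eta m0 \<omega> $ \<gamma>)\<^sup>2 \<partial>P) \<longlongrightarrow> 0) ?N"
  proof (rule tendstoI)
    fix e :: real assume "0 < e"
    show "\<forall>\<^sub>F m in ?N. dist (\<integral>\<omega>. (eta m \<omega> $ \<gamma> - eta m0 \<omega> $ \<gamma>)\<^sup>2 \<partial>P) 0 < e"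
      using small[OF \<open>0 < e\<close>]
    proof eventually_elim
      fix m assume m: "is_model P W m \<and> model_dist P m m0 < e"
      have "0 \<le> (\<integral>\<omega>. (eta m \<omega> $ \<gamma> - eta m0 \<omega> $ \<gamma>)\<^sup>2 \<partial>P)" by simp
      then show "dist (\<integral>\<omega>. (eta m \<omega> $ \<gamma> - eta m0 \<omega> $ \<gamma>)\<^sup>2 \<partial>P) 0 < e" using le[of m] m by (simp add: dist_real_def)
    qed
  qed
  have "((\<lambda>m. ((\<integral>\<omega>. eta m \<omega> $ \<gamma> \<partial>P) - (\<integral>\<omega>. eta m0 \<omega> $ \<gamma> \<partial>P))\<^sup>2) \<longlongrightarrow> 0) ?N"
  proof (rule tendsto_sandwich[OF _ _ tendsto_const lim])
    show "\<forall>\<^sub>F m in ?N. ((\<integral>\<omega>. eta m \<omega> $ \<gamma> \<partial>P) - (\<integral>\<omega>. eta m0 \<omega> $ \<gamma> \<partial>P))\<^sup>2 \<le> (\<integral>\<omega>. (eta m \<omega> $ \<gamma> - eta m0 \<omega> $ \<gamma>)\<^sup>2 \<partial>P)"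
      using ev
    proof eventually_elim
      fix m assume m: "is_model P W m"
      then show "((\<integral>\<omega>. eta m \<omega> $ \<gamma> \<partial>P) - (\<integral>\<omega>. eta m0 \<omega> $ \<gamma> \<partial>P))\<^sup>2 \<le> (\<integral>\<omega>. (eta m \<omega> $ \<gamma> - eta m0 \<omega> $ \<gamma>)\<^sup>2 \<partial>P)"
        using integral_square_le[OF sq[OF m]] square_integrable_integrable[OF eta_square_integrable[OF m]]
          square_integrable_integrable[OF eta_square_integrable[OF m0]] by (simp add: prob_space)
    qed
  qed simp
  then have "((\<lambda>m. sqrt (((\<integral>\<omega>. eta m \<omega> $ \<gamma> \<partial>P) - (\<integral>\<omega>. eta m0 \<omega> $ \<gamma> \<partial>P))\<^sup>2)) \<longlongrightarrow> sqrt 0) ?N"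
    by (rule tendsto_real_sqrt)
  then have "((\<lambda>m. (\<integral>\<omega>. eta m \<omega> $ \<gamma> \<partial>P) - (\<integral>\<omega>. eta m0 \<omega> $ \<gamma> \<partial>P)) \<longlongrightarrow> 0) ?N"
    by (simp add: tendsto_rabs_zero_iff)
  then show "((\<lambda>m. \<integral>\<omega>. eta m \<omega> $ \<gamma> \<partial>P) \<longlongrightarrow> (\<integral>\<omega>. eta m0 \<omega> $ \<gamma> \<partial>P)) ?N" by (rule LIM_zero_cancel)
qed

section \<open>Dependence of the states on the model\<close>

lemma closed_loop_uniform_limit:
  fixes A :: "'p \<Rightarrow> real ^ 'n ^ 'n" and B :: "'p \<Rightarrow> real ^ 'l ^ 'n"
  assumes "(A \<longlongrightarrow> A0) F" "(B \<longlongrightarrow> B0) F" "uniform_limit {0..T} \<Gamma> \<Gamma>0 F" "uniform_limit {0..T} g g0 F"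
    and c: "continuous_on {0..T} \<Gamma>0" "continuous_on {0..T} g0"
  shows "uniform_limit {0..T} (\<lambda>p t. A p - B p ** \<Gamma> p t) (\<lambda>t. A0 - B0 ** \<Gamma>0 t) F"
    and "uniform_limit {0..T} (\<lambda>p t. - (B p *v g p t)) (\<lambda>t. - (B0 *v g0 t)) F"
proof -
  have A: "uniform_limit {0..T} (\<lambda>p t. A p) (\<lambda>t. A0) F" and B: "uniform_limit {0..T} (\<lambda>p t. B p) (\<lambda>t. B0) F"
    using tendstoD[OF assms(1)] tendstoD[OF assms(2)] by (auto simp: uniform_limit_iff)
  have b: "bounded ((\<lambda>t. B0) ` {0..T})" by (rule bounded_continuous_image) simp
  show "uniform_limit {0..T} (\<lambda>p t. A p - B p ** \<Gamma> p t) (\<lambda>t. A0 - B0 ** \<Gamma>0 t) F"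
    by (intro uniform_limit_minus mmult.bounded_uniform_limit A B assms bounded_continuous_image[OF c(1)] b)
  show "uniform_limit {0..T} (\<lambda>p t. - (B p *v g p t)) (\<lambda>t. - (B0 *v g0 t)) F"
    by (intro uniform_limit_uminus vmult.bounded_uniform_limit B assms bounded_continuous_image[OF c(2)] b)
qed

lemma x_init_limit:
  assumes m0: "is_model P W m0"
  shows "((\<lambda>m. \<integral>\<omega>. (x_init P m \<omega> $ l - x_init P m0 \<omega> $ l)\<^sup>2 \<partial>P) \<longlongrightarrow> 0) (models_near m0)"
proof -
  note lim = models_near_limits[OF m0]
  have "((\<lambda>m. (mean\<^sub>1 m - mean\<^sub>1 m0)\<^sup>2) \<longlongrightarrow> (mean\<^sub>1 m0 - mean\<^sub>1 m0)\<^sup>2) (models_near m0)"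
    by (intro tendsto_intros lim(4))
  then have "\<forall>l. ((\<lambda>m. \<integral>\<omega>. (x_init P m \<omega> $ l - x_init P m0 \<omega> $ l)\<^sup>2 \<partial>P) \<longlongrightarrow> 0) (models_near m0)"
    unfolding forall_5 x_init_def using lim(3)[of Alpha] lim(3)[of Beta] by (simp add: prob_space)
  then show ?thesis by blast
qed

lemma noise_coef_limit: "(\<theta> \<longlongrightarrow> \<theta>0) F \<Longrightarrow> ((\<lambda>p. noise_coef (\<theta> p)) \<longlongrightarrow> noise_coef \<theta>0) F"
  by (intro vec_tendsto_5I) (auto simp: noise_coef_def intro!: tendsto_intros)

lemma system_state_limit:
  fixes S :: "real ^ param \<Rightarrow> ('l::finite) system"
  assumes m0: "is_model P W m0" and B: "((\<lambda>m. mB (S (par m))) \<longlongrightarrow> mB (S (par m0))) (models_near m0)"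
    and R0: "system_data (par m0) (S (par m0)) \<Gamma>0 g0 \<Phi>0 \<Psi>0"
    and R: "\<forall>\<^sub>F m in models_near m0. system_data (par m) (S (par m)) (\<Gamma> m) (g m) (\<Phi> m) (\<Psi> m)"
    and u: "uniform_limit {0..T} \<Gamma> \<Gamma>0 (models_near m0)" "uniform_limit {0..T} g g0 (models_near m0)"
      "uniform_limit {0..T} \<Phi> \<Phi>0 (models_near m0)" "uniform_limit {0..T} \<Psi> \<Psi>0 (models_near m0)"
  shows "l2_limit (models_near m0) (\<lambda>m t \<omega>. system_state m (S (par m)) (\<Gamma> m) (g m) (\<Phi> m) (\<Psi> m) t \<omega> $ j)
     (system_state m0 (S (par m0)) \<Gamma>0 g0 \<Phi>0 \<Psi>0 \<^bold>$ j)"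
proof -
  let ?N = "models_near m0"
  note lim = models_near_limits[OF m0]
  note c0 = riccati_data_continuous[OF R0[unfolded system_data_def]]
  note H = closed_loop_uniform_limit[OF tendsto_mat_A[OF lim(2)] B u(1,2) c0(1,2)]
  show ?thesis
    unfolding system_state_def
  proof (rule lin_state_l2_limit[OF u(3,4) H noise_coef_limit[OF lim(2)] c0(3,4,5,6)])
    show "\<forall>\<^sub>F m in ?N. continuous_on {0..T} (\<Psi> m) \<and> continuous_on {0..T} (\<lambda>t. mat_A (par m) - mB (S (par m)) ** \<Gamma> m t) \<and>
        continuous_on {0..T} (\<lambda>t. - (mB (S (par m)) *v g m t))"
      using R
    proof eventually_elim
      fix m assume "system_data (par m) (S (par m)) (\<Gamma> m) (g m) (\<Phi> m) (\<Psi> m)"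
      note riccati_data_continuous[OF this[unfolded system_data_def]]
      then show "continuous_on {0..T} (\<Psi> m) \<and> continuous_on {0..T} (\<lambda>t. mat_A (par m) - mB (S (par m)) ** \<Gamma> m t) \<and>
        continuous_on {0..T} (\<lambda>t. - (mB (S (par m)) *v g m t))" by blast
    qed
    show "\<forall>\<^sub>F m in ?N. L2 (\<lambda>\<omega>. x_init P m \<omega> $ l)" for l
      using lim(1) by eventually_elim (rule x_init_component)
  qed (rule x_init_component[OF m0] x_init_limit[OF m0])+
qed

lemma fluct_state_limit:
  assumes m0: "is_model P W m0"
    and R0: "fluct_data (par m0) \<Gamma>0 g0 \<Phi>0 \<Psi>0"
    and R: "\<forall>\<^sub>F m in models_near m0. fluct_data (par m) (\<Gamma> m) (g m) (\<Phi> m) (\<Psi> m)"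
    and u: "uniform_limit {0..T} \<Gamma> \<Gamma>0 (models_near m0)" "uniform_limit {0..T} g g0 (models_near m0)"
      "uniform_limit {0..T} \<Phi> \<Phi>0 (models_near m0)" "uniform_limit {0..T} \<Psi> \<Psi>0 (models_near m0)"
  shows "l2_limit (models_near m0) (\<lambda>m t \<omega>. fluct_state m (\<Gamma> m) (g m) (\<Phi> m) (\<Psi> m) t \<omega> $ j)
     (fluct_state m0 \<Gamma>0 g0 \<Phi>0 \<Psi>0 \<^bold>$ j)"
proof -
  let ?N = "models_near m0"
  note lim = models_near_limits[OF m0]
  note c0 = riccati_data_continuous[OF R0[unfolded fluct_data_def]]
  have r: "par m0 $ R\<^sub>1 \<noteq> 0" using m0 by (auto simp: is_model_def Let_def)
  have A: "((\<lambda>m. \<chi> i j. par m $ A\<^sub>1) \<longlongrightarrow> (\<chi> i j. par m0 $ A\<^sub>1 :: real ^ 1 ^ 1)) ?N"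
      and B: "((\<lambda>m. \<chi> i j. (par m $ E\<^sub>1)\<^sup>2 / par m $ R\<^sub>1) \<longlongrightarrow> (\<chi> i j. (par m0 $ E\<^sub>1)\<^sup>2 / par m0 $ R\<^sub>1 :: real ^ 1 ^ 1)) ?N"
      and C: "((\<lambda>m. \<chi> i. par m $ \<sigma>\<^sub>1) \<longlongrightarrow> (\<chi> i. par m0 $ \<sigma>\<^sub>1 :: real ^ 1)) ?N"
    by (intro tendsto_intros lim(2) r)+
  note H = closed_loop_uniform_limit[OF A B u(1,2) c0(1,2)]
  let ?\<eta> = "\<lambda>m \<omega>. eta m \<omega> $ Follower - mean\<^sub>1 m"
  have \<eta>sq: "L2 (?\<eta> m)" if "is_model P W m" for m
    by (intro square_integrable_diff eta_square_integrable[OF that] square_integrable_const)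
  have \<eta>lim: "((\<lambda>m. \<integral>\<omega>. (?\<eta> m \<omega> - ?\<eta> m0 \<omega>)\<^sup>2 \<partial>P) \<longlongrightarrow> 0) ?N"
  proof (rule tendsto_sandwich[OF _ _ tendsto_const])
    let ?d = "\<lambda>m. mean\<^sub>1 m - mean\<^sub>1 m0"
    let ?b = "\<lambda>m. 2 * (\<integral>\<omega>. (eta m \<omega> $ Follower - eta m0 \<omega> $ Follower)\<^sup>2 \<partial>P) + 2 * (?d m)\<^sup>2"
    have "(?b \<longlongrightarrow> 2 * 0 + 2 * (mean\<^sub>1 m0 - mean\<^sub>1 m0)\<^sup>2) ?N"
      by (intro tendsto_intros lim(3,4))
    then show "(?b \<longlongrightarrow> 0) ?N" by simp
    show "\<forall>\<^sub>F m in ?N. (\<integral>\<omega>. (?\<eta> m \<omega> - ?\<eta> m0 \<omega>)\<^sup>2 \<partial>P) \<le> ?b m"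
      using lim(1)
    proof eventually_elim
      fix m assume m: "is_model P W m"
      have e: "?\<eta> m \<omega> - ?\<eta> m0 \<omega> = (eta m \<omega> $ Follower - eta m0 \<omega> $ Follower) + - ?d m" for \<omega> by simp
      have "(\<integral>\<omega>. ((eta m \<omega> $ Follower - eta m0 \<omega> $ Follower) + - ?d m)\<^sup>2 \<partial>P) \<le> 2 * (\<integral>\<omega>. (eta m \<omega> $ Follower - eta m0 \<omega> $ Follower)\<^sup>2 \<partial>P)
          + 2 * (\<integral>\<omega>. (- ?d m)\<^sup>2 \<partial>P)"
        by (intro integral_square_add_le square_integrable_diff square_integrable_const eta_square_integrable m m0)
      also have "(\<integral>\<omega>. (- ?d m)\<^sup>2 \<partial>P) = (?d m)\<^sup>2" by (simp add: prob_space power2_commute)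
      finally show "(\<integral>\<omega>. (?\<eta> m \<omega> - ?\<eta> m0 \<omega>)\<^sup>2 \<partial>P) \<le> ?b m" unfolding e .
    qed
  qed simp
  show ?thesis
    unfolding fluct_state_def
  proof (rule lin_state_l2_limit[OF u(3,4) H C c0(3,4,5,6)])
    show "\<forall>\<^sub>F m in ?N. continuous_on {0..T} (\<Psi> m) \<and>
        continuous_on {0..T} (\<lambda>t. (\<chi> i j. par m $ A\<^sub>1 :: real ^ 1 ^ 1) - (\<chi> i j. (par m $ E\<^sub>1)\<^sup>2 / par m $ R\<^sub>1 :: real ^ 1 ^ 1) ** \<Gamma> m t) \<and>
        continuous_on {0..T} (\<lambda>t. - ((\<chi> i j. (par m $ E\<^sub>1)\<^sup>2 / par m $ R\<^sub>1 :: real ^ 1 ^ 1) *v g m t))"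
      using R
    proof eventually_elim
      fix m assume "fluct_data (par m) (\<Gamma> m) (g m) (\<Phi> m) (\<Psi> m)"
      note riccati_data_continuous[OF this[unfolded fluct_data_def]]
      then show "continuous_on {0..T} (\<Psi> m) \<and>
        continuous_on {0..T} (\<lambda>t. (\<chi> i j. par m $ A\<^sub>1 :: real ^ 1 ^ 1) - (\<chi> i j. (par m $ E\<^sub>1)\<^sup>2 / par m $ R\<^sub>1 :: real ^ 1 ^ 1) ** \<Gamma> m t) \<and>
        continuous_on {0..T} (\<lambda>t. - ((\<chi> i j. (par m $ E\<^sub>1)\<^sup>2 / par m $ R\<^sub>1 :: real ^ 1 ^ 1) *v g m t))" by blast
    qed
    show "\<forall>\<^sub>F m in ?N. L2 (\<lambda>\<omega>. (\<chi> i. ?\<eta> m \<omega>) $ l)" for l :: 1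
      using lim(1) by eventually_elim (simp add: \<eta>sq)
  qed (use \<eta>sq[OF m0] \<eta>lim in simp_all)
qed

definition system_cost where
  "system_cost m S \<Gamma> g \<Phi> \<Psi> \<Gamma>f gf \<Phi>f \<Psi>f = J_follower P T (par m) (system_state m S \<Gamma> g \<Phi> \<Psi> \<^bold>$ 1)
     (system_state m S \<Gamma> g \<Phi> \<Psi> \<^bold>$ 2) (system_state m S \<Gamma> g \<Phi> \<Psi> \<^bold>$ 3)
     (\<lambda>t \<omega>. system_state m S \<Gamma> g \<Phi> \<Psi> t \<omega> $ 3 + fluct_state m \<Gamma>f gf \<Phi>f \<Psi>f t \<omega> $ 1)
     (\<lambda>t \<omega>. - (par m $ E\<^sub>1 / par m $ R\<^sub>1) * ((\<Gamma> t *v system_state m S \<Gamma> g \<Phi> \<Psi> t \<omega> + g t) $ 3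
        + (\<Gamma>f t *v fluct_state m \<Gamma>f gf \<Phi>f \<Psi>f t \<omega> + gf t) $ 1))"

text \<open>Common to both games: the hypothesis \<open>sol\<close> says that the explicit candidate
  has the required optimality, so only the coefficient matrices and their nondegeneracy differ.
  \<open>j m\<close> is the cost of the candidate, given by a formula for every \<open>m\<close> but
  known to be an equilibrium cost only near \<open>m0\<close>.\<close>

lemma equilibrium_cost_limit:
  fixes S :: "real ^ param \<Rightarrow> ('l::{finite, numeral}) system"
  assumes m0: "is_model P W m0"
    and S: "((\<lambda>m. mB (S (par m))) \<longlongrightarrow> mB (S (par m0))) (models_near m0)" "((\<lambda>m. mC (S (par m))) \<longlongrightarrow> mC (S (par m0))) (models_near m0)"
      "((\<lambda>m. mD (S (par m))) \<longlongrightarrow> mD (S (par m0))) (models_near m0)" "((\<lambda>m. mE (S (par m))) \<longlongrightarrow> mE (S (par m0))) (models_near m0)"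
      "((\<lambda>m. mM (S (par m))) \<longlongrightarrow> mM (S (par m0))) (models_near m0)" "((\<lambda>m. mh (S (par m))) \<longlongrightarrow> mh (S (par m0))) (models_near m0)"
    and nd: "nondegenerate T (mat_A (par m0)) (mB (S (par m0))) (mC (S (par m0))) (mD (S (par m0))) (mE (S (par m0)))"
    and rows: "\<And>\<theta>. system_rows \<theta> (S \<theta>)"
    and sol: "\<And>m \<Gamma> g \<Phi> \<Psi> \<Gamma>f gf \<Phi>f \<Psi>f. is_model P W m \<Longrightarrow> system_data (par m) (S (par m)) \<Gamma> g \<Phi> \<Psi> \<Longrightarrow> fluct_data (par m) \<Gamma>f gf \<Phi>f \<Psi>f \<Longrightarrow>
      sol P W T m (\<lambda>t \<omega>. - (par m $ D\<^sub>\<alpha> / par m $ R\<^sub>\<alpha>) * ((\<Gamma> t *v system_state m (S (par m)) \<Gamma> g \<Phi> \<Psi> t \<omega> + g t) $ 1))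
        (\<lambda>t \<omega>. - (par m $ D\<^sub>\<beta> / par m $ R\<^sub>\<beta>) * ((\<Gamma> t *v system_state m (S (par m)) \<Gamma> g \<Phi> \<Psi> t \<omega> + g t) $ 2))
        (system_state m (S (par m)) \<Gamma> g \<Phi> \<Psi> \<^bold>$ 1) (system_state m (S (par m)) \<Gamma> g \<Phi> \<Psi> \<^bold>$ 2)
        (system_state m (S (par m)) \<Gamma> g \<Phi> \<Psi> \<^bold>$ 3)"
  obtains j where "equilibrium_cost P W T sol (S (par m0)) m0 (j m0)"
    "\<forall>\<^sub>F m in models_near m0. equilibrium_cost P W T sol (S (par m)) m (j m)" "(j \<longlongrightarrow> j m0) (models_near m0)"
proof -
  let ?N = "models_near m0"
  note lim = models_near_limits[OF m0]
  obtain \<Gamma> g \<Phi> \<Psi> where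
    R0: "system_data (par m0) (S (par m0)) (\<Gamma> m0) (g m0) (\<Phi> m0) (\<Psi> m0)"
    and R: "\<forall>\<^sub>F m in ?N. system_data (par m) (S (par m)) (\<Gamma> m) (g m) (\<Phi> m) (\<Psi> m)"
    and u: "uniform_limit {0..T} \<Gamma> (\<Gamma> m0) ?N" "uniform_limit {0..T} g (g m0) ?N"
      "uniform_limit {0..T} \<Phi> (\<Phi> m0) ?N" "uniform_limit {0..T} \<Psi> (\<Psi> m0) ?N"
    using riccati_family[where A = "\<lambda>m. mat_A (par m)" and ?p0.0 = m0, OF tendsto_mat_A[OF lim(2)] S(1-6) less_imp_le[OF T_pos] nd]
    unfolding system_data_def by blast
  have pos: "par m0 $ R\<^sub>1 > 0" "par m0 $ Q\<^sub>1 > 0" "par m0 $ Qb\<^sub>1 \<ge> 0" "par m0 $ E\<^sub>1 \<noteq> 0" using m0 by (auto simp: is_model_def Let_def)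
  obtain \<Gamma>f gf \<Phi>f \<Psi>f where
    F0: "fluct_data (par m0) (\<Gamma>f m0) (gf m0) (\<Phi>f m0) (\<Psi>f m0)"
    and F: "\<forall>\<^sub>F m in ?N. fluct_data (par m) (\<Gamma>f m) (gf m) (\<Phi>f m) (\<Psi>f m)"
    and uf: "uniform_limit {0..T} \<Gamma>f (\<Gamma>f m0) ?N" "uniform_limit {0..T} gf (gf m0) ?N"
      "uniform_limit {0..T} \<Phi>f (\<Phi>f m0) ?N" "uniform_limit {0..T} \<Psi>f (\<Psi>f m0) ?N"
  \<comment> \<open>The follower's regulator is treated by the same Riccati theory in dimension one,
    with zero affine data.\<close>
  proof (rule riccati_family[where ?p0.0 = m0 and F = ?N and T = T and A = "\<lambda>m. \<chi> i j. par m $ A\<^sub>1 :: real ^ 1 ^ 1" and B = "\<lambda>m. \<chi> i j. (par m $ E\<^sub>1)\<^sup>2 / par m $ R\<^sub>1 :: real ^ 1 ^ 1"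
        and C = "\<lambda>m. \<chi> i j. par m $ A\<^sub>1 :: real ^ 1 ^ 1" and D = "\<lambda>m. \<chi> i j. par m $ Q\<^sub>1 :: real ^ 1 ^ 1" and E = "\<lambda>m. \<chi> i j. par m $ Qb\<^sub>1 :: real ^ 1 ^ 1"
        and M = "\<lambda>m. 0" and h = "\<lambda>m. 0"])
    show "nondegenerate T (\<chi> i j. par m0 $ A\<^sub>1 :: real ^ 1 ^ 1) (\<chi> i j. (par m0 $ E\<^sub>1)\<^sup>2 / par m0 $ R\<^sub>1 :: real ^ 1 ^ 1) (\<chi> i j. par m0 $ A\<^sub>1)
        (\<chi> i j. par m0 $ Q\<^sub>1) (\<chi> i j. par m0 $ Qb\<^sub>1)"
      by (rule scalar_nondegenerate) (use pos in simp_all)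
    show "0 \<le> T" using T_pos by simp
  qed (use pos in \<open>(intro tendsto_intros lim(2); simp)+ | (unfold fluct_data_def, blast)\<close>)+
  let ?x = "\<lambda>m. system_state m (S (par m)) (\<Gamma> m) (g m) (\<Phi> m) (\<Psi> m)" and ?y = "\<lambda>m. fluct_state m (\<Gamma>f m) (gf m) (\<Phi>f m) (\<Psi>f m)"
  let ?p = "\<lambda>m t \<omega>. \<Gamma> m t *v ?x m t \<omega> + g m t" and ?q = "\<lambda>m t \<omega>. \<Gamma>f m t *v ?y m t \<omega> + gf m t"
  let ?u = "\<lambda>m t \<omega>. - (par m $ E\<^sub>1 / par m $ R\<^sub>1) * (?p m t \<omega> $ 3 + ?q m t \<omega> $ 1)"
  define j where "j m = system_cost m (S (par m)) (\<Gamma> m) (g m) (\<Phi> m) (\<Psi> m) (\<Gamma>f m) (gf m) (\<Phi>f m) (\<Psi>f m)" for m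
  have eq: "equilibrium_cost P W T sol (S (par m)) m (j m)" if "is_model P W m" "system_data (par m) (S (par m)) (\<Gamma> m) (g m) (\<Phi> m) (\<Psi> m)"
      "fluct_data (par m) (\<Gamma>f m) (gf m) (\<Phi>f m) (\<Psi>f m)" for m
    unfolding j_def system_cost_def by (rule equilibrium_cost_construct[where sol = sol and ?S = "S (par m)", OF that(1,2) rows that(3) sol[OF that]])
  have s: "sqp (\<lambda>t \<omega>. ?x m t \<omega> $ 1) \<and> sqp (\<lambda>t \<omega>. ?x m t \<omega> $ 2) \<and> sqp (\<lambda>t \<omega>. ?x m t \<omega> $ 3) \<and>
      sqp (\<lambda>t \<omega>. ?x m t \<omega> $ 3 + ?y m t \<omega> $ 1) \<and> sqp (?u m)"
    if "is_model P W m" "system_data (par m) (S (par m)) (\<Gamma> m) (g m) (\<Phi> m) (\<Psi> m)"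
      "fluct_data (par m) (\<Gamma>f m) (gf m) (\<Phi>f m) (\<Psi>f m)" for m
  proof -
    note \<G> = filtration_leader[OF that(1)] and \<F> = filtration_full[OF that(1)]
    have a: "sqp (\<lambda>t \<omega>. ?x m t \<omega> $ i)" "sqp (\<lambda>t \<omega>. ?p m t \<omega> $ 3)" "sqp (\<lambda>t \<omega>. ?y m t \<omega> $ 1)" "sqp (\<lambda>t \<omega>. ?q m t \<omega> $ 1)" for i
      by (rule state_process_sqp[OF \<G> system_process(2)[OF that(1,2) refl refl]] state_process_sqp[OF \<G> system_process(4)[OF that(1,2) refl refl]]
          state_process_sqp[OF \<F> fluctuation(1)[OF that(1,3)]] state_process_sqp[OF \<F> fluctuation(2)[OF that(1,3)]])+
    show ?thesis by (intro conjI sqp_cmult sqp_add a)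
  qed
  have xl: "l2_limit ?N (\<lambda>m t \<omega>. ?x m t \<omega> $ i) (\<lambda>t \<omega>. ?x m0 t \<omega> $ i)" for i
    by (rule system_state_limit[OF m0 S(1) R0 R u])
  have yl: "l2_limit ?N (\<lambda>m t \<omega>. ?y m t \<omega> $ i) (\<lambda>t \<omega>. ?y m0 t \<omega> $ i)" for i
    by (rule fluct_state_limit[OF m0 F0 F uf])
  note c0 = riccati_data_continuous(1,2)[OF R0[unfolded system_data_def]] and cf0 = riccati_data_continuous(1,2)[OF F0[unfolded fluct_data_def]]
  have pl: "l2_limit ?N (\<lambda>m t \<omega>. ?p m t \<omega> $ 3) (\<lambda>t \<omega>. ?p m0 t \<omega> $ 3)"
    by (rule l2_limit_lincomb[OF xl u(1) c0(1) u(2) c0(2)])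
  have ql: "l2_limit ?N (\<lambda>m t \<omega>. ?q m t \<omega> $ 1) (\<lambda>t \<omega>. ?q m0 t \<omega> $ 1)"
    by (rule l2_limit_lincomb[OF yl uf(1) cf0(1) uf(2) cf0(2)])
  have ul: "l2_limit ?N ?u (?u m0)"
    by (intro l2_limit_scale l2_limit_add pl ql tendsto_intros lim(2)) (use pos in simp)
  have "(j \<longlongrightarrow> j m0) ?N"
    unfolding j_def system_cost_def
  proof (rule J_follower_limit[OF xl xl xl l2_limit_add[OF xl yl] ul lim(2)])
    show "\<forall>\<^sub>F m in ?N. sqp (\<lambda>t \<omega>. ?x m t \<omega> $ 1) \<and> sqp (\<lambda>t \<omega>. ?x m t \<omega> $ 2) \<and> sqp (\<lambda>t \<omega>. ?x m t \<omega> $ 3) \<and>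
        sqp (\<lambda>t \<omega>. ?x m t \<omega> $ 3 + ?y m t \<omega> $ 1) \<and> sqp (?u m)"
      using lim(1) R F by eventually_elim (rule s)
  qed (rule s[OF m0 R0 F0])
  moreover have "\<forall>\<^sub>F m in ?N. equilibrium_cost P W T sol (S (par m)) m (j m)"
    using lim(1) R F by eventually_elim (rule eq)
  ultimately show ?thesis using that eq[OF m0 R0 F0] by blast
qed

lemma system_limits:
  assumes "is_model P W m0"
  shows "((\<lambda>m. mat_BN (par m)) \<longlongrightarrow> mat_BN (par m0)) (models_near m0)" "((\<lambda>m. mat_BP (par m)) \<longlongrightarrow> mat_BP (par m0)) (models_near m0)"
    "((\<lambda>m. mat_CN (par m)) \<longlongrightarrow> mat_CN (par m0)) (models_near m0)" "((\<lambda>m. mat_DN (par m)) \<longlongrightarrow> mat_DN (par m0)) (models_near m0)"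
    "((\<lambda>m. mat_DN (barred (par m))) \<longlongrightarrow> mat_DN (barred (par m0))) (models_near m0)"
    "((\<lambda>m. vec_MN (par m)) \<longlongrightarrow> vec_MN (par m0)) (models_near m0)"
    "((\<lambda>m. vec_MN (barred (par m))) \<longlongrightarrow> vec_MN (barred (par m0))) (models_near m0)"
  by (intro tendsto_mat_BN tendsto_mat_BP tendsto_mat_CN tendsto_mat_DN tendsto_vec_MN tendsto_barred
      models_near_limits(2)[OF assms]; use assms in \<open>auto simp: is_model_def Let_def\<close>)+

text \<open>Uniqueness of the cost identifies the constructed \<open>j\<close> with the definite
  description wherever \<open>j\<close> is an equilibrium cost.\<close>

lemma equilibrium_cost_the_limit:
  fixes S :: "real ^ param \<Rightarrow> ('l::{finite, numeral}) system"
  assumes m0: "is_model P W m0" and sol: "\<And>m ua ub xa xb z. sol P W T m ua ub xa xb z \<Longrightarrow> leader_outcome P W T m ua ub xa xb z"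
    and j: "equilibrium_cost P W T sol (S (par m0)) m0 (j m0)"
      "\<forall>\<^sub>F m in models_near m0. equilibrium_cost P W T sol (S (par m)) m (j m)" "(j \<longlongrightarrow> j m0) (models_near m0)"
  shows "\<forall>\<^sub>F m in models_near m0. \<exists>!c. equilibrium_cost P W T sol (S (par m)) m c"
    and "((\<lambda>m. THE c. equilibrium_cost P W T sol (S (par m)) m c) \<longlongrightarrow> (THE c. equilibrium_cost P W T sol (S (par m0)) m0 c)) (models_near m0)"
proof -
  let ?N = "models_near m0"
  have u: "\<exists>!c. equilibrium_cost P W T sol (S (par m)) m c" "(THE c. equilibrium_cost P W T sol (S (par m)) m c) = c"
    if m: "is_model P W m" and c: "equilibrium_cost P W T sol (S (par m)) m c" for m c
  proof -
    have eq: "c' = c" if "equilibrium_cost P W T sol (S (par m)) m c'" for c'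
      by (rule equilibrium_cost_unique[OF m sol that c])
    show "\<exists>!c. equilibrium_cost P W T sol (S (par m)) m c" using c eq by blast
    show "(THE c. equilibrium_cost P W T sol (S (par m)) m c) = c" using c eq by (rule the_equality)
  qed
  show "\<forall>\<^sub>F m in ?N. \<exists>!c. equilibrium_cost P W T sol (S (par m)) m c"
    using models_near_limits(1)[OF m0] j(2) by eventually_elim (rule u(1))
  have "\<forall>\<^sub>F m in ?N. j m = (THE c. equilibrium_cost P W T sol (S (par m)) m c)"
    using models_near_limits(1)[OF m0] j(2) by eventually_elim (rule u(2)[symmetric])
  from tendsto_cong[OF this] j(3)
  show "((\<lambda>m. THE c. equilibrium_cost P W T sol (S (par m)) m c) \<longlongrightarrow> (THE c. equilibrium_cost P W T sol (S (par m0)) m0 c)) ?N"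
    unfolding u(2)[OF m0 j(1)] by simp
qed

lemma J1_nash_limit:
  assumes m0: "is_model P W m0" and "assumption_2 (par m0)"
  shows "\<forall>\<^sub>F m in models_near m0. \<exists>!c. is_J1_nash P W T m c"
    and "((\<lambda>m. J1_nash P W T m) \<longlongrightarrow> J1_nash P W T m0) (models_near m0)"
proof -
  note lim = system_limits[OF m0]
  obtain j where j: "equilibrium_cost P W T nash (nash_system (par m0)) m0 (j m0)"
    "\<forall>\<^sub>F m in models_near m0. equilibrium_cost P W T nash (nash_system (par m)) m (j m)" "(j \<longlongrightarrow> j m0) (models_near m0)"
  proof (rule equilibrium_cost_limit[where S = nash_system and sol = nash, OF m0])
    \<comment> \<open>In the first alternative of \<open>assumption_2\<close> the Nash system is
      covered by \<open>condition_2A\<close>, in the second by \<open>condition_2B\<close>.\<close>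
    show "nondegenerate T (mat_A (par m0)) (mB (nash_system (par m0))) (mC (nash_system (par m0))) (mD (nash_system (par m0))) (mE (nash_system (par m0)))"
      using assms(2) unfolding assumption_2_def by (blast intro: condition_2A_nondegenerate condition_2B_nondegenerate)
  qed (assumption | rule system_rows_nash nash_construct | simp add: nash_system_def lim)+
  note L = equilibrium_cost_the_limit[where S = nash_system and sol = nash, OF m0 _ j]
  show "\<forall>\<^sub>F m in models_near m0. \<exists>!c. is_J1_nash P W T m c"
    unfolding is_J1_nash_def by (rule L(1)) (simp add: nash_def)
  show "((\<lambda>m. J1_nash P W T m) \<longlongrightarrow> J1_nash P W T m0) (models_near m0)"
    unfolding J1_nash_def is_J1_nash_def by (rule L(2)) (simp add: nash_def)
qed

lemma J1_pareto_limit: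
  assumes m0: "is_model P W m0" and "assumption_2 (par m0)"
  shows "\<forall>\<^sub>F m in models_near m0. \<exists>!c. is_J1_pareto P W T m c"
    and "((\<lambda>m. J1_pareto P W T m) \<longlongrightarrow> J1_pareto P W T m0) (models_near m0)"
proof -
  note lim = system_limits[OF m0]
  obtain j where j: "equilibrium_cost P W T pareto (pareto_system (par m0)) m0 (j m0)"
    "\<forall>\<^sub>F m in models_near m0. equilibrium_cost P W T pareto (pareto_system (par m)) m (j m)" "(j \<longlongrightarrow> j m0) (models_near m0)"
  proof (rule equilibrium_cost_limit[where S = pareto_system and sol = pareto, OF m0])
    show "nondegenerate T (mat_A (par m0)) (mB (pareto_system (par m0))) (mC (pareto_system (par m0))) (mD (pareto_system (par m0))) (mE (pareto_system (par m0)))"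
      using assms(2) unfolding assumption_2_def by (blast intro: condition_2A_nondegenerate)
  qed (assumption | rule system_rows_pareto pareto_construct | simp add: pareto_system_def,
      (intro mmult.tendsto vmult.tendsto tendsto_const lim)[1])+
  note L = equilibrium_cost_the_limit[where S = pareto_system and sol = pareto, OF m0 _ j]
  show "\<forall>\<^sub>F m in models_near m0. \<exists>!c. is_J1_pareto P W T m c"
    unfolding is_J1_pareto_def by (rule L(1)) (simp add: pareto_def)
  show "((\<lambda>m. J1_pareto P W T m) \<longlongrightarrow> J1_pareto P W T m0) (models_near m0)"
    unfolding J1_pareto_def is_J1_pareto_def by (rule L(2)) (simp add: pareto_def)
qed

end

theorem theorem4p3:
  fixes P :: "'a measure" and W :: "'a noise" and T :: real
    and \<MM>0 :: "'a model" and \<Delta>J :: real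
  assumes "prob_space P" and "0 < T" and "independent_wieners P W"
    and "is_model P W \<MM>0"
    and "assumption_3_1 (par \<MM>0)" and "assumption_2 (par \<MM>0)"
    and "\<Delta>J = \<bar>J1_nash P W T \<MM>0 - J1_pareto P W T \<MM>0\<bar>" and "\<Delta>J > 0"
  shows "\<exists>\<C>>0. \<forall>\<MM> :: 'a model.
           is_model P W \<MM> \<and>
           model_dist P \<MM> \<MM>0 < \<C> * \<Delta>J \<and>
           horizon_condition T nash_system (par \<MM>0) (par \<MM>) \<and>
           horizon_condition T pareto_system (par \<MM>0) (par \<MM>) \<longrightarrow>
             (\<exists>!c. is_J1_nash P W T \<MM> c) \<and> (\<exists>!c. is_J1_pareto P W T \<MM> c) \<and>
             (J1_nash P W T \<MM>0 > J1_pareto P W T \<MM>0 \<longrightarrow> J1_nash P W T \<MM> > J1_pareto P W T \<MM>) \<and>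
             (J1_nash P W T \<MM>0 < J1_pareto P W T \<MM>0 \<longrightarrow> J1_nash P W T \<MM> < J1_pareto P W T \<MM>)"
proof -
  interpret game_space P T W
    by (intro game_space.intro horizon.intro game_space_axioms.intro horizon_axioms.intro assms(1-3))
  note N = J1_nash_limit[OF assms(4,6)] and R = J1_pareto_limit[OF assms(4,6)]
  let ?Q = "\<lambda>m. (\<exists>!c. is_J1_nash P W T m c) \<and> (\<exists>!c. is_J1_pareto P W T m c) \<and>
             (J1_nash P W T \<MM>0 > J1_pareto P W T \<MM>0 \<longrightarrow> J1_nash P W T m > J1_pareto P W T m) \<and>
             (J1_nash P W T \<MM>0 < J1_pareto P W T \<MM>0 \<longrightarrow> J1_nash P W T m < J1_pareto P W T m)"
  have "((\<lambda>m. J1_nash P W T m - J1_pareto P W T m) \<longlongrightarrow> J1_nash P W T \<MM>0 - J1_pareto P W T \<MM>0) (models_near \<MM>0)"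
    by (intro tendsto_diff N(2) R(2))
  \<comment> \<open>The tolerance \<open>\<Delta>J\<close> itself suffices: a real number whose
    distance to d is less than the absolute value of d has the sign of d.\<close>
  from tendstoD[OF this assms(8)] N(1) R(1) have "\<forall>\<^sub>F m in models_near \<MM>0. ?Q m"
  proof eventually_elim
    fix m assume d: "dist (J1_nash P W T m - J1_pareto P W T m) (J1_nash P W T \<MM>0 - J1_pareto P W T \<MM>0) < \<Delta>J"
      and ex: "\<exists>!c. is_J1_nash P W T m c" "\<exists>!c. is_J1_pareto P W T m c"
    have "J1_nash P W T \<MM>0 > J1_pareto P W T \<MM>0 \<longrightarrow> J1_nash P W T m > J1_pareto P W T m"
      "J1_nash P W T \<MM>0 < J1_pareto P W T \<MM>0 \<longrightarrow> J1_nash P W T m < J1_pareto P W T m"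
      using d assms(7) unfolding dist_real_def by linarith+
    with ex show "?Q m" by (intro conjI)
  qed
  then have "\<exists>e>0. \<forall>m. is_model P W m \<longrightarrow> model_dist P m \<MM>0 < e \<longrightarrow> ?Q m"
    unfolding eventually_models_near .
  then obtain e where e: "0 < e" "\<forall>m. is_model P W m \<longrightarrow> model_dist P m \<MM>0 < e \<longrightarrow> ?Q m"
    by (elim exE conjE)
  show ?thesis
  proof (rule exI[of _ "e / \<Delta>J"], rule conjI, goal_cases)
    case 1
    show ?case using e(1) assms(8) by simp
  next
    case 2
    show ?case
    proof (intro allI impI, elim conjE)
      fix \<MM> :: "'a model" assume "is_model P W \<MM>" "model_dist P \<MM> \<MM>0 < e / \<Delta>J * \<Delta>J"
      then show "?Q \<MM>" using e(2)[THEN spec, THEN mp, THEN mp, of \<MM>] assms(8) by simp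
    qed
  qed
qed

end
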